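(* Let $F$ be a number field. For a transitive group $G\le S_n$ consider the following two assertions. $\mathrm{M}(F,G)$: for all $\epsilon>0$, $N(F,G;X)=O_{\epsilon,F}(X^{1/a(G)+\epsilon})$. $\mathrm{DM}(F,G)$: for all $\epsilon>0$ and all $D\in\mathbb{N}$, $a_D(F,G)=O_{\epsilon,F,n}(D^{\epsilon})$. Then: (i) If $\mathrm{M}(F,G)$ holds for all finite transitive permutation groups $G$ (of all degrees $n>1$), then $\mathrm{DM}(F,G)$ holds for all finite transitive permutation groups $G$ (of all degrees $n>1$). (ii) For every transitive group $G\le S_n$ with $n>1$, $\mathrm{DM}(F,G)$ implies $\mathrm{M}(F,G)$.
   Context: For an extension $E/F$ of number fields of degree $n$, $\mathrm{Disc}(E/F)$ denotes the absolute norm of the discriminant ideal $\mathfrak{d}(E/F)$ of $\mathcal{O}_F$. One writes $\mathrm{Gal}(E/F)=G\le S_n$ if the Galois group of the Galois closure $\hat E/F$ of $E/F$, viewed as a permutation group on the set of embeddings of $E$ into $\hat E$ over $F$, is permutation isomorphic to $G$. Extensions $E/F$ are counted inside a fixed algebraic closure of $F$. Define $$N(F,G;X):=\#\{E/F \mid \mathrm{Gal}(E/F)=G,\ \mathrm{Disc}(E/F)\le X\},$$ $$a_D(F,G):=\#\{E/F\mid \mathrm{Gal}(E/F)=G,\ \mathrm{Disc}(E/F)=D\}.$$ For a transitive group $G\le S_n$ with $n>1$ and $g\in G$, the index is $\mathrm{ind}(g):=n-(\text{number of orbits of } g \text{ on } \{1,\dots,n\})$, and $a(G):=\mathrm{ind}(G):=\min\{\mathrm{ind}(g):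 \mathrm{id}\neq g\in G\}$. Subscripts on $O$ indicate the quantities on which the implied constant may depend. *)

theory Defs
  imports
    "HOL-Algebra.Algebraic_Closure_Type"
    "HOL-Algebra.Bij"
    "HOL-Algebra.Sym_Groups"
    "HOL-Combinatorics.Orbits"
    "HOL-Library.Landau_Symbols"
    "Jordan_Normal_Form.Determinant"
begin

text \<open>
  The type \<open>'a\<close> is the carrier of the algebraic closure of the base field; all fields that occur
  are subfields of it. The record \<open>\<Omega>\<close> makes the notions of HOL-Algebra available for these sets.
\<close>

abbreviation \<Omega> :: "'a::{alg_closed_field, field_char_0} ring"
  where "\<Omega> \<equiv> ring_of_type_algebra"

abbreviation on_carrier :: "'a::{alg_closed_field, field_char_0} set \<Rightarrow> 'a ring"
  where "on_carrier S \<equiv> \<Omega>\<lparr>carrier := S\<rparr>"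

definition number_field :: "'a::{alg_closed_field, field_char_0} set \<Rightarrow> bool" where
  "number_field F \<longleftrightarrow> subfield F \<Omega> \<and> ring.finite_dimension \<Omega> \<rat> F"

definition ext_of_degree ::
    "'a::{alg_closed_field, field_char_0} set \<Rightarrow> nat \<Rightarrow> 'a set \<Rightarrow> bool" where
  "ext_of_degree F n E \<longleftrightarrow> subfield E \<Omega> \<and> F \<subseteq> E \<and> ring.dimension \<Omega> n F E"


section \<open>Galois groups as permutation groups\<close>

text \<open>
  Maps are extensional on their domain, so that distinct functions are distinct embeddings.
\<close>

definition embeddings ::
    "'a::{alg_closed_field, field_char_0} set \<Rightarrow> 'a set \<Rightarrow> 'a set \<Rightarrow> ('a \<Rightarrow> 'a) set" where
  "embeddings F E L =
     {\<sigma> \<in> extensional E. \<sigma> \<in> Ring.ring_hom (on_carrier E) (on_carrier L) \<and> (\<forall>x\<in>F. \<sigma> x = x)}"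

definition gal_group ::
    "'a::{alg_closed_field, field_char_0} set \<Rightarrow> 'a set \<Rightarrow> ('a \<Rightarrow> 'a) monoid" where
  "gal_group F L = BijGroup L\<lparr>carrier := embeddings F L L \<inter> Bij L\<rparr>"

definition galois_ext :: "'a::{alg_closed_field, field_char_0} set \<Rightarrow> 'a set \<Rightarrow> bool" where
  "galois_ext F L \<longleftrightarrow> subfield L \<Omega> \<and> F \<subseteq> L \<and>
     {x \<in> L. \<forall>\<sigma> \<in> carrier (gal_group F L). \<sigma> x = x} = F"

definition galois_closure ::
    "'a::{alg_closed_field, field_char_0} set \<Rightarrow> 'a set \<Rightarrow> 'a set" where
  "galois_closure F E = \<Inter>{L. galois_ext F L \<and> E \<subseteq> L}"

definition perm_isomorphic ::
    "('g, 'c) monoid_scheme \<Rightarrow> ('g \<Rightarrow> 'x \<Rightarrow> 'x) \<Rightarrow> 'x set \<Rightarrow>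
     ('h, 'd) monoid_scheme \<Rightarrow> ('h \<Rightarrow> 'y \<Rightarrow> 'y) \<Rightarrow> 'y set \<Rightarrow> bool" where
  "perm_isomorphic H act A K act' B \<longleftrightarrow>
     (\<exists>\<psi> \<in> iso H K. \<exists>\<beta>. bij_betw \<beta> A B \<and>
        (\<forall>h \<in> carrier H. \<forall>x \<in> A. \<beta> (act h x) = act' (\<psi> h) (\<beta> x)))"

definition transitive_group :: "nat \<Rightarrow> (nat \<Rightarrow> nat) set \<Rightarrow> bool" where
  "transitive_group n G \<longleftrightarrow> subgroup G (sym_group n) \<and>
     (\<forall>i \<in> {1..n}. \<forall>j \<in> {1..n}. \<exists>g \<in> G. g i = j)"

definition has_gal ::
    "'a::{alg_closed_field, field_char_0} set \<Rightarrow> 'a set \<Rightarrow> nat \<Rightarrow> (nat \<Rightarrow> nat) set \<Rightarrow> bool" where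
  "has_gal F E n G \<longleftrightarrow>
     perm_isomorphic
       (gal_group F (galois_closure F E)) (\<lambda>\<tau> \<sigma>. compose E \<tau> \<sigma>) (embeddings F E (galois_closure F E))
       (sym_group n\<lparr>carrier := G\<rparr>) (\<lambda>g i. g i) {1..n}"


section \<open>Discriminants\<close>

definition ring_of_integers :: "'a::{alg_closed_field, field_char_0} set \<Rightarrow> 'a set" where
  "ring_of_integers K = {x \<in> K. algebraic_int x}"

text \<open>
  The discriminant ideal is generated by the discriminants \<open>d(b\<^sub>1, \<dots>, b\<^sub>n) = det(\<sigma>\<^sub>i b\<^sub>j)\<^sup>2\<close> of the
  \<open>F\<close>-bases of \<open>E\<close> that consist of integral elements, where \<open>\<sigma>\<^sub>1, \<dots>, \<sigma>\<^sub>n\<close> are the \<open>F\<close>-embeddings of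
  \<open>E\<close> into the algebraic closure. Their order does not affect the square of the determinant.
\<close>

definition integral_basis_discs ::
    "'a::{alg_closed_field, field_char_0} set \<Rightarrow> 'a set \<Rightarrow> 'a set" where
  "integral_basis_discs F E =
     {(det (mat (length b) (length b) (\<lambda>(i, j). (s ! i) (b ! j))))\<^sup>2 | b s.
        ring.independent \<Omega> F b \<and> ring.Span \<Omega> F b = E \<and> set b \<subseteq> ring_of_integers E \<and>
        distinct s \<and> set s = embeddings F E UNIV}"

definition disc_ideal :: "'a::{alg_closed_field, field_char_0} set \<Rightarrow> 'a set \<Rightarrow> 'a set" where
  "disc_ideal F E = genideal (on_carrier (ring_of_integers F)) (integral_basis_discs F E)"

definition abs_norm :: "'a::{alg_closed_field, field_char_0} set \<Rightarrow> 'a set \<Rightarrow> nat" where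
  "abs_norm F I = card (carrier (on_carrier (ring_of_integers F) Quot I))"

definition Disc :: "'a::{alg_closed_field, field_char_0} set \<Rightarrow> 'a set \<Rightarrow> nat" where
  "Disc F E = abs_norm F (disc_ideal F E)"


section \<open>Counting functions and the two assertions\<close>

definition gal_exts ::
    "'a::{alg_closed_field, field_char_0} set \<Rightarrow> nat \<Rightarrow> (nat \<Rightarrow> nat) set \<Rightarrow> 'a set set" where
  "gal_exts F n G = {E. ext_of_degree F n E \<and> has_gal F E n G}"

definition exts_upto ::
    "'a::{alg_closed_field, field_char_0} set \<Rightarrow> nat \<Rightarrow> (nat \<Rightarrow> nat) set \<Rightarrow> real \<Rightarrow> 'a set set" where
  "exts_upto F n G x = {E \<in> gal_exts F n G. real (Disc F E) \<le> x}"

definition exts_with_disc ::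
    "'a::{alg_closed_field, field_char_0} set \<Rightarrow> nat \<Rightarrow> (nat \<Rightarrow> nat) set \<Rightarrow> nat \<Rightarrow> 'a set set" where
  "exts_with_disc F n G D = {E \<in> gal_exts F n G. Disc F E = D}"

definition perm_index :: "nat \<Rightarrow> (nat \<Rightarrow> nat) \<Rightarrow> nat" where
  "perm_index n g = n - card (orbit g ` {1..n})"

definition group_index :: "nat \<Rightarrow> (nat \<Rightarrow> nat) set \<Rightarrow> nat" where
  "group_index n G = Min (perm_index n ` (G - {id}))"

text \<open>
  Both assertions bound a number of fields. As \<open>card\<close> is 0 on infinite sets, the finiteness that
  such a bound includes has to be stated.
\<close>

definition M ::
    "'a::{alg_closed_field, field_char_0} set \<Rightarrow> nat \<Rightarrow> (nat \<Rightarrow> nat) set \<Rightarrow> bool" where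
  "M F n G \<longleftrightarrow> (\<forall>x. finite (exts_upto F n G x)) \<and>
     (\<forall>\<epsilon>>0. (\<lambda>x. real (card (exts_upto F n G x)))
               \<in> O(\<lambda>x. x powr (1 / real (group_index n G) + \<epsilon>)))"

text \<open>
  The implied constant \<open>C \<epsilon> n\<close> is an argument, because it may depend on \<open>\<epsilon>\<close>, on the degree \<open>n\<close> and
  on \<open>F\<close>, but not on \<open>D\<close> and not on \<open>G\<close> within a given degree.
\<close>

definition DM ::
    "(real \<Rightarrow> nat \<Rightarrow> real) \<Rightarrow>
     'a::{alg_closed_field, field_char_0} set \<Rightarrow> nat \<Rightarrow> (nat \<Rightarrow> nat) set \<Rightarrow> bool" where
  "DM C F n G \<longleftrightarrow> (\<forall>D\<ge>1. finite (exts_with_disc F n G D)) \<and>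
     (\<forall>\<epsilon>>0. \<forall>D\<ge>1. real (card (exts_with_disc F n G D)) \<le> C \<epsilon> n * real D powr \<epsilon>)"

end

theory Submission
  imports Defs "Jordan_Normal_Form.Char_Poly" "HOL-Algebra.Sylow"
begin

text \<open>
  (ii) Let \<open>p\<close> be a prime dividing \<open>Disc(E/F)\<close>. It lies below a prime \<open>P\<close> that ramifies in \<open>E\<close>, so some
  \<open>g \<noteq> id\<close> of the Galois group acts trivially modulo a prime above \<open>P\<close>. Embeddings in one \<open>g\<close>-orbit
  then have the same reduction, the trace form modulo \<open>P\<close> has rank at most \<open>n - ind(g)\<close>, and \<open>p\<close> to the
  power \<open>ind(g)\<close> divides the discriminant. Hence the discriminants that occur are \<open>a(G)\<close>-powerful
  numbers, of which there are \<open>O(x\<^bsup>1/a(G)\<^esup>)\<close> up to \<open>x\<close>.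

  (i) Take \<open>k\<close> fields of discriminant \<open>D\<close> with group \<open>G\<close>. The Galois closure of their compositum has
  bounded degree \<open>N\<close>. It ramifies only above primes dividing \<open>D\<close>, and the exponents of its discriminant
  are \<open>O(N)\<close>, so that the discriminant is at most \<open>(D N)\<^bsup>N deg F\<^esup>\<close>. Its Galois group acts regularly
  and has index at least \<open>N / 2\<close>. Malle's bound thus yields \<open>O(D\<^bsup>3 deg F\<^esup>)\<close> closures for every \<open>k\<close>,
  each of which contains boundedly many tuples. So \<open>a\<^sub>D(F,G)\<^bsup>k\<^esup> = O(D\<^bsup>3 deg F\<^esup>)\<close>, and \<open>k\<close> is arbitrary.
\<close>

section \<open>Algebraic integers\<close>

text \<open>No factorisation of ideals is developed. Everything happens at one maximal ideal
  \<open>P\<close> of \<open>OF\<close> at a time, with denominators outside \<open>P\<close> kept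
  explicit: invertibility of contents makes the localisation a valuation ring in which
  \<open>P\<close> has a generator \<open>\<pi>\<close>, and divisibility by
  \<open>\<pi> ^ k\<close> takes the place of exponents. Reductions are taken modulo a maximal ideal
  of the ring of all algebraic integers, so that one ideal serves all extension fields. The factor
  \<open>N\<close> next to \<open>D\<close> pays for wild ramification: for a normal extension of
  degree \<open>N\<close>, locally at a prime containing \<open>D\<close>, the codifferent times
  \<open>D * N\<close> is integral, because the trace is multiplication by \<open>N\<close> on
  \<open>F\<close>. The constant 3 is 2 + 1: a group of index at least \<open>N / 2\<close> gives
  the exponent \<open>2 / N\<close>, and \<epsilon> is taken to be \<open>1 / N\<close>. The degree
  \<open>N\<close> of the hull grows with the number of fields, but it cancels against the
  \<open>N\<close> in the exponent of the discriminant bound; this cancellation is what leaves the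
  number of fields free.\<close>

inductive_set int_span :: "'a::ring_1 set \<Rightarrow> 'a set" for V where
  zero: "0 \<in> int_span V"
| step: "s \<in> int_span V \<Longrightarrow> c \<in> \<int> \<Longrightarrow> v \<in> V \<Longrightarrow> c * v + s \<in> int_span V"

lemma int_span_base: "v \<in> V \<Longrightarrow> v \<in> int_span V"
  using int_span.step[OF int_span.zero, of 1 v V] by simp

lemma int_span_add: "s \<in> int_span V \<Longrightarrow> t \<in> int_span V \<Longrightarrow> s + t \<in> int_span V"
  by (induction rule: int_span.induct) (auto simp: add.assoc intro: int_span.intros)

lemma int_span_scale:
  fixes V :: "'a::comm_ring_1 set"
  shows "s \<in> int_span V \<Longrightarrow> c \<in> \<int> \<Longrightarrow> c * s \<in> int_span V"
proof (induction rule: int_span.induct)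
  case (step s d v)
  have "c * (d * v + s) = (c * d) * v + c * s"
    by (simp add: algebra_simps)
  then show ?case
    using step by (auto intro: int_span.intros)
qed (auto intro: int_span.intros)

lemma int_span_sum:
  assumes "\<And>i. i \<in> I \<Longrightarrow> f i \<in> int_span V"
  shows "sum f I \<in> int_span V"
  using assms by (induction I rule: infinite_finite_induct) (auto intro: int_span.zero int_span_add)

lemma int_span_mult:
  fixes V :: "'a::comm_ring_1 set"
  assumes "\<And>v. v \<in> V \<Longrightarrow> z * v \<in> int_span V" and "s \<in> int_span V"
  shows "z * s \<in> int_span V"
  using assms(2)
proof (induction rule: int_span.induct)
  case (step s c v)
  have "z * (c * v + s) = c * (z * v) + z * s"
    by (simp add: algebra_simps)
  then show ?case
    using step assms(1) by (auto intro: int_span_add int_span_scale)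
qed (auto intro: int_span.intros)

lemma int_span_coeffs:
  fixes V :: "'a::comm_ring_1 set"
  assumes "finite V" and "s \<in> int_span V"
  obtains c :: "'a \<Rightarrow> int" where "s = (\<Sum>v\<in>V. of_int (c v) * v)"
proof -
  from assms(2) have "\<exists>c :: 'a \<Rightarrow> int. s = (\<Sum>v\<in>V. of_int (c v) * v)"
  proof (induction rule: int_span.induct)
    case zero
    then show ?case by (intro exI[of _ "\<lambda>_. 0"]) auto
  next
    case (step s d w)
    then obtain c :: "'a \<Rightarrow> int" where c: "s = (\<Sum>v\<in>V. of_int (c v) * v)" by blast
    obtain e where e: "d = of_int e" using step by (auto elim: Ints_cases)
    have "(\<Sum>v\<in>V. of_int ((c(w := c w + e)) v) * v)
        = (\<Sum>v\<in>V. (if v = w then of_int e * v else 0) + of_int (c v) * v)"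
      by (intro sum.cong) (auto simp: algebra_simps)
    also have "\<dots> = d * w + s"
      using assms(1) step.hyps by (simp add: sum.distrib c e)
    finally show ?case by metis
  qed
  with that show thesis by blast
qed

text \<open>The ring element \<open>z\<close> is an eigenvalue of an integer matrix.\<close>

lemma algebraic_int_int_span:
  fixes V :: "'a::field_char_0 set"
  assumes V: "finite V" and stable: "\<And>v. v \<in> V \<Longrightarrow> z * v \<in> int_span V" and "w \<in> V" "w \<noteq> 0"
  shows "algebraic_int z"
proof -
  have "\<exists>c :: 'a \<Rightarrow> int. z * v = (\<Sum>u\<in>V. of_int (c u) * u)" if "v \<in> V" for v
    using int_span_coeffs[OF V stable[OF that]] by metis
  then obtain c :: "'a \<Rightarrow> 'a \<Rightarrow> int" where c: "\<And>v. v \<in> V \<Longrightarrow> z * v = (\<Sum>u\<in>V. of_int (c v u) * u)"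
    by metis
  define n where "n = card V"
  obtain b where b: "bij_betw b {..<n} V"
    using ex_bij_betw_nat_finite[OF V] by (auto simp: n_def atLeast0LessThan)
  define A where "A = mat n n (\<lambda>(i, j). c (b i) (b j))"
  have A: "A \<in> carrier_mat n n" by (simp add: A_def)
  let ?A = "map_mat (of_int :: int \<Rightarrow> 'a) A"
  have "eigenvector ?A (vec n b) z"
    unfolding eigenvector_def
  proof (intro conjI)
    obtain i where "i < n" "b i = w"
      using b \<open>w \<in> V\<close> by (metis bij_betw_imp_surj_on imageE lessThan_iff)
    then show "vec n b \<noteq> 0\<^sub>v (dim_row ?A)"
      using A \<open>w \<noteq> 0\<close> by (metis carrier_matD(1) index_map_mat(2) index_vec index_zero_vec(1))
    show "?A *\<^sub>v vec n b = z \<cdot>\<^sub>v vec n b"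
    proof (rule eq_vecI)
      fix i assume "i < dim_vec (z \<cdot>\<^sub>v vec n b)"
      then have i: "i < n" by simp
      then have "b i \<in> V" using b by (auto simp: bij_betw_def)
      then have "z * b i = (\<Sum>j\<in>{..<n}. of_int (c (b i) (b j)) * b j)"
        using c sum.reindex_bij_betw[OF b, of "\<lambda>u. of_int (c (b i) u) * u"] by simp
      then show "(?A *\<^sub>v vec n b) $ i = (z \<cdot>\<^sub>v vec n b) $ i"
        using i A by (simp add: scalar_prod_def A_def atLeast0LessThan)
    qed (use A in auto)
  qed (use A in auto)
  then have "eigenvalue ?A z" by (auto simp: eigenvalue_def)
  then have "poly (char_poly ?A) z = 0"
    using eigenvalue_root_char_poly[of ?A n z] A by auto
  then have "poly (map_poly of_int (char_poly A)) z = 0"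
    using of_int_hom.char_poly_hom[OF A] by metis
  moreover have "lead_coeff (char_poly A) = 1"
    using degree_monic_char_poly[OF A] by simp
  ultimately show ?thesis
    by (auto simp: algebraic_int_altdef_ipoly)
qed

text \<open>The form in which a monic equation is used: the span of
  \<open>1, ..., x ^ (n - 1)\<close> is closed under multiplication by \<open>x\<close>.\<close>

lemma algebraic_int_power_int_span:
  fixes x :: "'a::field_char_0"
  assumes "algebraic_int x"
  obtains n where "n > 0" "x ^ n \<in> int_span ((\<lambda>i. x ^ i) ` {..<n})"
proof -
  obtain p where p: "lead_coeff p = 1" "\<forall>i. coeff p i \<in> \<int>" "poly p x = 0"
    using assms by (auto elim: algebraic_int.cases)
  define n where "n = degree p"
  have "n > 0"
    using p by (intro Nat.gr0I) (auto simp: n_def elim!: degree_eq_zeroE)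
  have "0 = (\<Sum>i<n. coeff p i * x ^ i) + x ^ n"
    using p by (simp add: poly_altdef n_def lessThan_Suc_atMost [symmetric])
  then have "x ^ n = (\<Sum>i<n. (- coeff p i) * x ^ i)"
    by (simp add: sum_negf eq_neg_iff_add_eq_0 add.commute)
  also have "\<dots> \<in> int_span ((\<lambda>i. x ^ i) ` {..<n})"
    using p by (intro int_span_sum int_span_scale int_span_base) auto
  finally show thesis using that \<open>n > 0\<close> by blast
qed

text \<open>The monomials \<open>x ^ i * y ^ j\<close> below both exponents form a finite set whose
  integer span is stable under \<open>x\<close> and \<open>y\<close>, hence under
  \<open>x + y\<close> and \<open>x * y\<close>. It contains \<open>1\<close>, the nonzero element
  that the eigenvalue argument asks for.\<close>

lemma
  fixes x y :: "'a::field_char_0"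
  assumes "algebraic_int x" "algebraic_int y"
  shows algebraic_int_add: "algebraic_int (x + y)" and algebraic_int_mult: "algebraic_int (x * y)"
proof -
  obtain m where m: "m > 0" "x ^ m \<in> int_span ((\<lambda>i. x ^ i) ` {..<m})"
    using algebraic_int_power_int_span[OF assms(1)] by blast
  obtain n where n: "n > 0" "y ^ n \<in> int_span ((\<lambda>i. y ^ i) ` {..<n})"
    using algebraic_int_power_int_span[OF assms(2)] by blast
  define V where "V = (\<lambda>(i, j). x ^ i * y ^ j) ` ({..<m} \<times> {..<n})"
  have V: "x ^ i * y ^ j \<in> int_span V" if "i < m" "j < n" for i j
    using that by (intro int_span_base) (auto simp: V_def)
  have "finite V" by (auto simp: V_def)
  have "1 \<in> V"
    unfolding V_def by (rule image_eqI[of _ _ "(0, 0)"]) (use m n in auto)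
  have x: "x * v \<in> int_span V" if v: "v \<in> V" for v
  proof -
    obtain i j where ij: "i < m" "j < n" "v = x ^ i * y ^ j" using v by (auto simp: V_def)
    show ?thesis
    proof (cases "Suc i < m")
      case True
      then show ?thesis using V[of "Suc i" j] ij by (simp add: mult.assoc)
    next
      case False
      then have "Suc i = m" using ij by simp
      have "y ^ j * s \<in> int_span V" if "s \<in> int_span ((\<lambda>i. x ^ i) ` {..<m})" for s
        using that
      proof (induction rule: int_span.induct)
        case (step s c v)
        then obtain i' where "i' < m" "v = x ^ i'" by auto
        then have "c * (x ^ i' * y ^ j) + y ^ j * s \<in> int_span V"
          using int_span_add[OF int_span_scale[OF V] step.IH] step.hyps ij \<open>i' < m\<close> by blast
        then show ?case using \<open>v = x ^ i'\<close> by (simp add: algebra_simps)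
      qed (auto intro: int_span.intros)
      from this[OF m(2)] show ?thesis using ij \<open>Suc i = m\<close> by (auto simp: algebra_simps)
    qed
  qed
  have y: "y * v \<in> int_span V" if v: "v \<in> V" for v
  proof -
    obtain i j where ij: "i < m" "j < n" "v = x ^ i * y ^ j" using v by (auto simp: V_def)
    show ?thesis
    proof (cases "Suc j < n")
      case True
      then show ?thesis using V[of i "Suc j"] ij by (simp add: algebra_simps)
    next
      case False
      then have "Suc j = n" using ij by simp
      have "x ^ i * s \<in> int_span V" if "s \<in> int_span ((\<lambda>i. y ^ i) ` {..<n})" for s
        using that
      proof (induction rule: int_span.induct)
        case (step s c v)
        then obtain j' where "j' < n" "v = y ^ j'" by auto
        then have "c * (x ^ i * y ^ j') + x ^ i * s \<in> int_span V"
          using int_span_add[OF int_span_scale[OF V] step.IH] step.hyps ij \<open>j' < n\<close> by blast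
        then show ?case using \<open>v = y ^ j'\<close> by (simp add: algebra_simps)
      qed (auto intro: int_span.intros)
      from this[OF n(2)] show ?thesis using ij \<open>Suc j = n\<close> by (auto simp: algebra_simps)
    qed
  qed
  show "algebraic_int (x + y)"
    using \<open>finite V\<close> \<open>1 \<in> V\<close> x y
    by (intro algebraic_int_int_span[of V _ 1]) (auto simp: distrib_right intro: int_span_add)
  show "algebraic_int (x * y)"
    using \<open>finite V\<close> \<open>1 \<in> V\<close> int_span_mult[OF x] y
    by (intro algebraic_int_int_span[of V _ 1]) (auto simp: mult.assoc)
qed

lemma algebraic_int_diff:
  fixes x y :: "'a::field_char_0"
  shows "algebraic_int x \<Longrightarrow> algebraic_int y \<Longrightarrow> algebraic_int (x - y)"
  using algebraic_int_add[of x "- y"] by simp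

lemma algebraic_int_sum:
  fixes f :: "'b \<Rightarrow> 'a::field_char_0"
  assumes "\<And>i. i \<in> I \<Longrightarrow> algebraic_int (f i)"
  shows "algebraic_int (sum f I)"
  using assms by (induction I rule: infinite_finite_induct) (auto intro: algebraic_int_add)

lemma algebraic_int_prod:
  fixes f :: "'b \<Rightarrow> 'a::field_char_0"
  assumes "\<And>i. i \<in> I \<Longrightarrow> algebraic_int (f i)"
  shows "algebraic_int (prod f I)"
  using assms by (induction I rule: infinite_finite_induct) (auto intro: algebraic_int_mult)

lemma algebraic_int_power:
  fixes x :: "'a::field_char_0"
  shows "algebraic_int x \<Longrightarrow> algebraic_int (x ^ n)"
  by (induction n) (auto intro: algebraic_int_mult)

section \<open>Polynomials with coefficients in a set\<close>

definition poly_over :: "'a::zero set \<Rightarrow> 'a poly \<Rightarrow> bool" where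
  "poly_over K p \<longleftrightarrow> (\<forall>i. coeff p i \<in> K)"

text \<open>A predicate on plain sets, so that it speaks about the type-class operations of any ring
  type. Besides rings of integers it is applied to sets of polynomials.\<close>

definition subring_set :: "'a::ring_1 set \<Rightarrow> bool" where
  "subring_set K \<longleftrightarrow> 1 \<in> K \<and> (\<forall>x\<in>K. - x \<in> K) \<and> (\<forall>x\<in>K. \<forall>y\<in>K. x + y \<in> K \<and> x * y \<in> K)"

lemma subring_setD:
  assumes "subring_set K"
  shows "1 \<in> K" "0 \<in> K" "x \<in> K \<Longrightarrow> - x \<in> K" "x \<in> K \<Longrightarrow> y \<in> K \<Longrightarrow> x + y \<in> K"
    "x \<in> K \<Longrightarrow> y \<in> K \<Longrightarrow> x * y \<in> K" "x \<in> K \<Longrightarrow> y \<in> K \<Longrightarrow> x - y \<in> K" "x \<in> K \<Longrightarrow> x ^ n \<in> K"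
proof -
  show one: "1 \<in> K" and add: "\<And>x y. x \<in> K \<Longrightarrow> y \<in> K \<Longrightarrow> x + y \<in> K"
    and mult: "\<And>x y. x \<in> K \<Longrightarrow> y \<in> K \<Longrightarrow> x * y \<in> K"
    and minus: "\<And>x. x \<in> K \<Longrightarrow> - x \<in> K"
    using assms by (auto simp: subring_set_def)
  show "0 \<in> K" using add[OF one minus[OF one]] by simp
  show "x \<in> K \<Longrightarrow> y \<in> K \<Longrightarrow> x - y \<in> K" using add[OF _ minus, of x y] by simp
  show "x \<in> K \<Longrightarrow> x ^ n \<in> K" by (induction n) (auto simp: one mult)
qed

lemma subring_set_sum:
  assumes "subring_set K" "\<And>i. i \<in> I \<Longrightarrow> f i \<in> K"
  shows "sum f I \<in> K"
  using assms(2) by (induction I rule: infinite_finite_induct) (auto intro: subring_setD[OF assms(1)])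

lemma subring_set_prod:
  fixes K :: "'a::comm_ring_1 set"
  assumes "subring_set K" "\<And>i. i \<in> I \<Longrightarrow> f i \<in> K"
  shows "prod f I \<in> K"
  using assms(2) by (induction I rule: infinite_finite_induct) (auto intro: subring_setD[OF assms(1)])

lemma subring_set_of_int:
  assumes "subring_set K"
  shows "of_int k \<in> K"
proof -
  have nat: "of_nat n \<in> K" for n by (induction n) (auto intro: subring_setD[OF assms])
  show ?thesis
    by (cases k rule: int_cases2) (auto intro: nat subring_setD[OF assms])
qed

lemma subring_set_poly:
  fixes K :: "'a::comm_ring_1 set"
  assumes "subring_set K" "poly_over K p" "x \<in> K"
  shows "poly p x \<in> K"
  unfolding poly_altdef using assms(2,3)
  by (intro subring_set_sum subring_setD[OF assms(1)]) (auto simp: poly_over_def assms(1))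

lemma poly_over_0 [simp]: "subring_set K \<Longrightarrow> poly_over K 0"
  by (simp add: poly_over_def subring_setD)

lemma poly_over_pCons [simp]: "poly_over K (pCons a p) \<longleftrightarrow> a \<in> K \<and> poly_over K p"
  by (auto simp: poly_over_def coeff_pCons split: nat.splits)

lemma
  fixes K :: "'a::comm_ring_1 set"
  assumes K: "subring_set K" and p: "poly_over K p" and q: "poly_over K q"
  shows poly_over_add: "poly_over K (p + q)" and poly_over_mult: "poly_over K (p * q)"
  using p q unfolding poly_over_def coeff_add coeff_mult
  by (auto intro!: subring_setD[OF K] subring_set_sum[OF K])

lemma poly_over_minus:
  "subring_set K \<Longrightarrow> poly_over K p \<Longrightarrow> poly_over K (- p)"
  by (simp add: poly_over_def subring_setD)

lemma poly_over_smult: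
  fixes K :: "'a::comm_ring_1 set"
  assumes K: "subring_set K" and "a \<in> K" and p: "poly_over K p"
  shows "poly_over K (Polynomial.smult a p)"
  using p \<open>a \<in> K\<close> unfolding poly_over_def by (auto intro: subring_setD[OF K])

lemma poly_over_prod:
  fixes K :: "'a::comm_ring_1 set"
  assumes "subring_set K" "\<And>i. i \<in> I \<Longrightarrow> poly_over K (f i)"
  shows "poly_over K (prod f I)"
  using assms(2)
  by (induction I rule: infinite_finite_induct)
     (auto intro: poly_over_mult[OF assms(1)] simp: one_pCons subring_setD[OF assms(1)] assms(1))

lemma poly_over_mono: "K \<subseteq> L \<Longrightarrow> poly_over K p \<Longrightarrow> poly_over L p"
  by (auto simp: poly_over_def)

text \<open>A monic divisor cancels leading terms without dividing coefficients, so the division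
  stays inside any subring.\<close>

lemma poly_over_div_monic:
  fixes K :: "'a::comm_ring_1 set"
  assumes K: "subring_set K" and "poly_over K f" "poly_over K m" "lead_coeff m = 1"
  obtains q r where "poly_over K q" "poly_over K r" "f = m * q + r" "r = 0 \<or> degree r < degree m"
proof -
  have "\<exists>q r. poly_over K q \<and> poly_over K r \<and> f = m * q + r \<and> (r = 0 \<or> degree r < degree m)"
    using assms(2)
  proof (induction "degree f" arbitrary: f rule: less_induct)
    case less
    show ?case
    proof (cases "f = 0 \<or> degree f < degree m")
      case True
      then show ?thesis using less K by (intro exI[of _ 0] exI[of _ f]) auto
    next
      case False
      define t where "t = monom (lead_coeff f) (degree f - degree m)"
      have t: "poly_over K t"
        using less K by (auto simp: t_def poly_over_def subring_setD)
      define f' where "f' = f - m * t"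
      have f': "poly_over K f'"
        using poly_over_add[OF K less.prems poly_over_minus[OF K poly_over_mult[OF K assms(3) t]]]
        by (simp add: f'_def)
      have deg_mt: "degree (m * t) \<le> degree f"
        using False degree_mult_le[of m t] degree_monom_le[of "lead_coeff f" "degree f - degree m"]
        by (auto simp: t_def)
      have "coeff (m * t) (degree f) = lead_coeff f"
        using False assms(4) by (auto simp: t_def mult.commute[of m] coeff_monom_mult)
      then have lc: "coeff f' (degree f) = 0" by (simp add: f'_def)
      have deg: "degree f' \<le> degree f"
        using deg_mt unfolding f'_def by (intro degree_diff_le) auto
      show ?thesis
      proof (cases "f' = 0")
        case True
        then show ?thesis using t K by (intro exI[of _ t] exI[of _ 0]) (auto simp: f'_def)
      next
        case False
        then have "degree f' < degree f"
          using lc deg by (metis leading_coeff_0_iff order_le_less)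
        from less.hyps[OF this f'] obtain q r where
          "poly_over K q" "poly_over K r" "f' = m * q + r" "r = 0 \<or> degree r < degree m" by blast
        then show ?thesis using t
          by (intro exI[of _ "q + t"] exI[of _ r])
             (auto intro: poly_over_add[OF K] simp: f'_def algebra_simps)
      qed
    qed
  qed
  with that show thesis by blast
qed

section \<open>Automorphisms of an algebraic closure of the rationals\<close>

locale algebraic_type =
  fixes ty :: "'a::{alg_closed_field, field_char_0} itself"
  assumes algebraic_UNIV: "algebraic (x :: 'a)"
begin

text \<open>As every element is algebraic over \<open>\<rat>\<close>, closure under inverses is automatic.\<close>

definition fld :: "'a set \<Rightarrow> bool" where
  "fld K \<longleftrightarrow> \<rat> \<subseteq> K \<and> (\<forall>x\<in>K. \<forall>y\<in>K. x + y \<in> K \<and> x * y \<in> K)"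

lemma fld_Rats: "fld \<rat>"
  by (auto simp: fld_def)

lemma fldD:
  assumes "fld K"
  shows "\<rat> \<subseteq> K" "x \<in> K \<Longrightarrow> y \<in> K \<Longrightarrow> x + y \<in> K" "x \<in> K \<Longrightarrow> y \<in> K \<Longrightarrow> x * y \<in> K"
  using assms by (auto simp: fld_def)

lemma fld_subring:
  assumes "fld K"
  shows "subring_set K"
proof -
  have "- 1 \<in> K" "1 \<in> K" using fldD(1)[OF assms] by auto
  then show ?thesis
    using fldD(2,3)[OF assms] mult_minus1 unfolding subring_set_def by metis
qed

text \<open>Powers of the variable are divided out. The resulting equation exhibits \<open>x\<close>
  as a divisor of a nonzero constant, which yields inverses in \<open>fld_inverse\<close> and
  integer multiples in \<open>nat_multiple\<close>.\<close>

lemma nonzero_constant_coeff: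
  fixes x :: "'b::idom"
  assumes "p \<noteq> 0" "poly_over K p" "poly p x = 0" "x \<noteq> 0"
  obtains q where "poly_over K q" "poly q x = 0" "coeff q 0 \<noteq> 0"
  using assms
proof (induction p arbitrary: thesis rule: pCons_induct)
  case (pCons a p)
  show ?case
  proof (cases "a = 0")
    case True
    then show ?thesis using pCons by auto
  next
    case False
    then show ?thesis using pCons.prems(1)[of "pCons a p"] pCons.prems(3,4) by simp
  qed
qed simp

lemma fld_inverse:
  assumes K: "fld K" and "x \<in> K"
  shows "inverse x \<in> K"
proof (cases "x = 0")
  case True
  then show ?thesis using assms by simp
next
  case False
  obtain p where p: "p \<noteq> 0" "\<forall>i. coeff p i \<in> \<int>" "poly p x = 0"
    using algebraic_UNIV[of x] by (auto elim: algebraicE)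
  then have "poly_over \<rat> p"
    using Ints_subset_Rats by (auto simp: poly_over_def)
  then obtain q where q: "poly_over \<rat> q" "poly q x = 0" "coeff q 0 \<noteq> 0"
    using nonzero_constant_coeff p False by metis
  obtain a r where ar: "q = pCons a r" by (cases q)
  then have "a + x * poly r x = 0" "a \<noteq> 0" using q by auto
  then have "inverse x = - (inverse a * poly r x)"
    using False by (simp add: field_simps eq_neg_iff_add_eq_0)
  moreover have "poly r x \<in> K"
    using q ar assms fldD(1)[OF K] fld_subring[OF K]
    by (intro subring_set_poly) (auto intro: poly_over_mono)
  moreover have "inverse a \<in> K" using q ar fldD(1)[OF K] by auto
  ultimately show ?thesis
    by (auto intro!: subring_setD[OF fld_subring[OF K]])
qed

lemma fld_divide: "fld K \<Longrightarrow> x \<in> K \<Longrightarrow> y \<in> K \<Longrightarrow> x / y \<in> K"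
  by (simp add: divide_inverse fldD fld_inverse)

lemma poly_over_Rats_fld: "fld K \<Longrightarrow> poly_over \<rat> p \<Longrightarrow> poly_over K p"
  using fldD(1) poly_over_mono by blast

lemma annihilating_poly:
  obtains p where "p \<noteq> 0" "poly_over \<rat> p" "poly p (x :: 'a) = 0"
  using algebraic_UNIV[of x] Ints_subset_Rats by (auto elim!: algebraicE simp: poly_over_def)

lemma minimal_poly:
  assumes K: "fld K"
  obtains m where "poly_over K m" "lead_coeff m = 1" "poly m x = 0"
    "\<And>p. poly_over K p \<Longrightarrow> poly p x = 0 \<Longrightarrow> \<exists>q. poly_over K q \<and> p = m * q"
proof -
  let ?P = "\<lambda>p. p \<noteq> 0 \<and> poly_over K p \<and> poly p x = 0"
  obtain p0 where "?P p0"
    using annihilating_poly[of x] poly_over_Rats_fld[OF K] by metis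
  then obtain m0 where m0: "?P m0" "\<And>p. ?P p \<Longrightarrow> degree m0 \<le> degree p"
    using ex_has_least_nat[of ?P p0 degree] by blast
  define m where "m = Polynomial.smult (inverse (lead_coeff m0)) m0"
  have m: "poly_over K m" "lead_coeff m = 1" "poly m x = 0" "degree m = degree m0"
    using m0(1) K fld_inverse[OF K]
    by (auto simp: m_def poly_over_def intro!: fldD(3)[OF K])
  have "\<exists>q. poly_over K q \<and> p = m * q" if p: "poly_over K p" "poly p x = 0" for p
  proof -
    obtain q r where qr: "poly_over K q" "poly_over K r" "p = m * q + r" "r = 0 \<or> degree r < degree m"
      using poly_over_div_monic[OF fld_subring[OF K] p(1) m(1,2)] by metis
    then have "poly r x = 0" using p m by simp
    then have "r = 0" using qr m0(2)[of r] m by force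
    then show ?thesis using qr by auto
  qed
  then show thesis using that m by blast
qed

section \<open>Homomorphisms from subfields and their extension\<close>

definition hom_on :: "'a set \<Rightarrow> ('a \<Rightarrow> 'a) \<Rightarrow> bool" where
  "hom_on K f \<longleftrightarrow> (\<forall>q\<in>\<rat>. f q = q) \<and> (\<forall>x\<in>K. \<forall>y\<in>K. f (x + y) = f x + f y \<and> f (x * y) = f x * f y)"

lemma hom_on_0: "hom_on K f \<Longrightarrow> f 0 = 0"
  by (auto simp: hom_on_def)

lemma hom_on_sum:
  assumes "fld K" "hom_on K f" "\<And>i. i \<in> I \<Longrightarrow> g i \<in> K"
  shows "f (sum g I) = (\<Sum>i\<in>I. f (g i))"
  using assms(3)
proof (induction I rule: infinite_finite_induct)
  case (insert i I)
  then have "sum g I \<in> K" by (intro subring_set_sum[OF fld_subring[OF assms(1)]]) auto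
  then show ?case using insert assms(2) by (auto simp: hom_on_def)
qed (use hom_on_0[OF assms(2)] in auto)

lemma
  assumes "fld K" "hom_on K f" "poly_over K p" "poly_over K q"
  shows map_poly_hom_on_add: "map_poly f (p + q) = map_poly f p + map_poly f q"
    and map_poly_hom_on_mult: "map_poly f (p * q) = map_poly f p * map_poly f q"
proof -
  note f0 = hom_on_0[OF assms(2)]
  show "map_poly f (p + q) = map_poly f p + map_poly f q"
    using assms by (intro poly_eqI) (auto simp: coeff_map_poly f0 hom_on_def poly_over_def)
  have "f (\<Sum>i\<le>n. coeff p i * coeff q (n - i)) = (\<Sum>i\<le>n. f (coeff p i) * f (coeff q (n - i)))" for n
    using assms fldD(3)[OF assms(1)]
    by (subst hom_on_sum[OF assms(1,2)]) (auto simp: poly_over_def hom_on_def intro!: sum.cong)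
  then show "map_poly f (p * q) = map_poly f p * map_poly f q"
    by (intro poly_eqI) (simp add: coeff_map_poly f0 coeff_mult)
qed

text \<open>
  Homomorphisms from subfields are represented by their graphs, which Zorn's lemma orders by
  inclusion. The last clause amounts to single-valuedness.
\<close>

definition hom_graph :: "('a \<times> 'a) set \<Rightarrow> bool" where
  "hom_graph R \<longleftrightarrow> (\<forall>q\<in>\<rat>. (q, q) \<in> R) \<and>
     (\<forall>x y x' y'. (x, y) \<in> R \<longrightarrow> (x', y') \<in> R \<longrightarrow> (x + x', y + y') \<in> R \<and> (x * x', y * y') \<in> R) \<and>
     (\<forall>y. (0, y) \<in> R \<longrightarrow> y = 0)"

lemma hom_graph_cases:
  assumes R: "hom_graph R"
  obtains K f where "fld K" "hom_on K f" "R = {(x, f x) |x. x \<in> K}"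
proof -
  define K where "K = Domain R"
  have K: "fld K" using R unfolding fld_def K_def hom_graph_def by (auto simp: Domain_iff) metis+
  have unique: "y = y'" if yy': "(x, y) \<in> R" "(x, y') \<in> R" for x y y'
  proof -
    have "(- 1, - 1) \<in> R" using R by (auto simp: hom_graph_def)
    then have "(- 1 * x, - 1 * y') \<in> R" using R yy' unfolding hom_graph_def by blast
    then have "(x + - 1 * x, y + - 1 * y') \<in> R" using R yy' unfolding hom_graph_def by blast
    then show ?thesis using R by (auto simp: hom_graph_def)
  qed
  have "y = (SOME y. (x, y) \<in> R)" if "(x, y) \<in> R" for x y
    using unique[OF that] someI[of "\<lambda>y. (x, y) \<in> R", OF that] by simp
  then have "\<exists>f. \<forall>x y. (x, y) \<in> R \<longrightarrow> y = f x"
    by (intro exI[of _ "\<lambda>x. SOME y. (x, y) \<in> R"]) blast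
  then obtain f where f: "\<And>x y. (x, y) \<in> R \<Longrightarrow> y = f x" by blast
  then have f': "(x, f x) \<in> R" if "x \<in> K" for x using that by (auto simp: K_def)
  have "hom_on K f"
    unfolding hom_on_def
  proof (intro conjI ballI)
    show "f q = q" if "q \<in> \<rat>" for q
    proof -
      have "(q, q) \<in> R" using R that unfolding hom_graph_def by blast
      then show ?thesis using f by metis
    qed
    fix x y assume "x \<in> K" "y \<in> K"
    then have "(x + y, f x + f y) \<in> R" "(x * y, f x * f y) \<in> R"
      using R f' unfolding hom_graph_def by blast+
    then show "f (x + y) = f x + f y" "f (x * y) = f x * f y" using f by metis+
  qed
  moreover have "R = {(x, f x) |x. x \<in> K}"
    using f f' by (auto simp: K_def)
  ultimately show thesis using that[OF K] by blast
qed

lemma hom_graph_of_hom_on: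
  assumes "fld K" "hom_on K f"
  shows "hom_graph {(x, f x) |x. x \<in> K}"
proof -
  have "0 \<in> K" using fld_subring[OF assms(1)] subring_setD by blast
  then show ?thesis
    using assms hom_on_0[OF assms(2)] unfolding hom_graph_def
    by (auto simp: subset_iff hom_on_def fld_def)
qed

text \<open>The extension sends \<open>poly p x\<close> to \<open>poly (map_poly f p) y\<close>. It
  is single-valued because every \<open>p\<close> that vanishes at \<open>x\<close> is a multiple of
  \<open>m\<close>, whose image vanishes at \<open>y\<close>.\<close>

lemma hom_graph_simple_extension:
  assumes K: "fld K" and f: "hom_on K f" and m: "poly_over K m"
    "\<And>p. poly_over K p \<Longrightarrow> poly p x = 0 \<Longrightarrow> \<exists>q. poly_over K q \<and> p = m * q"
    and y: "poly (map_poly f m) y = 0"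
  obtains R where "hom_graph R" "{(z, f z) |z. z \<in> K} \<subseteq> R" "(x, y) \<in> R"
proof
  define R where "R = {(poly p x, poly (map_poly f p) y) |p. poly_over K p}"
  note f0 = hom_on_0[OF f] and ring = fld_subring[OF K]
  have const: "(c, f c) \<in> R" if "c \<in> K" for c
  proof -
    have "poly_over K [:c:]" using that ring by simp
    moreover have "map_poly f [:c:] = [:f c:]"
      by (intro poly_eqI) (simp add: coeff_map_poly f0 coeff_pCons split: nat.splits)
    ultimately show ?thesis unfolding R_def by (auto intro!: exI[of _ "[:c:]"])
  qed
  show "{(z, f z) |z. z \<in> K} \<subseteq> R" using const by auto
  have "poly_over K [:0, 1:]" using ring subring_setD[OF ring] by simp
  moreover have "map_poly f [:0, 1:] = [:0, 1:]"
    using f f0 by (intro poly_eqI) (simp add: coeff_map_poly hom_on_def coeff_pCons split: nat.splits)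
  ultimately show "(x, y) \<in> R" unfolding R_def by (auto intro!: exI[of _ "[:0, 1:]"])
  show "hom_graph R"
    unfolding hom_graph_def
  proof (intro conjI allI impI ballI)
    show "(q, q) \<in> R" if "q \<in> \<rat>" for q
      using const[of q] that f fldD(1)[OF K] by (auto simp: hom_on_def)
    fix a b a' b' assume "(a, b) \<in> R" "(a', b') \<in> R"
    then obtain p q where pq: "poly_over K p" "poly_over K q" "a = poly p x" "a' = poly q x"
      "b = poly (map_poly f p) y" "b' = poly (map_poly f q) y" by (auto simp: R_def)
    then have "poly_over K (p + q)" "poly_over K (p * q)"
      using poly_over_add[OF ring] poly_over_mult[OF ring] by blast+
    moreover have "(poly r x, poly (map_poly f r) y) \<in> R" if "poly_over K r" for r
      using that by (auto simp: R_def)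
    ultimately have "(poly (p + q) x, poly (map_poly f (p + q)) y) \<in> R"
      "(poly (p * q) x, poly (map_poly f (p * q)) y) \<in> R" by blast+
    with pq show "(a + a', b + b') \<in> R" "(a * a', b * b') \<in> R"
      by (simp_all add: map_poly_hom_on_add[OF K f] map_poly_hom_on_mult[OF K f])
  next
    fix b assume "(0, b) \<in> R"
    then obtain p where p: "poly_over K p" "poly p x = 0" "b = poly (map_poly f p) y"
      by (auto simp: R_def)
    then obtain q where "poly_over K q" "p = m * q" using m by blast
    then show "b = 0" using p m y by (simp add: map_poly_hom_on_mult[OF K f])
  qed
qed

text \<open>Endomorphisms of the whole closure; their bijectivity is derived in
  \<open>bij_Aut\<close>. Fixing \<open>\<rat>\<close> is a separate clause because \<open>K\<close>
  may be any set, and it includes that \<open>0\<close> and \<open>1\<close> are preserved.\<close>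

definition Aut :: "'a set \<Rightarrow> ('a \<Rightarrow> 'a) set" where
  "Aut K = {\<sigma>. (\<forall>x y. \<sigma> (x + y) = \<sigma> x + \<sigma> y \<and> \<sigma> (x * y) = \<sigma> x * \<sigma> y) \<and> (\<forall>x\<in>K. \<sigma> x = x) \<and> (\<forall>x\<in>\<rat>. \<sigma> x = x)}"

lemma AutD:
  assumes "\<sigma> \<in> Aut K"
  shows "\<sigma> (x + y) = \<sigma> x + \<sigma> y" "\<sigma> (x * y) = \<sigma> x * \<sigma> y" "x \<in> K \<Longrightarrow> \<sigma> x = x" "x \<in> \<rat> \<Longrightarrow> \<sigma> x = x"
  using assms by (auto simp: Aut_def)

lemma Aut_field_hom: "\<sigma> \<in> Aut K \<Longrightarrow> field_hom \<sigma>"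
  by standard (auto simp: AutD)

lemma Aut_mono: "K \<subseteq> L \<Longrightarrow> Aut L \<subseteq> Aut K"
  by (auto simp: Aut_def)

lemma id_Aut: "id \<in> Aut K" "(\<lambda>x. x) \<in> Aut K"
  by (auto simp: Aut_def)

lemma comp_Aut: "\<sigma> \<in> Aut K \<Longrightarrow> \<tau> \<in> Aut K \<Longrightarrow> \<sigma> \<circ> \<tau> \<in> Aut K"
  by (auto simp: Aut_def)

lemma inj_Aut: "\<sigma> \<in> Aut K \<Longrightarrow> inj \<sigma>"
proof (rule injI)
  fix x y assume s: "\<sigma> \<in> Aut K" and eq: "\<sigma> x = \<sigma> y"
  interpret field_hom \<sigma> using s by (rule Aut_field_hom)
  show "x = y" using eq by simp
qed

lemma map_poly_Aut_fixed:
  assumes "\<sigma> \<in> Aut K" "poly_over K p"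
  shows "map_poly \<sigma> p = p"
  using assms by (intro poly_eqI) (auto simp: coeff_map_poly AutD poly_over_def)

lemma poly_Aut:
  assumes "\<sigma> \<in> Aut K"
  shows "poly (map_poly \<sigma> p) (\<sigma> x) = \<sigma> (poly p x)"
proof -
  interpret field_hom \<sigma> using assms by (rule Aut_field_hom)
  show ?thesis by simp
qed

lemma finite_Aut_orbit: "finite ((\<lambda>\<sigma>. \<sigma> x) ` Aut K)"
proof -
  obtain p where p: "p \<noteq> 0" "poly_over \<rat> p" "poly p x = 0" by (rule annihilating_poly)
  have "poly p (\<sigma> x) = 0" if "\<sigma> \<in> Aut K" for \<sigma>
  proof -
    have "\<sigma> \<in> Aut \<rat>" using that by (auto simp: Aut_def)
    then show ?thesis
      using poly_Aut[of \<sigma> \<rat> p x] p map_poly_Aut_fixed[of \<sigma> \<rat> p] AutD(4)[of \<sigma> \<rat> 0] by simp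
  qed
  then have "(\<lambda>\<sigma>. \<sigma> x) ` Aut K \<subseteq> {z. poly p z = 0}" by auto
  then show ?thesis using poly_roots_finite[OF p(1)] finite_subset by blast
qed

text \<open>Surjectivity is obtained one orbit at a time: an injective map of a finite orbit into
  itself is onto.\<close>

lemma bij_Aut:
  assumes \<sigma>: "\<sigma> \<in> Aut K"
  shows "bij \<sigma>"
proof -
  have "z \<in> range \<sigma>" for z
  proof -
    let ?O = "(\<lambda>\<tau>. \<tau> z) ` Aut K"
    have sub: "\<sigma> ` ?O \<subseteq> ?O"
    proof safe
      fix \<tau> assume "\<tau> \<in> Aut K"
      then have "\<sigma> \<circ> \<tau> \<in> Aut K" using comp_Aut \<sigma> by blast
      then show "\<sigma> (\<tau> z) \<in> ?O" by (metis comp_apply imageI)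
    qed
    moreover have "inj_on \<sigma> ?O" using inj_Aut[OF \<sigma>] inj_on_subset by blast
    ultimately have "\<sigma> ` ?O = ?O"
      by (intro endo_inj_surj finite_Aut_orbit)
    moreover have "z \<in> ?O" using id_Aut by (metis id_apply imageI)
    ultimately show ?thesis by auto
  qed
  then show ?thesis using inj_Aut[OF \<sigma>] by (auto simp: bij_def)
qed

lemma inv_Aut:
  assumes \<sigma>: "\<sigma> \<in> Aut K"
  shows "inv_into UNIV \<sigma> \<in> Aut K"
proof -
  have s: "\<sigma> (inv_into UNIV \<sigma> x) = x" "inv_into UNIV \<sigma> (\<sigma> x) = x" for x
    using bij_Aut[OF \<sigma>] by (simp_all add: bij_def surj_f_inv_f)
  have "inv_into UNIV \<sigma> (x + y) = inv_into UNIV \<sigma> x + inv_into UNIV \<sigma> y" "inv_into UNIV \<sigma> (x * y) = inv_into UNIV \<sigma> x * inv_into UNIV \<sigma> y" for x y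
    using AutD(1,2)[OF \<sigma>, of "inv_into UNIV \<sigma> x" "inv_into UNIV \<sigma> y"]
      s(2)[of "inv_into UNIV \<sigma> x + inv_into UNIV \<sigma> y"] s(2)[of "inv_into UNIV \<sigma> x * inv_into UNIV \<sigma> y"]
    by (simp_all add: s(1))
  moreover have "inv_into UNIV \<sigma> x = x" if "x \<in> K \<or> x \<in> \<rat>" for x
    using that s(2)[of x] AutD(3,4)[OF \<sigma>, of x] by auto
  ultimately show ?thesis by (auto simp: Aut_def)
qed

lemma Aut_inv_simps:
  assumes "\<sigma> \<in> Aut K"
  shows "\<sigma> (inv_into UNIV \<sigma> x) = x" "inv_into UNIV \<sigma> (\<sigma> x) = x"
  using bij_Aut[OF assms] by (auto simp: bij_def surj_f_inv_f)

text \<open>A maximal graph is total. Any \<open>x\<close> has a minimal polynomial over the domain,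
  its image has a root in the algebraically closed field, and so the graph could be extended by
  \<open>x\<close>.\<close>

lemma hom_graph_extends_to_Aut:
  assumes "hom_graph R0"
  obtains \<sigma> where "\<sigma> \<in> Aut \<rat>" "\<And>x y. (x, y) \<in> R0 \<Longrightarrow> \<sigma> x = y"
proof -
  let ?A = "{R. hom_graph R \<and> R0 \<subseteq> R}"
  have chain: "\<Union>C \<in> ?A" if C: "C \<noteq> {}" "subset.chain ?A C" for C
  proof -
    have cmp: "R \<subseteq> S \<or> S \<subseteq> R" if "R \<in> C" "S \<in> C" for R S
      using subset.chain_total[OF C(2) that] by auto
    have A: "hom_graph R" "R0 \<subseteq> R" if "R \<in> C" for R
      using C(2) that by (auto simp: subset.chain_def)
    have "hom_graph (\<Union>C)"
      unfolding hom_graph_def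
    proof (intro conjI allI impI ballI)
      show "(q, q) \<in> \<Union>C" if "q \<in> \<rat>" for q
        using C(1) A that unfolding hom_graph_def by blast
      show "y = 0" if "(0, y) \<in> \<Union>C" for y
        using A that unfolding hom_graph_def by blast
      fix x y x' y' assume "(x, y) \<in> \<Union>C" "(x', y') \<in> \<Union>C"
      then obtain R S where RS: "R \<in> C" "S \<in> C" "(x, y) \<in> R" "(x', y') \<in> S" by blast
      then obtain T where "T \<in> C" "(x, y) \<in> T" "(x', y') \<in> T" using cmp by blast
      then show "(x + x', y + y') \<in> \<Union>C" "(x * x', y * y') \<in> \<Union>C"
        using A[of T] unfolding hom_graph_def by blast+
    qed
    then show ?thesis using C(1) A by auto
  qed
  obtain R where R: "R \<in> ?A" "\<forall>S\<in>?A. R \<subseteq> S \<longrightarrow> S = R"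
    using subset_Zorn_nonempty[of ?A] chain assms by blast
  obtain K f where Kf: "fld K" "hom_on K f" "R = {(x, f x) |x. x \<in> K}"
    using hom_graph_cases R by blast
  have "x \<in> K" for x
  proof -
    obtain m where m: "poly_over K m" "lead_coeff m = 1" "poly m x = 0"
      "\<And>p. poly_over K p \<Longrightarrow> poly p x = 0 \<Longrightarrow> \<exists>q. poly_over K q \<and> p = m * q"
      using minimal_poly[OF Kf(1)] by metis
    have "degree m > 0"
      using m by (intro Nat.gr0I) (auto elim!: degree_eq_zeroE)
    moreover have "f 1 = 1" using Kf(2) by (auto simp: hom_on_def)
    then have "degree (map_poly f m) = degree m"
      using m(2) by (intro degree_map_poly) auto
    ultimately obtain y where "poly (map_poly f m) y = 0"
      using alg_closed_imp_poly_has_root[of "map_poly f m"] by auto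
    then obtain S where "hom_graph S" "R \<subseteq> S" "(x, y) \<in> S"
      using hom_graph_simple_extension[OF Kf(1,2) m(1,4)] Kf(3) by metis
    then have "(x, y) \<in> R" using R by blast
    then show ?thesis using Kf by auto
  qed
  then have "f \<in> Aut \<rat>" using Kf by (auto simp: Aut_def hom_on_def)
  moreover have "f x = y" if "(x, y) \<in> R0" for x y using that R Kf by auto
  ultimately show thesis using that by blast
qed

lemma hom_on_extends_to_Aut:
  assumes "fld K" "hom_on K f"
  obtains \<sigma> where "\<sigma> \<in> Aut \<rat>" "\<And>x. x \<in> K \<Longrightarrow> \<sigma> x = f x"
  using hom_graph_extends_to_Aut[OF hom_graph_of_hom_on[OF assms]] by (metis (mono_tags, lifting) mem_Collect_eq)

text \<open>Every root of the minimal polynomial of \<open>x\<close> over \<open>K\<close> is an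
  image of \<open>x\<close> under \<open>Aut K\<close>, so \<open>x\<close> is its only root. A
  second linear factor would make the nonzero derivative vanish at \<open>x\<close>, against
  minimality; hence the polynomial is linear.\<close>

theorem fixed_field_Aut:
  assumes K: "fld K" and fixed: "\<And>\<sigma>. \<sigma> \<in> Aut K \<Longrightarrow> \<sigma> x = x"
  shows "x \<in> K"
proof -
  obtain m where m: "poly_over K m" "lead_coeff m = 1" "poly m x = 0"
    "\<And>p. poly_over K p \<Longrightarrow> poly p x = 0 \<Longrightarrow> \<exists>q. poly_over K q \<and> p = m * q"
    using minimal_poly[OF K] by metis
  have id: "hom_on K id" by (auto simp: hom_on_def)
  have root: "y = x" if "poly m y = 0" for y
  proof -
    have "poly (map_poly id m) y = 0" using that by simp
    from hom_graph_simple_extension[OF K id m(1,4) this]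
    obtain R where R: "hom_graph R" "{(z, id z) |z. z \<in> K} \<subseteq> R" "(x, y) \<in> R" by blast
    obtain \<sigma> where s: "\<sigma> \<in> Aut \<rat>" "\<And>x y. (x, y) \<in> R \<Longrightarrow> \<sigma> x = y"
      using hom_graph_extends_to_Aut[OF R(1)] by metis
    then have "\<sigma> \<in> Aut K" using R(2) by (auto simp: Aut_def)
    then show ?thesis using fixed s R by metis
  qed
  have "m \<noteq> 0" using m(2) by auto
  obtain q where q: "m = [:- x, 1:] * q" using m(3) unfolding poly_eq_0_iff_dvd by (elim dvdE)
  then have "q \<noteq> 0" using \<open>m \<noteq> 0\<close> by auto
  have deg: "degree m = Suc (degree q)" using \<open>q \<noteq> 0\<close> unfolding q by (subst degree_mult_eq) auto
  have "degree q = 0"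
  proof (rule ccontr)
    assume "degree q \<noteq> 0"
    then obtain y where "poly q y = 0" using alg_closed_imp_poly_has_root[of q] by auto
    then have "poly q x = 0" using root[of y] q by auto
    then have "poly (pderiv m) x = 0"
      unfolding q by (simp add: pderiv_mult del: mult_pCons_left)
    moreover have "poly_over K (pderiv m)"
      using m(1) fldD(1,3)[OF K] unfolding poly_over_def coeff_pderiv
      by (auto simp: subset_iff simp flip: of_nat_Suc simp del: of_nat_Suc)
    ultimately obtain r where "pderiv m = m * r" using m(4) by blast
    moreover have "pderiv m \<noteq> 0" using deg by (simp add: pderiv_eq_0_iff)
    ultimately have "degree m \<le> degree (pderiv m)" by (auto simp: degree_mult_eq)
    then show False using deg by (simp add: degree_pderiv)
  qed
  then obtain c where "q = [:c:]" by (elim degree_eq_zeroE)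
  then have "m = [:- x * c, c:]" using q by simp
  then have "m = [:- x, 1:]" using m(2) by (auto split: if_splits)
  then have "- x \<in> K" using m(1) by simp
  then show ?thesis using subring_setD(3)[OF fld_subring[OF K], of "- x"] by simp
qed

end

section \<open>Contents of polynomials\<close>

abbreviation algebraic_ints :: "'a::field set" where
  "algebraic_ints \<equiv> {x. algebraic_int x}"

lemma subring_algebraic_ints: "subring_set (algebraic_ints :: 'a::field_char_0 set)"
  by (auto simp: subring_set_def intro: algebraic_int_add algebraic_int_mult)

context algebraic_type
begin

section \<open>Conjugates of polynomials and integrality of their coefficients\<close>

lemma algebraic_int_Aut:
  assumes "\<sigma> \<in> Aut K" "algebraic_int x"
  shows "algebraic_int (\<sigma> x)"
proof -
  obtain p where p: "lead_coeff p = 1" "\<forall>i. coeff p i \<in> \<int>" "poly p x = 0"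
    using assms(2) by (auto elim: algebraic_int.cases)
  have "\<sigma> \<in> Aut \<rat>" using assms(1) by (auto simp: Aut_def)
  moreover have "poly_over \<rat> p" using p Ints_subset_Rats by (auto simp: poly_over_def)
  ultimately have "poly p (\<sigma> x) = 0"
    using poly_Aut[of \<sigma> \<rat> p x] p map_poly_Aut_fixed[of \<sigma> \<rat> p] AutD(4)[of \<sigma> \<rat> 0] by simp
  then show ?thesis using p by (auto intro: algebraic_int.intros)
qed

lemma finite_poly_orbit: "finite ((\<lambda>\<sigma>. map_poly \<sigma> f) ` Aut K)"
proof -
  let ?S = "\<Union>i\<le>degree f. (\<lambda>\<sigma>. \<sigma> (coeff f i)) ` Aut K"
  let ?X = "{xs. set xs \<subseteq> ?S \<and> length xs = Suc (degree f)}"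
  have "map_poly \<sigma> f \<in> Poly ` ?X" if s: "\<sigma> \<in> Aut K" for \<sigma>
  proof (rule image_eqI)
    let ?xs = "map (\<lambda>i. \<sigma> (coeff f i)) [0..<Suc (degree f)]"
    show "map_poly \<sigma> f = Poly ?xs"
      using AutD(4)[OF s, of 0]
      by (intro poly_eqI)
         (auto simp: coeff_map_poly coeff_Poly_eq nth_default_def coeff_eq_0 nth_append less_Suc_eq_le simp del: upt_Suc)
    show "?xs \<in> ?X" using s by (auto simp: less_Suc_eq_le simp del: upt_Suc)
  qed
  moreover have "finite ?X"
    by (intro finite_lists_length_eq finite_UN_I finite_Aut_orbit) auto
  ultimately show ?thesis by (meson finite_imageI finite_subset image_subsetI)
qed

lemma map_poly_Aut_comp:
  assumes "\<sigma> \<in> Aut K" "\<tau> \<in> Aut K"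
  shows "map_poly (\<sigma> \<circ> \<tau>) f = map_poly \<sigma> (map_poly \<tau> f)"
  using AutD(4)[OF assms(1), of 0] AutD(4)[OF assms(2), of 0]
  by (intro poly_eqI) (auto simp: coeff_map_poly)

lemma
  assumes "\<sigma> \<in> Aut K"
  shows map_poly_Aut_add: "map_poly \<sigma> (p + q) = map_poly \<sigma> p + map_poly \<sigma> q"
    and map_poly_Aut_mult: "map_poly \<sigma> (p * q) = map_poly \<sigma> p * map_poly \<sigma> q"
    and map_poly_Aut_1: "map_poly \<sigma> 1 = 1"
proof -
  have "fld UNIV" "hom_on UNIV \<sigma>"
    using assms by (auto simp: fld_def hom_on_def AutD)
  then show "map_poly \<sigma> (p + q) = map_poly \<sigma> p + map_poly \<sigma> q"
    "map_poly \<sigma> (p * q) = map_poly \<sigma> p * map_poly \<sigma> q"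
    by (auto intro: map_poly_hom_on_add map_poly_hom_on_mult simp: poly_over_def)
  show "map_poly \<sigma> 1 = 1"
    using AutD(4)[OF assms, of 0] AutD(4)[OF assms, of 1]
    by (intro poly_eqI) (auto simp: coeff_map_poly one_pCons coeff_pCons split: nat.splits)
qed

lemma map_poly_Aut_prod:
  assumes "\<sigma> \<in> Aut K"
  shows "map_poly \<sigma> (prod g I) = (\<Prod>i\<in>I. map_poly \<sigma> (g i))"
  by (induction I rule: infinite_finite_induct)
     (simp_all add: map_poly_Aut_mult[OF assms] map_poly_Aut_1[OF assms])

lemma map_poly_Aut_inj:
  assumes "\<sigma> \<in> Aut K"
  shows "inj (map_poly \<sigma>)"
proof (rule injI)
  fix p q assume "map_poly \<sigma> p = map_poly \<sigma> q"
  then have "\<sigma> (coeff p i) = \<sigma> (coeff q i)" for i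
    using AutD(4)[OF assms, of 0] by (metis Rats_0 coeff_map_poly)
  then show "p = q" using inj_Aut[OF assms] by (intro poly_eqI) (auto dest: injD)
qed

text \<open>A norm down to the rational polynomials. The product runs over the set of distinct
  conjugates, which is finite even if \<open>Aut \<rat>\<close> is not.\<close>

definition orbit_poly :: "'a poly \<Rightarrow> 'a poly" where
  "orbit_poly f = \<Prod>((\<lambda>\<sigma>. map_poly \<sigma> f) ` Aut \<rat>)"

lemma poly_over_fixed:
  assumes "fld K" "\<And>\<sigma>. \<sigma> \<in> Aut K \<Longrightarrow> map_poly \<sigma> f = f"
  shows "poly_over K f"
  unfolding poly_over_def
proof (intro allI fixed_field_Aut[OF assms(1)])
  fix i \<sigma> assume s: "\<sigma> \<in> Aut K"
  show "\<sigma> (coeff f i) = coeff f i"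
    using assms(2)[OF s] AutD(4)[OF s, of 0] by (metis Rats_0 coeff_map_poly)
qed

lemma orbit_poly_permuted:
  assumes "\<tau> \<in> Aut \<rat>"
  shows "map_poly \<tau> ` ((\<lambda>\<sigma>. map_poly \<sigma> f) ` Aut \<rat>) = (\<lambda>\<sigma>. map_poly \<sigma> f) ` Aut \<rat>"
proof -
  have "map_poly \<tau> ` ((\<lambda>\<sigma>. map_poly \<sigma> f) ` Aut \<rat>) \<subseteq> (\<lambda>\<sigma>. map_poly \<sigma> f) ` Aut \<rat>"
  proof safe
    fix \<sigma> assume "\<sigma> \<in> Aut \<rat>"
    then show "map_poly \<tau> (map_poly \<sigma> f) \<in> (\<lambda>\<sigma>. map_poly \<sigma> f) ` Aut \<rat>"
      using comp_Aut[OF assms] map_poly_Aut_comp[OF assms] by (metis imageI)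
  qed
  then show ?thesis
    by (intro endo_inj_surj finite_poly_orbit) (auto intro: inj_on_subset[OF map_poly_Aut_inj[OF assms]])
qed

lemma orbit_poly_rational: "poly_over \<rat> (orbit_poly f)"
proof (rule poly_over_fixed[OF fld_Rats])
  fix \<tau> assume t: "\<tau> \<in> Aut \<rat>"
  let ?O = "(\<lambda>\<sigma>. map_poly \<sigma> f) ` Aut \<rat>"
  have "map_poly \<tau> (orbit_poly f) = prod (map_poly \<tau>) ?O"
    unfolding orbit_poly_def by (simp add: map_poly_Aut_prod[OF t])
  also have "\<dots> = \<Prod>(map_poly \<tau> ` ?O)"
    by (subst prod.reindex) (auto intro: inj_on_subset[OF map_poly_Aut_inj[OF t]])
  finally show "map_poly \<tau> (orbit_poly f) = orbit_poly f"
    using orbit_poly_permuted[OF t] by (simp add: orbit_poly_def)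
qed

text \<open>Automorphisms over \<open>L\<close> fix \<open>f\<close> and permute its other
  conjugates, so the product of the others has coefficients in \<open>L\<close>.\<close>

lemma orbit_poly_cofactor:
  assumes "fld L" "poly_over L f"
  obtains g where "poly_over L g" "orbit_poly f = f * g"
proof
  let ?O = "(\<lambda>\<sigma>. map_poly \<sigma> f) ` Aut \<rat>"
  have f: "f \<in> ?O"
    using id_Aut(2)[of \<rat>] by (intro image_eqI[of _ _ "\<lambda>x. x"]) (auto simp: map_poly_idI)
  show "orbit_poly f = f * \<Prod>(?O - {f})"
    unfolding orbit_poly_def using f finite_poly_orbit by (simp add: prod.remove)
  show "poly_over L (\<Prod>(?O - {f}))"
  proof (rule poly_over_fixed[OF assms(1)])
    fix \<tau> assume t: "\<tau> \<in> Aut L"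
    then have tQ: "\<tau> \<in> Aut \<rat>" by (auto simp: Aut_def)
    have "map_poly \<tau> ` (?O - {f}) = map_poly \<tau> ` ?O - map_poly \<tau> ` {f}"
      using map_poly_Aut_inj[OF t] by (intro image_set_diff)
    also have "\<dots> = ?O - {f}"
      using orbit_poly_permuted[OF tQ] map_poly_Aut_fixed[OF t assms(2)] by simp
    finally have "\<Prod>(?O - {f}) = \<Prod>(map_poly \<tau> ` (?O - {f}))" by (rule arg_cong[OF sym])
    also have "\<dots> = prod (map_poly \<tau>) (?O - {f})"
      by (subst prod.reindex) (auto intro: inj_on_subset[OF map_poly_Aut_inj[OF t]])
    also have "\<dots> = map_poly \<tau> (\<Prod>(?O - {f}))" by (rule map_poly_Aut_prod[OF t, symmetric])
    finally show "map_poly \<tau> (\<Prod>(?O - {f})) = \<Prod>(?O - {f})" by (rule sym)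
  qed
qed

lemma orbit_poly_nonzero:
  assumes "f \<noteq> 0"
  shows "orbit_poly f \<noteq> 0"
proof -
  have "map_poly \<sigma> f \<noteq> 0" if s: "\<sigma> \<in> Aut \<rat>" for \<sigma>
  proof
    assume "map_poly \<sigma> f = 0"
    then have "map_poly \<sigma> f = map_poly \<sigma> 0" by simp
    then have "f = 0" using injD[OF map_poly_Aut_inj[OF s]] by blast
    then show False using assms by simp
  qed
  then show ?thesis
    unfolding orbit_poly_def using finite_poly_orbit by (auto simp: prod_zero_iff)
qed

text \<open>The norm of a monic polynomial with integral coefficients is monic, and its coefficients
  are rational as well as integral, hence in \<open>\<int>\<close>. It still vanishes at
  \<open>x\<close>.\<close>

lemma algebraic_int_root_monic:
  fixes f :: "'a poly"
  assumes f: "poly_over algebraic_ints f" "lead_coeff f = 1" and x: "poly f x = 0"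
  shows "algebraic_int x"
proof
  have s: "poly_over algebraic_ints (map_poly \<sigma> f) \<and> lead_coeff (map_poly \<sigma> f) = 1"
    if s: "\<sigma> \<in> Aut \<rat>" for \<sigma>
  proof -
    interpret field_hom \<sigma> using s by (rule Aut_field_hom)
    have "lead_coeff (map_poly \<sigma> f) = \<sigma> (lead_coeff f)" by (simp add: hom_distribs)
    then show ?thesis
      using f algebraic_int_Aut[OF s] by (auto simp: poly_over_def)
  qed
  show "lead_coeff (orbit_poly f) = 1"
    unfolding orbit_poly_def lead_coeff_prod using s by (intro prod.neutral) auto
  have "poly_over algebraic_ints (orbit_poly f)"
    unfolding orbit_poly_def using s by (intro poly_over_prod subring_algebraic_ints) auto
  then show "\<forall>i. coeff (orbit_poly f) i \<in> \<int>"
    using orbit_poly_rational[of f] by (auto simp: poly_over_def intro: rational_algebraic_int_is_int)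
  obtain g where "orbit_poly f = f * g"
    using orbit_poly_cofactor[of UNIV f] by (auto simp: fld_def poly_over_def)
  then show "poly (orbit_poly f) x = 0" using x by simp
qed

lemma algebraic_int_lead_coeff_mult_root:
  fixes f :: "'a poly"
  assumes "poly_over algebraic_ints f" "poly f x = 0" "f \<noteq> 0"
  shows "algebraic_int (lead_coeff f * x)"
proof -
  define n where "n = degree f"
  define a where "a = lead_coeff f"
  have a: "algebraic_int a" "a \<noteq> 0" using assms by (auto simp: a_def poly_over_def)
  have "n > 0" using assms by (intro Nat.gr0I) (auto simp: n_def elim!: degree_eq_zeroE)
  \<comment> \<open>The monic polynomial \<open>a ^ (n - 1) * f (T / a)\<close>, written without
    division.\<close>
  define g where "g = monom 1 n + (\<Sum>i<n. monom (coeff f i * a ^ (n - 1 - i)) i)"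
  have coeff_g: "coeff g k = (if k = n then 1 else if k < n then coeff f k * a ^ (n - 1 - k) else 0)" for k
    by (auto simp: g_def coeff_sum if_distrib[of "\<lambda>x. coeff x _"] sum.delta)
  have "degree g = n"
    by (intro antisym degree_le le_degree) (auto simp: coeff_g)
  have "poly g (a * x) = (\<Sum>i\<le>n. coeff g i * (a * x) ^ i)"
    by (simp add: poly_altdef \<open>degree g = n\<close>)
  also have "\<dots> = (\<Sum>i\<le>n. a ^ (n - 1) * (coeff f i * x ^ i))"
  proof (rule sum.cong[OF refl])
    fix i assume "i \<in> {..n}"
    then consider "i = n" | "i < n" by fastforce
    then show "coeff g i * (a * x) ^ i = a ^ (n - 1) * (coeff f i * x ^ i)"
    proof cases
      case 1
      have "a ^ n = a ^ (n - 1) * a" using \<open>n > 0\<close> by (metis power_minus_mult)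
      then show ?thesis using 1 by (simp add: coeff_g power_mult_distrib a_def n_def)
    next
      case 2
      then have "a ^ (n - 1) = a ^ (n - 1 - i) * a ^ i" by (simp flip: power_add)
      then show ?thesis using 2 by (simp add: coeff_g power_mult_distrib)
    qed
  qed
  also have "\<dots> = a ^ (n - 1) * poly f x"
    by (simp add: poly_altdef n_def sum_distrib_left)
  finally have "poly g (a * x) = 0" using assms by simp
  moreover have "lead_coeff g = 1" using \<open>degree g = n\<close> by (simp add: coeff_g)
  moreover have "poly_over algebraic_ints g"
    using assms(1) a unfolding poly_over_def coeff_g
    by (auto intro!: algebraic_int_mult algebraic_int_power)
  ultimately show ?thesis unfolding a_def using algebraic_int_root_monic by blast
qed

text \<open>With \<open>a\<close> the leading coefficient and \<open>n\<close> the degree of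
  \<open>q\<close>, the product \<open>(T - x) * a T ^ n\<close> is integral because
  \<open>a * x\<close> is. Subtracting it lowers the degree of the cofactor.\<close>

lemma poly_over_algebraic_ints_factor:
  fixes q :: "'a poly"
  assumes "poly_over algebraic_ints ([:- x, 1:] * q)"
  shows "poly_over algebraic_ints q"
  using assms
proof (induction "degree q" arbitrary: q rule: less_induct)
  case less
  show ?case
  proof (cases "q = 0")
    case False
    define n a where "n = degree q" and "a = lead_coeff q"
    let ?f = "[:- x, 1:] * q"
    have "?f \<noteq> 0" using False by (simp del: mult_pCons_left)
    have "lead_coeff ?f = lead_coeff [:- x, 1:] * lead_coeff q" by (rule lead_coeff_mult)
    then have lead: "lead_coeff ?f = a" by (simp add: a_def)
    then have a: "algebraic_int a" using less.prems unfolding poly_over_def by (metis mem_Collect_eq)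
    have "algebraic_int (a * x)"
      using algebraic_int_lead_coeff_mult_root[OF less.prems, of x] \<open>?f \<noteq> 0\<close> lead by simp
    define r where "r = q - monom a n"
    have "[:- x, 1:] * r = ?f - [:- x, 1:] * monom a n" by (simp add: r_def right_diff_distrib del: mult_pCons_left)
    also have "[:- x, 1:] * monom a n = monom (- (a * x)) n + monom a (Suc n)"
      by (simp add: monom_Suc smult_monom mult.commute)
    finally have "poly_over algebraic_ints ([:- x, 1:] * r)"
      using less.prems a \<open>algebraic_int (a * x)\<close> unfolding poly_over_def
      by (auto simp del: mult_pCons_left intro!: algebraic_int_diff algebraic_int_add)
    moreover have "r = 0 \<or> degree r < degree q"
    proof (cases "n = 0")
      case True
      then show ?thesis by (auto simp: r_def a_def n_def monom_0 elim!: degree_eq_zeroE)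
    next
      case False
      have "degree r \<le> n" unfolding r_def n_def
        by (intro degree_diff_le) (auto simp: degree_monom_le)
      moreover have "coeff r n = 0" by (simp add: r_def a_def n_def)
      ultimately show ?thesis unfolding n_def by (metis leading_coeff_0_iff order_le_less)
    qed
    ultimately have "poly_over algebraic_ints r"
      using less.hyps by (auto simp: poly_over_0[OF subring_algebraic_ints])
    moreover have "q = r + monom a n" by (simp add: r_def)
    ultimately show ?thesis using a by (auto simp: poly_over_def intro!: algebraic_int_add)
  qed (simp add: subring_algebraic_ints)
qed

text \<open>The linear factors outside \<open>B\<close> are split off one at a time by
  \<open>poly_over_algebraic_ints_factor\<close>; the value at 0 of what remains is the product over
  \<open>B\<close> up to sign.\<close>

lemma algebraic_int_roots_subset:
  fixes a :: 'a
  assumes "poly_over algebraic_ints (Polynomial.smult a (\<Prod>x\<in>#A. [:- x, 1:]))" "B \<subseteq># A"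
  shows "algebraic_int (a * prod_mset B)"
  using assms
proof (induction "size A" arbitrary: A)
  case 0
  then show ?case by (auto simp: poly_over_def dest: spec[of _ 0])
next
  case (Suc n)
  show ?case
  proof (cases "B = A")
    case True
    have "poly (Polynomial.smult a (\<Prod>x\<in>#A. [:- x, 1:])) 0 = a * (\<Prod>x\<in>#A. - x)"
      by (simp add: poly_prod_mset image_mset.compositionality comp_def)
    also have "(\<Prod>x\<in>#A. - x) = (- 1) ^ size A * prod_mset A"
      by (induction A) auto
    finally have "algebraic_int (a * ((- 1) ^ size A * prod_mset A))"
      using subring_set_poly[OF subring_algebraic_ints Suc.prems(1), of 0] by auto
    from algebraic_int_mult[OF this, of "(- 1) ^ size A"]
    have "algebraic_int (a * prod_mset A * ((- 1) ^ size A * (- 1) ^ size A))"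
      by (auto intro: algebraic_int_power simp: mult_ac)
    then show ?thesis using True by (simp flip: power_mult_distrib)
  next
    case False
    then have "B \<subset># A" using Suc.prems(2) by auto
    then obtain C where C: "A = B + C" "C \<noteq> {#}"
      by (metis add.right_neutral subset_mset.le_iff_add subset_mset.less_imp_le subset_mset.less_irrefl)
    then obtain y C' where C': "C = add_mset y C'" by (metis multiset_cases)
    define A' where "A' = B + C'"
    have A': "A = add_mset y A'" by (simp add: A'_def C C')
    have "poly_over algebraic_ints ([:- y, 1:] * Polynomial.smult a (\<Prod>x\<in>#A'. [:- x, 1:]))"
      using Suc.prems(1) by (simp add: A' mult_smult_right del: mult_pCons_left)
    then have "poly_over algebraic_ints (Polynomial.smult a (\<Prod>x\<in>#A'. [:- x, 1:]))"
      by (rule poly_over_algebraic_ints_factor)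
    moreover have "n = size A'" using Suc.hyps(2) A' by simp
    moreover have "B \<subseteq># A'" by (simp add: A'_def)
    ultimately show ?thesis using Suc.hyps(1) by blast
  qed
qed

text \<open>Each coefficient is a signed sum of products over submultisets. The factor
  \<open>c\<close> is kept general so that the induction can absorb a root into it.\<close>

lemma algebraic_int_coeff_prod:
  fixes c :: 'a
  assumes "\<And>B. B \<subseteq># A \<Longrightarrow> algebraic_int (c * prod_mset B)"
  shows "algebraic_int (c * coeff (\<Prod>x\<in>#A. [:- x, 1:]) k)"
  using assms
proof (induction A arbitrary: c k)
  case empty
  then show ?case by (cases k) (auto simp: one_pCons coeff_pCons)
next
  case (add y A)
  let ?P = "\<Prod>x\<in>#A. [:- x, 1:]"
  have "algebraic_int (c * y * coeff ?P k)"
  proof (rule add.IH)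
    fix B assume "B \<subseteq># A"
    then have "add_mset y B \<subseteq># add_mset y A" by simp
    from add.prems[OF this] show "algebraic_int (c * y * prod_mset B)" by (simp add: mult_ac)
  qed
  moreover have c: "algebraic_int (c * coeff ?P j)" for j
    using add.prems
    by (intro add.IH) (metis add_mset_add_single mset_subset_eq_add_left subset_mset.order_trans)
  moreover have "c * coeff ([:- y, 1:] * ?P) k
      = - (c * y * coeff ?P k) + (case k of 0 \<Rightarrow> 0 | Suc j \<Rightarrow> c * coeff ?P j)"
    by (auto simp: coeff_pCons algebra_simps split: nat.splits)
  ultimately show ?case
    by (auto intro!: algebraic_int_diff split: nat.splits simp del: mult_pCons_left simp flip: diff_conv_add_uminus)
qed

text \<open>Dedekind's Prague theorem, read off from the roots of the two factors.\<close>

theorem algebraic_int_coeff_mult: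
  fixes f g :: "'a poly"
  assumes fg: "poly_over algebraic_ints (f * g)"
  shows "algebraic_int (coeff f i * coeff g j)"
proof (cases "f = 0 \<or> g = 0")
  case False
  then have "f \<noteq> 0" "g \<noteq> 0" by auto
  from alg_closed_imp_factorization[OF this(1)] alg_closed_imp_factorization[OF this(2)]
  obtain A B where
    A: "f = Polynomial.smult (lead_coeff f) (\<Prod>x\<in>#A. [:- x, 1:])" and
    B: "g = Polynomial.smult (lead_coeff g) (\<Prod>x\<in>#B. [:- x, 1:])"
    by blast
  define a b where "a = lead_coeff f" and "b = lead_coeff g"
  have "f * g = Polynomial.smult (a * b) (\<Prod>x\<in>#A + B. [:- x, 1:])"
    by (subst A, subst B) (simp add: a_def b_def mult_smult_left mult_smult_right mult.commute[of "lead_coeff f"])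
  then have int: "algebraic_int (a * b * prod_mset C)" if "C \<subseteq># A + B" for C
    using fg that by (intro algebraic_int_roots_subset[of "a * b" "A + B"]) simp_all
  \<comment> \<open>\<open>algebraic_int_coeff_prod\<close> is applied twice, to the roots of
    \<open>f\<close> with the coefficient of \<open>g\<close> as part of the constant, and then to
    the roots of \<open>g\<close>.\<close>
  have "algebraic_int ((a * b * coeff (\<Prod>x\<in>#B. [:- x, 1:]) j) * coeff (\<Prod>x\<in>#A. [:- x, 1:]) i)"
  proof (rule algebraic_int_coeff_prod)
    fix C assume C: "C \<subseteq># A"
    have "algebraic_int ((a * b * prod_mset C) * coeff (\<Prod>x\<in>#B. [:- x, 1:]) j)"
    proof (rule algebraic_int_coeff_prod)
      fix D assume "D \<subseteq># B"
      then have "C + D \<subseteq># A + B" using C by (simp add: subset_mset.add_mono)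
      from int[OF this] show "algebraic_int (a * b * prod_mset C * prod_mset D)"
        by (simp add: mult_ac)
    qed
    then show "algebraic_int (a * b * coeff (\<Prod>x\<in>#B. [:- x, 1:]) j * prod_mset C)"
      by (simp add: mult_ac)
  qed
  moreover have "coeff f i = a * coeff (\<Prod>x\<in>#A. [:- x, 1:]) i"
    by (subst A) (simp add: a_def)
  moreover have "coeff g j = b * coeff (\<Prod>x\<in>#B. [:- x, 1:]) j"
    by (subst B) (simp add: b_def)
  ultimately show ?thesis by (simp add: mult_ac)
qed auto

lemma Gcd_int_combination:
  fixes a :: "nat \<Rightarrow> int"
  shows "\<exists>z. (\<Sum>k<n. z k * a k) = Gcd (a ` {..<n})"
proof (induction n)
  case (Suc n)
  then obtain z where z: "(\<Sum>k<n. z k * a k) = Gcd (a ` {..<n})" by blast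
  obtain u v where uv: "u * a n + v * Gcd (a ` {..<n}) = gcd (a n) (Gcd (a ` {..<n}))"
    using bezout_int by blast
  have "(\<Sum>k<Suc n. ((\<lambda>k. v * z k)(n := u)) k * a k) = v * (\<Sum>k<n. z k * a k) + u * a n"
    by (simp add: sum_distrib_left mult.assoc)
  also have "\<dots> = Gcd (a ` {..<Suc n})"
    using z uv by (simp add: lessThan_Suc)
  finally show ?case by blast
qed auto

text \<open>Denominators are cleared and the content is divided out. Primitivity is recorded by the
  Bezout coefficients \<open>z\<close>, the form in which \<open>content_invertible\<close> consumes
  it.\<close>

lemma rational_poly_primitive:
  assumes "poly_over \<rat> P" "P \<noteq> (0 :: 'a poly)"
  obtains c Z z where "c \<in> \<rat>" "Polynomial.smult c P = map_poly of_int Z"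
    "(\<Sum>k\<le>degree P. z k * coeff Z k) = (1 :: int)"
proof -
  have "\<exists>d :: int. d \<noteq> 0 \<and> of_int d * coeff P i \<in> \<int>" for i
  proof -
    have "coeff P i \<in> \<rat>" using assms(1) by (simp add: poly_over_def)
    then obtain a b where "b > 0" "coprime a b" "coeff P i = of_int a / of_int b"
      by (rule Rats_cases')
    then show ?thesis by (intro exI[of _ b]) auto
  qed
  then obtain d :: "nat \<Rightarrow> int" where d: "\<And>i. d i \<noteq> 0" "\<And>i. of_int (d i) * coeff P i \<in> \<int>" by metis
  define D where "D = (\<Prod>i\<le>degree P. d i)"
  have "D \<noteq> 0" using d by (simp add: D_def)
  have "\<exists>e. coeff (Polynomial.smult (of_int D) P) i = of_int e" for i
  proof (cases "i \<le> degree P")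
    case True
    then have "D = d i * (\<Prod>j\<in>{..degree P} - {i}. d j)" by (simp add: D_def prod.remove)
    then have "coeff (Polynomial.smult (of_int D) P) i = of_int (\<Prod>j\<in>{..degree P} - {i}. d j) * (of_int (d i) * coeff P i)"
      by (simp add: mult_ac)
    also have "\<dots> \<in> \<int>" by (rule Ints_mult[OF Ints_of_int d(2)])
    finally show ?thesis by (rule Ints_cases) blast
  qed (auto simp: coeff_eq_0 intro: exI[of _ 0])
  then obtain e where e: "\<And>i. coeff (Polynomial.smult (of_int D) P) i = of_int (e i)" by metis
  define Z0 where "Z0 = Poly (map e [0..<Suc (degree P)])"
  have Z0: "Polynomial.smult (of_int D) P = map_poly of_int Z0"
  proof (rule poly_eqI)
    fix i
    show "coeff (Polynomial.smult (of_int D) P) i = coeff (map_poly of_int Z0) i"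
      using e[of i] by (auto simp: Z0_def coeff_map_poly coeff_Poly_eq nth_default_def coeff_eq_0 simp del: upt_Suc)
  qed
  then have "Z0 \<noteq> 0" using \<open>D \<noteq> 0\<close> assms by auto
  define Z where "Z = primitive_part Z0"
  have "content Z = 1" using \<open>Z0 \<noteq> 0\<close> by (simp add: Z_def)
  have "Polynomial.smult (of_int (content Z0)) (map_poly of_int Z) = (map_poly of_int Z0 :: 'a poly)"
    by (subst (2) content_times_primitive_part[of Z0, symmetric], unfold Z_def [symmetric])
       (auto intro!: poly_eqI simp: coeff_map_poly)
  then have "Polynomial.smult (of_int D / of_int (content Z0)) P = map_poly of_int Z"
    using \<open>Z0 \<noteq> 0\<close> Z0 by (metis (no_types, lifting) content_eq_zero_iff divide_inverse mult.commute of_int_eq_0_iff right_inverse smult_1_left smult_smult)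
  moreover have "degree Z \<le> degree P"
    using Z0 \<open>D \<noteq> 0\<close> by (metis Z_def degree_primitive_part degree_smult_eq of_int_eq_0_iff of_int_hom.degree_map_poly_hom order_refl)
  moreover have "\<exists>z. (\<Sum>k<Suc (degree P). z k * coeff Z k) = 1"
  proof -
    have "Gcd (coeff Z ` {..<Suc (degree P)}) dvd coeff Z i" for i
      using \<open>degree Z \<le> degree P\<close> by (cases "i \<le> degree P") (auto simp: coeff_eq_0 intro!: Gcd_dvd)
    then have "Gcd (coeff Z ` {..<Suc (degree P)}) dvd content Z"
      by (simp add: const_poly_dvd_iff_dvd_content [symmetric] const_poly_dvd_iff)
    then have "Gcd (coeff Z ` {..<Suc (degree P)}) = 1"
      using \<open>content Z = 1\<close> by (metis Gcd_int_eq abs_Gcd_eq zdvd1_eq)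
    then show ?thesis using Gcd_int_combination[of "coeff Z" "Suc (degree P)"] by auto
  qed
  ultimately show thesis
    using that[of "of_int D / of_int (content Z0)" Z] by (auto simp: lessThan_Suc_atMost)
qed

text \<open>Finitely generated fractional ideals are invertible; here that of the coefficients of \<open>f\<close>.\<close>

theorem content_invertible:
  assumes L: "fld L" and f: "poly_over L f" "f \<noteq> 0"
  obtains h where "\<And>i. h i \<in> L" "\<And>i j. algebraic_int (coeff f i * h j)"
    "(\<Sum>i\<le>degree f. coeff f i * h i) = 1"
proof -
  obtain g where g: "poly_over L g" "orbit_poly f = f * g"
    using orbit_poly_cofactor[OF L f(1)] by metis
  let ?P = "orbit_poly f"
  define n where "n = degree ?P"
  obtain c Z z where c: "c \<in> \<rat>" "Polynomial.smult c ?P = map_poly of_int Z"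
    "(\<Sum>k\<le>n. z k * coeff Z k) = (1 :: int)"
    using rational_poly_primitive[OF orbit_poly_rational orbit_poly_nonzero[OF f(2)]] unfolding n_def by metis
  define g' where "g' = Polynomial.smult c g"
  have g': "poly_over L g'" "f * g' = map_poly of_int Z"
    using g c fldD[OF L] fld_subring[OF L] by (auto simp: g'_def intro: poly_over_smult)
  have int: "algebraic_int (coeff f i * coeff g' j)" for i j
    using g'(2) by (intro algebraic_int_coeff_mult) (auto simp: poly_over_def coeff_map_poly)
  \<comment> \<open>Grouping the identity \<open>(\<Sum>k\<le>n. z k * coeff (f * g') k) = 1\<close>
    by the coefficients of \<open>f\<close> leaves this cofactor of
    \<open>coeff f i\<close>.\<close>
  define h where "h i = (\<Sum>k\<in>{i..n}. of_int (z k) * coeff g' (k - i))" for i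
  have "(\<Sum>i\<le>degree f. coeff f i * h i) = (\<Sum>i\<le>n. coeff f i * h i)"
  proof (rule sum.mono_neutral_left)
    show "{..degree f} \<subseteq> {..n}"
      using g(2) orbit_poly_nonzero[OF f(2)] degree_mult_right_le[of g f] by (auto simp: n_def)
  qed (auto simp: coeff_eq_0)
  also have "\<dots> = (\<Sum>i\<le>n. \<Sum>k\<in>{i..n}. of_int (z k) * (coeff f i * coeff g' (k - i)))"
    by (simp add: h_def sum_distrib_left mult_ac)
  also have "\<dots> = (\<Sum>k\<le>n. \<Sum>i\<le>k. of_int (z k) * (coeff f i * coeff g' (k - i)))"
    by (subst sum.Sigma, simp, simp, subst sum.Sigma, simp, simp, 
        rule sum.reindex_bij_witness[of _ "\<lambda>(k, i). (i, k)" "\<lambda>(i, k). (k, i)"]) auto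
  also have "\<dots> = (\<Sum>k\<le>n. of_int (z k) * coeff (f * g') k)"
    by (simp add: coeff_mult sum_distrib_left)
  also have "\<dots> = of_int (\<Sum>k\<le>n. z k * coeff Z k)"
    by (simp add: g'(2) coeff_map_poly)
  finally have "(\<Sum>i\<le>degree f. coeff f i * h i) = 1" using c(3) by simp
  moreover have "h i \<in> L" for i
    unfolding h_def using g'(1) fldD[OF L] subring_set_of_int[OF fld_subring[OF L]]
    by (intro subring_set_sum[OF fld_subring[OF L]]) (auto simp: poly_over_def)
  moreover have "algebraic_int (coeff f i * h j)" for i j
  proof -
    have "coeff f i * h j = (\<Sum>k\<in>{j..n}. of_int (z k) * (coeff f i * coeff g' (k - j)))"
      by (simp add: h_def sum_distrib_left mult_ac)
    then show ?thesis by (simp add: algebraic_int_sum algebraic_int_mult[OF algebraic_int_of_int int])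
  qed
  ultimately show thesis using that by blast
qed

end

section \<open>Ideals of a subring\<close>

definition ideal_set :: "'a::comm_ring_1 set \<Rightarrow> 'a set \<Rightarrow> bool" where
  "ideal_set R I \<longleftrightarrow> I \<subseteq> R \<and> 0 \<in> I \<and> (\<forall>x\<in>I. \<forall>y\<in>I. x + y \<in> I) \<and> (\<forall>r\<in>R. \<forall>x\<in>I. r * x \<in> I)"

text \<open>Maximality is expressed by inverses modulo \<open>P\<close>, which is how it enters
  every later argument.\<close>

definition max_ideal :: "'a::comm_ring_1 set \<Rightarrow> 'a set \<Rightarrow> bool" where
  "max_ideal R P \<longleftrightarrow> ideal_set R P \<and> 1 \<notin> P \<and> (\<forall>x\<in>R - P. \<exists>r\<in>R. \<exists>p\<in>P. r * x + p = 1)"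

lemma ideal_setD:
  assumes "ideal_set R I"
  shows "I \<subseteq> R" "0 \<in> I" "x \<in> I \<Longrightarrow> y \<in> I \<Longrightarrow> x + y \<in> I" "r \<in> R \<Longrightarrow> x \<in> I \<Longrightarrow> r * x \<in> I"
    "r \<in> R \<Longrightarrow> x \<in> I \<Longrightarrow> x * r \<in> I"
  using assms by (auto simp: ideal_set_def mult.commute)

lemma
  assumes "subring_set R" "ideal_set R I"
  shows ideal_set_minus: "x \<in> I \<Longrightarrow> - x \<in> I"
    and ideal_set_diff: "x \<in> I \<Longrightarrow> y \<in> I \<Longrightarrow> x - y \<in> I"
proof -
  show m: "x \<in> I \<Longrightarrow> - x \<in> I" for x
    using ideal_setD(4)[OF assms(2), of "- 1" x] subring_setD(1,3)[OF assms(1)] by simp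
  show "x \<in> I \<Longrightarrow> y \<in> I \<Longrightarrow> x - y \<in> I"
    using ideal_setD(3)[OF assms(2), of x "- y"] m by simp
qed

lemma ideal_set_sum:
  assumes "ideal_set R I" "\<And>i. i \<in> A \<Longrightarrow> f i \<in> I"
  shows "sum f A \<in> I"
  using assms(2)
  by (induction A rule: infinite_finite_induct) (auto intro: ideal_setD[OF assms(1)])

lemma max_idealD:
  assumes "max_ideal R P"
  shows "ideal_set R P" "1 \<notin> P" "x \<in> R \<Longrightarrow> x \<notin> P \<Longrightarrow> \<exists>r\<in>R. \<exists>p\<in>P. r * x + p = 1"
  using assms by (auto simp: max_ideal_def)

lemma max_ideal_prime:
  assumes R: "subring_set R" and P: "max_ideal R P" and xy: "x \<in> R" "y \<in> R" "x * y \<in> P"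
  shows "x \<in> P \<or> y \<in> P"
proof (rule disjCI)
  assume "y \<notin> P"
  then obtain r p where rp: "r \<in> R" "p \<in> P" "r * y + p = 1"
    using max_idealD(3)[OF P] xy by blast
  have "x = r * (x * y) + x * p"
    using arg_cong[OF rp(3), of "\<lambda>z. x * z"] by (simp add: algebra_simps)
  then show "x \<in> P" using ideal_setD[OF max_idealD(1)[OF P]] rp xy by metis
qed

lemma max_ideal_prod:
  assumes R: "subring_set R" and P: "max_ideal R P" and "\<And>i. i \<in> A \<Longrightarrow> f i \<in> R - P"
  shows "prod f A \<in> R - P"
  using assms(3)
proof (induction A rule: infinite_finite_induct)
  case (insert i A)
  then show ?case using max_ideal_prime[OF R P, of "f i" "prod f A"] subring_setD[OF R] by auto
qed (use subring_setD[OF R] max_idealD[OF P] in auto)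

lemma ex_max_ideal:
  assumes R: "subring_set R" and I: "ideal_set R I" "1 \<notin> I"
  obtains P where "max_ideal R P" "I \<subseteq> P"
proof -
  let ?A = "{J. ideal_set R J \<and> I \<subseteq> J \<and> 1 \<notin> J}"
  have chain: "\<Union>C \<in> ?A" if C: "C \<noteq> {}" "subset.chain ?A C" for C
  proof -
    have J: "ideal_set R J" "I \<subseteq> J" "1 \<notin> J" if "J \<in> C" for J
      using C(2) that by (auto simp: subset.chain_def)
    have "ideal_set R (\<Union>C)"
      unfolding ideal_set_def
    proof (intro conjI ballI)
      show "\<Union>C \<subseteq> R" using J(1) ideal_setD(1) by blast
      show "0 \<in> \<Union>C" using J(1) ideal_setD(2) C(1) by blast
      show "r * x \<in> \<Union>C" if "r \<in> R" "x \<in> \<Union>C" for r x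
        using J(1) ideal_setD(4) that by blast
      fix x y assume "x \<in> \<Union>C" "y \<in> \<Union>C"
      then obtain J1 J2 where "J1 \<in> C" "J2 \<in> C" "x \<in> J1" "y \<in> J2" by blast
      then obtain J where "J \<in> C" "x \<in> J" "y \<in> J"
        using subset.chain_total[OF C(2), of J1 J2] by auto
      then show "x + y \<in> \<Union>C" using J(1) ideal_setD(3) by blast
    qed
    then show ?thesis using J C(1) by blast
  qed
  have "I \<in> ?A" using I by simp
  then obtain P where P: "P \<in> ?A" "\<forall>J\<in>?A. P \<subseteq> J \<longrightarrow> J = P"
    using subset_Zorn_nonempty[of ?A] chain by blast
  then have iP: "ideal_set R P" by simp
  have "\<exists>r\<in>R. \<exists>p\<in>P. r * x + p = 1" if x: "x \<in> R - P" for x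
  proof (rule ccontr)
    assume no: "\<not> (\<exists>r\<in>R. \<exists>p\<in>P. r * x + p = 1)"
    let ?J = "{r * x + p |r p. r \<in> R \<and> p \<in> P}"
    have "ideal_set R ?J"
      unfolding ideal_set_def
    proof (intro conjI ballI)
      show "?J \<subseteq> R" using x ideal_setD(1)[OF iP] by (auto intro: subring_setD[OF R])
      show "0 \<in> ?J" using ideal_setD(2)[OF iP] subring_setD(2)[OF R] by force
      fix a assume "a \<in> ?J"
      then obtain r p where a: "r \<in> R" "p \<in> P" "a = r * x + p" by blast
      show "s * a \<in> ?J" if "s \<in> R" for s
      proof -
        have "s * a = (s * r) * x + s * p" by (simp add: a algebra_simps)
        then show ?thesis using a that subring_setD(5)[OF R] ideal_setD(4)[OF iP] by blast
      qed
      fix b assume "b \<in> ?J"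
      then obtain r' p' where b: "r' \<in> R" "p' \<in> P" "b = r' * x + p'" by blast
      have "a + b = (r + r') * x + (p + p')" by (simp add: a b algebra_simps)
      then show "a + b \<in> ?J" using a b subring_setD(4)[OF R] ideal_setD(3)[OF iP] by blast
    qed
    moreover have PJ: "P \<subseteq> ?J"
    proof
      fix p assume "p \<in> P"
      moreover have "p = 0 * x + p" by simp
      ultimately show "p \<in> ?J" using subring_setD(2)[OF R] by blast
    qed
    moreover have "1 \<notin> ?J"
    proof
      assume "1 \<in> ?J"
      then obtain r p where "r \<in> R" "p \<in> P" "r * x + p = 1" by (auto dest: sym)
      then show False using no by blast
    qed
    moreover have "I \<subseteq> ?J" using P(1) PJ by (metis (mono_tags, lifting) mem_Collect_eq subset_trans)
    ultimately have "?J \<in> ?A" by simp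
    then have "?J = P" using PJ P(2) by (metis (no_types, lifting))
    moreover have "x = 1 * x + 0" by simp
    then have "x \<in> ?J" using subring_setD(1)[OF R] ideal_setD(2)[OF iP] by blast
    ultimately show False using x by simp
  qed
  then have "max_ideal R P" using P by (auto simp: max_ideal_def)
  then show thesis using that P by blast
qed

section \<open>Residues and localisations of a ring of integers\<close>

text \<open>\<open>deg\<close> bounds the degree of \<open>F\<close> over \<open>\<rat>\<close>: any
  \<open>deg + 1\<close> elements satisfy a linear relation, with its denominators already
  cleared.\<close>

locale number_base = algebraic_type ty for ty :: "'a::{alg_closed_field, field_char_0} itself" +
  fixes F :: "'a set" and deg :: nat
  assumes fld_F: "fld F"
    and dependent: "(\<And>i. i \<le> deg \<Longrightarrow> x i \<in> F) \<Longrightarrow>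
      \<exists>c :: nat \<Rightarrow> int. (\<exists>i\<le>deg. c i \<noteq> 0) \<and> (\<Sum>i\<le>deg. of_int (c i) * x i) = 0"
begin

abbreviation (input) OF :: "'a set" where "OF \<equiv> ring_of_integers F"

lemma mem_OF: "x \<in> OF \<longleftrightarrow> x \<in> F \<and> algebraic_int x"
  by (simp add: ring_of_integers_def)

lemma subring_ring_of_integers:
  assumes "fld K"
  shows "subring_set (ring_of_integers K)"
  using subring_setD[OF fld_subring[OF assms]]
  by (auto simp: subring_set_def ring_of_integers_def intro: algebraic_int_add algebraic_int_mult)

lemmas OF_ring = subring_ring_of_integers[OF fld_F]
lemmas OFD = subring_setD[OF OF_ring]

lemma of_int_OF [simp]: "of_int k \<in> OF" and of_nat_OF [simp]: "of_nat n \<in> OF"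
proof -
  show k: "of_int k \<in> OF" for k
    using subring_set_of_int[OF OF_ring] .
  show "of_nat n \<in> OF"
    using k[of "int n"] by simp
qed

definition multiples :: "'a \<Rightarrow> 'a set" where
  "multiples a = {a * x |x. x \<in> OF}"

lemma multiples_add: "x \<in> multiples a \<Longrightarrow> y \<in> multiples a \<Longrightarrow> x + y \<in> multiples a"
  unfolding multiples_def using OFD(4) by (auto simp flip: distrib_left)

lemma multiples_mult: "x \<in> multiples a \<Longrightarrow> y \<in> OF \<Longrightarrow> y * x \<in> multiples a"
  unfolding multiples_def using OFD(5) by (auto simp: mult.left_commute)

lemma multiples_base: "x \<in> OF \<Longrightarrow> a * x \<in> multiples a"
  by (auto simp: multiples_def)

lemma multiples_sum:
  assumes "\<And>i. i \<in> I \<Longrightarrow> f i \<in> multiples a"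
  shows "sum f I \<in> multiples a"
  using assms
proof (induction I rule: infinite_finite_induct)
  case (insert i I)
  then show ?case by (simp add: multiples_add)
qed (use OFD(2) in \<open>auto simp: multiples_def intro!: exI[of _ 0]\<close>)

text \<open>Linear independence over the field with \<open>p\<close> elements of the residues of
  \<open>x 0, ..., x (n - 1)\<close> in \<open>OF\<close> modulo \<open>p\<close>.\<close>

definition independent_mod :: "nat \<Rightarrow> nat \<Rightarrow> (nat \<Rightarrow> 'a) \<Rightarrow> bool" where
  "independent_mod p n x \<longleftrightarrow> (\<forall>i<n. x i \<in> OF) \<and>
     (\<forall>c :: nat \<Rightarrow> int. (\<Sum>i<n. of_int (c i) * x i) \<in> multiples (of_nat p) \<longrightarrow> (\<forall>i<n. int p dvd c i))"

text \<open>A descent. More than \<open>deg\<close> elements satisfy an integer relation;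
  independence makes \<open>p\<close> divide all its coefficients, the quotient is again a relation,
  and so every power of \<open>p\<close> divides them.\<close>

lemma independent_mod_le:
  assumes p: "prime p" and x: "independent_mod p n x"
  shows "n \<le> deg"
proof (rule ccontr)
  assume "\<not> n \<le> deg"
  then have n: "{..deg} \<subseteq> {..<n}" by auto
  then obtain c :: "nat \<Rightarrow> int" where c: "\<exists>i\<le>deg. c i \<noteq> 0" "(\<Sum>i\<le>deg. of_int (c i) * x i) = 0"
    using dependent[of x] x by (auto simp: independent_mod_def mem_OF subset_iff)
  define c' where "c' i = (if i \<le> deg then c i else 0)" for i
  have c': "(\<Sum>i<n. of_int (c' i) * x i) = 0"
  proof -
    have "(\<Sum>i<n. of_int (c' i) * x i) = (\<Sum>i\<le>deg. of_int (c' i) * x i)"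
      using n by (intro sum.mono_neutral_right) (auto simp: c'_def)
    then show ?thesis using c(2) by (simp add: c'_def)
  qed
  have "\<forall>i<n. int p ^ k dvd c' i" for k
  proof (induction k)
    case (Suc k)
    then have "\<forall>i. \<exists>e. i < n \<longrightarrow> c' i = int p ^ k * e" by (auto elim: dvdE)
    then obtain e where e: "\<And>i. i < n \<Longrightarrow> c' i = int p ^ k * e i" by metis
    have "of_nat p ^ k * (\<Sum>i<n. of_int (e i) * x i) = (\<Sum>i<n. of_int (c' i) * x i)"
      unfolding sum_distrib_left by (intro sum.cong) (auto simp: e)
    then have "(\<Sum>i<n. of_int (e i) * x i) = 0"
      using c' prime_gt_0_nat[OF p] by simp
    then have "(\<Sum>i<n. of_int (e i) * x i) \<in> multiples (of_nat p)"
      using OFD(2) by (auto simp: multiples_def intro!: exI[of _ 0])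
    then have "\<forall>i<n. int p dvd e i" using x unfolding independent_mod_def by blast
    then show ?case using e by (auto simp: mult_dvd_mono)
  qed simp
  moreover obtain i where i: "i \<le> deg" "c' i \<noteq> 0" using c(1) by (auto simp: c'_def)
  ultimately have "int p ^ nat \<bar>c' i\<bar> dvd c' i" using n by auto
  then have "int p ^ nat \<bar>c' i\<bar> \<le> \<bar>c' i\<bar>" using i by (simp add: zdvd_imp_le)
  moreover have "nat \<bar>c' i\<bar> < p ^ nat \<bar>c' i\<bar>"
    using prime_gt_1_nat[OF p] by (simp add: power_gt_expt)
  ultimately show False by (metis int_nat_eq linorder_not_less of_nat_less_iff of_nat_power abs_ge_zero)
qed

text \<open>A maximal independent family spans \<open>OF\<close> modulo \<open>p\<close>, so its
  combinations with coefficients below \<open>p\<close> represent all residues. This replaces an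
  integral basis of \<open>F\<close>.\<close>

lemma residues_prime:
  assumes p: "prime p"
  obtains T where "T \<subseteq> OF" "finite T" "card T \<le> p ^ deg"
    "\<And>x. x \<in> OF \<Longrightarrow> \<exists>t\<in>T. x - t \<in> multiples (of_nat p)"
proof -
  have "independent_mod p 0 x" for x by (simp add: independent_mod_def)
  moreover have "\<forall>n. (\<exists>x. independent_mod p n x) \<longrightarrow> n \<le> deg" using independent_mod_le[OF p] by blast
  ultimately obtain n where n: "\<exists>x. independent_mod p n x" "\<And>m. \<exists>x. independent_mod p m x \<Longrightarrow> m \<le> n"
    using Nat.ex_has_greatest_nat[of "\<lambda>n. \<exists>x. independent_mod p n x" 0 deg] by blast
  then obtain x where x: "independent_mod p n x" by blast
  then have xO: "\<And>i. i < n \<Longrightarrow> x i \<in> OF" by (auto simp: independent_mod_def)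
  have "n \<le> deg" using independent_mod_le[OF p x] .
  define T where "T = (\<lambda>c. \<Sum>i<n. of_nat (c i) * x i) ` (PiE {..<n} (\<lambda>_. {..<p}))"
  have fin: "finite (PiE {..<n} (\<lambda>_. {..<p}))" by (intro finite_PiE) auto
  have "card T \<le> p ^ n"
    unfolding T_def using card_image_le[OF fin] by (simp add: card_PiE)
  also have "\<dots> \<le> p ^ deg" using \<open>n \<le> deg\<close> prime_gt_0_nat[OF p] by (intro power_increasing) auto
  finally have card: "card T \<le> p ^ deg" .
  have "\<exists>t\<in>T. y - t \<in> multiples (of_nat p)" if y: "y \<in> OF" for y
  proof -
    have "\<not> independent_mod p (Suc n) (x(n := y))" using n(2)[of "Suc n"] by auto
    then obtain c :: "nat \<Rightarrow> int" where c: "(\<Sum>i<Suc n. of_int (c i) * (x(n := y)) i) \<in> multiples (of_nat p)"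
      "\<exists>i<Suc n. \<not> int p dvd c i"
      using xO y unfolding independent_mod_def by (auto simp: less_Suc_eq)
    have c': "(\<Sum>i<n. of_int (c i) * x i) + of_int (c n) * y \<in> multiples (of_nat p)"
      using c(1) by simp
    have "\<not> int p dvd c n"
    proof
      assume "int p dvd c n"
      then obtain e where e: "c n = int p * e" by (auto elim: dvdE)
      have "- (of_int (c n) * y) \<in> multiples (of_nat p)"
        using y OFD(3)[of "of_int e * y"] OFD(5)[OF of_int_OF y, of e]
        by (auto simp: e multiples_def mult.assoc intro!: exI[of _ "- (of_int e * y)"])
      from multiples_add[OF c' this] have "\<forall>i<n. int p dvd c i"
        using x unfolding independent_mod_def by simp
      then show False using c(2) \<open>int p dvd c n\<close> by (auto simp: less_Suc_eq)
    qed
    then have "coprime (int p) (c n)"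
      using p by (simp add: prime_imp_coprime)
    then obtain u v where uv: "u * int p + v * c n = 1"
      by (metis bezout_int coprime_imp_gcd_eq_1)
    \<comment> \<open>As \<open>v\<close> inverts \<open>c n\<close> modulo \<open>p\<close>, the
      relation solves to \<open>y\<close> being congruent to the sum of
      \<open>- v * c i * x i\<close>; these are the reduced coefficients.\<close>
    define b where "b i = (if i < n then nat ((- v * c i) mod int p) else undefined)" for i
    have "p > 0" using p by (rule prime_gt_0_nat)
    have b: "of_nat (b i) = (of_int ((- v * c i) mod int p) :: 'a)" "b i < p" if "i < n" for i
      using \<open>p > 0\<close> that by (auto simp: b_def nat_less_iff)
    have t: "(\<Sum>i<n. of_nat (b i) * x i) \<in> T"
      unfolding T_def by (rule imageI) (auto simp: PiE_def extensional_def b(2), simp add: b_def)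
    have "y - (\<Sum>i<n. of_nat (b i) * x i)
        = of_nat p * (of_int u * y) + of_int v * ((\<Sum>i<n. of_int (c i) * x i) + of_int (c n) * y)
          + (\<Sum>i<n. of_nat p * (of_int ((- v * c i) div int p) * x i))"
    proof -
      have "y = of_int (u * int p + v * c n) * y" using uv by simp
      then have y1: "y = of_nat p * (of_int u * y) + of_int v * (of_int (c n) * y)"
        by (simp add: algebra_simps)
      have "- of_nat (b i) * x i = of_int v * (of_int (c i) * x i) + of_nat p * (of_int ((- v * c i) div int p) * x i)"
        if "i < n" for i
      proof -
        define q r where "q = (- v * c i) div int p" and "r = (- v * c i) mod int p"
        have "- (v * c i) = q * int p + r" by (simp add: q_def r_def)
        then have "- (of_int v * of_int (c i)) = of_int q * of_nat p + (of_int r :: 'a)"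
          by (metis of_int_add of_int_minus of_int_mult of_int_of_nat_eq)
        moreover have "of_nat (b i) = (of_int r :: 'a)" using b(1)[OF that] by (simp add: r_def)
        ultimately have vc: "of_int v * of_int (c i) = - (of_int q * of_nat p) - (of_nat (b i) :: 'a)"
          by (simp add: minus_equation_iff [of _ "of_int q * of_nat p + of_int r"])
        have "of_int v * (of_int (c i) * x i) = (of_int v * of_int (c i)) * x i" by (simp only: mult.assoc)
        also have "\<dots> = - of_nat (b i) * x i - of_nat p * (of_int q * x i)"
          unfolding vc by (simp add: algebra_simps)
        finally have "- of_nat (b i) * x i = of_int v * (of_int (c i) * x i) + of_nat p * (of_int q * x i)"
          by simp
        then show ?thesis by (simp add: q_def)
      qed
      then have s1: "- (\<Sum>i<n. of_nat (b i) * x i) = of_int v * (\<Sum>i<n. of_int (c i) * x i)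
          + (\<Sum>i<n. of_nat p * (of_int ((- v * c i) div int p) * x i))"
        unfolding sum_distrib_left sum.distrib [symmetric] sum_negf [symmetric]
        by (intro sum.cong) auto
      have "y - (\<Sum>i<n. of_nat (b i) * x i) = y + - (\<Sum>i<n. of_nat (b i) * x i)" by simp
      also note arg_cong2[where f = "(+)", OF y1 s1]
      finally show ?thesis by (simp only: distrib_left ac_simps)
    qed
    also have "\<dots> \<in> multiples (of_nat p)"
      using y xO by (intro multiples_add multiples_sum multiples_mult[OF c'] multiples_base OFD(5)) auto
    finally show ?thesis using t by blast
  qed
  moreover have "T \<subseteq> OF" unfolding T_def
    using xO by (auto intro!: subring_set_sum[OF OF_ring] OFD(5))
  ultimately show thesis using that[of T] card fin by (auto simp: T_def)
qed

text \<open>Residues modulo \<open>p * k\<close> are built from two digits as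
  \<open>t + k * s\<close>, with \<open>t\<close> a residue modulo \<open>k\<close> and
  \<open>s\<close> one modulo \<open>p\<close>.\<close>

lemma residues:
  assumes "m > 0"
  obtains T where "T \<subseteq> OF" "finite T" "card T \<le> m ^ deg"
    "\<And>x. x \<in> OF \<Longrightarrow> \<exists>t\<in>T. x - t \<in> multiples (of_nat m)"
proof -
  have "\<exists>T. T \<subseteq> OF \<and> finite T \<and> card T \<le> m ^ deg \<and>
    (\<forall>x\<in>OF. \<exists>t\<in>T. x - t \<in> multiples (of_nat m))"
    using assms
  proof (induction m rule: less_induct)
    case (less m)
    show ?case
    proof (cases "m = 1")
      case True
      then show ?thesis using OFD(2)
        by (intro exI[of _ "{0}"]) (auto simp: multiples_def)
    next
      case False
      then obtain p where p: "prime p" "p dvd m" using prime_factor_nat by blast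
      then obtain k where k: "m = p * k" by (auto elim: dvdE)
      have "k > 0" "k < m" using less.prems prime_gt_1_nat[OF p(1)] k by auto
      from less.IH[OF this(2,1)] obtain T where T: "T \<subseteq> OF" "finite T" "card T \<le> k ^ deg"
        "\<And>x. x \<in> OF \<Longrightarrow> \<exists>t\<in>T. x - t \<in> multiples (of_nat k)" by blast
      obtain S where S: "S \<subseteq> OF" "finite S" "card S \<le> p ^ deg"
        "\<And>x. x \<in> OF \<Longrightarrow> \<exists>t\<in>S. x - t \<in> multiples (of_nat p)"
        using residues_prime[OF p(1)] by metis
      let ?T = "(\<lambda>(s, t). t + of_nat k * s) ` (S \<times> T)"
      have "card ?T \<le> card S * card T"
        using card_image_le[of "S \<times> T"] S(2) T(2) by (metis card_cartesian_product finite_cartesian_product)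
      also have "\<dots> \<le> m ^ deg" using S(3) T(3) by (simp add: k power_mult_distrib mult_mono)
      finally have "card ?T \<le> m ^ deg" .
      moreover have "\<exists>t\<in>?T. x - t \<in> multiples (of_nat m)" if x: "x \<in> OF" for x
      proof -
        obtain t y where t: "t \<in> T" "x - t = of_nat k * y" "y \<in> OF"
          using T(4)[OF x] by (auto simp: multiples_def)
        obtain s z where s: "s \<in> S" "y - s = of_nat p * z" "z \<in> OF"
          using S(4)[OF t(3)] by (auto simp: multiples_def)
        have "x - (t + of_nat k * s) = of_nat k * (y - s)" using t(2) by (simp add: algebra_simps)
        also have "\<dots> = of_nat m * z" by (simp add: s k)
        finally have "x - (t + of_nat k * s) \<in> multiples (of_nat m)" using s(3) by (simp add: multiples_base)
        then show ?thesis using s(1) t(1) by (intro bexI[of _ "t + of_nat k * s"]) auto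
      qed
      moreover have "?T \<subseteq> OF" using S(1) T(1) by (auto intro!: OFD(4,5))
      ultimately show ?thesis using S(2) T(2) by (intro exI[of _ ?T]) auto
    qed
  qed
  with that show thesis by blast
qed

lemma nat_multiple:
  assumes "a \<in> OF" "a \<noteq> 0"
  obtains m where "m > 0" "of_nat m \<in> multiples a"
proof -
  obtain p where p: "lead_coeff p = 1" "\<forall>i. coeff p i \<in> \<int>" "poly p a = 0"
    using assms(1) by (auto simp: mem_OF elim: algebraic_int.cases)
  then have "p \<noteq> 0" "poly_over \<int> p" by (auto simp: poly_over_def)
  then obtain q where q: "poly_over \<int> q" "poly q a = 0" "coeff q 0 \<noteq> 0"
    using nonzero_constant_coeff p(3) assms(2) by metis
  obtain c r where cr: "q = pCons c r" by (cases q)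
  have c: "c \<in> \<int>" "c \<noteq> 0" and r: "poly_over \<int> r" and eq: "c + a * poly r a = 0"
    using q cr by auto
  obtain k where k: "c = of_int k" using c by (auto elim: Ints_cases)
  have "poly_over OF r" using r by (auto simp: poly_over_def elim!: Ints_cases) (metis Ints_cases of_int_OF)
  then have rO: "poly r a \<in> OF" using subring_set_poly[OF OF_ring] assms(1) by blast
  have "of_int k = a * (- poly r a)" using eq k by (simp add: eq_neg_iff_add_eq_0)
  then have "of_int k \<in> multiples a" using OFD(3)[OF rO] by (metis multiples_base)
  moreover have "of_nat (nat \<bar>k\<bar>) = of_int (sgn k) * (of_int k :: 'a)"
    by (cases k rule: linorder_cases[of _ 0]) auto
  ultimately have "of_nat (nat \<bar>k\<bar>) \<in> multiples a" using multiples_mult by simp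
  then show thesis using that[of "nat \<bar>k\<bar>"] c k by auto
qed

section \<open>The localisation at a maximal ideal\<close>

definition local_ring :: "'a set \<Rightarrow> 'a set" where
  "local_ring P = {x \<in> F. \<exists>u\<in>OF - P. u * x \<in> OF}"

context
  fixes P assumes P: "max_ideal OF P"
begin

lemmas P_ideal = max_idealD(1)[OF P]
lemmas PD = ideal_setD[OF P_ideal]

lemma unit_mult: "u \<in> OF - P \<Longrightarrow> v \<in> OF - P \<Longrightarrow> u * v \<in> OF - P"
  using max_ideal_prime[OF OF_ring P, of u v] OFD(5) by auto

lemma unit_1: "1 \<in> OF - P"
  using OFD(1) max_idealD(2)[OF P] by auto

lemma OF_local: "x \<in> OF \<Longrightarrow> x \<in> local_ring P"
  using unit_1 by (auto simp: local_ring_def mem_OF intro!: bexI[of _ 1])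

lemma local_ring_subring: "subring_set (local_ring P)"
  unfolding subring_set_def
proof (intro conjI ballI)
  show "1 \<in> local_ring P" using OF_local OFD(1) by blast
  fix x assume x: "x \<in> local_ring P"
  then obtain u where u: "u \<in> OF - P" "u * x \<in> OF" "x \<in> F" by (auto simp: local_ring_def)
  show "- x \<in> local_ring P"
    using u OFD(3)[of "u * x"] subring_setD(3)[OF fld_subring[OF fld_F]]
    by (auto simp: local_ring_def)
  fix y assume y: "y \<in> local_ring P"
  then obtain v where v: "v \<in> OF - P" "v * y \<in> OF" "y \<in> F" by (auto simp: local_ring_def)
  have "v * (u * x) + u * (v * y) \<in> OF" "(u * x) * (v * y) \<in> OF"
    using u v by (auto intro!: OFD(4) OFD(5)[of v] OFD(5)[of u "v * y"] OFD(5)[OF u(2) v(2)])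
  moreover have "v * (u * x) + u * (v * y) = (u * v) * (x + y)" "(u * x) * (v * y) = (u * v) * (x * y)"
    by (simp_all add: algebra_simps)
  ultimately have "(u * v) * (x + y) \<in> OF" "(u * v) * (x * y) \<in> OF" by metis+
  then show "x + y \<in> local_ring P" "x * y \<in> local_ring P"
    using unit_mult[OF u(1) v(1)] fldD(2,3)[OF fld_F u(3) v(3)] unfolding local_ring_def by blast+
qed

lemma local_ring_common_denominator:
  assumes "finite A" "\<And>i. i \<in> A \<Longrightarrow> x i \<in> local_ring P"
  obtains u where "u \<in> OF - P" "\<And>i. i \<in> A \<Longrightarrow> u * x i \<in> OF"
proof -
  have "\<forall>i. \<exists>u. i \<in> A \<longrightarrow> u \<in> OF - P \<and> u * x i \<in> OF" using assms(2) by (auto simp: local_ring_def)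
  then obtain u where u: "\<And>i. i \<in> A \<Longrightarrow> u i \<in> OF - P" "\<And>i. i \<in> A \<Longrightarrow> u i * x i \<in> OF" by metis
  have "prod u A * x i \<in> OF" if "i \<in> A" for i
  proof -
    have "prod u A * x i = prod u (A - {i}) * (u i * x i)"
      using that assms(1) by (simp add: prod.remove[of A i] mult_ac)
    moreover have "prod u (A - {i}) \<in> OF" using u by (intro subring_set_prod[OF OF_ring]) blast
    ultimately show ?thesis using OFD(5)[OF _ u(2)[OF that]] by metis
  qed
  then show thesis using that max_ideal_prod[OF OF_ring P, of A u] u by blast
qed

text \<open>Invertibility of the content of \<open>1 + x T\<close> gives
  \<open>h 0 + x * h 1 = 1\<close> with all \<open>h j\<close> and \<open>x * h j\<close> integral.
  If \<open>x\<close> is not local, every \<open>h j\<close> lies in \<open>P\<close>; then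
  \<open>u = x * h 1\<close> is outside \<open>P\<close>, and \<open>u / x\<close> is
  \<open>h 1\<close>.\<close>

lemma local_ring_valuation:
  assumes "x \<in> F" "x \<notin> local_ring P"
  obtains u where "u \<in> OF - P" "u / x \<in> P"
proof -
  have L: "poly_over F [:1, x:]" "[:1, x:] \<noteq> 0"
    using assms subring_setD[OF fld_subring[OF fld_F]] fld_subring[OF fld_F] by auto
  obtain h where h: "\<And>i. h i \<in> F" "\<And>i j. algebraic_int (coeff [:1, x:] i * h j)"
    "(\<Sum>i\<le>degree [:1, x:]. coeff [:1, x:] i * h i) = 1"
    using content_invertible[OF fld_F L] by metis
  have hO: "h j \<in> OF" "x * h j \<in> OF" for j
    using h(1)[of j] h(2)[of 0 j] h(2)[of 1 j] fldD(3)[OF fld_F assms(1)] by (auto simp: mem_OF)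
  have "x \<noteq> 0" using assms OF_local[OF OFD(2)] by auto
  then have sum: "h 0 + x * h 1 = 1" using h(3) by simp
  have hP: "h j \<in> P" for j
  proof (rule ccontr)
    assume "h j \<notin> P"
    then have "x \<in> local_ring P"
      using hO[of j] assms by (auto simp: local_ring_def mult.commute intro!: bexI[of _ "h j"])
    then show False using assms by simp
  qed
  then have "x * h 1 \<notin> P" using sum PD(3) max_idealD(2)[OF P] by metis
  then show thesis using that[of "x * h 1"] hO hP \<open>x \<noteq> 0\<close> by simp
qed

lemma local_ring_inverse:
  assumes "x \<in> F" "x \<notin> local_ring P"
  shows "inverse x \<in> local_ring P"
proof -
  obtain u where "u \<in> OF - P" "u / x \<in> P" using local_ring_valuation[OF assms] .
  then show ?thesis
    using fld_inverse[OF fld_F assms(1)] PD(1)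
    by (auto simp: local_ring_def divide_inverse intro!: bexI[of _ u])
qed

text \<open>Discriminants of two bases that differ in one vector have the square of a coefficient as
  their quotient; this recovers the coefficient itself.\<close>

lemma local_ring_square:
  assumes "x \<in> F" "x ^ 2 \<in> local_ring P"
  shows "x \<in> local_ring P"
proof (rule ccontr)
  assume x: "x \<notin> local_ring P"
  then obtain u where u: "u \<in> OF - P" "u / x \<in> P" using local_ring_valuation assms by blast
  obtain v where v: "v \<in> OF - P" "v * x ^ 2 \<in> OF" using assms(2) by (auto simp: local_ring_def)
  have "x \<noteq> 0" using x OF_local[OF OFD(2)] by auto
  then have "u * (u * v) = (v * x ^ 2) * ((u / x) * (u / x))"
    by (simp add: power2_eq_square field_simps)
  also have "\<dots> \<in> P" by (intro PD(4)) (use u v PD(1) in blast)+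
  finally show False using unit_mult[OF u(1) unit_mult[OF u(1) v(1)]] by simp
qed

text \<open>An element of least valuation at \<open>P\<close>, found by counting. \<open>J s\<close>
  collects the integers that \<open>s\<close> divides locally, so a smaller valuation means a larger
  \<open>J s\<close>. All \<open>J s\<close> in question contain the multiples of a fixed
  \<open>m\<close>, so they are measured by their part in a finite set of residues modulo
  \<open>m\<close>, and a largest one exists.\<close>

lemma local_minimum:
  assumes S: "S \<subseteq> OF - {0}" "S \<noteq> {}"
  obtains s where "s \<in> S" "\<And>t. t \<in> S \<Longrightarrow> t / s \<in> local_ring P"
proof -
  obtain s0 where s0: "s0 \<in> S" using S by blast
  then obtain m where m: "m > 0" "of_nat m \<in> multiples s0" using nat_multiple[of s0] S by blast
  obtain T where T: "T \<subseteq> OF" "finite T" "\<And>x. x \<in> OF \<Longrightarrow> \<exists>t\<in>T. x - t \<in> multiples (of_nat m)"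
    using residues[OF m(1)] by metis
  define J where "J s = {a \<in> OF. a / s \<in> local_ring P}" for s
  let ?Q = "\<lambda>s. s \<in> S \<and> J s0 \<subseteq> J s"
  note loc = subring_setD[OF local_ring_subring]
  have "\<forall>s. ?Q s \<longrightarrow> card (T \<inter> J s) < Suc (card T)"
    using T(2) by (simp add: card_mono less_Suc_eq_le)
  then obtain s where s: "?Q s" "\<And>t. ?Q t \<Longrightarrow> card (T \<inter> J t) \<le> card (T \<inter> J s)"
    using ex_has_greatest_nat[of ?Q s0 "\<lambda>s. card (T \<inter> J s)" "Suc (card T)"] s0
    by (metis less_imp_le order_refl)
  have "t / s \<in> local_ring P" if t: "t \<in> S" for t
  proof (rule ccontr)
    assume no: "t / s \<notin> local_ring P"
    have nz: "s \<noteq> 0" "t \<noteq> 0" "t \<in> OF" "s \<in> OF" using s(1) t S by auto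
    then have "s / t \<in> local_ring P"
      using local_ring_inverse[of "t / s"] no fld_divide[OF fld_F] by (simp add: mem_OF)
    then have sub: "J s \<subseteq> J t"
    proof (intro subsetI)
      fix a assume "s / t \<in> local_ring P" "a \<in> J s"
      then have "(a / s) * (s / t) \<in> local_ring P"
        using loc(5)[of "a / s" "s / t"] by (simp only: J_def mem_Collect_eq)
      moreover have "(a / s) * (s / t) = a / t" using nz by simp
      ultimately have "a / t \<in> local_ring P" by metis
      then show "a \<in> J t" using \<open>a \<in> J s\<close> by (simp add: J_def)
    qed
    have mult: "y \<in> J s" if y: "y \<in> multiples (of_nat m)" for y
    proof -
      obtain z where z: "y = of_nat m * z" "z \<in> OF" using y by (auto simp: multiples_def)
      obtain w where w: "of_nat m = s0 * w" "w \<in> OF" using m(2) by (auto simp: multiples_def)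
      have "y = s0 * (w * z)" using z w by simp
      moreover have "s0 \<noteq> 0" "s0 \<in> OF" using s0 S by auto
      ultimately have "y \<in> OF" "y / s0 \<in> local_ring P"
        using OFD(5)[OF w(2) z(2)] OFD(5)[of s0 "w * z"] OF_local[of "w * z"] by auto
      then show ?thesis using s(1) by (auto simp: J_def)
    qed
    obtain t0 where t0: "t0 \<in> T" "t - t0 \<in> multiples (of_nat m)" using T(3) nz by blast
    then have d: "(t - t0) / s \<in> local_ring P" "(t - t0) / t \<in> local_ring P"
      using mult sub by (auto simp: J_def)
    have "t0 \<in> J t"
      using loc(6)[OF loc(1) d(2)] nz T(1) t0(1) by (auto simp: J_def diff_divide_distrib)
    moreover have "t0 \<notin> J s"
      using loc(4)[OF d(1), of "t0 / s"] no by (auto simp: J_def simp flip: add_divide_distrib)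
    ultimately have "T \<inter> J s \<subset> T \<inter> J t" using sub t0(1) by blast
    then have "card (T \<inter> J s) < card (T \<inter> J t)" using T(2) by (intro psubset_card_mono) auto
    moreover have "?Q t" using t s(1) sub by blast
    ultimately show False using s(2)[of t] by simp
  qed
  then show thesis using that s(1) by blast
qed

text \<open>If \<open>P\<close> were zero, \<open>2\<close> would be invertible in
  \<open>OF\<close>, although \<open>1 / 2\<close> is rational and not an integer.\<close>

lemma P_nonzero: "\<exists>x\<in>P. x \<noteq> 0"
proof (rule ccontr)
  assume no: "\<not> (\<exists>x\<in>P. x \<noteq> 0)"
  then have "(2 :: 'a) \<notin> P" by auto
  moreover have "(2 :: 'a) \<in> OF" using of_nat_OF[of 2] by simp
  ultimately obtain r p where "r \<in> OF" "p \<in> P" "r * 2 + p = 1"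
    using max_idealD(3)[OF P] by blast
  then have "r * 2 = 1" "algebraic_int r" using no by (auto simp: mem_OF)
  then have r: "r = 1 / 2" by (simp add: field_simps)
  moreover have "(1 / 2 :: 'a) \<in> \<rat>" by (intro Rats_divide) auto
  ultimately have "r \<in> \<int>"
    using rational_algebraic_int_is_int \<open>algebraic_int r\<close> by blast
  then obtain k where "r = of_int k" by (auto elim: Ints_cases)
  then have "of_int (k * 2) = (of_int 1 :: 'a)" using \<open>r * 2 = 1\<close> by simp
  then have "k * 2 = 1" by (metis of_int_eq_iff)
  then show False by presburger
qed

text \<open>A nonzero element of \<open>P\<close> of least valuation generates \<open>P\<close> in
  the localisation. The denominator \<open>u\<close> stays explicit, so that all computations remain
  in \<open>OF\<close>.\<close>

lemma uniformizer:
  obtains \<pi> where "\<pi> \<in> P" "\<pi> \<noteq> 0" "\<And>y. y \<in> P \<Longrightarrow> \<exists>u\<in>OF - P. \<exists>z\<in>OF. u * y = \<pi> * z"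
proof -
  have "P - {0} \<subseteq> OF - {0}" "P - {0} \<noteq> {}" using PD(1) P_nonzero by auto
  then obtain s where s: "s \<in> P - {0}" "\<And>t. t \<in> P - {0} \<Longrightarrow> t / s \<in> local_ring P"
    using local_minimum by metis
  have "\<exists>u\<in>OF - P. \<exists>z\<in>OF. u * y = s * z" if y: "y \<in> P" for y
  proof (cases "y = 0")
    case True
    then show ?thesis using unit_1 OFD(2) by (intro bexI[of _ 1] bexI[of _ 0]) auto
  next
    case False
    then obtain u where "u \<in> OF - P" "u * (y / s) \<in> OF" using s(2) y by (auto simp: local_ring_def)
    then show ?thesis using s(1) by (intro bexI[of _ u] bexI[of _ "u * (y / s)"]) auto
  qed
  then show thesis using that s by blast
qed

text \<open>The ideal \<open>?I\<close> consists of the algebraic integers that \<open>\<pi>\<close>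
  divides up to a denominator outside \<open>P\<close>. It contains \<open>P\<close> and is proper,
  since \<open>u = \<pi> * w\<close> with \<open>w\<close> integral would put \<open>u\<close> into
  \<open>P\<close>. Working in the ring of all algebraic integers gives one prime for all extensions
  at once.\<close>

lemma lying_over:
  obtains M where "max_ideal algebraic_ints M" "M \<inter> OF = P"
proof -
  obtain \<pi> where \<pi>: "\<pi> \<in> P" "\<pi> \<noteq> 0" "\<And>y. y \<in> P \<Longrightarrow> \<exists>u\<in>OF - P. \<exists>z\<in>OF. u * y = \<pi> * z"
    using uniformizer by blast
  let ?I = "{z. algebraic_int z \<and> (\<exists>u\<in>OF - P. \<exists>w. algebraic_int w \<and> u * z = \<pi> * w)}"
  have I1: "ideal_set algebraic_ints ?I"
    unfolding ideal_set_def
  proof (intro conjI ballI)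
    show "0 \<in> ?I" using unit_1 by (intro CollectI conjI bexI[of _ 1] exI[of _ 0]) auto
    fix x assume "x \<in> ?I"
    then obtain u w where x: "algebraic_int x" "u \<in> OF - P" "algebraic_int w" "u * x = \<pi> * w" by blast
    show "r * x \<in> ?I" if "r \<in> algebraic_ints" for r
    proof -
      have "u * (r * x) = \<pi> * (r * w)" using x(4) by (simp add: mult.left_commute)
      then show ?thesis using that x algebraic_int_mult by blast
    qed
    fix y assume "y \<in> ?I"
    then obtain v w' where y: "algebraic_int y" "v \<in> OF - P" "algebraic_int w'" "v * y = \<pi> * w'" by blast
    have "(u * v) * (x + y) = v * (u * x) + u * (v * y)" by (simp add: algebra_simps)
    also have "\<dots> = \<pi> * (v * w + u * w')" by (simp add: x y algebra_simps)
    finally have "(u * v) * (x + y) = \<pi> * (v * w + u * w')" .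
    moreover have "algebraic_int (v * w + u * w')"
      using x y by (auto simp: mem_OF intro!: algebraic_int_add algebraic_int_mult)
    ultimately show "x + y \<in> ?I" using unit_mult[OF x(2) y(2)] x(1) y(1) algebraic_int_add by blast
  qed auto
  have I2: "1 \<notin> ?I"
  proof
    assume "1 \<in> ?I"
    then obtain u w where u: "u \<in> OF - P" "algebraic_int w" "u = \<pi> * w" by auto
    then have "w = u / \<pi>" using \<pi> by simp
    then have "w \<in> OF" using u fld_divide[OF fld_F, of u \<pi>] PD(1) \<pi>(1) by (auto simp: mem_OF)
    then show False using u PD(5)[of w \<pi>] \<pi>(1) by simp
  qed
  obtain M where M: "max_ideal algebraic_ints M" "?I \<subseteq> M"
    by (rule ex_max_ideal[OF subring_algebraic_ints I1 I2])
  note MD = ideal_setD[OF max_idealD(1)[OF M(1)]]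
  have "P \<subseteq> ?I"
  proof
    fix y assume y: "y \<in> P"
    then obtain u z where "u \<in> OF - P" "z \<in> OF" "u * y = \<pi> * z" using \<pi>(3) by blast
    moreover from this have "algebraic_int y" "algebraic_int z" using y PD(1) by (auto simp: mem_OF)
    ultimately show "y \<in> ?I" by blast
  qed
  then have PM: "P \<subseteq> M" using M by blast
  have "x \<in> P" if x: "x \<in> M" "x \<in> OF" for x
  proof (rule ccontr)
    assume "x \<notin> P"
    then obtain r p where "r \<in> OF" "p \<in> P" "r * x + p = 1"
      using max_idealD(3)[OF P x(2)] by blast
    moreover have "r * x \<in> M" using MD(4)[of r x] x calculation(1) by (simp add: mem_OF)
    ultimately have "1 \<in> M" using MD(3)[of "r * x" p] PM by auto
    then show False using max_idealD(2)[OF M(1)] by blast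
  qed
  then have "M \<inter> OF = P" using PM PD(1) by blast
  then show thesis using that M(1) by blast
qed

end

end

section \<open>Independence of characters modulo a prime ideal\<close>

lemma det_in_subring:
  assumes R: "subring_set R" and A: "A \<in> carrier_mat n n"
    "\<And>i j. i < n \<Longrightarrow> j < n \<Longrightarrow> A $$ (i, j) \<in> R"
  shows "det A \<in> R"
proof -
  have "signof p \<in> R" for p
    using subring_setD[OF R] by (cases p rule: sign_cases) auto
  then show ?thesis
    unfolding det_def'[OF A(1)]
    by (intro subring_set_sum[OF R] subring_set_prod[OF R] subring_setD(5)[OF R])
       (auto intro!: A(2) simp: permutes_in_image)
qed

lemma prod_cong_mod:
  assumes R: "subring_set R" and I: "ideal_set R I"
    and "\<And>i. i \<in> A \<Longrightarrow> f i \<in> R" "\<And>i. i \<in> A \<Longrightarrow> g i \<in> R" "\<And>i. i \<in> A \<Longrightarrow> f i - g i \<in> I"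
  shows "prod f A - prod g A \<in> I"
  using assms(3-5)
proof (induction A rule: infinite_finite_induct)
  case (insert i A)
  have "prod f A \<in> R" "g i \<in> R" using insert.prems by (auto intro: subring_set_prod[OF R])
  then have "prod f A * (f i - g i) + g i * (prod f A - prod g A) \<in> I"
    using insert by (intro ideal_setD(3)[OF I] ideal_setD(4)[OF I]) auto
  moreover have "f i * prod f A - g i * prod g A = prod f A * (f i - g i) + g i * (prod f A - prod g A)"
    by (simp add: algebra_simps)
  ultimately show ?case using insert.hyps by simp
qed (use ideal_setD(2)[OF I] in auto)

lemma det_cong_mod:
  assumes R: "subring_set R" and I: "ideal_set R I"
    and A: "A \<in> carrier_mat n n" "\<And>i j. i < n \<Longrightarrow> j < n \<Longrightarrow> A $$ (i, j) \<in> R"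
    and B: "B \<in> carrier_mat n n" "\<And>i j. i < n \<Longrightarrow> j < n \<Longrightarrow> B $$ (i, j) \<in> R"
    and AB: "\<And>i j. i < n \<Longrightarrow> j < n \<Longrightarrow> A $$ (i, j) - B $$ (i, j) \<in> I"
  shows "det A - det B \<in> I"
proof -
  have s: "signof p \<in> R" for p
    using subring_setD[OF R] by (cases p rule: sign_cases) auto
  have "det A - det B = (\<Sum>p\<in>{p. p permutes {0..<n}}.
      signof p * ((\<Prod>i = 0..<n. A $$ (i, p i)) - (\<Prod>i = 0..<n. B $$ (i, p i))))"
    by (simp add: det_def'[OF A(1)] det_def'[OF B(1)] sum_subtractf right_diff_distrib)
  also have "\<dots> \<in> I"
    by (intro ideal_set_sum[OF I] ideal_setD(4)[OF I] s prod_cong_mod[OF R I])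
       (auto intro!: A(2) B(2) AB simp: permutes_in_image)
  finally show ?thesis .
qed

text \<open>A substitute for ranks over the residue field: either some minor of full size survives
  modulo \<open>Q\<close>, or the rows satisfy a relation. If a minor survives but no enlargement of
  it does, the expansion of the enlarged determinant along its new column is the relation.\<close>

lemma minor_or_relation:
  fixes \<tau> :: "nat \<Rightarrow> 'x \<Rightarrow> 'a::comm_ring_1"
  assumes R: "subring_set R" and Q: "ideal_set R Q" "1 \<notin> Q"
    and \<tau>: "\<And>i x. i < m \<Longrightarrow> x \<in> S \<Longrightarrow> \<tau> i x \<in> R"
  shows "(\<exists>x. (\<forall>j<m. x j \<in> S) \<and> det (mat m m (\<lambda>(i, j). \<tau> i (x j))) \<notin> Q) \<or>
    (\<exists>c. (\<forall>i<m. c i \<in> R) \<and> (\<exists>i<m. c i \<notin> Q) \<and> (\<forall>x\<in>S. (\<Sum>i<m. c i * \<tau> i x) \<in> Q))"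
  using \<tau>
proof (induction m)
  case 0
  then show ?case using Q(2) by (auto simp: det_dim_zero)
next
  case (Suc m)
  consider (minor) x where "\<forall>j<m. x j \<in> S" "det (mat m m (\<lambda>(i, j). \<tau> i (x j))) \<notin> Q"
    | (relation) c where "\<forall>i<m. c i \<in> R" "\<exists>i<m. c i \<notin> Q" "\<forall>x\<in>S. (\<Sum>i<m. c i * \<tau> i x) \<in> Q"
    using Suc.IH[OF Suc.prems] by (auto simp: less_Suc_eq)
  then show ?case
  proof cases
    case relation
    have "(\<Sum>i<Suc m. (c(m := 0)) i * \<tau> i x) = (\<Sum>i<m. c i * \<tau> i x)" for x
      by simp
    moreover have "\<forall>i<Suc m. (c(m := 0)) i \<in> R"
      using relation(1) subring_setD(2)[OF R] by (auto simp: less_Suc_eq)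
    moreover have "\<exists>i<Suc m. (c(m := 0)) i \<notin> Q"
    proof -
      obtain i where "i < m" "c i \<notin> Q" using relation(2) by blast
      then show ?thesis by (intro exI[of _ i]) auto
    qed
    ultimately show ?thesis using relation(3) by (intro disjI2 exI[of _ "c(m := 0)"]) simp
  next
    case minor
    let ?A = "\<lambda>y. mat (Suc m) (Suc m) (\<lambda>(i, j). \<tau> i ((x(m := y)) j))"
    \<comment> \<open>The cofactors of the last column. They do not involve the new point
      \<open>y\<close>, and \<open>c m\<close> is the old minor.\<close>
    define c where "c i = (- 1) ^ (i + m) * det (mat m m (\<lambda>(i', j). \<tau> (if i' < i then i' else Suc i') (x j)))" for i
    have det: "det (?A y) = (\<Sum>i<Suc m. c i * \<tau> i y)" for y
    proof -
      have "det (?A y) = (\<Sum>i<Suc m. ?A y $$ (i, m) * cofactor (?A y) i m)"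
        by (rule laplace_expansion_column) auto
      also have "\<dots> = (\<Sum>i<Suc m. c i * \<tau> i y)"
      proof (rule sum.cong[OF refl])
        fix i assume i: "i \<in> {..<Suc m}"
        have "mat_delete (?A y) i m = mat m m (\<lambda>(i', j). \<tau> (if i' < i then i' else Suc i') (x j))"
          using i by (intro eq_matI) (auto simp: mat_delete_def)
        then show "?A y $$ (i, m) * cofactor (?A y) i m = c i * \<tau> i y"
          using i by (simp add: cofactor_def c_def mult_ac)
      qed
      finally show ?thesis .
    qed
    show ?thesis
    proof (cases "\<exists>y\<in>S. det (?A y) \<notin> Q")
      case True
      then obtain y where y: "y \<in> S" "det (?A y) \<notin> Q" by blast
      then show ?thesis
        using minor(1) by (intro disjI1 exI[of _ "x(m := y)"]) (auto simp: less_Suc_eq)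
    next
      case False
      have "c i \<in> R" if "i < Suc m" for i
        unfolding c_def using that minor(1) Suc.prems
        by (intro subring_setD(5)[OF R] subring_setD(7)[OF R] det_in_subring[OF R, of _ m])
           (auto simp: subring_setD[OF R])
      moreover have "c m \<notin> Q"
      proof -
        have "mat m m (\<lambda>(i', j). \<tau> (if i' < m then i' else Suc i') (x j)) = mat m m (\<lambda>(i, j). \<tau> i (x j))"
          by (intro eq_matI) auto
        then have "c m = (- 1) ^ (m + m) * det (mat m m (\<lambda>(i, j). \<tau> i (x j)))"
          by (simp add: c_def)
        then show ?thesis using minor(2) by (simp add: power_add flip: power_mult_distrib)
      qed
      ultimately show ?thesis using False det by (intro disjI2 exI[of _ c]) (auto intro!: exI[of _ m])
    qed
  qed
qed

text \<open>Artin's elimination argument for characters, with values modulo a prime ideal; primality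
  replaces cancellation in a field.\<close>

lemma dedekind_independence:
  fixes \<tau> :: "'i \<Rightarrow> 'x::monoid_mult \<Rightarrow> 'a::comm_ring_1"
  assumes R: "subring_set R" and Q: "ideal_set R Q"
    and prime: "\<And>x y. x \<in> R \<Longrightarrow> y \<in> R \<Longrightarrow> x * y \<in> Q \<Longrightarrow> x \<in> Q \<or> y \<in> Q"
    and S: "1 \<in> S" "\<And>x y. x \<in> S \<Longrightarrow> y \<in> S \<Longrightarrow> x * y \<in> S"
    and I: "finite I"
    and \<tau>: "\<And>i x. i \<in> I \<Longrightarrow> x \<in> S \<Longrightarrow> \<tau> i x \<in> R" "\<And>i. i \<in> I \<Longrightarrow> \<tau> i 1 = 1"
      "\<And>i x y. i \<in> I \<Longrightarrow> x \<in> S \<Longrightarrow> y \<in> S \<Longrightarrow> \<tau> i (x * y) = \<tau> i x * \<tau> i y"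
    and distinct: "\<And>i j. i \<in> I \<Longrightarrow> j \<in> I \<Longrightarrow> i \<noteq> j \<Longrightarrow> \<exists>x\<in>S. \<tau> i x - \<tau> j x \<notin> Q"
    and c: "\<And>i. i \<in> I \<Longrightarrow> c i \<in> R" "\<And>x. x \<in> S \<Longrightarrow> (\<Sum>i\<in>I. c i * \<tau> i x) \<in> Q"
  shows "\<forall>i\<in>I. c i \<in> Q"
  using I \<tau> distinct c
proof (induction I arbitrary: c rule: finite_induct)
  case (insert k I)
  note c = insert.prems(5,6)
  have *: "c i \<in> Q" if i: "i \<in> I" for i
  proof -
    obtain y where y: "y \<in> S" "\<tau> i y - \<tau> k y \<notin> Q"
      using insert.prems(4)[of i k] insert.hyps i by auto
    \<comment> \<open>The relation at \<open>y * x\<close> minus \<open>\<tau> k y\<close> times the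
      relation at \<open>x\<close>: the coefficient at \<open>k\<close> becomes 0, which leaves a
      relation on \<open>I\<close>.\<close>
    define d where "d j = c j * (\<tau> j y - \<tau> k y)" for j
    have dR: "d j \<in> R" if "j \<in> I" for j
      using that c(1) insert.prems(1) y(1) unfolding d_def
      by (intro subring_setD(5)[OF R] subring_setD(6)[OF R]) auto
    have "(\<Sum>j\<in>I. d j * \<tau> j x) \<in> Q" if x: "x \<in> S" for x
    proof -
      have "(\<Sum>j\<in>insert k I. c j * \<tau> j (y * x)) - \<tau> k y * (\<Sum>j\<in>insert k I. c j * \<tau> j x) \<in> Q"
        using c(2)[OF S(2)[OF y(1) x]] c(2)[OF x] insert.prems(1)[of k y] y(1)
        by (intro ideal_set_diff[OF R Q] ideal_setD(4)[OF Q]) auto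
      also have "(\<Sum>j\<in>insert k I. c j * \<tau> j (y * x)) - \<tau> k y * (\<Sum>j\<in>insert k I. c j * \<tau> j x)
          = (\<Sum>j\<in>insert k I. d j * \<tau> j x)"
        unfolding sum_distrib_left sum_subtractf [symmetric] using insert.prems(3) y(1) x
        by (intro sum.cong) (auto simp: d_def algebra_simps)
      also have "\<dots> = (\<Sum>j\<in>I. d j * \<tau> j x)"
        using insert.hyps by (simp add: d_def)
      finally show ?thesis .
    qed
    then have "\<forall>j\<in>I. d j \<in> Q"
      using insert.prems(1-4) dR by (intro insert.IH) auto
    then have "c i * (\<tau> i y - \<tau> k y) \<in> Q" using i by (simp add: d_def)
    then show ?thesis
      using prime[of "c i" "\<tau> i y - \<tau> k y"] y c(1) insert.prems(1) i subring_setD(6)[OF R] by auto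
  qed
  have "c k * \<tau> k 1 + (\<Sum>j\<in>I. c j * \<tau> j 1) \<in> Q"
    using c(2)[OF S(1)] insert.hyps by simp
  moreover have "(\<Sum>j\<in>I. c j * \<tau> j 1) \<in> Q"
    using * insert.prems(2) by (intro ideal_set_sum[OF Q]) auto
  ultimately have "c k \<in> Q"
    using ideal_set_diff[OF R Q] insert.prems(2)[of k] by fastforce
  then show ?case using * by simp
qed simp

text \<open>With \<open>Q = {0}\<close> this supplies integral bases. With a maximal ideal it
  supplies a discriminant outside that ideal whenever the reductions of the embeddings are pairwise
  distinct.\<close>

lemma characters_det:
  fixes \<tau> :: "nat \<Rightarrow> 'x::monoid_mult \<Rightarrow> 'a::comm_ring_1"
  assumes R: "subring_set R" and Q: "ideal_set R Q" "1 \<notin> Q"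
    and prime: "\<And>x y. x \<in> R \<Longrightarrow> y \<in> R \<Longrightarrow> x * y \<in> Q \<Longrightarrow> x \<in> Q \<or> y \<in> Q"
    and S: "1 \<in> S" "\<And>x y. x \<in> S \<Longrightarrow> y \<in> S \<Longrightarrow> x * y \<in> S"
    and \<tau>: "\<And>i x. i < n \<Longrightarrow> x \<in> S \<Longrightarrow> \<tau> i x \<in> R" "\<And>i. i < n \<Longrightarrow> \<tau> i 1 = 1"
      "\<And>i x y. i < n \<Longrightarrow> x \<in> S \<Longrightarrow> y \<in> S \<Longrightarrow> \<tau> i (x * y) = \<tau> i x * \<tau> i y"
    and distinct: "\<And>i j. i < n \<Longrightarrow> j < n \<Longrightarrow> i \<noteq> j \<Longrightarrow> \<exists>x\<in>S. \<tau> i x - \<tau> j x \<notin> Q"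
  obtains x where "\<And>j. j < n \<Longrightarrow> x j \<in> S" "det (mat n n (\<lambda>(i, j). \<tau> i (x j))) \<notin> Q"
proof -
  have "\<not> (\<exists>c. (\<forall>i<n. c i \<in> R) \<and> (\<exists>i<n. c i \<notin> Q) \<and> (\<forall>x\<in>S. (\<Sum>i<n. c i * \<tau> i x) \<in> Q))"
  proof
    assume "\<exists>c. (\<forall>i<n. c i \<in> R) \<and> (\<exists>i<n. c i \<notin> Q) \<and> (\<forall>x\<in>S. (\<Sum>i<n. c i * \<tau> i x) \<in> Q)"
    then obtain c where c: "\<forall>i<n. c i \<in> R" "\<exists>i<n. c i \<notin> Q" "\<forall>x\<in>S. (\<Sum>i<n. c i * \<tau> i x) \<in> Q" by blast
    have "\<forall>i\<in>{..<n}. c i \<in> Q"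
      by (rule dedekind_independence[OF R Q(1) prime S _ \<tau> distinct]) (use c in auto)
    then show False using c(2) by auto
  qed
  then show thesis using minor_or_relation[where m = n and S = S and \<tau> = \<tau>, OF R Q \<tau>(1)] that by blast
qed

section \<open>Embeddings and dimension\<close>

lemma det_nonzero_kernel:
  fixes a :: "nat \<Rightarrow> nat \<Rightarrow> 'a::field"
  assumes "det (mat n n (\<lambda>(i, j). a i j)) \<noteq> 0" "\<And>i. i < n \<Longrightarrow> (\<Sum>j<n. a i j * c j) = 0" "j < n"
  shows "c j = 0"
proof -
  let ?A = "mat n n (\<lambda>(i, j). a i j)"
  have "?A *\<^sub>v vec n c = 0\<^sub>v n"
    using assms(2) by (intro eq_vecI) (auto simp: scalar_prod_def atLeast0LessThan)
  moreover have "vec n c \<in> carrier_vec n" "?A \<in> carrier_mat n n" by auto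
  ultimately have "vec n c = 0\<^sub>v n"
    using det_0_iff_vec_prod_zero_field[of ?A n] assms(1) by blast
  then have "vec n c $ j = 0\<^sub>v n $ j" by simp
  then show ?thesis using assms(3) by simp
qed

lemma det_nonzero_solve:
  fixes a :: "nat \<Rightarrow> nat \<Rightarrow> 'a::field"
  assumes "det (mat n n (\<lambda>(i, j). a i j)) \<noteq> 0"
  obtains c where "\<And>i. i < n \<Longrightarrow> (\<Sum>j<n. a i j * c j) = v i"
proof
  let ?A = "mat n n (\<lambda>(i, j). a i j)"
  define c where "c j = (adj_mat ?A *\<^sub>v vec n v) $ j / det ?A" for j
  have A: "?A \<in> carrier_mat n n" by simp
  note adj = adj_mat[OF A]
  have "?A *\<^sub>v (adj_mat ?A *\<^sub>v vec n v) = det ?A \<cdot>\<^sub>v vec n v"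
  proof -
    have "?A *\<^sub>v (adj_mat ?A *\<^sub>v vec n v) = (?A * adj_mat ?A) *\<^sub>v vec n v"
      using adj(1) by (intro assoc_mult_mat_vec[symmetric]) auto
    also have "\<dots> = det ?A \<cdot>\<^sub>v vec n v"
      unfolding adj(2) by (intro eq_vecI) (auto simp: scalar_prod_def if_distrib[of "\<lambda>z. z * _"] if_distrib[of "\<lambda>z. _ * z"] sum.delta cong: if_cong)
    finally show ?thesis .
  qed
  moreover have "(?A *\<^sub>v w) $ i = (\<Sum>j<n. a i j * w $ j)" if "i < n" "w \<in> carrier_vec n" for w i
    using that by (simp add: scalar_prod_def atLeast0LessThan)
  moreover have "adj_mat ?A *\<^sub>v vec n v \<in> carrier_vec n" using adj(1) by simp
  ultimately have "(\<Sum>j<n. a i j * (adj_mat ?A *\<^sub>v vec n v) $ j) = det ?A * v i" if "i < n" for i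
    using that by (metis index_smult_vec(1) index_vec dim_vec)
  then show "(\<Sum>j<n. a i j * c j) = v i" if "i < n" for i
    using that assms by (simp add: c_def sum_divide_distrib [symmetric])
qed

section \<open>Subfields, spans and independence in terms of sums\<close>

context algebraic_type
begin

interpretation \<Omega>: field "\<Omega> :: 'a ring" by (rule field_from_type_algebra)

lemma \<Omega>_simps [simp]:
  "carrier (\<Omega> :: 'a ring) = UNIV" "x \<otimes>\<^bsub>\<Omega> :: 'a ring\<^esub> y = x * y" "x \<oplus>\<^bsub>\<Omega> :: 'a ring\<^esub> y = x + y"
  "\<one>\<^bsub>\<Omega> :: 'a ring\<^esub> = 1" "\<zero>\<^bsub>\<Omega> :: 'a ring\<^esub> = 0"
  by (auto simp: ring_of_type_algebra_def)

lemma \<Omega>_minus: "\<ominus>\<^bsub>\<Omega> :: 'a ring\<^esub> x = - x"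
  using \<Omega>.minus_equality[of "- x" x] by simp

lemma \<Omega>_inv: "x \<noteq> 0 \<Longrightarrow> m_inv (\<Omega> :: 'a ring) x = inverse x"
  using \<Omega>.inv_unique'[of x "inverse x"] by simp

lemma subfield_iff_fld: "subfield K (\<Omega> :: 'a ring) \<longleftrightarrow> fld K"
proof
  assume K: "subfield K (\<Omega> :: 'a ring)"
  note r = subringE[OF subfieldE(1)[OF K]]
  have K_add: "x + y \<in> K" and K_mult: "x * y \<in> K" if "x \<in> K" "y \<in> K" for x y
    using r(6,7) that by auto
  have K1: "1 \<in> K" "0 \<in> K" using r by auto
  have neg: "- x \<in> K" if "x \<in> K" for x using r(5)[OF that] by (simp add: \<Omega>_minus)
  have "subring_set K" using K1 K_add K_mult neg by (auto simp: subring_set_def)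
  then have int: "of_int k \<in> K" for k by (rule subring_set_of_int)
  have "inverse x \<in> K" if "x \<in> K" for x
    using \<Omega>.subfield_m_inv(1)[OF K, of x] that K1 \<Omega>_inv by (cases "x = 0") auto
  then have "\<rat> \<subseteq> K"
    using int K_mult by (auto elim!: Rats_cases' simp: divide_inverse)
  then show "fld K" using K_add K_mult by (auto simp: fld_def)
next
  assume K: "fld K"
  note r = subring_setD[OF fld_subring[OF K]]
  show "subfield K (\<Omega> :: 'a ring)"
  proof (rule \<Omega>.subfieldI')
    show "subring K (\<Omega> :: 'a ring)"
      using r by (intro \<Omega>.subringI) (auto simp: \<Omega>_minus)
    show "m_inv (\<Omega> :: 'a ring) k \<in> K" if "k \<in> K - {\<zero>\<^bsub>\<Omega> :: 'a ring\<^esub>}" for k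
      using that fld_inverse[OF K] by (simp add: \<Omega>_inv)
  qed
qed

lemma Span_iff:
  assumes K: "fld K"
  shows "x \<in> ring.Span (\<Omega> :: 'a ring) K b \<longleftrightarrow>
    (\<exists>c. (\<forall>i<length b. c i \<in> K) \<and> x = (\<Sum>i<length b. c i * b ! i))"
proof (induction b arbitrary: x)
  case Nil
  then show ?case by simp
next
  case (Cons a b)
  have "x \<in> ring.Span (\<Omega> :: 'a ring) K (a # b) \<longleftrightarrow>
      (\<exists>k\<in>K. \<exists>v\<in>ring.Span (\<Omega> :: 'a ring) K b. x = k * a + v)"
    by (simp add: \<Omega>.line_extension_mem_iff)
  also have "\<dots> \<longleftrightarrow> (\<exists>c. (\<forall>i<length (a # b). c i \<in> K) \<and> x = (\<Sum>i<length (a # b). c i * (a # b) ! i))"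
  proof
    assume "\<exists>k\<in>K. \<exists>v\<in>ring.Span (\<Omega> :: 'a ring) K b. x = k * a + v"
    then obtain k v where k: "k \<in> K" "v \<in> ring.Span (\<Omega> :: 'a ring) K b" "x = k * a + v" by blast
    then obtain c where "\<forall>i<length b. c i \<in> K" "v = (\<Sum>i<length b. c i * b ! i)" using Cons by blast
    then show "\<exists>c. (\<forall>i<length (a # b). c i \<in> K) \<and> x = (\<Sum>i<length (a # b). c i * (a # b) ! i)"
      using k by (intro exI[of _ "case_nat k c"])
        (auto simp: sum.lessThan_Suc_shift split: nat.splits simp del: sum.lessThan_Suc)
  next
    assume "\<exists>c. (\<forall>i<length (a # b). c i \<in> K) \<and> x = (\<Sum>i<length (a # b). c i * (a # b) ! i)"
    then obtain c where c: "\<forall>i<Suc (length b). c i \<in> K" "x = (\<Sum>i<Suc (length b). c i * (a # b) ! i)" by auto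
    then have "x = c 0 * a + (\<Sum>i<length b. c (Suc i) * b ! i)"
      by (simp add: sum.lessThan_Suc_shift del: sum.lessThan_Suc)
    moreover have "(\<Sum>i<length b. c (Suc i) * b ! i) \<in> ring.Span (\<Omega> :: 'a ring) K b"
      unfolding Cons using c(1) by (intro exI[of _ "\<lambda>i. c (Suc i)"]) auto
    ultimately show "\<exists>k\<in>K. \<exists>v\<in>ring.Span (\<Omega> :: 'a ring) K b. x = k * a + v"
      using c(1) by blast
  qed
  finally show ?case .
qed

lemma independentI:
  assumes K: "fld K"
    and "\<And>c. (\<And>i. i < length b \<Longrightarrow> c i \<in> K) \<Longrightarrow> (\<Sum>i<length b. c i * b ! i) = 0 \<Longrightarrow> \<forall>i<length b. c i = 0"
  shows "ring.independent (\<Omega> :: 'a ring) K b"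
  using assms(2)
proof (induction b)
  case (Cons a b)
  have "a \<notin> ring.Span (\<Omega> :: 'a ring) K b"
  proof
    assume "a \<in> ring.Span (\<Omega> :: 'a ring) K b"
    then obtain c where c: "\<forall>i<length b. c i \<in> K" "a = (\<Sum>i<length b. c i * b ! i)"
      using Span_iff[OF K] by blast
    have "- 1 \<in> K" using subring_setD[OF fld_subring[OF K]] by blast
    then have "\<forall>i<length (a # b). case_nat (- 1) c i = 0"
      using c by (intro Cons.prems) (auto simp: sum.lessThan_Suc_shift split: nat.splits simp del: sum.lessThan_Suc)
    then show False by (auto dest: spec[of _ 0])
  qed
  moreover have "ring.independent (\<Omega> :: 'a ring) K b"
  proof (rule Cons.IH)
    fix c assume c: "\<And>i. i < length b \<Longrightarrow> c i \<in> K" "(\<Sum>i<length b. c i * b ! i) = 0"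
    have "0 \<in> K" using subring_setD[OF fld_subring[OF K]] by blast
    then have "\<forall>i<length (a # b). case_nat 0 c i = 0"
      using c by (intro Cons.prems) (auto simp: sum.lessThan_Suc_shift split: nat.splits simp del: sum.lessThan_Suc)
    then show "\<forall>i<length b. c i = 0" by (auto dest: spec[of _ "Suc _"])
  qed
  ultimately show ?case by (intro \<Omega>.li_Cons) auto
qed (simp add: \<Omega>.li_Nil)

section \<open>Embeddings as restrictions of automorphisms\<close>

abbreviation embs :: "'a set \<Rightarrow> 'a set \<Rightarrow> ('a \<Rightarrow> 'a) set" where
  "embs F E \<equiv> embeddings F E UNIV"

text \<open>Every embedding extends to an automorphism of the closure by
  \<open>hom_on_extends_to_Aut\<close>. Composing and permuting embeddings thereby reduces to
  composing automorphisms.\<close>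

lemma embeddings_eq:
  assumes F: "fld F" and E: "fld E" "F \<subseteq> E"
    and L: "\<And>\<sigma>. \<sigma> \<in> Aut F \<Longrightarrow> \<sigma> ` E \<subseteq> L"
  shows "embeddings F E L = (\<lambda>\<sigma>. restrict \<sigma> E) ` Aut F"
proof (intro equalityI subsetI)
  fix \<tau> assume "\<tau> \<in> (\<lambda>\<sigma>. restrict \<sigma> E) ` Aut F"
  then obtain \<sigma> where s: "\<sigma> \<in> Aut F" "\<tau> = restrict \<sigma> E" by blast
  show "\<tau> \<in> embeddings F E L"
    unfolding embeddings_def Ring.ring_hom_def using s L[OF s(1)] E fldD[OF E(1)]
    by (auto simp: AutD[OF s(1)] subset_iff)
next
  fix \<tau> assume "\<tau> \<in> embeddings F E L"
  then have t: "\<tau> \<in> extensional E" "\<And>x. x \<in> F \<Longrightarrow> \<tau> x = x"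
    "\<And>x y. x \<in> E \<Longrightarrow> y \<in> E \<Longrightarrow> \<tau> (x + y) = \<tau> x + \<tau> y \<and> \<tau> (x * y) = \<tau> x * \<tau> y"
    by (auto simp: embeddings_def Ring.ring_hom_def)
  have "hom_on E \<tau>" using t fldD(1)[OF F] by (auto simp: hom_on_def)
  then obtain \<sigma> where s: "\<sigma> \<in> Aut \<rat>" "\<And>x. x \<in> E \<Longrightarrow> \<sigma> x = \<tau> x"
    using hom_on_extends_to_Aut[OF E(1)] by metis
  have "\<sigma> \<in> Aut F" using s t E by (auto simp: Aut_def subset_iff)
  moreover have "\<tau> = restrict \<sigma> E" using s(2) t(1) by (auto simp: extensional_def restrict_def)
  ultimately show "\<tau> \<in> (\<lambda>\<sigma>. restrict \<sigma> E) ` Aut F" by blast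
qed

lemma embs_eq:
  assumes "fld F" "fld E" "F \<subseteq> E"
  shows "embs F E = (\<lambda>\<sigma>. restrict \<sigma> E) ` Aut F"
  using embeddings_eq[OF assms] by simp

lemma embs_lift:
  assumes "fld F" "fld E" "F \<subseteq> E" "\<tau> \<in> embs F E"
  obtains \<sigma> where "\<sigma> \<in> Aut F" "\<tau> = restrict \<sigma> E"
  using assms by (auto simp: embs_eq)

lemma embs_comp:
  assumes "fld F" "fld E" "F \<subseteq> E" and g: "g \<in> Aut F"
  shows "bij_betw (\<lambda>\<tau>. restrict (g \<circ> \<tau>) E) (embs F E) (embs F E)"
proof -
  have maps: "restrict (h \<circ> \<tau>) E \<in> embs F E" if h: "h \<in> Aut F" and t: "\<tau> \<in> embs F E" for h \<tau>
  proof -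
    obtain \<sigma> where "\<sigma> \<in> Aut F" "\<tau> = restrict \<sigma> E" using embs_lift[OF assms(1-3) t] .
    moreover have "restrict (h \<circ> restrict \<sigma> E) E = restrict (h \<circ> \<sigma>) E" by auto
    ultimately show ?thesis using comp_Aut[OF h] by (auto simp: embs_eq[OF assms(1-3)])
  qed
  have "restrict (inv_into UNIV g \<circ> restrict (g \<circ> \<tau>) E) E = \<tau>"
    "restrict (g \<circ> restrict (inv_into UNIV g \<circ> \<tau>) E) E = \<tau>" if "\<tau> \<in> embs F E" for \<tau>
  proof -
    have ext: "\<tau> \<in> extensional E" using that by (auto simp: embeddings_def)
    show "restrict (inv_into UNIV g \<circ> restrict (g \<circ> \<tau>) E) E = \<tau>"
      "restrict (g \<circ> restrict (inv_into UNIV g \<circ> \<tau>) E) E = \<tau>"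
      using Aut_inv_simps[OF g] ext by (auto intro!: ext simp: extensional_def restrict_def fun_eq_iff)
  qed
  then show ?thesis
    using maps g inv_Aut[OF g]
    by (intro bij_betw_byWitness[of _ "\<lambda>\<tau>. restrict (inv_into UNIV g \<circ> \<tau>) E"]) auto
qed

lemma embs_list_permuted:
  assumes "fld F" "fld E" "F \<subseteq> E" and g: "g \<in> Aut F"
    and s: "distinct s" "set s = embs F E"
  obtains \<pi> where "bij_betw \<pi> {..<length s} {..<length s}"
    "\<And>i x. i < length s \<Longrightarrow> x \<in> E \<Longrightarrow> g ((s ! i) x) = (s ! \<pi> i) x"
proof -
  let ?f = "\<lambda>\<tau>. restrict (g \<circ> \<tau>) E"
  have nth: "bij_betw (\<lambda>i. s ! i) {..<length s} (embs F E)"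
    using bij_betw_nth[OF s(1) refl s(2)[symmetric]] by simp
  define \<pi> where "\<pi> = inv_into {..<length s} (\<lambda>i. s ! i) \<circ> ?f \<circ> (\<lambda>i. s ! i)"
  have "bij_betw \<pi> {..<length s} {..<length s}"
    unfolding \<pi>_def comp_assoc using nth embs_comp[OF assms(1-4)]
    by (blast intro: bij_betw_trans bij_betw_inv_into)
  moreover have "g ((s ! i) x) = (s ! \<pi> i) x" if "i < length s" "x \<in> E" for i x
  proof -
    have "?f (s ! i) \<in> embs F E"
      using embs_comp[OF assms(1-4)] nth_mem[OF that(1)] s(2) unfolding bij_betw_def by blast
    then have "s ! \<pi> i = ?f (s ! i)"
      using bij_betw_inv_into_right[OF nth] by (simp add: \<pi>_def)
    then show ?thesis using that by simp
  qed
  ultimately show thesis using that by blast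
qed

lemma nth_embs_lift:
  assumes "fld F" "fld E" "F \<subseteq> E" and "set s = embs F E" "i < length s"
  obtains \<sigma> where "\<sigma> \<in> Aut F" "s ! i = restrict \<sigma> E"
  using embs_lift[OF assms(1-3), of "s ! i"] assms(4,5) nth_mem by metis

text \<open>The coordinates solve the system of all conjugate equations, where the determinant is
  nonzero. An automorphism over \<open>F\<close> only permutes these equations, so by uniqueness it
  fixes the solution, which therefore lies in \<open>F\<close>.\<close>

lemma coordinates:
  assumes F: "fld F" and E: "fld E" "F \<subseteq> E" and s: "distinct s" "set s = embs F E" "length s = n"
    and b: "\<And>j. j < n \<Longrightarrow> b j \<in> E" and d: "det (mat n n (\<lambda>(i, j). (s ! i) (b j))) \<noteq> 0"
    and x: "x \<in> E"
  obtains c where "\<And>j. j < n \<Longrightarrow> c j \<in> F" "x = (\<Sum>j<n. c j * b j)"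
proof -
  obtain c where c: "\<And>i. i < n \<Longrightarrow> (\<Sum>j<n. (s ! i) (b j) * c j) = (s ! i) x"
    using det_nonzero_solve[OF d, of "\<lambda>i. (s ! i) x"] by metis
  have "g (c j) = c j" if g: "g \<in> Aut F" and j: "j < n" for g j
  proof -
    obtain \<pi> where p: "bij_betw \<pi> {..<n} {..<n}" "\<And>i x. i < n \<Longrightarrow> x \<in> E \<Longrightarrow> g ((s ! i) x) = (s ! \<pi> i) x"
      using embs_list_permuted[OF F E g s(1,2)] s(3) by metis
    interpret g: field_hom g using g by (rule Aut_field_hom)
    have "(\<Sum>j<n. (s ! k) (b j) * (g (c j) - c j)) = 0" if k: "k < n" for k
    proof -
      obtain i where i: "i < n" "\<pi> i = k" using p(1) k by (metis bij_betw_imp_surj_on imageE lessThan_iff)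
      have "(\<Sum>j<n. (s ! k) (b j) * g (c j)) = g (\<Sum>j<n. (s ! i) (b j) * c j)"
        using p(2)[OF i(1)] b i by (simp add: g.hom_sum g.hom_mult)
      also have "\<dots> = (s ! k) x" using c[OF i(1)] p(2)[OF i(1) x] i by simp
      finally show ?thesis using c[OF k] by (simp add: right_diff_distrib sum_subtractf)
    qed
    from det_nonzero_kernel[OF d this j] have "g (c j) - c j = 0" .
    then show ?thesis by simp
  qed
  then have cF: "c j \<in> F" if "j < n" for j using fixed_field_Aut[OF F] that by blast
  define y where "y = (\<Sum>j<n. c j * b j)"
  have "n > 0" using s embs_eq[OF F E] id_Aut by (metis (no_types) empty_iff image_is_empty length_greater_0_conv list.set(1))
  then obtain \<sigma> where \<sigma>: "\<sigma> \<in> Aut F" "s ! 0 = restrict \<sigma> E"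
    using nth_embs_lift[OF F E s(2), of 0] s(3) by auto
  interpret \<sigma>: field_hom \<sigma> using \<sigma>(1) by (rule Aut_field_hom)
  have "\<sigma> y = (\<Sum>j<n. (s ! 0) (b j) * c j)"
    unfolding y_def using b cF \<sigma> AutD(3)[OF \<sigma>(1)] by (simp add: \<sigma>.hom_sum \<sigma>.hom_mult mult.commute)
  also have "\<dots> = \<sigma> x" using c[OF \<open>n > 0\<close>] \<sigma>(2) x by simp
  finally have "x = (\<Sum>j<n. c j * b j)"
    unfolding y_def using injD[OF inj_Aut[OF \<sigma>(1)]] by metis
  then show thesis using that cF by blast
qed

lemma coordinates_unique:
  assumes F: "fld F" and E: "fld E" "F \<subseteq> E" and s: "set s \<subseteq> embs F E" "length s = n"
    and b: "\<And>j. j < n \<Longrightarrow> b j \<in> E" and d: "det (mat n n (\<lambda>(i, j). (s ! i) (b j))) \<noteq> 0"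
    and c: "\<And>j. j < n \<Longrightarrow> c j \<in> F" "(\<Sum>j<n. c j * b j) = 0" and "j < n"
  shows "c j = 0"
proof (rule det_nonzero_kernel[OF d _ \<open>j < n\<close>])
  fix i assume i: "i < n"
  obtain \<sigma> where \<sigma>: "\<sigma> \<in> Aut F" "s ! i = restrict \<sigma> E"
    using embs_lift[OF F E, of "s ! i"] s i by (metis nth_mem subsetD)
  interpret \<sigma>: field_hom \<sigma> using \<sigma>(1) by (rule Aut_field_hom)
  have "(\<Sum>j<n. (s ! i) (b j) * c j) = \<sigma> (\<Sum>j<n. c j * b j)"
    using b c(1) \<sigma> AutD(3)[OF \<sigma>(1)] by (simp add: \<sigma>.hom_sum \<sigma>.hom_mult mult.commute)
  then show "(\<Sum>j<n. (s ! i) (b j) * c j) = 0" using c(2) by simp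
qed

lemma independent_of_det:
  assumes F: "fld F" and E: "fld E" "F \<subseteq> E" and s: "set s \<subseteq> embs F E" "length s = n"
    and b: "length b = n" "set b \<subseteq> E" and d: "det (mat n n (\<lambda>(i, j). (s ! i) (b ! j))) \<noteq> 0"
  shows "ring.independent (\<Omega> :: 'a ring) F b"
proof (rule independentI[OF F])
  fix c assume c: "\<And>i. i < length b \<Longrightarrow> c i \<in> F" "(\<Sum>i<length b. c i * b ! i) = 0"
  have "b ! j \<in> E" if "j < n" for j using that b by (metis nth_mem subsetD)
  then show "\<forall>i<length b. c i = 0"
    using coordinates_unique[OF F E s _ d, of c] c b(1) by auto
qed

lemma Span_of_det:
  assumes F: "fld F" and E: "fld E" "F \<subseteq> E" and s: "distinct s" "set s = embs F E" "length s = n"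
    and b: "length b = n" "set b \<subseteq> E" and d: "det (mat n n (\<lambda>(i, j). (s ! i) (b ! j))) \<noteq> 0"
  shows "ring.Span (\<Omega> :: 'a ring) F b = E"
proof (intro equalityI subsetI)
  have bE: "b ! j \<in> E" if "j < n" for j using that b by (metis nth_mem subsetD)
  fix x
  show "x \<in> E" if "x \<in> ring.Span (\<Omega> :: 'a ring) F b"
    using that bE b(1) E fldD[OF E(1)] unfolding Span_iff[OF F]
    by (auto intro!: subring_set_sum[OF fld_subring[OF E(1)]])
  show "x \<in> ring.Span (\<Omega> :: 'a ring) F b" if "x \<in> E"
    using coordinates[OF F E s bE d that] unfolding Span_iff[OF F] b(1) by metis
qed

lemma integral_multiple:
  obtains k :: nat where "k > 0" "algebraic_int (of_nat k * (x :: 'a))"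
proof -
  obtain p where p: "p \<noteq> 0" "\<forall>i. coeff p i \<in> \<int>" "poly p x = 0"
    using algebraic_UNIV[of x] by (auto elim: algebraicE)
  then obtain l where l: "lead_coeff p = of_int l" by (metis Ints_cases)
  have "l \<noteq> 0" using p l by auto
  have "algebraic_int (of_int l * x)"
    using algebraic_int_lead_coeff_mult_root[of p x] p l
    by (auto simp: poly_over_def intro: int_imp_algebraic_int)
  then have "algebraic_int (of_int (sgn l) * (of_int l * x))" by (rule algebraic_int_mult[OF algebraic_int_of_int])
  moreover have "of_int (sgn l) * (of_int l * x) = of_nat (nat \<bar>l\<bar>) * x"
    by (cases l rule: linorder_cases[of _ 0]) auto
  ultimately show thesis using that[of "nat \<bar>l\<bar>"] \<open>l \<noteq> 0\<close> by auto
qed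

lemma embs_differ_on_integers:
  assumes F: "fld F" and E: "fld E" "F \<subseteq> E" and "\<sigma> \<in> embs F E" "\<tau> \<in> embs F E" "\<sigma> \<noteq> \<tau>"
  obtains x where "x \<in> ring_of_integers E" "\<sigma> x \<noteq> \<tau> x"
proof -
  obtain s t where st: "s \<in> Aut F" "\<sigma> = restrict s E" "t \<in> Aut F" "\<tau> = restrict t E"
    using embs_lift[OF F E assms(4)] embs_lift[OF F E assms(5)] by metis
  then obtain x where x: "x \<in> E" "s x \<noteq> t x" using assms(6) by (auto simp: restrict_def fun_eq_iff split: if_splits)
  obtain k where k: "k > 0" "algebraic_int (of_nat k * x)" using integral_multiple .
  have kQ: "(of_nat k :: 'a) \<in> \<rat>" "of_nat k * x \<in> E"
    using x fldD[OF E(1)] by (auto simp: subset_iff)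
  then have "\<sigma> (of_nat k * x) \<noteq> \<tau> (of_nat k * x)"
    using x k st AutD(2,4)[OF st(1)] AutD(2,4)[OF st(3)] by auto
  then show thesis using that kQ k by (auto simp: ring_of_integers_def)
qed

lemma Aut_ring_of_integers:
  assumes "\<sigma> \<in> Aut F" "x \<in> ring_of_integers E"
  shows "algebraic_int (\<sigma> x)"
  using algebraic_int_Aut[OF assms(1)] assms(2) by (auto simp: ring_of_integers_def)

lemma embs_algebraic_int:
  assumes "fld F" "fld E" "F \<subseteq> E" "\<tau> \<in> embs F E" "x \<in> ring_of_integers E"
  shows "algebraic_int (\<tau> x)"
proof -
  obtain \<sigma> where "\<sigma> \<in> Aut F" "\<tau> = restrict \<sigma> E" using embs_lift[OF assms(1-4)] .
  then show ?thesis using assms(5) Aut_ring_of_integers by (auto simp: ring_of_integers_def)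
qed

lemma embs_characters:
  assumes F: "fld F" and E: "fld E" "F \<subseteq> E" and s: "set s \<subseteq> embs F E" "length s = n"
    and Q: "ideal_set algebraic_ints Q" "1 \<notin> Q"
    and prime: "\<And>x y. algebraic_int x \<Longrightarrow> algebraic_int y \<Longrightarrow> x * y \<in> Q \<Longrightarrow> x \<in> Q \<or> y \<in> Q"
    and distinct: "\<And>i j. i < n \<Longrightarrow> j < n \<Longrightarrow> i \<noteq> j \<Longrightarrow> \<exists>x\<in>ring_of_integers E. (s ! i) x - (s ! j) x \<notin> Q"
  obtains b where "\<And>j. j < n \<Longrightarrow> b j \<in> ring_of_integers E" "det (mat n n (\<lambda>(i, j). (s ! i) (b j))) \<notin> Q"
proof (rule characters_det[of "algebraic_ints :: 'a set" Q "ring_of_integers E" n "\<lambda>i. (s ! i)"])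
  have si: "s ! i \<in> embs F E" if "i < n" for i using that s by (metis nth_mem subsetD)
  have lift: "\<exists>\<sigma>\<in>Aut F. s ! i = restrict \<sigma> E" if "i < n" for i
    using embs_lift[OF F E si[OF that]] by metis
  have ring: "1 \<in> E" "\<And>x y. x \<in> E \<Longrightarrow> y \<in> E \<Longrightarrow> x * y \<in> E"
    using subring_setD[OF fld_subring[OF E(1)]] by auto
  show "subring_set (algebraic_ints :: 'a set)" by (rule subring_algebraic_ints)
  show "1 \<in> ring_of_integers E" using ring by (simp add: ring_of_integers_def)
  show "x * y \<in> ring_of_integers E" if "x \<in> ring_of_integers E" "y \<in> ring_of_integers E" for x y
    using that ring by (auto simp: ring_of_integers_def intro: algebraic_int_mult)
  show "(s ! i) x \<in> algebraic_ints" if "i < n" "x \<in> ring_of_integers E" for i x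
    using embs_algebraic_int[OF F E si] that by blast
  show "(s ! i) 1 = 1" if "i < n" for i
    using lift[OF that] ring by (auto simp: AutD)
  show "(s ! i) (x * y) = (s ! i) x * (s ! i) y"
    if "i < n" "x \<in> ring_of_integers E" "y \<in> ring_of_integers E" for i x y
    using lift[OF that(1)] that ring by (auto simp: AutD ring_of_integers_def)
qed (use Q prime distinct that in auto)

lemma zero_prime_ideal:
  "ideal_set algebraic_ints {0 :: 'a}" "1 \<notin> {0 :: 'a}"
  by (auto simp: ideal_set_def)

lemma integral_basis_exists:
  assumes F: "fld F" and E: "fld E" "F \<subseteq> E" and s: "distinct s" "set s \<subseteq> embs F E" "length s = n"
  obtains b where "length b = n" "set b \<subseteq> ring_of_integers E"
    "det (mat n n (\<lambda>(i, j). (s ! i) (b ! j))) \<noteq> 0"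
proof -
  have distinct: "\<exists>x\<in>ring_of_integers E. (s ! i) x - (s ! j) x \<notin> {0}" if "i < n" "j < n" "i \<noteq> j" for i j
  proof -
    have "s ! i \<noteq> s ! j" using that s by (simp add: nth_eq_iff_index_eq)
    moreover have "s ! i \<in> embs F E" "s ! j \<in> embs F E" using that s by (metis nth_mem subsetD)+
    ultimately show ?thesis using embs_differ_on_integers[OF F E] by (metis eq_iff_diff_eq_0 singletonD)
  qed
  obtain b where b: "\<And>j. j < n \<Longrightarrow> b j \<in> ring_of_integers E" "det (mat n n (\<lambda>(i, j). (s ! i) (b j))) \<notin> {0}"
    by (rule embs_characters[OF F E s(2,3) zero_prime_ideal _ distinct]) auto
  have "mat n n (\<lambda>(i, j). (s ! i) (map b [0..<n] ! j)) = mat n n (\<lambda>(i, j). (s ! i) (b j))"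
    by (intro eq_matI) auto
  moreover have "set (map b [0..<n]) \<subseteq> ring_of_integers E" using b(1) by auto
  ultimately show thesis using that[of "map b [0..<n]"] b(2) by simp
qed

lemma ext_of_degreeD:
  assumes "fld F" "ext_of_degree F n E"
  shows "fld E" "F \<subseteq> E" "ring.dimension (\<Omega> :: 'a ring) n F E"
  using assms by (auto simp: ext_of_degree_def subfield_iff_fld)

text \<open>Elements with a nonzero determinant against a set of embeddings are independent, so no
  finite set of embeddings exceeds the dimension. Against all embeddings such elements also span,
  which gives equality.\<close>

lemma
  assumes F: "fld F" and E: "ext_of_degree F n E"
  shows finite_embs: "finite (embs F E)" and card_embs: "card (embs F E) = n"
proof -
  note E' = ext_of_degreeD[OF F E]
  have subF: "subfield F (\<Omega> :: 'a ring)" using F by (simp add: subfield_iff_fld)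
  have le: "card S \<le> n" if S: "S \<subseteq> embs F E" "finite S" for S
  proof -
    obtain s where s: "set s = S" "distinct s" using finite_distinct_list[OF S(2)] by blast
    then obtain b where b: "length b = length s" "set b \<subseteq> ring_of_integers E"
      "det (mat (length s) (length s) (\<lambda>(i, j). (s ! i) (b ! j))) \<noteq> 0"
      using integral_basis_exists[OF F E'(1,2) s(2) _ refl] S by blast
    have "set b \<subseteq> E" using b by (auto simp: ring_of_integers_def)
    then have "ring.independent (\<Omega> :: 'a ring) F b"
      using independent_of_det[OF F E'(1,2) _ refl b(1) _ b(3)] s S by auto
    then have "length b \<le> n"
      using \<Omega>.independent_length_le_dimension[OF subF E'(3)] \<open>set b \<subseteq> E\<close> by auto
    then show ?thesis using b s by (metis distinct_card)
  qed
  then show fin: "finite (embs F E)"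
    using finite_if_finite_subsets_card_bdd[of "embs F E" n] by auto
  obtain s where s: "set s = embs F E" "distinct s" using finite_distinct_list[OF fin] by blast
  then obtain b where b: "length b = length s" "set b \<subseteq> ring_of_integers E"
    "det (mat (length s) (length s) (\<lambda>(i, j). (s ! i) (b ! j))) \<noteq> 0"
    using integral_basis_exists[OF F E'(1,2) s(2) _ refl] by blast
  have "set b \<subseteq> E" using b by (auto simp: ring_of_integers_def)
  then have "ring.independent (\<Omega> :: 'a ring) F b" "ring.Span (\<Omega> :: 'a ring) F b = E"
    using independent_of_det[OF F E'(1,2) _ refl b(1) _ b(3)] Span_of_det[OF F E'(1,2) s(2,1) refl b(1) _ b(3)] s by auto
  then have "ring.dimension (\<Omega> :: 'a ring) (length b) F E"
    using \<Omega>.dimension_independent by metis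
  then have "length b = n" using \<Omega>.dimension_is_inj[OF subF _ E'(3)] by blast
  then show "card (embs F E) = n" using b s by (metis distinct_card)
qed

text \<open>For the hull of several fields the embeddings are counted first; this turns their number
  into the degree.\<close>

lemma ext_of_degree_card_embs:
  assumes F: "fld F" and E: "fld E" "F \<subseteq> E" and fin: "finite (embs F E)"
  shows "ext_of_degree F (card (embs F E)) E"
proof -
  obtain s where s: "set s = embs F E" "distinct s" using finite_distinct_list[OF fin] by blast
  then obtain b where b: "length b = length s" "set b \<subseteq> ring_of_integers E"
    "det (mat (length s) (length s) (\<lambda>(i, j). (s ! i) (b ! j))) \<noteq> 0"
    using integral_basis_exists[OF F E s(2) _ refl] by blast
  have "set b \<subseteq> E" using b by (auto simp: ring_of_integers_def)
  then have "ring.independent (\<Omega> :: 'a ring) F b" "ring.Span (\<Omega> :: 'a ring) F b = E"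
    using independent_of_det[OF F E _ refl b(1) _ b(3)] Span_of_det[OF F E s(2,1) refl b(1) _ b(3)] s by auto
  then have "ring.dimension (\<Omega> :: 'a ring) (length b) F E"
    using \<Omega>.dimension_independent by metis
  moreover have "length b = card (embs F E)" using b s by (metis distinct_card)
  ultimately show ?thesis using E by (simp add: ext_of_degree_def subfield_iff_fld)
qed

end

section \<open>Indices of additive subgroups\<close>

definition add_subgroup :: "'a::ab_group_add set \<Rightarrow> bool" where
  "add_subgroup A \<longleftrightarrow> 0 \<in> A \<and> (\<forall>x\<in>A. \<forall>y\<in>A. x - y \<in> A)"

text \<open>The summands stand in the order of the right cosets of HOL-Algebra, with which these
  sets are identified in \<open>residue_group\<close> and \<open>abs_norm_eq\<close>.\<close>

definition residue_classes :: "'a::ab_group_add set \<Rightarrow> 'a set \<Rightarrow> 'a set set" where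
  "residue_classes A B = (\<lambda>a. (\<lambda>b. b + a) ` B) ` A"

lemma residue_classesE:
  assumes "V \<in> residue_classes A B"
  obtains a where "a \<in> A" "V = (\<lambda>b. b + a) ` B"
  using assms unfolding residue_classes_def by (rule imageE)

lemma residue_classesI: "a \<in> A \<Longrightarrow> V = (\<lambda>b. b + a) ` B \<Longrightarrow> V \<in> residue_classes A B"
  unfolding residue_classes_def by (rule image_eqI)

lemma residue_classes_representatives:
  obtains r where "\<And>V. V \<in> residue_classes A B \<Longrightarrow> r V \<in> A"
    "\<And>V. V \<in> residue_classes A B \<Longrightarrow> V = (\<lambda>b. b + r V) ` B"
proof
  let ?r = "inv_into A (\<lambda>a. (\<lambda>b. b + a) ` B)"
  show "?r V \<in> A" if "V \<in> residue_classes A B" for V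
    using that unfolding residue_classes_def by (rule inv_into_into)
  show "V = (\<lambda>b. b + ?r V) ` B" if "V \<in> residue_classes A B" for V
    using f_inv_into_f[of V "\<lambda>a. (\<lambda>b. b + a) ` B" A] that by (simp add: residue_classes_def)
qed

lemma add_subgroupD:
  assumes "add_subgroup A"
  shows "0 \<in> A" "x \<in> A \<Longrightarrow> y \<in> A \<Longrightarrow> x - y \<in> A" "x \<in> A \<Longrightarrow> - x \<in> A" "x \<in> A \<Longrightarrow> y \<in> A \<Longrightarrow> x + y \<in> A"
proof -
  show 0: "0 \<in> A" and d: "\<And>x y. x \<in> A \<Longrightarrow> y \<in> A \<Longrightarrow> x - y \<in> A" using assms by (auto simp: add_subgroup_def)
  show m: "x \<in> A \<Longrightarrow> - x \<in> A" for x using d[OF 0, of x] by simp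
  show "x \<in> A \<Longrightarrow> y \<in> A \<Longrightarrow> x + y \<in> A" using d[OF _ m, of x y] by simp
qed

lemma ideal_set_add_subgroup: "subring_set R \<Longrightarrow> ideal_set R I \<Longrightarrow> add_subgroup I"
  by (auto simp: add_subgroup_def intro: ideal_set_diff ideal_setD(2))

lemma subring_set_add_subgroup: "subring_set R \<Longrightarrow> add_subgroup R"
  by (auto simp: add_subgroup_def intro: subring_setD)

lemma residue_class_eq_iff:
  assumes B: "add_subgroup B"
  shows "(\<lambda>b. b + x) ` B = (\<lambda>b. b + y) ` B \<longleftrightarrow> x - y \<in> B"
proof
  assume "(\<lambda>b. b + x) ` B = (\<lambda>b. b + y) ` B"
  moreover have "x \<in> (\<lambda>b. b + x) ` B" using add_subgroupD(1)[OF B] by force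
  ultimately obtain b where "b \<in> B" "x = b + y" by blast
  then show "x - y \<in> B" by simp
next
  have sub: "(\<lambda>b. b + x) ` B \<subseteq> (\<lambda>b. b + y) ` B" if "x - y \<in> B" for x y
  proof safe
    fix b assume "b \<in> B"
    then have "b + (x - y) \<in> B" "b + x = b + (x - y) + y" using add_subgroupD(4)[OF B] that by auto
    then show "b + x \<in> (\<lambda>b. b + y) ` B" by blast
  qed
  assume "x - y \<in> B"
  moreover from add_subgroupD(3)[OF B this] have "y - x \<in> B" by simp
  ultimately show "(\<lambda>b. b + x) ` B = (\<lambda>b. b + y) ` B" using sub by blast
qed

lemma
  assumes B: "add_subgroup B" and T: "finite T" "\<And>x. x \<in> A \<Longrightarrow> \<exists>t\<in>T. x - t \<in> B"
  shows finite_residue_classes: "finite (residue_classes A B)"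
    and card_residue_classes_le: "card (residue_classes A B) \<le> card T"
proof -
  have sub: "residue_classes A B \<subseteq> (\<lambda>t. (\<lambda>b. b + t) ` B) ` T"
  proof
    fix V assume "V \<in> residue_classes A B"
    then obtain a where a: "a \<in> A" "V = (\<lambda>b. b + a) ` B" by (elim residue_classesE)
    then obtain t where t: "t \<in> T" "a - t \<in> B" using T(2) by blast
    then have "V = (\<lambda>b. b + t) ` B" using residue_class_eq_iff[OF B] a(2) by simp
    then show "V \<in> (\<lambda>t. (\<lambda>b. b + t) ` B) ` T" using t(1) by (rule image_eqI)
  qed
  then show "finite (residue_classes A B)" using T(1) by (auto intro: finite_subset)
  have "card (residue_classes A B) \<le> card ((\<lambda>t. (\<lambda>b. b + t) ` B) ` T)"
    using sub T(1) by (intro card_mono) auto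
  also have "\<dots> \<le> card T" using T(1) by (rule card_image_le)
  finally show "card (residue_classes A B) \<le> card T" .
qed

lemma residue_classes_mult:
  assumes A: "add_subgroup A" and B: "add_subgroup B" and C: "add_subgroup C" and sub: "C \<subseteq> B" "B \<subseteq> A"
  shows "card (residue_classes A C) = card (residue_classes A B) * card (residue_classes B C)"
proof -
  obtain r where r: "\<And>V. V \<in> residue_classes A B \<Longrightarrow> r V \<in> A"
    "\<And>V. V \<in> residue_classes A B \<Longrightarrow> V = (\<lambda>b. b + r V) ` B"
    using residue_classes_representatives[of A B] by blast
  let ?f = "\<lambda>(V, Y). (\<lambda>y. y + r V) ` Y"
  have f: "?f (V, (\<lambda>c. c + b) ` C) = (\<lambda>c. c + (b + r V)) ` C" for V b
    by (auto simp: image_image add.assoc)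
  have "bij_betw ?f (residue_classes A B \<times> residue_classes B C) (residue_classes A C)"
    unfolding bij_betw_def
  proof
    show "inj_on ?f (residue_classes A B \<times> residue_classes B C)"
    proof (rule inj_onI, clarify)
      fix V Y V' Y'
      assume *: "V \<in> residue_classes A B" "Y \<in> residue_classes B C" "V' \<in> residue_classes A B" "Y' \<in> residue_classes B C"
        "(\<lambda>y. y + r V) ` Y = (\<lambda>y. y + r V') ` Y'"
      from *(2) obtain b where "b \<in> B" "Y = (\<lambda>c. c + b) ` C" by (rule residue_classesE)
      moreover from *(4) obtain b' where "b' \<in> B" "Y' = (\<lambda>c. c + b') ` C" by (rule residue_classesE)
      ultimately have b: "b \<in> B" "Y = (\<lambda>c. c + b) ` C" "b' \<in> B" "Y' = (\<lambda>c. c + b') ` C" by auto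
      then have "(\<lambda>c. c + (b + r V)) ` C = (\<lambda>c. c + (b' + r V')) ` C"
        using *(5) by (simp add: image_image add.assoc)
      then have d: "(b + r V) - (b' + r V') \<in> C" using residue_class_eq_iff[OF C] by blast
      then have "((b + r V) - (b' + r V')) - (b - b') \<in> B"
        using sub b add_subgroupD(2)[OF B] by blast
      then have "r V - r V' \<in> B" by (simp add: algebra_simps)
      then have "V = V'" using r(2)[OF *(1)] r(2)[OF *(3)] residue_class_eq_iff[OF B] by metis
      moreover from this d have "b - b' \<in> C" by simp
      ultimately show "V = V' \<and> Y = Y'" using b residue_class_eq_iff[OF C] by metis
    qed
    show "?f ` (residue_classes A B \<times> residue_classes B C) = residue_classes A C"
    proof (intro equalityI subsetI)
      fix Z assume "Z \<in> ?f ` (residue_classes A B \<times> residue_classes B C)"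
      then obtain V Y where "V \<in> residue_classes A B" "Y \<in> residue_classes B C" "Z = ?f (V, Y)" by blast
      moreover from this(2) obtain b where "b \<in> B" "Y = (\<lambda>c. c + b) ` C" by (rule residue_classesE)
      ultimately have V: "V \<in> residue_classes A B" "b \<in> B" "Z = ?f (V, (\<lambda>c. c + b) ` C)" by auto
      then have "b + r V \<in> A" using r(1) sub add_subgroupD(4)[OF A] by blast
      then show "Z \<in> residue_classes A C" unfolding V(3) f by (rule residue_classesI) (rule refl)
    next
      fix Z assume "Z \<in> residue_classes A C"
      then obtain a where a: "a \<in> A" "Z = (\<lambda>c. c + a) ` C" by (rule residue_classesE)
      define V where "V = (\<lambda>b. b + a) ` B"
      have V: "V \<in> residue_classes A B" using a(1) V_def by (rule residue_classesI)
      then have "a - r V \<in> B" using r(2)[OF V] residue_class_eq_iff[OF B] V_def by metis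
      then have "(V, (\<lambda>c. c + (a - r V)) ` C) \<in> residue_classes A B \<times> residue_classes B C"
        using V by (blast intro: residue_classesI)
      moreover have "Z = ?f (V, (\<lambda>c. c + (a - r V)) ` C)" unfolding f a by simp
      ultimately show "Z \<in> ?f ` (residue_classes A B \<times> residue_classes B C)" by blast
    qed
  qed
  then show ?thesis by (metis bij_betw_same_card card_cartesian_product)
qed

text \<open>The group \<open>D\<close> generated by \<open>C\<close> and \<open>x\<close> lies
  between \<open>C\<close> and \<open>B\<close> and has index exactly \<open>p\<close> over
  \<open>C\<close>.\<close>

lemma prime_dvd_residue_classes:
  fixes B C :: "'a::comm_ring_1 set"
  assumes p: "prime p" and B: "add_subgroup B" and C: "add_subgroup C" "C \<subseteq> B"
    and x: "x \<in> B" "x \<notin> C" "of_nat p * x \<in> C"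
  shows "p dvd card (residue_classes B C)"
proof -
  have int_mult: "of_int k * y \<in> A" if "add_subgroup A" "y \<in> A" for A :: "'a set" and k y
  proof -
    have nat: "of_nat n * y \<in> A" for n
      using add_subgroupD[OF that(1)] that(2) by (induction n) (auto simp: distrib_right)
    show ?thesis
      using add_subgroupD(3)[OF that(1) nat] nat by (cases k rule: int_cases2) auto
  qed
  define D where "D = {c + of_int k * x |c k. c \<in> C}"
  have D: "add_subgroup D"
    unfolding add_subgroup_def
  proof (intro conjI ballI)
    show "0 \<in> D" unfolding D_def using add_subgroupD(1)[OF C(1)] by (auto intro!: exI[of _ 0])
    fix y z assume "y \<in> D" "z \<in> D"
    then obtain c k c' k' where "y = c + of_int k * x" "z = c' + of_int k' * x" "c \<in> C" "c' \<in> C"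
      by (auto simp: D_def)
    moreover from this have "y - z = (c - c') + of_int (k - k') * x" by (simp add: algebra_simps)
    ultimately show "y - z \<in> D" unfolding D_def using add_subgroupD(2)[OF C(1)] by blast
  qed
  have "C \<subseteq> D"
  proof
    fix c assume "c \<in> C"
    moreover have "c = c + of_int 0 * x" by simp
    ultimately show "c \<in> D" unfolding D_def by blast
  qed
  have "D \<subseteq> B" unfolding D_def using C(2) int_mult[OF B x(1)] add_subgroupD(4)[OF B] by blast
  have mod_p: "int p dvd k" if "of_int k * x \<in> C" for k
  proof (rule ccontr)
    assume "\<not> int p dvd k"
    then have "coprime (int p) k" using p by (simp add: prime_imp_coprime)
    then obtain u v where uv: "u * int p + v * k = 1" by (metis bezout_int coprime_imp_gcd_eq_1)
    have "of_int u * (of_nat p * x) + of_int v * (of_int k * x) \<in> C"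
      using int_mult[OF C(1)] x(3) that add_subgroupD(4)[OF C(1)] by blast
    moreover have "of_int u * (of_nat p * x) + of_int v * (of_int k * x) = of_int (u * int p + v * k) * x"
      by (simp add: algebra_simps)
    ultimately show False using uv x(2) by simp
  qed
  have "residue_classes D C = (\<lambda>i. (\<lambda>b. b + of_nat i * x) ` C) ` {..<p}"
  proof (intro equalityI subsetI)
    fix Z assume "Z \<in> residue_classes D C"
    then obtain d where d: "d \<in> D" "Z = (\<lambda>b. b + d) ` C" by (rule residue_classesE)
    then obtain c k where ck: "c \<in> C" "Z = (\<lambda>b. b + (c + of_int k * x)) ` C"
      unfolding D_def by blast
    define i where "i = nat (k mod int p)"
    have "p > 0" using p by (rule prime_gt_0_nat)
    have i: "i < p" "int i = k mod int p" using \<open>p > 0\<close> by (auto simp: i_def nat_less_iff)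
    have "k = (k div int p) * int p + int i" using i by simp
    then have "of_int k * x = (of_int (k div int p) * of_nat p + of_nat i) * x"
      by (metis of_int_add of_int_mult of_int_of_nat_eq)
    then have "c + of_int k * x - of_nat i * x = c + of_int (k div int p) * (of_nat p * x)"
      by (simp add: distrib_right mult.assoc)
    also have "\<dots> \<in> C" using ck(1) int_mult[OF C(1) x(3)] add_subgroupD(4)[OF C(1)] by blast
    finally have "Z = (\<lambda>b. b + of_nat i * x) ` C"
      unfolding ck using residue_class_eq_iff[OF C(1)] by blast
    then show "Z \<in> (\<lambda>i. (\<lambda>b. b + of_nat i * x) ` C) ` {..<p}" using i by blast
  next
    fix Z assume "Z \<in> (\<lambda>i. (\<lambda>b. b + of_nat i * x) ` C) ` {..<p}"
    then obtain i where "Z = (\<lambda>b. b + of_nat i * x) ` C" by blast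
    moreover have "0 + of_int (int i) * x \<in> D" unfolding D_def using add_subgroupD(1)[OF C(1)] by blast
    ultimately show "Z \<in> residue_classes D C" by (intro residue_classesI[of "of_nat i * x"]) auto
  qed
  moreover have "inj_on (\<lambda>i. (\<lambda>b. b + of_nat i * x) ` C) {..<p}"
  proof (rule inj_onI)
    fix i j assume ij: "i \<in> {..<p}" "j \<in> {..<p}"
      "(\<lambda>b. b + of_nat i * x) ` C = (\<lambda>b. b + of_nat j * x) ` C"
    then have "of_nat i * x - of_nat j * x \<in> C" using residue_class_eq_iff[OF C(1)] by blast
    then have "of_int (int i - int j) * x \<in> C" by (simp add: algebra_simps)
    then have "int p dvd int i - int j" by (rule mod_p)
    then have "int i mod int p = int j mod int p" by (simp add: mod_eq_dvd_iff)
    then show "i = j" using ij(1,2) by (simp flip: of_nat_mod)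
  qed
  ultimately have "card (residue_classes D C) = p" by (simp add: card_image)
  then show ?thesis using residue_classes_mult[OF B D C(1) \<open>C \<subseteq> D\<close> \<open>D \<subseteq> B\<close>] by simp
qed

text \<open>Presents the residue classes as a factor group, to which the theorems of Lagrange and
  Sylow apply.\<close>

lemma residue_group:
  fixes A B :: "'a::comm_ring_1 set"
  assumes A: "add_subgroup A" and B: "add_subgroup B" "B \<subseteq> A"
  defines "G \<equiv> \<lparr>carrier = A, monoid.mult = (+), one = 0\<rparr>"
  shows "group (G Mod B)" "carrier (G Mod B) = residue_classes A B"
    "\<one>\<^bsub>G Mod B\<^esub> = B"
    "x \<in> A \<Longrightarrow> ((\<lambda>b. b + x) ` B) [^]\<^bsub>G Mod B\<^esub> (n :: nat) = (\<lambda>b. b + of_nat n * x) ` B"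
proof -
  note AD = add_subgroupD[OF A] and BD = add_subgroupD[OF B(1)]
  interpret G: comm_group G
  proof (rule comm_groupI)
    show "\<exists>y\<in>carrier G. y \<otimes>\<^bsub>G\<^esub> x = \<one>\<^bsub>G\<^esub>" if "x \<in> carrier G" for x
      using that AD(3) by (auto simp: G_def intro!: bexI[of _ "- x"])
  qed (use AD in \<open>auto simp: G_def add.assoc add.commute\<close>)
  have inv: "inv\<^bsub>G\<^esub> x = - x" if "x \<in> A" for x
    using that AD(3) by (intro G.inv_equality) (auto simp: G_def)
  have "subgroup B G"
    by (rule G.subgroupI) (use B BD inv in \<open>auto simp: G_def subset_iff\<close>)
  then have N: "B \<lhd> G" by (rule G.subgroup_imp_normal)
  show grp: "group (G Mod B)" using N by (rule normal.factorgroup_is_group)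
  interpret Q: group "G Mod B" by (rule grp)
  have cos: "B #>\<^bsub>G\<^esub> x = (\<lambda>b. b + x) ` B" for x by (auto simp: r_coset_def G_def)
  show "carrier (G Mod B) = residue_classes A B"
    unfolding FactGroup_def RCOSETS_def residue_classes_def using cos by (auto simp: G_def)
  show one: "\<one>\<^bsub>G Mod B\<^esub> = B" by (simp add: FactGroup_def)
  have carr: "B #>\<^bsub>G\<^esub> x \<in> carrier (G Mod B)" if "x \<in> A" for x
    using that by (auto simp: FactGroup_def RCOSETS_def G_def)
  assume x: "x \<in> A"
  show "((\<lambda>b. b + x) ` B) [^]\<^bsub>G Mod B\<^esub> n = (\<lambda>b. b + of_nat n * x) ` B"
  proof (induction n)
    case 0
    then show ?case using one by simp
  next
    case (Suc n)
    have "of_nat n * x \<in> A" using AD x by (induction n) (auto simp: distrib_right)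
    then have "(B #>\<^bsub>G\<^esub> (of_nat n * x)) <#>\<^bsub>G\<^esub> (B #>\<^bsub>G\<^esub> x) = B #>\<^bsub>G\<^esub> (of_nat n * x \<otimes>\<^bsub>G\<^esub> x)"
      using x by (intro normal.rcos_sum[OF N]) (auto simp: G_def)
    then show ?case using Suc by (simp add: cos FactGroup_def) (simp add: G_def algebra_simps)
  qed
qed

lemma card_residue_classes_mult_mem:
  fixes A B :: "'a::comm_ring_1 set"
  assumes A: "add_subgroup A" and B: "add_subgroup B" "B \<subseteq> A" and fin: "finite (residue_classes A B)"
    and "x \<in> A"
  shows "of_nat (card (residue_classes A B)) * x \<in> B"
proof -
  note g = residue_group[OF A B]
  let ?Q = "\<lparr>carrier = A, monoid.mult = (+), one = 0\<rparr> Mod B"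
  interpret Q: group ?Q by (rule g)
  have "(\<lambda>b. b + x) ` B \<in> carrier ?Q" unfolding g(2) using \<open>x \<in> A\<close> by (rule residue_classesI) (rule refl)
  then have "((\<lambda>b. b + x) ` B) [^]\<^bsub>?Q\<^esub> Coset.order ?Q = \<one>\<^bsub>?Q\<^esub>" by (rule Q.pow_order_eq_1)
  then have "(\<lambda>b. b + of_nat (card (residue_classes A B)) * x) ` B = B"
    unfolding g(4)[OF \<open>x \<in> A\<close>] g(3) Coset.order_def g(2) .
  then show ?thesis using residue_class_eq_iff[OF B(1), of _ 0] by simp
qed

text \<open>Cauchy's theorem, from a subgroup of order \<open>p\<close>; the witness has
  \<open>k = 1\<close>.\<close>

lemma prime_dvd_card_residue_classes:
  fixes A B :: "'a::comm_ring_1 set"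
  assumes A: "add_subgroup A" and B: "add_subgroup B" "B \<subseteq> A" and fin: "finite (residue_classes A B)"
    and p: "prime p" "p dvd card (residue_classes A B)"
  obtains x k where "x \<in> A" "x \<notin> B" "of_nat (p ^ k) * x \<in> B"
proof -
  note g = residue_group[OF A B]
  let ?Q = "\<lparr>carrier = A, monoid.mult = (+), one = 0\<rparr> Mod B"
  interpret Q: group ?Q by (rule g)
  obtain m where m: "Coset.order ?Q = p ^ 1 * m" using p(2) g(2) by (auto simp: Coset.order_def elim: dvdE)
  then obtain H where H: "subgroup H ?Q" "card H = p ^ 1"
    using sylow_thm[OF p(1) g(1) m] fin g(2) by auto
  interpret H: group "?Q\<lparr>carrier := H\<rparr>" using H(1) Q.subgroup_imp_group by blast
  have "card H > 1" using H(2) prime_gt_1_nat[OF p(1)] by simp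
  then obtain h where h: "h \<in> H" "h \<noteq> \<one>\<^bsub>?Q\<^esub>"
    by (metis card_le_Suc0_iff_eq One_nat_def card_eq_0_iff not_one_less_zero not_le)
  have order_H: "Coset.order (?Q\<lparr>carrier := H\<rparr>) = p" using H(2) by (simp add: Coset.order_def)
  have "h [^]\<^bsub>?Q\<^esub> p = \<one>\<^bsub>?Q\<^esub>"
    using H.pow_order_eq_1[of h] h(1) unfolding order_H by (simp add: nat_pow_def)
  moreover obtain x where x: "x \<in> A" "h = (\<lambda>b. b + x) ` B"
    using subgroup.subset[OF H(1)] h(1) g(2) by (metis residue_classesE subsetD)
  ultimately have "(\<lambda>b. b + of_nat p * x) ` B = B" using g(3) g(4)[OF x(1)] by simp
  then have "of_nat (p ^ 1) * x \<in> B" using residue_class_eq_iff[OF B(1), of _ 0] by simp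
  moreover have "x \<notin> B" using h(2) x(2) g(3) residue_class_eq_iff[OF B(1), of x 0] by auto
  ultimately show thesis using that x(1) by blast
qed

section \<open>Discriminant ideals\<close>

context number_base
begin

interpretation \<Omega>: field "\<Omega> :: 'a ring" by (rule field_from_type_algebra)

lemma OF_cring: "cring (on_carrier OF :: 'a ring)"
proof -
  have "subring OF (\<Omega> :: 'a ring)"
    using OFD by (intro \<Omega>.subringI) (auto simp: \<Omega>_minus)
  then show ?thesis
    by (intro \<Omega>.subcring_iff[THEN iffD1] \<Omega>.subcringI) auto
qed

lemma ideal_iff: "ideal I (on_carrier OF :: 'a ring) \<longleftrightarrow> ideal_set OF I"
proof
  interpret R: cring "on_carrier OF :: 'a ring" by (rule OF_cring)
  assume "ideal I (on_carrier OF :: 'a ring)"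
  then interpret I: ideal I "on_carrier OF :: 'a ring" .
  show "ideal_set OF I"
    unfolding ideal_set_def
    using I.a_subset I.zero_closed I.a_closed I.I_l_closed by auto
next
  interpret R: cring "on_carrier OF :: 'a ring" by (rule OF_cring)
  assume I: "ideal_set OF I"
  note ID = ideal_setD[OF I]
  have minus: "\<ominus>\<^bsub>on_carrier OF :: 'a ring\<^esub> x = - x" if "x \<in> OF" for x
    using that OFD(3) by (intro R.minus_equality) auto
  show "ideal I (on_carrier OF :: 'a ring)"
  proof (rule idealI)
    show "ring (on_carrier OF :: 'a ring)" by (rule R.ring_axioms)
    show "subgroup I (add_monoid (on_carrier OF :: 'a ring))"
    proof (rule R.add.subgroupI)
      show "\<ominus>\<^bsub>on_carrier OF :: 'a ring\<^esub> x \<in> I" if "x \<in> I" for x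
        using minus[of x] that ID(1) ideal_set_minus[OF OF_ring I that] by auto
    qed (use ID in auto)
  qed (use ID in auto)
qed

lemma abs_norm_eq:
  shows "abs_norm F I = card (residue_classes OF I)"
proof -
  have "a_rcosets\<^bsub>on_carrier OF :: 'a ring\<^esub> I = residue_classes OF I"
    unfolding A_RCOSETS_def RCOSETS_def residue_classes_def r_coset_def by auto
  then show ?thesis by (simp add: abs_norm_def FactRing_def)
qed

lemma
  assumes "integral_basis_discs F E \<subseteq> OF"
  shows disc_ideal_ideal: "ideal_set OF (disc_ideal F E)"
    and discs_subset_disc_ideal: "integral_basis_discs F E \<subseteq> disc_ideal F E"
    and disc_ideal_subset: "\<And>I. ideal_set OF I \<Longrightarrow> integral_basis_discs F E \<subseteq> I \<Longrightarrow> disc_ideal F E \<subseteq> I"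
proof -
  interpret R: cring "on_carrier OF :: 'a ring" by (rule OF_cring)
  show "ideal_set OF (disc_ideal F E)"
    using R.genideal_ideal[of "integral_basis_discs F E"] assms by (simp add: disc_ideal_def ideal_iff)
  show "integral_basis_discs F E \<subseteq> disc_ideal F E"
    using R.genideal_self[of "integral_basis_discs F E"] assms by (simp add: disc_ideal_def)
  show "disc_ideal F E \<subseteq> I" if "ideal_set OF I" "integral_basis_discs F E \<subseteq> I" for I
    using R.genideal_minimal[of I "integral_basis_discs F E"] that by (simp add: disc_ideal_def ideal_iff)
qed

lemma residue_classes_bound:
  assumes I: "ideal_set OF I" and m: "m > 0" "of_nat m \<in> I"
  shows "finite (residue_classes OF I)" "card (residue_classes OF I) \<le> m ^ deg"
proof -
  obtain T where T: "T \<subseteq> OF" "finite T" "card T \<le> m ^ deg"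
    "\<And>x. x \<in> OF \<Longrightarrow> \<exists>t\<in>T. x - t \<in> multiples (of_nat m)"
    using residues[OF m(1)] by metis
  have "multiples (of_nat m) \<subseteq> I" using ideal_setD(5)[OF I _ m(2)] by (auto simp: multiples_def)
  then have T': "\<exists>t\<in>T. x - t \<in> I" if "x \<in> OF" for x using T(4)[OF that] by blast
  note sg = ideal_set_add_subgroup[OF OF_ring I]
  show "finite (residue_classes OF I)" using finite_residue_classes[OF sg T(2), of OF] T' by blast
  show "card (residue_classes OF I) \<le> m ^ deg"
    using card_residue_classes_le[OF sg T(2), of OF] T' T(3) by (meson le_trans)
qed

end

section \<open>Trace, determinant of embeddings and discriminants of bases\<close>

locale number_ext = number_base ty F deg
  for ty :: "'a::{alg_closed_field, field_char_0} itself" and F deg +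
  fixes E :: "'a set" and n :: nat and s :: "('a \<Rightarrow> 'a) list"
  assumes E: "ext_of_degree F n E" and s: "distinct s" "set s = embs F E"
begin

lemma fld_E: "fld E" and FE: "F \<subseteq> E"
  using ext_of_degreeD[OF fld_F E] by auto

lemma length_s: "length s = n"
  using card_embs[OF fld_F E] s by (metis distinct_card)

abbreviation (input) OE :: "'a set" where "OE \<equiv> ring_of_integers E"

lemmas OED = subring_setD[OF subring_ring_of_integers[OF fld_E]]

lemma mem_OE: "x \<in> OE \<longleftrightarrow> x \<in> E \<and> algebraic_int x"
  by (simp add: ring_of_integers_def)

lemma OF_OE: "x \<in> OF \<Longrightarrow> x \<in> OE"
  using FE by (auto simp: ring_of_integers_def)

lemma s_lift:
  assumes "i < n"
  obtains \<sigma> where "\<sigma> \<in> Aut F" "s ! i = restrict \<sigma> E"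
  using nth_embs_lift[OF fld_F fld_E FE s(2)] assms length_s by metis

lemma s_add: "i < n \<Longrightarrow> x \<in> E \<Longrightarrow> y \<in> E \<Longrightarrow> (s ! i) (x + y) = (s ! i) x + (s ! i) y"
  and s_mult: "i < n \<Longrightarrow> x \<in> E \<Longrightarrow> y \<in> E \<Longrightarrow> (s ! i) (x * y) = (s ! i) x * (s ! i) y"
  and s_fix: "i < n \<Longrightarrow> x \<in> F \<Longrightarrow> (s ! i) x = x"
  using FE fldD(2,3)[OF fld_E] by (auto elim!: s_lift simp: AutD)

lemma s_sum:
  assumes "i < n" "\<And>j. j \<in> A \<Longrightarrow> f j \<in> E"
  shows "(s ! i) (sum f A) = (\<Sum>j\<in>A. (s ! i) (f j))"
  using assms(2)
proof (induction A rule: infinite_finite_induct)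
  case (insert j A)
  then have "sum f A \<in> E" by (intro subring_set_sum[OF fld_subring[OF fld_E]]) auto
  then show ?case using insert s_add[OF assms(1)] by simp
qed (use s_fix[OF assms(1)] fldD(1)[OF fld_F] in auto)

lemma s_int: "i < n \<Longrightarrow> x \<in> OE \<Longrightarrow> algebraic_int ((s ! i) x)"
  using embs_algebraic_int[OF fld_F fld_E FE] s length_s by (metis nth_mem)

lemma n_pos: "n > 0"
proof -
  have "embs F E \<noteq> {}" using embs_eq[OF fld_F fld_E FE] id_Aut by blast
  then show ?thesis using s length_s by force
qed

definition trace :: "'a \<Rightarrow> 'a" where
  "trace x = (\<Sum>i<n. (s ! i) x)"

lemma trace_F:
  assumes "x \<in> E"
  shows "trace x \<in> F"
proof (rule fixed_field_Aut[OF fld_F])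
  fix g assume g: "g \<in> Aut F"
  interpret g: field_hom g using g by (rule Aut_field_hom)
  obtain \<pi> where p: "bij_betw \<pi> {..<n} {..<n}" "\<And>i x. i < n \<Longrightarrow> x \<in> E \<Longrightarrow> g ((s ! i) x) = (s ! \<pi> i) x"
    using embs_list_permuted[OF fld_F fld_E FE g s] length_s by metis
  have "g (trace x) = (\<Sum>i<n. (s ! \<pi> i) x)" by (simp add: trace_def g.hom_sum p(2) assms)
  also have "\<dots> = trace x" unfolding trace_def by (rule sum.reindex_bij_betw[OF p(1)])
  finally show "g (trace x) = trace x" .
qed

lemma trace_OF: "x \<in> OE \<Longrightarrow> trace x \<in> OF"
  using trace_F[of x] algebraic_int_sum[of "{..<n}" "\<lambda>i. (s ! i) x"] s_int[of _ x]
  by (simp add: mem_OE mem_OF trace_def)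

lemma trace_sum: "(\<And>j. j \<in> A \<Longrightarrow> f j \<in> E) \<Longrightarrow> trace (sum f A) = (\<Sum>j\<in>A. trace (f j))"
  unfolding trace_def by (simp add: s_sum sum.swap[of _ A])

lemma trace_scale: "c \<in> F \<Longrightarrow> x \<in> E \<Longrightarrow> trace (c * x) = c * trace x"
  unfolding trace_def using FE by (simp add: s_mult s_fix sum_distrib_left subset_iff)

definition emb_det :: "(nat \<Rightarrow> 'a) \<Rightarrow> 'a" where
  "emb_det b = det (mat n n (\<lambda>(i, j). (s ! i) (b j)))"

text \<open>The Gram matrix of the trace form has entries in \<open>F\<close>, whereas
  \<open>emb_det b\<close> itself may lie outside \<open>F\<close>.\<close>

lemma emb_det_square:
  assumes "\<And>j. j < n \<Longrightarrow> b j \<in> E"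
  shows "(emb_det b)\<^sup>2 = det (mat n n (\<lambda>(j, k). trace (b j * b k)))"
proof -
  let ?A = "mat n n (\<lambda>(i, j). (s ! i) (b j))"
  have "(emb_det b)\<^sup>2 = det ?A\<^sup>T * det ?A"
    by (simp add: emb_det_def power2_eq_square det_transpose[of ?A n])
  also have "\<dots> = det (?A\<^sup>T * ?A)" by (rule det_mult[symmetric]) auto
  also have "?A\<^sup>T * ?A = mat n n (\<lambda>(j, k). trace (b j * b k))"
    using assms by (intro eq_matI) (auto simp: scalar_prod_def trace_def s_mult atLeast0LessThan)
  finally show ?thesis .
qed

lemma emb_det_OF:
  assumes "\<And>j. j < n \<Longrightarrow> b j \<in> OE"
  shows "(emb_det b)\<^sup>2 \<in> OF"
  using assms OED(5) trace_OF
  by (subst emb_det_square) (auto simp: mem_OE intro!: det_in_subring[OF OF_ring, of _ n])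

lemma emb_det_int:
  assumes "\<And>j. j < n \<Longrightarrow> b j \<in> OE"
  shows "algebraic_int (emb_det b)"
  using det_in_subring[OF subring_algebraic_ints, of "mat n n (\<lambda>(i, j). (s ! i) (b j))" n] assms s_int
  by (auto simp: emb_det_def)

text \<open>Cramer's rule: the new column is the matrix applied to the coordinate vector
  \<open>c\<close>.\<close>

lemma emb_det_replace:
  assumes b: "\<And>j. j < n \<Longrightarrow> b j \<in> E" and c: "\<And>j. j < n \<Longrightarrow> c j \<in> F" and "k < n"
  shows "emb_det (b(k := (\<Sum>j<n. c j * b j))) = c k * emb_det b"
proof -
  let ?A = "mat n n (\<lambda>(i, j). (s ! i) (b j))"
  have A: "?A \<in> carrier_mat n n" by simp
  have "mat n n (\<lambda>(i, j). (s ! i) ((b(k := (\<Sum>j<n. c j * b j))) j)) = replace_col ?A (?A *\<^sub>v vec n c) k"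
  proof (intro eq_matI)
    fix i j assume "i < dim_row (replace_col ?A (?A *\<^sub>v vec n c) k)" "j < dim_col (replace_col ?A (?A *\<^sub>v vec n c) k)"
    then have ij: "i < n" "j < n" by (auto simp: replace_col_def)
    have "(s ! i) (\<Sum>j<n. c j * b j) = (\<Sum>j<n. (s ! i) (b j) * c j)"
      using ij b c FE fldD(3)[OF fld_E] by (subst s_sum) (auto simp: s_mult s_fix subset_iff mult.commute)
    then show "mat n n (\<lambda>(i, j). (s ! i) ((b(k := (\<Sum>j<n. c j * b j))) j)) $$ (i, j)
        = replace_col ?A (?A *\<^sub>v vec n c) k $$ (i, j)"
      using ij by (auto simp: replace_col_def scalar_prod_def atLeast0LessThan)
  qed (auto simp: replace_col_def)
  then show ?thesis
    using cramer_lemma_mat[OF A vec_carrier, of k c] \<open>k < n\<close> by (simp add: emb_det_def)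
qed

lemma emb_det_disc:
  assumes "\<And>j. j < n \<Longrightarrow> b j \<in> OE" "emb_det b \<noteq> 0"
  shows "(emb_det b)\<^sup>2 \<in> integral_basis_discs F E"
proof -
  let ?b = "map b [0..<n]"
  have eq: "mat n n (\<lambda>(i, j). (s ! i) (?b ! j)) = mat n n (\<lambda>(i, j). (s ! i) (b j))"
    by (intro eq_matI) auto
  have d: "det (mat n n (\<lambda>(i, j). (s ! i) (?b ! j))) \<noteq> 0" using assms(2) unfolding eq emb_det_def .
  have "set ?b \<subseteq> E" "set ?b \<subseteq> OE" using assms(1) by (auto simp: mem_OE)
  then have "ring.independent (\<Omega> :: 'a ring) F ?b" "ring.Span (\<Omega> :: 'a ring) F ?b = E"
    using independent_of_det[OF fld_F fld_E FE _ length_s _ _ d] Span_of_det[OF fld_F fld_E FE s length_s _ _ d] s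
    by auto
  then show ?thesis
    unfolding integral_basis_discs_def mem_Collect_eq using s \<open>set ?b \<subseteq> OE\<close> eq
    by (intro exI[of _ ?b] exI[of _ s]) (simp add: emb_det_def)
qed

lemma integral_basis:
  obtains b where "\<And>j. j < n \<Longrightarrow> b j \<in> OE" "emb_det b \<noteq> 0"
proof -
  obtain b where b: "length b = n" "set b \<subseteq> OE" "det (mat n n (\<lambda>(i, j). (s ! i) (b ! j))) \<noteq> 0"
    using integral_basis_exists[OF fld_F fld_E FE s(1) _ length_s] s(2) by blast
  then show thesis using that[of "\<lambda>j. b ! j"] by (auto simp: emb_det_def subset_iff)
qed

end

section \<open>The discriminant ideal and its norm\<close>

context number_base
begin

text \<open>Each element of \<open>integral_basis_discs\<close> comes with its own enumeration of
  the embeddings, so \<open>s\<close> is obtained together with \<open>b\<close>.\<close>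

lemma disc_cases:
  assumes E: "ext_of_degree F n E" and d: "d \<in> integral_basis_discs F E"
  obtains s b where "number_ext F deg E n s" "\<And>j. j < n \<Longrightarrow> b j \<in> ring_of_integers E"
    "d = (number_ext.emb_det n s b)\<^sup>2"
proof -
  obtain b s where b: "d = (det (mat (length b) (length b) (\<lambda>(i, j). (s ! i) (b ! j))))\<^sup>2"
    "ring.independent (\<Omega> :: 'a ring) F b" "ring.Span (\<Omega> :: 'a ring) F b = E" "set b \<subseteq> ring_of_integers E"
    "distinct s" "set s = embs F E"
    using d by (auto simp: integral_basis_discs_def)
  interpret number_ext ty F deg E n s
    by unfold_locales (use E b in auto)
  interpret \<Omega>: field "\<Omega> :: 'a ring" by (rule field_from_type_algebra)
  have "ring.dimension (\<Omega> :: 'a ring) (length b) F E" using \<Omega>.dimension_independent[OF b(2)] b(3) by simp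
  then have "length b = n"
    using \<Omega>.dimension_is_inj[of F] ext_of_degreeD(3)[OF fld_F E] fld_F by (auto simp: subfield_iff_fld)
  then have d: "d = (emb_det (\<lambda>j. b ! j))\<^sup>2" using b(1) by (simp add: emb_det_def)
  have "b ! j \<in> ring_of_integers E" if "j < n" for j
    using b(4) \<open>length b = n\<close> that by (metis nth_mem subsetD)
  then show thesis by (rule that[OF number_ext_axioms _ d])
qed

lemma ext_list:
  assumes "ext_of_degree F n E"
  obtains s where "number_ext F deg E n s"
proof -
  obtain s where "set s = embs F E" "distinct s"
    using finite_distinct_list[OF finite_embs[OF fld_F assms]] by blast
  then have "number_ext F deg E n s" using assms by unfold_locales auto
  then show thesis by (rule that)
qed

lemma discs_OF:
  assumes "ext_of_degree F n E"
  shows "integral_basis_discs F E \<subseteq> OF"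
proof
  fix d assume "d \<in> integral_basis_discs F E"
  then obtain s b where "number_ext F deg E n s" "\<And>j. j < n \<Longrightarrow> b j \<in> ring_of_integers E"
    "d = (number_ext.emb_det n s b)\<^sup>2" using disc_cases[OF assms] by metis
  then show "d \<in> OF" using number_ext.emb_det_OF by blast
qed

lemma disc_ideal_nonzero:
  assumes E: "ext_of_degree F n E"
  obtains m where "m > 0" "of_nat m \<in> disc_ideal F E"
proof -
  obtain s where "number_ext F deg E n s" using ext_list[OF E] .
  then interpret number_ext ty F deg E n s .
  obtain b where b: "\<And>j. j < n \<Longrightarrow> b j \<in> OE" "emb_det b \<noteq> 0" using integral_basis by blast
  then have d: "(emb_det b)\<^sup>2 \<in> disc_ideal F E" "(emb_det b)\<^sup>2 \<in> OF" "(emb_det b)\<^sup>2 \<noteq> 0"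
    using emb_det_disc[OF b] discs_subset_disc_ideal[OF discs_OF[OF E]] emb_det_OF by auto
  obtain m where "m > 0" "of_nat m \<in> multiples ((emb_det b)\<^sup>2)" using nat_multiple[OF d(2,3)] .
  moreover from this have "of_nat m \<in> disc_ideal F E"
    using ideal_setD(5)[OF disc_ideal_ideal[OF discs_OF[OF E]] _ d(1)] by (auto simp: multiples_def)
  ultimately show thesis using that by blast
qed

text \<open>The discriminant ideal contains a positive integer, so its index is finite; by
  Lagrange's theorem the index then annihilates \<open>1\<close> in the quotient, that is, it lies
  in the ideal.\<close>

lemma
  assumes E: "ext_of_degree F n E"
  shows finite_disc_classes: "finite (residue_classes OF (disc_ideal F E))"
    and Disc_pos: "Disc F E > 0"
    and Disc_mem_disc_ideal: "of_nat (Disc F E) \<in> disc_ideal F E"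
proof -
  note I = disc_ideal_ideal[OF discs_OF[OF E]]
  obtain m where m: "m > 0" "of_nat m \<in> disc_ideal F E" using disc_ideal_nonzero[OF E] .
  show fin: "finite (residue_classes OF (disc_ideal F E))" using residue_classes_bound[OF I m] by blast
  have "residue_classes OF (disc_ideal F E) \<noteq> {}" using OFD(1) by (auto simp: residue_classes_def)
  then show "Disc F E > 0" using fin by (simp add: Disc_def abs_norm_eq card_gt_0_iff)
  show "of_nat (Disc F E) \<in> disc_ideal F E"
    using card_residue_classes_mult_mem[OF subring_set_add_subgroup[OF OF_ring]
        ideal_set_add_subgroup[OF OF_ring I] ideal_setD(1)[OF I] fin OFD(1)]
    by (simp add: Disc_def abs_norm_eq)
qed

lemma Disc_le:
  assumes E: "ext_of_degree F n E" and "m > 0" "of_nat m \<in> disc_ideal F E"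
  shows "Disc F E \<le> m ^ deg"
  using residue_classes_bound[OF disc_ideal_ideal[OF discs_OF[OF E]] assms(2,3)]
  by (simp add: Disc_def abs_norm_eq)

text \<open>Cauchy's theorem gives an \<open>x\<close> outside the discriminant ideal that a power
  of \<open>p\<close> carries into it. The annihilator of \<open>x\<close> modulo the ideal is
  proper, and any maximal ideal above it contains both the discriminant ideal and
  \<open>p\<close>.\<close>

lemma prime_dvd_Disc:
  assumes E: "ext_of_degree F n E" and p: "prime p" "p dvd Disc F E"
  obtains P where "max_ideal OF P" "disc_ideal F E \<subseteq> P" "of_nat p \<in> P"
proof -
  let ?D = "disc_ideal F E"
  note I = disc_ideal_ideal[OF discs_OF[OF E]]
  obtain x k where x: "x \<in> OF" "x \<notin> ?D" "of_nat (p ^ k) * x \<in> ?D"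
    using prime_dvd_card_residue_classes[OF subring_set_add_subgroup[OF OF_ring]
        ideal_set_add_subgroup[OF OF_ring I] ideal_setD(1)[OF I] finite_disc_classes[OF E] p(1)] p(2)
    by (metis Disc_def abs_norm_eq)
  let ?I = "{a \<in> OF. a * x \<in> ?D}"
  have I1: "ideal_set OF ?I"
    unfolding ideal_set_def using ideal_setD[OF I] OFD x(1)
    by (auto simp: distrib_right mult.assoc)
  have I2: "1 \<notin> ?I" using x(2) by simp
  obtain P where P: "max_ideal OF P" "?I \<subseteq> P" using ex_max_ideal[OF OF_ring I1 I2] .
  have "?D \<subseteq> ?I" using ideal_setD(1)[OF I] ideal_setD(5)[OF I x(1)] by auto
  moreover have "of_nat p \<in> P"
  proof (rule ccontr)
    assume "of_nat p \<notin> P"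
    then have "(of_nat p :: 'a) \<in> OF - P" by simp
    then have "(\<Prod>i<k. of_nat p) \<in> OF - P" by (intro max_ideal_prod[OF OF_ring P(1)])
    then have "(of_nat p ^ k :: 'a) \<notin> P" by simp
    moreover have "(of_nat p ^ k :: 'a) \<in> ?I" using x(3) OFD(7)[of "of_nat p" k] by simp
    ultimately show False using P(2) by blast
  qed
  ultimately show thesis using that P by blast
qed

end

section \<open>Ramification: a lower bound for the discriminant\<close>

context number_base
begin

text \<open>For a local generator \<open>\<pi>\<close> of \<open>P\<close> this is the symbolic
  power of \<open>P\<close>: the integers divisible by \<open>\<pi> ^ k\<close> in the
  localisation.\<close>

definition local_power :: "'a set \<Rightarrow> 'a \<Rightarrow> nat \<Rightarrow> 'a set" where
  "local_power P \<pi> k = {a \<in> OF. \<exists>u\<in>OF - P. \<exists>z\<in>OF. u * a = \<pi> ^ k * z}"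

context
  fixes P \<pi> assumes P: "max_ideal OF P" and \<pi>: "\<pi> \<in> P" "\<pi> \<noteq> 0"
    "\<And>y. y \<in> P \<Longrightarrow> \<exists>u\<in>OF - P. \<exists>z\<in>OF. u * y = \<pi> * z"
begin

lemma local_powerI: "a \<in> OF \<Longrightarrow> u \<in> OF - P \<Longrightarrow> z \<in> OF \<Longrightarrow> u * a = \<pi> ^ k * z \<Longrightarrow> a \<in> local_power P \<pi> k"
  unfolding local_power_def by blast

lemma local_power_mult:
  assumes "a \<in> local_power P \<pi> j" "b \<in> local_power P \<pi> k"
  shows "a * b \<in> local_power P \<pi> (j + k)"
proof -
  obtain u z where a: "a \<in> OF" "u \<in> OF - P" "z \<in> OF" "u * a = \<pi> ^ j * z"
    using assms(1) by (auto simp: local_power_def)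
  obtain v w where b: "b \<in> OF" "v \<in> OF - P" "w \<in> OF" "v * b = \<pi> ^ k * w"
    using assms(2) by (auto simp: local_power_def)
  have "(u * v) * (a * b) = (u * a) * (v * b)" by (simp add: mult_ac)
  also have "\<dots> = (\<pi> ^ j * z) * (\<pi> ^ k * w)" by (simp only: a(4) b(4))
  also have "\<dots> = \<pi> ^ (j + k) * (z * w)" by (simp add: power_add mult_ac)
  finally show ?thesis
    by (intro local_powerI[OF OFD(5)[OF a(1) b(1)] unit_mult[OF P a(2) b(2)] OFD(5)[OF a(3) b(3)]])
qed

lemma local_power_0: "local_power P \<pi> 0 = OF"
proof -
  have "a \<in> local_power P \<pi> 0" if "a \<in> OF" for a
    using that unit_1[OF P] by (intro local_powerI[of a 1 a]) auto
  then show ?thesis by (auto simp: local_power_def)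
qed

lemma P_local_power: "y \<in> P \<Longrightarrow> y \<in> local_power P \<pi> 1"
  using \<pi>(3) PD(1)[OF P] by (fastforce simp: local_power_def)

lemma local_power_ideal: "ideal_set OF (local_power P \<pi> k)"
  unfolding ideal_set_def
proof (intro conjI ballI)
  show "local_power P \<pi> k \<subseteq> OF" by (auto simp: local_power_def)
  show "0 \<in> local_power P \<pi> k"
    using OFD(2) unit_1[OF P] by (intro local_powerI[of 0 1 0]) auto
  show "r * a \<in> local_power P \<pi> k" if "r \<in> OF" "a \<in> local_power P \<pi> k" for r a
    using local_power_mult[of r 0 a k] that local_power_0 by simp
  fix a b assume "a \<in> local_power P \<pi> k" "b \<in> local_power P \<pi> k"
  then obtain u z v w where a: "a \<in> OF" "u \<in> OF - P" "z \<in> OF" "u * a = \<pi> ^ k * z"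
    and b: "b \<in> OF" "v \<in> OF - P" "w \<in> OF" "v * b = \<pi> ^ k * w"
    unfolding local_power_def by blast
  have "(u * v) * (a + b) = v * (u * a) + u * (v * b)" by (simp add: algebra_simps)
  also have "\<dots> = v * (\<pi> ^ k * z) + u * (\<pi> ^ k * w)" by (simp only: a(4) b(4))
  also have "\<dots> = \<pi> ^ k * (v * z + u * w)" by (simp add: algebra_simps)
  finally show "a + b \<in> local_power P \<pi> k"
    using a(1-3) b(1-3) unit_mult[OF P a(2) b(2)] OFD(4,5)
    by (intro local_powerI[of "a + b" "u * v" "v * z + u * w"]) auto
qed

lemma local_power_unit:
  assumes "v \<in> OF - P" "a \<in> OF" "v * a \<in> local_power P \<pi> k"
  shows "a \<in> local_power P \<pi> k"
proof -
  obtain u z where u: "u \<in> OF - P" "z \<in> OF" "u * (v * a) = \<pi> ^ k * z"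
    using assms(3) by (auto simp: local_power_def)
  then show ?thesis
    using local_powerI[OF assms(2) unit_mult[OF P u(1) assms(1)] u(2)] by (simp add: mult.assoc)
qed

lemma local_power_prod:
  assumes "finite A" "J \<subseteq> A" "\<And>i. i \<in> A \<Longrightarrow> f i \<in> OF" "\<And>i. i \<in> J \<Longrightarrow> f i \<in> P"
  shows "prod f A \<in> local_power P \<pi> (card J)"
proof -
  have "finite J" using assms(1,2) finite_subset by blast
  then have "prod f J \<in> local_power P \<pi> (card J)" using assms(4)
  proof (induction J rule: finite_induct)
    case empty
    then show ?case using OFD(1) local_power_0 by simp
  next
    case (insert i J)
    then show ?case using local_power_mult[of "f i" 1 "prod f J" "card J"] P_local_power[of "f i"] by simp
  qed
  moreover have "prod f (A - J) \<in> OF" using assms(3) by (intro subring_set_prod[OF OF_ring]) auto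
  moreover have "prod f A = prod f (A - J) * prod f J" by (rule prod.subset_diff[OF assms(2,1)])
  ultimately show ?thesis using ideal_setD(4)[OF local_power_ideal] by metis
qed

text \<open>Every Leibniz term has one factor in each row, hence \<open>card J\<close> factors in
  \<open>P\<close>.\<close>

lemma local_power_det:
  assumes "J \<subseteq> {..<n}" "\<And>i k. i < n \<Longrightarrow> k < n \<Longrightarrow> a i k \<in> OF" "\<And>i k. i \<in> J \<Longrightarrow> k < n \<Longrightarrow> a i k \<in> P"
  shows "det (mat n n (\<lambda>(i, k). a i k)) \<in> local_power P \<pi> (card J)"
proof -
  let ?A = "mat n n (\<lambda>(i, k). a i k)"
  have s: "signof p \<in> OF" for p
    using OFD by (cases p rule: sign_cases) auto
  have "(\<Prod>i = 0..<n. ?A $$ (i, p i)) \<in> local_power P \<pi> (card J)" if p: "p permutes {0..<n}" for p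
  proof (rule local_power_prod)
    have pi: "p i < n" if "i < n" for i using permutes_in_image[OF p, of i] that by simp
    show "?A $$ (i, p i) \<in> OF" if "i \<in> {0..<n}" for i using that pi assms(2) by simp
    show "?A $$ (i, p i) \<in> P" if "i \<in> J" for i using that pi assms(1,3) by auto
  qed (use assms(1) in auto)
  then show ?thesis
    unfolding det_def'[of ?A n, OF mat_carrier]
    by (intro ideal_set_sum[OF local_power_ideal] ideal_setD(4)[OF local_power_ideal] s) auto
qed

text \<open>The local powers form a descending chain. Each index in it is divisible by
  \<open>p\<close>, because \<open>\<pi> ^ j\<close> is not in the next power while
  \<open>of_nat p * \<pi> ^ j\<close> is.\<close>

lemma prime_power_dvd_index:
  assumes p: "prime p" "of_nat p \<in> P" and D: "ideal_set OF D" "D \<subseteq> local_power P \<pi> k"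
    and fin: "finite (residue_classes OF D)"
  shows "p ^ k dvd card (residue_classes OF D)"
proof -
  note sg = ideal_set_add_subgroup[OF OF_ring]
  note OFsg = subring_set_add_subgroup[OF OF_ring]
  note Isg = sg[OF local_power_ideal]
  have sub: "local_power P \<pi> j \<subseteq> OF" for j using ideal_setD(1)[OF local_power_ideal] .
  have pi_OF: "\<pi> \<in> OF" using \<pi>(1) PD(1)[OF P] by blast
  have "p ^ k dvd card (residue_classes OF (local_power P \<pi> k))"
  proof (induction k)
    case (Suc j)
    have le: "local_power P \<pi> (Suc j) \<subseteq> local_power P \<pi> j"
    proof
      fix a assume "a \<in> local_power P \<pi> (Suc j)"
      then obtain u z where "a \<in> OF" "u \<in> OF - P" "z \<in> OF" "u * a = \<pi> ^ Suc j * z"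
        by (auto simp: local_power_def)
      then show "a \<in> local_power P \<pi> j"
        using OFD(5)[OF pi_OF, of z] by (intro local_powerI[of a u "\<pi> * z"]) (auto simp: mult_ac)
    qed
    have "p dvd card (residue_classes (local_power P \<pi> j) (local_power P \<pi> (Suc j)))"
    proof (rule prime_dvd_residue_classes[OF p(1) Isg Isg le, of "\<pi> ^ j"])
      show pj: "\<pi> ^ j \<in> local_power P \<pi> j"
        using OFD(7)[OF pi_OF] OFD(1) unit_1[OF P] by (intro local_powerI[of _ 1 1]) auto
      show "\<pi> ^ j \<notin> local_power P \<pi> (Suc j)"
      proof
        assume "\<pi> ^ j \<in> local_power P \<pi> (Suc j)"
        then obtain u z where "u \<in> OF - P" "z \<in> OF" "u * \<pi> ^ j = \<pi> ^ Suc j * z"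
          by (auto simp: local_power_def)
        then have "u = \<pi> * z" using \<pi>(2) by (simp add: mult.left_commute mult.commute)
        then show False using \<open>u \<in> OF - P\<close> \<open>z \<in> OF\<close> PD(5)[OF P, of z \<pi>] \<pi>(1) by blast
      qed
      show "of_nat p * \<pi> ^ j \<in> local_power P \<pi> (Suc j)"
        using local_power_mult[OF P_local_power[OF p(2)] pj] by simp
    qed
    then show ?case
      using residue_classes_mult[OF OFsg Isg Isg le sub] mult_dvd_mono[OF Suc.IH] by (metis power_Suc2)
  qed simp
  then show ?thesis
    using residue_classes_mult[OF OFsg Isg sg[OF D(1)] D(2) sub] by simp
qed

end

end

context number_ext
begin

context
  fixes P MM \<pi> and r :: nat and \<kappa> :: "nat \<Rightarrow> nat" and y :: "nat \<Rightarrow> 'a \<Rightarrow> 'a"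
  assumes P: "max_ideal OF P" and \<pi>: "\<pi> \<in> P" "\<pi> \<noteq> 0"
    "\<And>y. y \<in> P \<Longrightarrow> \<exists>u\<in>OF - P. \<exists>z\<in>OF. u * y = \<pi> * z"
    and MM: "max_ideal algebraic_ints MM" "MM \<inter> OF = P"
    and \<kappa>: "\<And>i. i < n \<Longrightarrow> \<kappa> i < r"
      "\<And>c x. c < r \<Longrightarrow> x \<in> OE \<Longrightarrow> algebraic_int (y c x)"
      "\<And>i x. i < n \<Longrightarrow> x \<in> OE \<Longrightarrow> (s ! i) x - y (\<kappa> i) x \<in> MM"
begin

text \<open>
  Modulo \<open>MM\<close> the embeddings fall into the \<open>r\<close> classes \<open>\<kappa> i\<close>, so the trace form has rank at most \<open>r\<close>.
\<close>

lemma trace_minor_mem: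
  assumes "m > r" and b: "\<And>j. j < m \<Longrightarrow> b j \<in> OE" and b': "\<And>j. j < m \<Longrightarrow> b' j \<in> OE"
  shows "det (mat m m (\<lambda>(j, l). trace (b j * b' l))) \<in> MM"
proof -
  note ZI = subring_algebraic_ints
  \<comment> \<open>\<open>A\<close> sums the embeddings of each class and \<open>B\<close>
    evaluates one representative per class. Row \<open>r\<close> of \<open>B\<close> is zero, so the
    product is singular, and it is congruent to the trace matrix.\<close>
  define A where "A = mat m m (\<lambda>(j, c). \<Sum>i | i < n \<and> \<kappa> i = c. (s ! i) (b j))"
  define B where "B = mat m m (\<lambda>(c, l). if c < r then y c (b' l) else 0)"
  have AB: "A \<in> carrier_mat m m" "B \<in> carrier_mat m m" by (auto simp: A_def B_def)
  have "det B = (\<Sum>l<m. B $$ (r, l) * cofactor B r l)"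
    by (rule laplace_expansion_row[OF AB(2) assms(1)])
  also have "\<dots> = 0" using assms(1) by (intro sum.neutral) (auto simp: B_def)
  finally have "det (A * B) = 0" using det_mult[OF AB] by simp
  have AB_entry: "(A * B) $$ (j, l) = (\<Sum>i<n. (s ! i) (b j) * y (\<kappa> i) (b' l))" if "j < m" "l < m" for j l
  proof -
    have "(A * B) $$ (j, l) = (\<Sum>c<m. (\<Sum>i | i < n \<and> \<kappa> i = c. (s ! i) (b j)) * (if c < r then y c (b' l) else 0))"
      using that by (simp add: A_def B_def scalar_prod_def atLeast0LessThan)
    also have "\<dots> = (\<Sum>c<m. \<Sum>i\<in>{i \<in> {..<n}. \<kappa> i = c}. (s ! i) (b j) * y (\<kappa> i) (b' l))"
    proof (rule sum.cong[OF refl])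
      fix c
      show "(\<Sum>i | i < n \<and> \<kappa> i = c. (s ! i) (b j)) * (if c < r then y c (b' l) else 0)
          = (\<Sum>i\<in>{i \<in> {..<n}. \<kappa> i = c}. (s ! i) (b j) * y (\<kappa> i) (b' l))"
      proof (cases "c < r")
        case True
        then show ?thesis by (auto simp: sum_distrib_right intro!: sum.cong)
      next
        case False
        then have "{i \<in> {..<n}. \<kappa> i = c} = {}" using \<kappa>(1) by auto
        then show ?thesis using False by (simp only: sum.empty) simp
      qed
    qed
    also have "\<dots> = (\<Sum>i<n. (s ! i) (b j) * y (\<kappa> i) (b' l))"
      using \<kappa>(1) assms(1) by (intro sum.group) (auto intro: less_trans)
    finally show ?thesis .
  qed
  have "det (mat m m (\<lambda>(j, l). trace (b j * b' l))) - det (A * B) \<in> MM"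
  proof (rule det_cong_mod[OF ZI max_idealD(1)[OF MM(1)], of _ m])
    fix j l assume jl: "j < m" "l < m"
    have E: "b j \<in> E" "b' l \<in> E" using b b' jl by (auto simp: mem_OE)
    show "mat m m (\<lambda>(j, l). trace (b j * b' l)) $$ (j, l) \<in> algebraic_ints"
      using trace_OF[OF OED(5)[OF b b']] jl by (auto simp: mem_OF)
    show "(A * B) $$ (j, l) \<in> algebraic_ints"
      using b b' jl s_int \<kappa>(1,2) by (auto simp: AB_entry intro!: algebraic_int_sum algebraic_int_mult)
    have "mat m m (\<lambda>(j, l). trace (b j * b' l)) $$ (j, l) - (A * B) $$ (j, l)
        = (\<Sum>i<n. (s ! i) (b j) * ((s ! i) (b' l) - y (\<kappa> i) (b' l)))"
      using jl E by (simp add: AB_entry trace_def s_mult right_diff_distrib sum_subtractf)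
    also have "\<dots> \<in> MM"
      using b b' jl s_int \<kappa>(3)
      by (intro ideal_set_sum[OF max_idealD(1)[OF MM(1)]] ideal_setD(4)[OF max_idealD(1)[OF MM(1)]]) auto
    finally show "mat m m (\<lambda>(j, l). trace (b j * b' l)) $$ (j, l) - (A * B) $$ (j, l) \<in> MM" .
  qed (use AB in auto)
  then show ?thesis using \<open>det (A * B) = 0\<close> by simp
qed

text \<open>The radical of the trace form modulo \<open>P\<close>.\<close>

definition radical :: "'a set" where
  "radical = {x \<in> OE. \<forall>z\<in>OE. trace (x * z) \<in> P}"

text \<open>Vectors are moved into the radical one by one. While more than \<open>r\<close> of them
  are outside \<open>J\<close>, \<open>trace_minor_mem\<close> excludes a surviving minor, so
  \<open>minor_or_relation\<close> yields a relation. The combination with its coefficients lies in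
  the radical and replaces a vector whose coefficient is outside \<open>P\<close>; the determinant
  changes by a local unit, collected in \<open>u\<close>.\<close>

lemma radical_basis:
  assumes b: "\<And>j. j < n \<Longrightarrow> b j \<in> OE"
  shows "q \<le> n - r \<Longrightarrow> \<exists>b' u J. (\<forall>j<n. b' j \<in> OE) \<and> u \<in> OF - P \<and> emb_det b' = u * emb_det b \<and>
    J \<subseteq> {..<n} \<and> card J = q \<and> (\<forall>j\<in>J. b' j \<in> radical)"
proof (induction q)
  case 0
  show ?case using b unit_1[OF P] by (intro exI[of _ b] exI[of _ 1] exI[of _ "{}"]) auto
next
  case (Suc q)
  then obtain b' u J where IH: "\<forall>j<n. b' j \<in> OE" "u \<in> OF - P" "emb_det b' = u * emb_det b"
    "J \<subseteq> {..<n}" "card J = q" "\<forall>j\<in>J. b' j \<in> radical" by auto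
  define m where "m = n - q"
  have fJ: "finite J" using IH(4) finite_subset by blast
  then have "card ({..<n} - J) = m" using IH(4,5) by (simp add: m_def card_Diff_subset)
  then obtain e where e: "bij_betw e {..<m} ({..<n} - J)"
    using ex_bij_betw_nat_finite[of "{..<n} - J"] by (auto simp: atLeast0LessThan)
  then have en: "e i < n" "e i \<notin> J" if "i < m" for i using that by (auto simp: bij_betw_def)
  have "m > r" using Suc.prems by (simp add: m_def)
  have ring: "trace (b' (e i) * z) \<in> OF" if "i < m" "z \<in> OE" for i z
    using that IH(1) en by (intro trace_OF OED(5)) auto
  have "\<not> (\<exists>x. (\<forall>j<m. x j \<in> OE) \<and> det (mat m m (\<lambda>(i, j). trace (b' (e i) * x j))) \<notin> P)"
  proof safe
    fix x assume x: "\<forall>j<m. x j \<in> OE" "det (mat m m (\<lambda>(i, j). trace (b' (e i) * x j))) \<notin> P"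
    have "det (mat m m (\<lambda>(i, j). trace (b' (e i) * x j))) \<in> MM"
      using trace_minor_mem[OF \<open>m > r\<close>, of "\<lambda>i. b' (e i)" x] IH(1) en x(1) by auto
    moreover have "det (mat m m (\<lambda>(i, j). trace (b' (e i) * x j))) \<in> OF"
      using ring x(1) by (intro det_in_subring[OF OF_ring, of _ m]) auto
    ultimately show False using MM(2) x(2) by blast
  qed
  then obtain c where c: "\<forall>i<m. c i \<in> OF" "\<exists>i<m. c i \<notin> P"
    "\<forall>z\<in>OE. (\<Sum>i<m. c i * trace (b' (e i) * z)) \<in> P"
    using minor_or_relation[where \<tau> = "\<lambda>i z. trace (b' (e i) * z)" and m = m and S = OE,
        OF OF_ring P_ideal[OF P] max_idealD(2)[OF P] ring] by blast
  define c' where "c' j = (if j \<in> {..<n} - J then c (inv_into {..<m} e j) else 0)" for j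
  have c'_e: "c' (e i) = c i" if "i < m" for i
    using that en bij_betw_inv_into_left[OF e, of i] by (simp add: c'_def)
  have c'OF: "c' j \<in> OF" if "j < n" for j
    using that c(1) OFD(2) bij_betw_inv_into[OF e] by (auto simp: c'_def bij_betw_def)
  have sum_eq: "(\<Sum>j<n. c' j * f j) = (\<Sum>i<m. c i * f (e i))" for f :: "nat \<Rightarrow> 'a"
  proof -
    have "(\<Sum>j<n. c' j * f j) = (\<Sum>j\<in>{..<n} - J. c' j * f j)"
      by (intro sum.mono_neutral_right) (auto simp: c'_def)
    also have "\<dots> = (\<Sum>i<m. c' (e i) * f (e i))" by (rule sum.reindex_bij_betw[OF e, symmetric])
    finally show ?thesis using c'_e by simp
  qed
  define x where "x = (\<Sum>j<n. c' j * b' j)"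
  have xOE: "x \<in> OE" unfolding x_def
    using c'OF IH(1) OF_OE OED(5) by (intro subring_set_sum[OF subring_ring_of_integers[OF fld_E]]) auto
  have "trace (x * z) \<in> P" if z: "z \<in> OE" for z
  proof -
    have F: "c' j \<in> F" "b' j * z \<in> E" if "j < n" for j
      using c'OF[OF that] OED(5)[of "b' j" z] IH(1) that z by (auto simp: mem_OF mem_OE)
    have "trace (x * z) = (\<Sum>j<n. trace (c' j * (b' j * z)))"
      unfolding x_def sum_distrib_right using F FE fldD(3)[OF fld_E]
      by (subst trace_sum) (auto simp: mult.assoc subset_iff)
    also have "\<dots> = (\<Sum>j<n. c' j * trace (b' j * z))" using F by (simp add: trace_scale)
    also have "\<dots> \<in> P" using sum_eq[of "\<lambda>j. trace (b' j * z)"] c(3) z by simp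
    finally show ?thesis .
  qed
  then have xrad: "x \<in> radical" using xOE by (simp add: radical_def)
  obtain i where i: "i < m" "c i \<notin> P" using c(2) by blast
  let ?b = "b'(e i := x)"
  have "emb_det ?b = c' (e i) * emb_det b'"
    unfolding x_def using IH(1) c'OF en[OF i(1)] by (intro emb_det_replace) (auto simp: mem_OE mem_OF)
  then have "emb_det ?b = (c i * u) * emb_det b" using c'_e[OF i(1)] IH(3) by simp
  moreover have "c i * u \<in> OF - P" using unit_mult[OF P, of "c i" u] c(1) i IH(2) by blast
  moreover have "card (insert (e i) J) = Suc q" using en[OF i(1)] IH(5) fJ by simp
  moreover have "\<forall>j\<in>insert (e i) J. ?b j \<in> radical" using xrad IH(6) by auto
  moreover have "\<forall>j<n. ?b j \<in> OE" using xOE IH(1) by auto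
  moreover have "insert (e i) J \<subseteq> {..<n}" using en[OF i(1)] IH(4) by auto
  ultimately show ?case by blast
qed

text \<open>A basis with \<open>n - r\<close> vectors in the radical has a Gram matrix with
  \<open>n - r\<close> rows in \<open>P\<close>. The unit that relates it to the given basis is
  divided out locally.\<close>

lemma disc_local_power:
  assumes b: "\<And>j. j < n \<Longrightarrow> b j \<in> OE"
  shows "(emb_det b)\<^sup>2 \<in> local_power P \<pi> (n - r)"
proof -
  obtain b' u J where b': "\<forall>j<n. b' j \<in> OE" "u \<in> OF - P" "emb_det b' = u * emb_det b"
    "J \<subseteq> {..<n}" "card J = n - r" "\<forall>j\<in>J. b' j \<in> radical"
    using radical_basis[of b, OF b order_refl] by blast
  have "det (mat n n (\<lambda>(j, k). trace (b' j * b' k))) \<in> local_power P \<pi> (card J)"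
  proof (rule local_power_det[OF P \<pi> b'(4)])
    show "trace (b' j * b' k) \<in> OF" if "j < n" "k < n" for j k
      using that b'(1) by (intro trace_OF OED(5)) auto
    show "trace (b' j * b' k) \<in> P" if "j \<in> J" "k < n" for j k
      using that b'(1,6) by (auto simp: radical_def)
  qed
  then have "(u * u) * (emb_det b)\<^sup>2 \<in> local_power P \<pi> (n - r)"
    using emb_det_square[of b'] b'(1,3,5) by (simp add: mem_OE power2_eq_square mult_ac)
  then show ?thesis
    using local_power_unit[OF P \<pi> unit_mult[OF P b'(2) b'(2)] emb_det_OF[of b, OF b]] by blast
qed

end

end

section \<open>Inertia\<close>

context number_ext
begin

text \<open>If the reductions of the embeddings were pairwise distinct, their independence as
  characters would produce a discriminant outside \<open>MM\<close>, although all discriminants lie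
  in \<open>P\<close>.\<close>

lemma congruent_embeddings:
  assumes P: "max_ideal OF P" "integral_basis_discs F E \<subseteq> P"
    and MM: "max_ideal algebraic_ints MM" "MM \<inter> OF = P"
  obtains i j where "i < n" "j < n" "i \<noteq> j" "\<And>x. x \<in> OE \<Longrightarrow> (s ! i) x - (s ! j) x \<in> MM"
proof -
  have "\<exists>i<n. \<exists>j<n. i \<noteq> j \<and> (\<forall>x\<in>OE. (s ! i) x - (s ! j) x \<in> MM)"
  proof (rule ccontr)
    assume "\<not> (\<exists>i<n. \<exists>j<n. i \<noteq> j \<and> (\<forall>x\<in>OE. (s ! i) x - (s ! j) x \<in> MM))"
    then have distinct: "\<exists>x\<in>OE. (s ! i) x - (s ! j) x \<notin> MM" if "i < n" "j < n" "i \<noteq> j" for i j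
      using that by blast
    have prime: "x \<in> MM \<or> y \<in> MM" if "algebraic_int x" "algebraic_int y" "x * y \<in> MM" for x y
      using max_ideal_prime[OF subring_algebraic_ints MM(1)] that by auto
    have sub: "set s \<subseteq> embs F E" using s by simp
    obtain b where b: "\<And>j. j < n \<Longrightarrow> b j \<in> OE" "det (mat n n (\<lambda>(i, j). (s ! i) (b j))) \<notin> MM"
      by (rule embs_characters[OF fld_F fld_E FE sub length_s max_idealD(1,2)[OF MM(1)] prime distinct]) blast+
    then have d: "emb_det b \<notin> MM" by (simp add: emb_det_def)
    then have "emb_det b \<noteq> 0" using ideal_setD(2)[OF max_idealD(1)[OF MM(1)]] by auto
    then have "(emb_det b)\<^sup>2 \<in> P" using emb_det_disc[of b, OF b(1)] P(2) by blast
    then have "emb_det b * emb_det b \<in> MM" using MM(2) by (auto simp: power2_eq_square)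
    then show False using prime emb_det_int[of b, OF b(1)] d by blast
  qed
  then show thesis using that by blast
qed

text \<open>Two congruent rows make the determinant vanish modulo \<open>MM\<close>. This converse
  of \<open>congruent_embeddings\<close> passes ramification of a hull down to one of the fields
  that generate it.\<close>

lemma disc_mem_of_congruent:
  assumes MM: "max_ideal algebraic_ints MM"
    and ij: "i < n" "j < n" "i \<noteq> j" "\<And>x. x \<in> OE \<Longrightarrow> (s ! i) x - (s ! j) x \<in> MM"
    and b: "\<And>j. j < n \<Longrightarrow> b j \<in> OE"
  shows "(emb_det b)\<^sup>2 \<in> MM"
proof -
  let ?A = "mat n n (\<lambda>(i, j). (s ! i) (b j))"
  let ?B = "mat n n (\<lambda>(k, l). if k = i then (s ! j) (b l) else (s ! k) (b l))"
  note MI = max_idealD(1)[OF MM]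
  have "det ?B = 0"
    by (rule det_identical_rows[of ?B n i j]) (use ij in \<open>auto intro!: eq_vecI\<close>)
  moreover have "det ?A - det ?B \<in> MM"
    by (rule det_cong_mod[OF subring_algebraic_ints MI, of _ n])
       (use ij b s_int ideal_setD(2)[OF MI] in auto)
  ultimately have "emb_det b \<in> MM" by (simp add: emb_det_def)
  then show ?thesis
    using ideal_setD(4)[OF MI, of "emb_det b" "emb_det b"] emb_det_int[of b, OF b] by (simp add: power2_eq_square)
qed

end

section \<open>Products of linear factors and polynomials modulo a maximal ideal\<close>

lemma ring_hom_coeff_prod:
  fixes h :: "'b::comm_ring_1 \<Rightarrow> 'b"
  assumes "\<And>x y. h (x + y) = h x + h y" "\<And>x y. h (x * y) = h x * h y" "h 0 = 0" "h 1 = 1"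
  shows "h (coeff (\<Prod>\<phi>\<in>\<Phi>. [:g \<phi>, 1:]) k) = coeff (\<Prod>\<phi>\<in>\<Phi>. [:h (g \<phi>), 1:]) k"
proof (induction \<Phi> arbitrary: k rule: infinite_finite_induct)
  case (insert \<phi> \<Phi>)
  then show ?case using assms by (auto simp: coeff_pCons split: nat.splits)
qed (use assms in \<open>auto simp: one_pCons coeff_pCons split: nat.splits\<close>)

lemma poly_over_prod_linear:
  fixes g :: "'i \<Rightarrow> 'b::comm_ring_1"
  assumes S: "subring_set S" and "\<And>\<phi>. \<phi> \<in> \<Phi> \<Longrightarrow> g \<phi> \<in> S"
  shows "poly_over S (\<Prod>\<phi>\<in>\<Phi>. [:g \<phi>, 1:])"
  using assms by (intro poly_over_prod[OF S]) (auto simp: subring_setD)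

lemma subring_poly_over:
  fixes S :: "'b::comm_ring_1 set"
  assumes "subring_set S"
  shows "subring_set {p. poly_over S p}"
  using poly_over_add[OF assms] poly_over_mult[OF assms] poly_over_minus[OF assms] subring_setD[OF assms]
    poly_over_0[OF assms]
  by (auto simp: subring_set_def one_pCons)

lemma ideal_poly_over:
  fixes R :: "'b::comm_ring_1 set"
  assumes R: "subring_set R" and I: "ideal_set R I"
  shows "ideal_set {p. poly_over R p} {p. poly_over I p}"
proof -
  have "poly_over I (r * x)" if "poly_over R r" "poly_over I x" for r x
    using that unfolding poly_over_def coeff_mult
    by (intro allI ideal_set_sum[OF I] ideal_setD(4)[OF I]) auto
  then show ?thesis
    using ideal_setD[OF I] poly_over_mono[OF ideal_setD(1)[OF I]]
    unfolding ideal_set_def by (auto simp: poly_over_def)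
qed

text \<open>Gauss's lemma. The product of the first coefficients outside \<open>P\<close> is
  congruent modulo \<open>P\<close> to the coefficient of \<open>p * q\<close> at the sum of their
  positions.\<close>

lemma prime_poly_over:
  fixes R :: "'b::comm_ring_1 set"
  assumes R: "subring_set R" and P: "max_ideal R P"
    and pq: "poly_over R p" "poly_over R q" "poly_over P (p * q)"
  shows "poly_over P p \<or> poly_over P q"
proof (rule ccontr)
  assume "\<not> (poly_over P p \<or> poly_over P q)"
  then have ex: "\<exists>i. coeff p i \<notin> P" "\<exists>i. coeff q i \<notin> P" by (auto simp: poly_over_def)
  define i j where "i = (LEAST i. coeff p i \<notin> P)" and "j = (LEAST j. coeff q j \<notin> P)"
  have i: "coeff p i \<notin> P" "\<And>k. k < i \<Longrightarrow> coeff p k \<in> P"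
    unfolding i_def using LeastI_ex[OF ex(1)] not_less_Least by blast+
  have j: "coeff q j \<notin> P" "\<And>k. k < j \<Longrightarrow> coeff q k \<in> P"
    unfolding j_def using LeastI_ex[OF ex(2)] not_less_Least by blast+
  note PI = max_idealD(1)[OF P]
  have R': "coeff p k \<in> R" "coeff q k \<in> R" for k using pq by (auto simp: poly_over_def)
  have "(\<Sum>k\<in>{..i + j} - {i}. coeff p k * coeff q (i + j - k)) \<in> P"
  proof (rule ideal_set_sum[OF PI])
    fix k assume k: "k \<in> {..i + j} - {i}"
    show "coeff p k * coeff q (i + j - k) \<in> P"
    proof (cases "k < i")
      case True
      then show ?thesis using i(2) R' ideal_setD(5)[OF PI] by blast
    next
      case False
      then have "i + j - k < j" using k by auto
      then show ?thesis using j(2) R' ideal_setD(4)[OF PI] by blast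
    qed
  qed
  moreover have "coeff (p * q) (i + j) \<in> P" using pq(3) by (simp add: poly_over_def)
  moreover have "coeff (p * q) (i + j) = coeff p i * coeff q j + (\<Sum>k\<in>{..i + j} - {i}. coeff p k * coeff q (i + j - k))"
    unfolding coeff_mult by (subst sum.remove[of _ i]) auto
  ultimately have "coeff p i * coeff q j \<in> P"
    using ideal_set_diff[OF R PI] by (metis add_diff_cancel_right')
  then show False using max_ideal_prime[OF R P] R' i(1) j(1) by blast
qed

lemma prime_poly_over_prod:
  fixes R :: "'b::comm_ring_1 set"
  assumes R: "subring_set R" and P: "max_ideal R P" and "finite A"
    and "\<And>i. i \<in> A \<Longrightarrow> poly_over R (f i)" "poly_over P (prod f A)"
  shows "\<exists>i\<in>A. poly_over P (f i)"
  using assms(3-5)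
proof (induction A rule: finite_induct)
  case empty
  then show ?case using max_idealD(2)[OF P] by (auto simp: poly_over_def dest: spec[of _ 0])
next
  case (insert i A)
  then show ?case
    using prime_poly_over[OF R P, of "f i" "prod f A"] poly_over_prod[OF R, of A f] by auto
qed

context algebraic_type
begin

text \<open>
  Two primes above the same prime of the fixed field are conjugate. The conjugating automorphism
  is chosen uniformly by applying the classical norm argument to polynomials with coefficients in
  the ring of integers of \<open>L\<close>.
\<close>

lemma congruent_lift:
  assumes E: "fld E" and L: "fld L" "E \<subseteq> L" "\<And>h. h \<in> Aut E \<Longrightarrow> h ` L \<subseteq> L" and fin: "finite (embs E L)"
    and MM: "max_ideal algebraic_ints MM"
    and \<sigma>: "\<sigma> \<in> Aut K" and \<tau>: "\<tau> \<in> Aut K" and cong: "\<And>x. x \<in> ring_of_integers E \<Longrightarrow> \<sigma> x - \<tau> x \<in> MM"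
  obtains h where "h \<in> Aut E" "\<And>x. x \<in> ring_of_integers L \<Longrightarrow> \<sigma> x - \<tau> (h x) \<in> MM"
proof -
  let ?\<Phi> = "embs E L"
  let ?ZZ = "algebraic_ints :: 'a set"
  note MI = max_idealD(1)[OF MM]
  have "\<exists>\<phi>\<in>?\<Phi>. \<forall>x\<in>ring_of_integers L. \<sigma> x - \<tau> (\<phi> x) \<in> MM"
  proof (rule ccontr)
    assume "\<not> (\<exists>\<phi>\<in>?\<Phi>. \<forall>x\<in>ring_of_integers L. \<sigma> x - \<tau> (\<phi> x) \<in> MM)"
    then have "\<forall>\<phi>\<in>?\<Phi>. \<exists>x. x \<in> ring_of_integers L \<and> \<sigma> x - \<tau> (\<phi> x) \<notin> MM" by blast
    then obtain w where w: "\<And>\<phi>. \<phi> \<in> ?\<Phi> \<Longrightarrow> w \<phi> \<in> ring_of_integers L"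
      "\<And>\<phi>. \<phi> \<in> ?\<Phi> \<Longrightarrow> \<sigma> (w \<phi>) - \<tau> (\<phi> (w \<phi>)) \<notin> MM" by metis
    obtain e where e: "bij_betw e {..<card ?\<Phi>} ?\<Phi>"
      using ex_bij_betw_nat_finite[OF fin] by (auto simp: atLeast0LessThan)
    \<comment> \<open>A single polynomial carries the witnesses against all embeddings; its
      coefficient at \<open>k\<close> is the one for \<open>e k\<close>.\<close>
    define f where "f = (\<Sum>k<card ?\<Phi>. monom (w (e k)) k)"
    have coeff_f: "coeff f k = (if k < card ?\<Phi> then w (e k) else 0)" for k
      by (simp add: f_def coeff_sum)
    have f_OL: "coeff f k \<in> ring_of_integers L" for k
      using e w(1) subring_setD(2)[OF fld_subring[OF L(1)]]
      by (auto simp: coeff_f bij_betw_def ring_of_integers_def)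
    define a where "a \<phi> = map_poly \<phi> f" for \<phi> :: "'a \<Rightarrow> 'a"
    have lift: "\<exists>h\<in>Aut E. \<phi> = restrict h L" if "\<phi> \<in> ?\<Phi>" for \<phi>
      using embs_lift[OF E L(1,2) that] by metis
    have \<phi>0: "\<phi> 0 = 0" if "\<phi> \<in> ?\<Phi>" for \<phi>
      using lift[OF that] subring_setD(2)[OF fld_subring[OF L(1)]] by (auto simp: AutD)
    have a_h: "a (restrict h L) = map_poly h f" if "h \<in> Aut E" for h
      unfolding a_def
      by (intro poly_eqI)
         (use f_OL subring_setD(2)[OF fld_subring[OF L(1)]] AutD(4)[OF that, of 0] in \<open>auto simp: coeff_map_poly ring_of_integers_def\<close>)
    have a_int: "poly_over ?ZZ (a \<phi>)" "poly_over L (a \<phi>)" if \<phi>: "\<phi> \<in> ?\<Phi>" for \<phi>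
    proof -
      obtain h where h: "h \<in> Aut E" "\<phi> = restrict h L" using lift[OF \<phi>] by blast
      show "poly_over ?ZZ (a \<phi>)" "poly_over L (a \<phi>)"
        unfolding h(2) a_h[OF h(1)] poly_over_def
        using f_OL algebraic_int_Aut[OF h(1)] L(3)[OF h(1)] AutD(4)[OF h(1), of 0]
        by (auto simp: coeff_map_poly ring_of_integers_def)
    qed
    \<comment> \<open>The characteristic polynomial of \<open>f\<close> over \<open>E\<close>. The
      coefficients of its coefficients are integers of \<open>E\<close>, on which
      \<open>\<sigma>\<close> and \<open>\<tau>\<close> agree modulo \<open>MM\<close>.\<close>
    define Q where "Q = (\<Prod>\<phi>\<in>?\<Phi>. [:- a \<phi>, 1:])"
    have neg: "- map_poly g p = map_poly g (- p)" if "g \<in> Aut K'" for g K' p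
    proof -
      interpret g: field_hom g using that by (rule Aut_field_hom)
      show ?thesis by (intro poly_eqI) (simp add: coeff_map_poly g.hom_uminus)
    qed
    have map_Q: "map_poly g (coeff Q k) = coeff (\<Prod>\<phi>\<in>?\<Phi>. [:- map_poly g (a \<phi>), 1:]) k" if "g \<in> Aut K'" for g K' k
      unfolding Q_def neg[OF that]
      by (rule ring_hom_coeff_prod)
         (auto simp: map_poly_Aut_add[OF that] map_poly_Aut_mult[OF that] map_poly_Aut_1[OF that])
    have Q_E: "poly_over E (coeff Q k)" for k
    proof (rule poly_over_fixed[OF E])
      fix g assume g: "g \<in> Aut E"
      have "map_poly g (a \<phi>) = a (restrict (g \<circ> \<phi>) L)" if \<phi>: "\<phi> \<in> ?\<Phi>" for \<phi>
      proof -
        obtain h where h: "h \<in> Aut E" "\<phi> = restrict h L" using lift[OF \<phi>] by blast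
        have "restrict (g \<circ> \<phi>) L = restrict (g \<circ> h) L" using h by auto
        then show ?thesis using a_h[OF h(1)] a_h[OF comp_Aut[OF g h(1)]] map_poly_Aut_comp[OF g h(1)] h(2) by simp
      qed
      then have "map_poly g (coeff Q k) = coeff (\<Prod>\<phi>\<in>?\<Phi>. [:- a (restrict (g \<circ> \<phi>) L), 1:]) k"
        by (simp add: map_Q[OF g])
      also have "(\<Prod>\<phi>\<in>?\<Phi>. [:- a (restrict (g \<circ> \<phi>) L), 1:]) = Q"
        unfolding Q_def by (rule prod.reindex_bij_betw[OF embs_comp[OF E L(1,2) g]])
      finally show "map_poly g (coeff Q k) = coeff Q k" .
    qed
    have "poly_over {p. poly_over ?ZZ p} Q"
      unfolding Q_def using a_int(1) poly_over_minus[OF subring_algebraic_ints]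
      by (intro poly_over_prod_linear subring_poly_over subring_algebraic_ints) auto
    then have Q_OE: "coeff (coeff Q k) l \<in> ring_of_integers E" for k l
      using Q_E[of k] by (auto simp: poly_over_def ring_of_integers_def)
    define Qs Qt where "Qs = (\<Prod>\<phi>\<in>?\<Phi>. [:- map_poly \<sigma> (a \<phi>), 1:])" and "Qt = (\<Prod>\<phi>\<in>?\<Phi>. [:- map_poly \<tau> (a \<phi>), 1:])"
    have diff: "poly_over MM (coeff (Qs - Qt) k)" for k
    proof -
      have "coeff (Qs - Qt) k = map_poly \<sigma> (coeff Q k) - map_poly \<tau> (coeff Q k)"
        by (simp add: Qs_def Qt_def map_Q[OF \<sigma>] map_Q[OF \<tau>])
      then show ?thesis
        using cong[OF Q_OE] AutD(4)[OF \<sigma>, of 0] AutD(4)[OF \<tau>, of 0]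
        by (auto simp: poly_over_def coeff_map_poly)
    qed
    have map_int: "poly_over ?ZZ (map_poly g p)" if "g \<in> Aut K'" "poly_over ?ZZ p" for g K' p
      using that algebraic_int_Aut[OF that(1)] AutD(4)[OF that(1), of 0]
      by (auto simp: poly_over_def coeff_map_poly)
    let ?y = "map_poly \<sigma> f"
    have y_int: "poly_over ?ZZ ?y" using map_int[OF \<sigma>] f_OL by (auto simp: poly_over_def ring_of_integers_def)
    have idL: "restrict id L \<in> ?\<Phi>" using id_Aut(1) by (auto simp: embs_eq[OF E L(1,2)])
    have "a (restrict id L) = f" using a_h[OF id_Aut(1)] by simp
    have "poly Qs ?y = (\<Prod>\<phi>\<in>?\<Phi>. ?y - map_poly \<sigma> (a \<phi>))" by (simp add: Qs_def poly_prod)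
    also have "\<dots> = 0" using fin idL \<open>a (restrict id L) = f\<close> by (auto intro!: prod_zero bexI[OF _ idL])
    finally have Qs0: "poly Qs ?y = 0" .
    \<comment> \<open>At the root \<open>?y\<close> of \<open>Qs\<close> the congruent polynomial
      \<open>Qt\<close> has a value with coefficients in \<open>MM\<close>. That value is a product
      over the embeddings, so Gauss's lemma singles out one of them.\<close>
    have "poly (Qs - Qt) ?y = - (\<Prod>\<phi>\<in>?\<Phi>. ?y - map_poly \<tau> (a \<phi>))"
      by (simp add: Qs0 Qt_def poly_prod)
    moreover have "poly_over MM (poly (Qs - Qt) ?y)"
    proof -
      note I = ideal_poly_over[OF subring_algebraic_ints MI]
      have "poly (Qs - Qt) ?y \<in> {p. poly_over MM p}"
        unfolding poly_altdef
        using diff subring_setD(7)[OF subring_poly_over[OF subring_algebraic_ints], of ?y] y_int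
        by (intro ideal_set_sum[OF I] ideal_setD(5)[OF I]) auto
      then show ?thesis by simp
    qed
    ultimately have "poly_over MM (\<Prod>\<phi>\<in>?\<Phi>. ?y - map_poly \<tau> (a \<phi>))"
      using ideal_set_minus[OF subring_algebraic_ints MI] by (metis add.inverse_inverse coeff_minus poly_over_def)
    moreover have "poly_over ?ZZ (?y - map_poly \<tau> (a \<phi>))" if "\<phi> \<in> ?\<Phi>" for \<phi>
      using y_int map_int[OF \<tau> a_int(1)[OF that]] by (auto simp: poly_over_def intro: algebraic_int_diff)
    ultimately obtain \<phi> where \<phi>: "\<phi> \<in> ?\<Phi>" "poly_over MM (?y - map_poly \<tau> (a \<phi>))"
      using prime_poly_over_prod[OF subring_algebraic_ints MM fin] by metis
    obtain k where k: "k < card ?\<Phi>" "e k = \<phi>" using e \<phi>(1) by (metis bij_betw_imp_surj_on imageE lessThan_iff)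
    have "coeff (?y - map_poly \<tau> (a \<phi>)) k = \<sigma> (w \<phi>) - \<tau> (\<phi> (w \<phi>))"
      using k AutD(4)[OF \<sigma>, of 0] AutD(4)[OF \<tau>, of 0] \<phi>0[OF \<phi>(1)]
      by (simp add: coeff_map_poly a_def coeff_f)
    then show False using \<phi>(2) w(2)[OF \<phi>(1)] by (simp add: poly_over_def) metis
  qed
  then obtain \<phi> where \<phi>: "\<phi> \<in> ?\<Phi>" "\<forall>x\<in>ring_of_integers L. \<sigma> x - \<tau> (\<phi> x) \<in> MM" by blast
  obtain h where "h \<in> Aut E" "\<phi> = restrict h L" using embs_lift[OF E L(1,2) \<phi>(1)] .
  then show thesis using that \<phi>(2) by (auto simp: ring_of_integers_def)
qed

end

section \<open>The codifferent of a normal extension\<close>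

lemma coeff_prod_linear_ideal:
  fixes g :: "'i \<Rightarrow> 'b::comm_ring_1"
  assumes R: "subring_set R" and I: "ideal_set R I" and "finite A" and "\<And>i. i \<in> A \<Longrightarrow> g i \<in> I" and "k < card A"
  shows "coeff (\<Prod>i\<in>A. [:g i, 1:]) k \<in> I"
  using assms(3-5)
proof (induction A arbitrary: k rule: finite_induct)
  case (insert i A)
  have "poly_over R (\<Prod>i\<in>A. [:g i, 1:])"
    using insert.prems(1) ideal_setD(1)[OF I] by (intro poly_over_prod_linear[OF R]) auto
  then have "g i * coeff (\<Prod>i\<in>A. [:g i, 1:]) k \<in> I"
    using insert.prems(1)[of i] ideal_setD(5)[OF I] by (simp add: poly_over_def)
  moreover have "(case k of 0 \<Rightarrow> 0 | Suc j \<Rightarrow> coeff (\<Prod>i\<in>A. [:g i, 1:]) j) \<in> I"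
    using insert ideal_setD(2)[OF I] by (auto split: nat.splits)
  ultimately show ?case
    using insert.hyps ideal_setD(3)[OF I] by (simp add: coeff_pCons split: nat.splits)
qed simp

lemma degree_prod_linear:
  fixes g :: "'i \<Rightarrow> 'b::idom"
  assumes "finite A"
  shows "degree (\<Prod>i\<in>A. [:g i, 1:]) = card A" "coeff (\<Prod>i\<in>A. [:g i, 1:]) (card A) = 1"
proof -
  show d: "degree (\<Prod>i\<in>A. [:g i, 1:]) = card A"
    by (subst degree_prod_sum_eq) auto
  have "lead_coeff (\<Prod>i\<in>A. [:g i, 1:]) = 1" by (simp add: lead_coeff_prod)
  then show "coeff (\<Prod>i\<in>A. [:g i, 1:]) (card A) = 1" using d by simp
qed

locale normal_ext = number_ext +
  assumes normal: "\<And>\<sigma>. \<sigma> \<in> Aut F \<Longrightarrow> \<sigma> ` E \<subseteq> E"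
begin

lemma Aut_OE: "\<sigma> \<in> Aut F \<Longrightarrow> x \<in> OE \<Longrightarrow> \<sigma> x \<in> OE"
  using normal algebraic_int_Aut by (auto simp: mem_OE)

text \<open>Normality lets \<open>\<sigma>\<close> act from the right: precomposition with it
  permutes the embeddings of \<open>E\<close>.\<close>

lemma trace_Aut:
  assumes \<sigma>: "\<sigma> \<in> Aut F" and x: "x \<in> E"
  shows "trace (\<sigma> x) = trace x"
proof -
  have \<sigma>E: "\<sigma> z \<in> E" "inv_into UNIV \<sigma> z \<in> E" if "z \<in> E" for z
    using normal[OF \<sigma>] normal[OF inv_Aut[OF \<sigma>]] that by auto
  have maps: "restrict (\<tau> \<circ> \<rho>) E \<in> embs F E" if \<rho>: "\<rho> \<in> Aut F" and \<tau>: "\<tau> \<in> embs F E" for \<rho> \<tau>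
  proof -
    obtain \<omega> where \<omega>: "\<omega> \<in> Aut F" "\<tau> = restrict \<omega> E" using embs_lift[OF fld_F fld_E FE \<tau>] .
    have "restrict (\<tau> \<circ> \<rho>) E = restrict (\<omega> \<circ> \<rho>) E"
      using normal[OF \<rho>] by (auto simp: \<omega>(2) fun_eq_iff)
    then show ?thesis using comp_Aut[OF \<omega>(1) \<rho>] by (auto simp: embs_eq[OF fld_F fld_E FE])
  qed
  have "restrict (restrict (\<tau> \<circ> \<sigma>) E \<circ> inv_into UNIV \<sigma>) E = \<tau>"
    "restrict (restrict (\<tau> \<circ> inv_into UNIV \<sigma>) E \<circ> \<sigma>) E = \<tau>" if "\<tau> \<in> embs F E" for \<tau>
    using that \<sigma>E Aut_inv_simps[OF \<sigma>]
    by (auto simp: embeddings_def extensional_def fun_eq_iff)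
  then have "bij_betw (\<lambda>\<tau>. restrict (\<tau> \<circ> \<sigma>) E) (embs F E) (embs F E)"
    using maps \<sigma> inv_Aut[OF \<sigma>]
    by (intro bij_betw_byWitness[of _ "\<lambda>\<tau>. restrict (\<tau> \<circ> inv_into UNIV \<sigma>) E"]) auto
  then have "(\<Sum>\<tau>\<in>embs F E. restrict (\<tau> \<circ> \<sigma>) E x) = (\<Sum>\<tau>\<in>embs F E. \<tau> x)"
    by (rule sum.reindex_bij_betw[of _ _ _ "\<lambda>\<tau>. \<tau> x"])
  moreover have reindex: "(\<Sum>i<n. f (s ! i)) = (\<Sum>\<tau>\<in>embs F E. f \<tau>)" for f :: "('a \<Rightarrow> 'a) \<Rightarrow> 'a"
    using sum.reindex_bij_betw[OF bij_betw_nth[OF s(1) refl s(2)[symmetric]], of f] by (simp add: length_s)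
  ultimately show ?thesis
    using x reindex[of "\<lambda>\<tau>. \<tau> (\<sigma> x)"] reindex[of "\<lambda>\<tau>. \<tau> x"] by (simp add: trace_def)
qed

text \<open>
  Write \<open>1 = h\<^sub>0 + x\<close> with \<open>x = \<Sum> c\<^sub>i h\<^sub>i\<close>, where the \<open>c\<^sub>i\<close> are the conjugates of \<open>\<delta> n x\<^sub>0\<close> and
  all products \<open>c\<^sub>i h\<^sub>j\<close> are integral. The trace condition puts the lower coefficients of
  \<open>\<Prod>(T - \<sigma> x)\<close> into \<open>P\<close>, so that its value \<open>\<Prod> \<sigma> h\<^sub>0\<close> at \<open>T = 1\<close> is a unit modulo \<open>P\<close>; this value
  also clears the denominator of \<open>\<delta> n x\<^sub>0\<close>.
\<close>

lemma codifferent_bound: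
  assumes P: "max_ideal OF P" and \<delta>: "\<delta> \<in> P" "\<delta> \<noteq> 0"
    and x0: "x0 \<in> E" and tr: "\<And>z. z \<in> OE \<Longrightarrow> trace (x0 * z) \<in> local_ring P"
  obtains u where "u \<in> OF - P" "algebraic_int (u * (\<delta> * of_nat n * x0))"
proof -
  note PI = P_ideal[OF P]
  \<comment> \<open>The factor \<open>of_nat n\<close> makes up for the trace being multiplication
    by \<open>n\<close> on \<open>F\<close>; the factor \<open>\<delta>\<close> turns local
    integrality into membership in \<open>P\<close>.\<close>
  define c where "c i = \<delta> * of_nat n * (s ! i) x0" for i
  have \<delta>F: "\<delta> * of_nat n \<in> F" "\<delta> * of_nat n \<noteq> 0" "\<delta> \<in> F"
    using \<delta> PD(1)[OF P] n_pos fldD(1,3)[OF fld_F] by (auto simp: mem_OF subset_iff)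
  have sE: "(s ! i) z \<in> E" if "i < n" "z \<in> E" for i z
  proof -
    obtain \<sigma> where "\<sigma> \<in> Aut F" "s ! i = restrict \<sigma> E" using s_lift[OF \<open>i < n\<close>] .
    then show ?thesis using normal \<open>z \<in> E\<close> by auto
  qed
  have cE: "c i \<in> E" if "i < n" for i
    using that sE x0 \<delta>F(1) FE fldD(3)[OF fld_E] by (auto simp: c_def subset_iff)
  \<comment> \<open>The constant coefficient \<open>1\<close> makes every \<open>h j\<close>
    integral and contributes the summand \<open>h 0\<close>.\<close>
  define f where "f = pCons 1 (\<Sum>i<n. monom (c i) i)"
  have coeff_f: "coeff f 0 = 1" "coeff f (Suc i) = (if i < n then c i else 0)" for i
    by (auto simp: f_def coeff_sum)
  have "poly_over E f"
    using cE subring_setD[OF fld_subring[OF fld_E]] by (auto simp: poly_over_def coeff_f f_def coeff_sum coeff_pCons split: nat.splits)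
  moreover have "f \<noteq> 0" by (simp add: f_def)
  ultimately obtain h where h: "\<And>i. h i \<in> E" "\<And>i j. algebraic_int (coeff f i * h j)"
    "(\<Sum>i\<le>degree f. coeff f i * h i) = 1"
    using content_invertible[OF fld_E] by metis
  have "degree f \<le> n" using coeff_f by (intro degree_le) (auto simp: gr0_conv_Suc elim!: less_natE)
  then have "(\<Sum>i\<le>n. coeff f i * h i) = 1"
    unfolding h(3)[symmetric] by (intro sum.mono_neutral_right) (auto simp: coeff_eq_0)
  then have one: "h 0 + (\<Sum>i<n. c i * h (Suc i)) = 1"
    by (simp add: sum.atMost_shift coeff_f)
  have hO: "h j \<in> OE" for j using h(1)[of j] h(2)[of 0 j] by (simp add: mem_OE coeff_f)
  have ch: "c i * h j \<in> OE" if "i < n" for i j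
    using cE[OF that] h(1)[of j] h(2)[of "Suc i" j] fldD(3)[OF fld_E] that by (simp add: mem_OE coeff_f)
  \<comment> \<open>The integral part of the fractional ideal generated by the \<open>c i\<close>.
    Automorphisms over \<open>F\<close> permute these generators, so all conjugates of
    \<open>x\<close> lie in \<open>I\<close>.\<close>
  define I where "I = {y \<in> OE. \<exists>z. (\<forall>i<n. z i \<in> OE) \<and> y = (\<Sum>i<n. c i * z i)}"
  have I_I: "y \<in> I" if "y \<in> OE" "\<And>i. i < n \<Longrightarrow> z i \<in> OE" "y = (\<Sum>i<n. c i * z i)" for y z
    using that unfolding I_def by blast
  have I: "ideal_set OE I"
    unfolding ideal_set_def
  proof (intro conjI ballI)
    show "I \<subseteq> OE" by (auto simp: I_def)
    show "0 \<in> I" unfolding I_def using OED(2) by (auto intro!: exI[of _ "\<lambda>_. 0"])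
    fix y assume "y \<in> I"
    then obtain z where z: "y \<in> OE" "\<forall>i<n. z i \<in> OE" "y = (\<Sum>i<n. c i * z i)" by (auto simp: I_def)
    show "r * y \<in> I" if "r \<in> OE" for r
    proof -
      have "r * y = (\<Sum>i<n. c i * (r * z i))" by (simp add: z(3) sum_distrib_left mult_ac)
      then show ?thesis using OED(5)[OF that z(1)] OED(5)[OF that] z(2) by (intro I_I[of _ "\<lambda>i. r * z i"]) auto
    qed
    fix y' assume "y' \<in> I"
    then obtain z' where z': "y' \<in> OE" "\<forall>i<n. z' i \<in> OE" "y' = (\<Sum>i<n. c i * z' i)" by (auto simp: I_def)
    have "y + y' = (\<Sum>i<n. c i * (z i + z' i))" by (simp add: z z' sum.distrib distrib_left)
    then show "y + y' \<in> I" using OED(4)[OF z(1) z'(1)] OED(4) z(2) z'(2) by (intro I_I[of _ "\<lambda>i. z i + z' i"]) auto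
  qed
  define x where "x = (\<Sum>i<n. c i * h (Suc i))"
  have x: "x \<in> OE" unfolding x_def
    using ch by (intro subring_set_sum[OF subring_ring_of_integers[OF fld_E]]) auto
  have xI: "x \<in> I" using x hO by (intro I_I[of x "\<lambda>i. h (Suc i)"]) (auto simp: x_def)
  have I_Aut: "g y \<in> I" if g: "g \<in> Aut F" and y: "y \<in> I" for g y
  proof -
    obtain z where z: "y \<in> OE" "\<forall>i<n. z i \<in> OE" "y = (\<Sum>i<n. c i * z i)" using y by (auto simp: I_def)
    interpret g: field_hom g using g by (rule Aut_field_hom)
    obtain \<pi> where p: "bij_betw \<pi> {..<n} {..<n}" "\<And>i x. i < n \<Longrightarrow> x \<in> E \<Longrightarrow> g ((s ! i) x) = (s ! \<pi> i) x"
      using embs_list_permuted[OF fld_F fld_E FE g s] length_s by metis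
    define \<rho> where "\<rho> = inv_into {..<n} \<pi>"
    have "g y = (\<Sum>i<n. c (\<pi> i) * g (z i))"
      unfolding z(3) using p(2) x0 AutD(3)[OF g \<delta>F(1)]
      by (simp add: g.hom_sum g.hom_mult c_def)
    also have "\<dots> = (\<Sum>i<n. c (\<pi> i) * g (z (\<rho> (\<pi> i))))"
      using p(1) by (intro sum.cong) (auto simp: \<rho>_def bij_betw_def)
    also have "\<dots> = (\<Sum>i<n. c i * g (z (\<rho> i)))" by (rule sum.reindex_bij_betw[OF p(1)])
    finally have "g y = (\<Sum>i<n. c i * g (z (\<rho> i)))" .
    moreover have "g (z (\<rho> i)) \<in> OE" if "i < n" for i
      using that z(2) Aut_OE[OF g] bij_betw_inv_into[OF p(1)] by (auto simp: \<rho>_def bij_betw_def)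
    ultimately show ?thesis using Aut_OE[OF g z(1)] by (intro I_I[of _ "\<lambda>i. g (z (\<rho> i))"]) auto
  qed
  have sI: "(s ! i) x \<in> I" if i: "i < n" for i
  proof -
    obtain \<sigma> where "\<sigma> \<in> Aut F" "s ! i = restrict \<sigma> E" using s_lift[OF i] .
    then show ?thesis using I_Aut[of \<sigma> x] xI x by (simp add: mem_OE)
  qed
  define \<mu> where "\<mu> = (\<Prod>i<n. [:- (s ! i) x, 1:])"
  have \<mu>F: "coeff \<mu> k \<in> F" for k
  proof (rule fixed_field_Aut[OF fld_F])
    fix g assume g: "g \<in> Aut F"
    interpret g: field_hom g using g by (rule Aut_field_hom)
    obtain \<pi> where p: "bij_betw \<pi> {..<n} {..<n}" "\<And>i x. i < n \<Longrightarrow> x \<in> E \<Longrightarrow> g ((s ! i) x) = (s ! \<pi> i) x"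
      using embs_list_permuted[OF fld_F fld_E FE g s] length_s by metis
    have "g (coeff \<mu> k) = coeff (\<Prod>i<n. [:g (- (s ! i) x), 1:]) k"
      unfolding \<mu>_def by (rule ring_hom_coeff_prod) (auto simp: g.hom_add g.hom_mult)
    also have "(\<Prod>i<n. [:g (- (s ! i) x), 1:]) = (\<Prod>i<n. [:- (s ! \<pi> i) x, 1:])"
      using p(2) x by (intro prod.cong) (auto simp: g.hom_uminus mem_OE)
    also have "\<dots> = \<mu>" unfolding \<mu>_def by (rule prod.reindex_bij_betw[OF p(1)])
    finally show "g (coeff \<mu> k) = coeff \<mu> k" .
  qed
  have \<mu>P: "coeff \<mu> k \<in> P" if k: "k < n" for k
  proof -
    define a where "a = coeff \<mu> k"
    have "a \<in> I" unfolding a_def \<mu>_def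
      using k sI ideal_set_minus[OF subring_ring_of_integers[OF fld_E] I]
      by (intro coeff_prod_linear_ideal[OF subring_ring_of_integers[OF fld_E] I]) auto
    then obtain z where z: "a \<in> OE" "\<forall>i<n. z i \<in> OE" "a = (\<Sum>i<n. c i * z i)" by (auto simp: I_def)
    have aF: "a \<in> F" "a \<in> OF" using \<mu>F[of k] z(1) by (auto simp: a_def mem_OE mem_OF)
    \<comment> \<open>Since \<open>a\<close> lies in \<open>F\<close>, so does \<open>y\<close>, and
      its trace is \<open>a / \<delta>\<close>. The trace condition, carried over to the conjugates
      of \<open>x0\<close>, makes this trace local, and that forces \<open>a\<close> into
      \<open>P\<close>.\<close>
    define y where "y = (\<Sum>i<n. (s ! i) x0 * z i)"
    have ay: "a = \<delta> * of_nat n * y" by (simp add: z(3) y_def c_def sum_distrib_left mult.assoc)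
    then have y: "y = a / (\<delta> * of_nat n)" using \<delta>F by simp
    then have "y \<in> F" using aF \<delta>F fld_divide[OF fld_F] by simp
    then have "trace y = of_nat n * y" by (simp add: trace_def s_fix)
    then have "trace y = a / \<delta>" using y n_pos by simp
    have tr_i: "trace ((s ! i) x0 * z i) \<in> local_ring P" if i: "i < n" for i
    proof -
      obtain \<sigma> where \<sigma>: "\<sigma> \<in> Aut F" "s ! i = restrict \<sigma> E" using s_lift[OF i] .
      let ?w = "inv_into UNIV \<sigma> (z i)"
      have w: "?w \<in> OE" using Aut_OE[OF inv_Aut[OF \<sigma>(1)]] z(2) i by blast
      have "(s ! i) x0 * z i = \<sigma> (x0 * ?w)" using \<sigma> x0 AutD(2)[OF \<sigma>(1)] Aut_inv_simps[OF \<sigma>(1)] by simp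
      then have "trace ((s ! i) x0 * z i) = trace (x0 * ?w)"
        using trace_Aut[OF \<sigma>(1), of "x0 * ?w"] w x0 fldD(3)[OF fld_E] by (simp add: mem_OE)
      then show ?thesis using tr[OF w] by simp
    qed
    have "trace y = (\<Sum>i<n. trace ((s ! i) x0 * z i))"
      unfolding y_def using sE x0 z(2) fldD(3)[OF fld_E] by (intro trace_sum) (auto simp: mem_OE)
    also have "\<dots> \<in> local_ring P" using tr_i by (intro subring_set_sum[OF local_ring_subring[OF P]]) auto
    finally have "a / \<delta> \<in> local_ring P" using \<open>trace y = a / \<delta>\<close> by simp
    then obtain u where u: "u \<in> OF - P" "u * (a / \<delta>) \<in> OF" by (auto simp: local_ring_def)
    have "u * a = u * (a / \<delta>) * \<delta>" using \<delta>(2) by simp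
    also have "\<dots> \<in> P" using u \<delta>(1) by (intro PD(4)[OF P]) auto
    finally show ?thesis using max_ideal_prime[OF OF_ring P, of u a] u aF a_def by blast
  qed
  define q where "q = poly \<mu> 1"
  have deg: "degree \<mu> = n" "coeff \<mu> n = 1"
    unfolding \<mu>_def using degree_prod_linear[of "{..<n}" "\<lambda>i. - (s ! i) x"] by auto
  have "q = (\<Sum>k<n. coeff \<mu> k) + 1"
    using deg by (simp add: q_def poly_altdef lessThan_Suc_atMost[symmetric])
  moreover have sumP: "(\<Sum>k<n. coeff \<mu> k) \<in> P" using \<mu>P by (intro ideal_set_sum[OF PI]) auto
  ultimately have qOF: "q \<in> OF" using PD(1)[OF P] OFD(1,4) by auto
  have "q \<notin> P"
  proof
    assume "q \<in> P"
    then have "q - (\<Sum>k<n. coeff \<mu> k) \<in> P" using sumP by (rule ideal_set_diff[OF OF_ring PI])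
    then show False using \<open>q = (\<Sum>k<n. coeff \<mu> k) + 1\<close> max_idealD(2)[OF P] by simp
  qed
  have sh: "1 - (s ! i) x = (s ! i) (h 0)" if i: "i < n" for i
  proof -
    have "(s ! i) (h 0 + x) = 1" using one fldD(1)[OF fld_F] s_fix[OF i, of 1] by (auto simp: x_def)
    then show ?thesis using s_add[OF i, of "h 0" x] h(1) x by (simp add: mem_OE algebra_simps)
  qed
  have "restrict id E \<in> embs F E" using id_Aut(1) by (auto simp: embs_eq[OF fld_F fld_E FE])
  then obtain i1 where i1: "i1 < n" "s ! i1 = restrict id E"
    using s(2) length_s by (metis in_set_conv_nth)
  have "q = (\<Prod>i<n. (s ! i) (h 0))" using sh by (simp add: q_def \<mu>_def poly_prod)
  also have "\<dots> = h 0 * (\<Prod>i\<in>{..<n} - {i1}. (s ! i) (h 0))"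
    using i1 h(1) by (subst prod.remove[of _ i1]) auto
  finally have "q * (\<delta> * of_nat n * x0) = (c i1 * h 0) * (\<Prod>i\<in>{..<n} - {i1}. (s ! i) (h 0))"
    using i1(2) x0 by (simp add: c_def mult_ac)
  moreover have "algebraic_int \<dots>"
    using ch[OF i1(1), of 0] hO s_int by (auto simp: mem_OE[of "c i1 * h 0"] intro!: algebraic_int_mult algebraic_int_prod)
  ultimately show thesis using that[of q] qOF \<open>q \<notin> P\<close> by simp
qed

text \<open>Take a basis whose discriminant has least valuation at \<open>P\<close>. Exchanging its
  \<open>j\<close>-th vector for \<open>z\<close> multiplies the discriminant by the square of the
  coordinate \<open>a j\<close>, so that square is local, and then so is \<open>a j\<close>.\<close>

lemma local_integral_basis:
  assumes P: "max_ideal OF P"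
  obtains b where "\<And>j. j < n \<Longrightarrow> b j \<in> OE" "emb_det b \<noteq> 0"
    "\<And>z. z \<in> OE \<Longrightarrow> \<exists>a. (\<forall>j<n. a j \<in> local_ring P) \<and> z = (\<Sum>j<n. a j * b j)"
proof -
  define S where "S = {(emb_det b)\<^sup>2 |b. (\<forall>j<n. b j \<in> OE) \<and> emb_det b \<noteq> 0}"
  have "S \<subseteq> OF - {0}" unfolding S_def using emb_det_OF by auto
  moreover have "S \<noteq> {}"
  proof -
    obtain b where "\<And>j. j < n \<Longrightarrow> b j \<in> OE" "emb_det b \<noteq> 0" using integral_basis by blast
    then have "(emb_det b)\<^sup>2 \<in> S" unfolding S_def by blast
    then show ?thesis by blast
  qed
  ultimately obtain d where d: "d \<in> S" "\<And>t. t \<in> S \<Longrightarrow> t / d \<in> local_ring P"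
    using local_minimum[OF P, of S] by blast
  then obtain b where b: "\<forall>j<n. b j \<in> OE" "emb_det b \<noteq> 0" "d = (emb_det b)\<^sup>2" unfolding S_def by blast
  have bE: "b j \<in> E" if "j < n" for j using b(1) that by (auto simp: mem_OE)
  have "\<exists>a. (\<forall>j<n. a j \<in> local_ring P) \<and> z = (\<Sum>j<n. a j * b j)" if z: "z \<in> OE" for z
  proof -
    obtain a where a: "\<And>j. j < n \<Longrightarrow> a j \<in> F" "z = (\<Sum>j<n. a j * b j)"
      using coordinates[OF fld_F fld_E FE s length_s, of b z] bE b(2) z unfolding emb_det_def mem_OE by blast
    have "a j \<in> local_ring P" if j: "j < n" for j
    proof (cases "a j = 0")
      case True
      then show ?thesis using subring_setD(2)[OF local_ring_subring[OF P]] by simp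
    next
      case False
      have e: "emb_det (b(j := z)) = a j * emb_det b"
        unfolding a(2) by (rule emb_det_replace[OF bE a(1) j])
      have "(emb_det (b(j := z)))\<^sup>2 \<in> S"
        unfolding S_def using b(1,2) z False e by (auto intro!: exI[of _ "b(j := z)"])
      then have "(emb_det (b(j := z)))\<^sup>2 / d \<in> local_ring P" using d(2) by blast
      then have "(a j)\<^sup>2 \<in> local_ring P" using e b(2,3) by (simp add: power_mult_distrib)
      then show ?thesis using local_ring_square[OF P a(1)[OF j]] by blast
    qed
    then show ?thesis using a(2) by blast
  qed
  then show thesis using that b(1,2) by blast
qed

text \<open>Locally at \<open>P\<close>, the dual basis times \<open>\<delta> * n\<close> and a unit
  is integral. After clearing denominators its coordinates form an integral matrix \<open>A\<close>
  for which \<open>A * T\<close> is scalar, and comparing determinants puts a unit at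
  \<open>P\<close> times \<open>(\<delta> * n) ^ n\<close> into the discriminant ideal.\<close>

lemma disc_ideal_contains:
  assumes \<delta>: "\<delta> > 0" and ram: "\<And>P. max_ideal OF P \<Longrightarrow> disc_ideal F E \<subseteq> P \<Longrightarrow> of_nat \<delta> \<in> P"
  shows "of_nat ((\<delta> * n) ^ n) \<in> disc_ideal F E"
proof (rule ccontr)
  assume no: "of_nat ((\<delta> * n) ^ n) \<notin> disc_ideal F E"
  let ?D = "disc_ideal F E" and ?\<delta>n = "of_nat \<delta> * of_nat n :: 'a"
  note DI = disc_ideal_ideal[OF discs_OF[OF E]]
  have pow: "of_nat ((\<delta> * n) ^ n) = ?\<delta>n ^ n" by simp
  \<comment> \<open>The multipliers that carry the claimed element into the ideal. If they form a
    proper ideal, it lies in some \<open>P\<close>, and an element of \<open>J\<close> outside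
    \<open>P\<close> is the contradiction aimed at.\<close>
  define J where "J = {a \<in> OF. a * ?\<delta>n ^ n \<in> ?D}"
  have JI: "ideal_set OF J"
    unfolding ideal_set_def J_def using ideal_setD[OF DI] OFD
    by (auto simp: distrib_right mult.assoc)
  have "1 \<notin> J" using no unfolding pow J_def by simp
  then obtain P where P: "max_ideal OF P" "J \<subseteq> P" using ex_max_ideal[OF OF_ring JI] by blast
  have "?D \<subseteq> J"
    using ideal_setD(1)[OF DI] ideal_setD(5)[OF DI, of "?\<delta>n ^ n"] OFD(7)[of ?\<delta>n n] OFD(5)[of "of_nat \<delta>" "of_nat n"]
    by (auto simp: J_def)
  then have \<delta>P: "of_nat \<delta> \<in> P" using ram P by blast
  obtain b where b: "\<And>j. j < n \<Longrightarrow> b j \<in> OE" "emb_det b \<noteq> 0"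
    "\<And>z. z \<in> OE \<Longrightarrow> \<exists>a. (\<forall>j<n. a j \<in> local_ring P) \<and> z = (\<Sum>j<n. a j * b j)"
    using local_integral_basis[OF P(1)] by blast
  have bE: "b j \<in> E" if "j < n" for j using b(1) that by (auto simp: mem_OE)
  define T where "T = mat n n (\<lambda>(j, k). trace (b j * b k))"
  define d where "d = det T"
  have T: "T \<in> carrier_mat n n" by (simp add: T_def)
  have d: "d = (emb_det b)\<^sup>2" "d \<noteq> 0" using emb_det_square[of b] bE b(2) by (auto simp: d_def T_def)
  have dD: "d \<in> ?D" "d \<in> OF"
    using emb_det_disc[of b] emb_det_OF[of b] b(1,2) discs_subset_disc_ideal[OF discs_OF[OF E]] d(1) by auto
  have T_F: "trace (b j * b k) \<in> OF" if "j < n" "k < n" for j k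
    using that b(1) by (intro trace_OF OED(5)) auto
  define t where "t j k = adj_mat T $$ (j, k)" for j k
  note adj = adj_mat[OF T]
  have t_OF: "t j k \<in> OF" if "j < n" "k < n" for j k
  proof -
    have "mat_delete T k j \<in> carrier_mat (n - 1) (n - 1)" using T by (rule mat_delete_carrier)
    moreover have "mat_delete T k j $$ (i, l) \<in> OF" if "i < n - 1" "l < n - 1" for i l
      using that T_F by (auto simp: mat_delete_def T_def)
    ultimately have "det (mat_delete T k j) \<in> OF" by (intro det_in_subring[OF OF_ring])
    then show ?thesis
      using that T OFD(1,3,5,7) by (auto simp: t_def adj_mat_def cofactor_def)
  qed
  \<comment> \<open>The adjugate of the trace matrix gives \<open>d\<close> times the dual
    basis.\<close>
  define e where "e j = (\<Sum>k<n. t j k * b k)" for j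
  have eE: "e j \<in> E" if "j < n" for j
    unfolding e_def using that t_OF bE FE fldD(3)[OF fld_E]
    by (intro subring_set_sum[OF fld_subring[OF fld_E]]) (auto simp: mem_OF subset_iff)
  have tr_e: "trace (e j * b l) = (if j = l then d else 0)" if jl: "j < n" "l < n" for j l
  proof -
    have F: "t j k \<in> F" "b k * b l \<in> E" if "k < n" for k
      using t_OF[OF jl(1) that] bE jl that fldD(3)[OF fld_E] by (auto simp: mem_OF)
    have "trace (e j * b l) = (\<Sum>k<n. trace (t j k * (b k * b l)))"
      unfolding e_def sum_distrib_right using F FE fldD(3)[OF fld_E]
      by (subst trace_sum) (auto simp: mult.assoc subset_iff)
    also have "\<dots> = (\<Sum>k<n. t j k * trace (b k * b l))" using F by (simp add: trace_scale)
    also have "\<dots> = (adj_mat T * T) $$ (j, l)"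
      using jl adj(1) T by (simp add: scalar_prod_def t_def T_def atLeast0LessThan)
    also have "\<dots> = (if j = l then d else 0)" unfolding adj(3) using jl by (simp add: d_def)
    finally show ?thesis .
  qed
  have dF: "d \<in> F" "inverse d \<in> F" using dD(2) fld_inverse[OF fld_F] by (auto simp: mem_OF)
  have "\<exists>u. u \<in> OF - P \<and> algebraic_int (u * (?\<delta>n * (e j / d)))" if j: "j < n" for j
  proof -
    have edE: "e j / d \<in> E" using eE[OF j] dF FE fld_divide[OF fld_E] by blast
    have tr: "trace (e j / d * z) \<in> local_ring P" if z: "z \<in> OE" for z
    proof -
      obtain a where a: "\<forall>l<n. a l \<in> local_ring P" "z = (\<Sum>l<n. a l * b l)" using b(3)[OF z] by blast
      have F: "a l * inverse d \<in> F" "e j * b l \<in> E" if "l < n" for l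
        using a(1) that dF eE[OF j] bE fldD(3)[OF fld_F] fldD(3)[OF fld_E] by (auto simp: local_ring_def)
      have "e j / d * z = (\<Sum>l<n. (a l * inverse d) * (e j * b l))"
        unfolding a(2) sum_distrib_left by (simp add: divide_inverse mult_ac)
      then have "trace (e j / d * z) = (\<Sum>l<n. trace ((a l * inverse d) * (e j * b l)))"
        using F FE fldD(3)[OF fld_E] by (simp only:) (intro trace_sum, auto simp: subset_iff)
      also have "\<dots> = (\<Sum>l<n. (a l * inverse d) * (if j = l then d else 0))"
        using F j tr_e by (simp add: trace_scale)
      also have "\<dots> = a j" using j d(2) by (simp add: if_distrib sum.delta cong: if_cong)
      finally show ?thesis using a(1) j by simp
    qed
    show ?thesis
    proof -
      have "(of_nat \<delta> :: 'a) \<noteq> 0" using \<delta> by simp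
      from codifferent_bound[OF P(1) \<delta>P this edE tr] show ?thesis by blast
    qed
  qed
  then obtain u where u: "\<And>j. j < n \<Longrightarrow> u j \<in> OF - P" "\<And>j. j < n \<Longrightarrow> algebraic_int (u j * (?\<delta>n * (e j / d)))"
    by metis
  define v where "v = (\<Prod>j<n. u j)"
  have v: "v \<in> OF - P" unfolding v_def using u(1) by (intro max_ideal_prod[OF OF_ring P(1)]) auto
  define y where "y j = v * (?\<delta>n * (e j / d))" for j
  have vF: "v * ?\<delta>n * inverse d \<in> F"
    using v dF fldD(1,3)[OF fld_F] by (auto simp: mem_OF subset_iff)
  have y_OE: "y j \<in> OE" if j: "j < n" for j
  proof -
    have "v = u j * (\<Prod>i\<in>{..<n} - {j}. u i)" unfolding v_def using j by (simp add: prod.remove)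
    then have "y j = (\<Prod>i\<in>{..<n} - {j}. u i) * (u j * (?\<delta>n * (e j / d)))" by (simp add: y_def mult_ac)
    moreover have "algebraic_int (\<Prod>i\<in>{..<n} - {j}. u i)"
      using u(1) by (intro algebraic_int_prod) (auto simp: mem_OF)
    ultimately have "algebraic_int (y j)" using u(2)[OF j] algebraic_int_mult by metis
    moreover have "y j = (v * ?\<delta>n * inverse d) * e j" by (simp add: y_def divide_inverse mult_ac)
    ultimately show ?thesis using vF eE[OF j] FE fldD(3)[OF fld_E] by (auto simp: mem_OE subset_iff)
  qed
  have "\<exists>a. (\<forall>k<n. a k \<in> local_ring P) \<and> y j = (\<Sum>k<n. a k * b k)" if "j < n" for j
    using b(3)[OF y_OE[OF that]] .
  then obtain a where a: "\<And>j k. j < n \<Longrightarrow> k < n \<Longrightarrow> a j k \<in> local_ring P" "\<And>j. j < n \<Longrightarrow> y j = (\<Sum>k<n. a j k * b k)"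
    by metis
  have aP: "a (fst jk) (snd jk) \<in> local_ring P" if "jk \<in> {..<n} \<times> {..<n}" for jk
    using that a(1) by auto
  have "finite ({..<n} \<times> {..<n})" by simp
  then have "\<exists>w\<in>OF - P. \<forall>j<n. \<forall>k<n. w * a j k \<in> OF"
  proof (rule local_ring_common_denominator[OF P(1) _ aP])
    fix w assume w: "w \<in> OF - P"
      "\<And>jk. jk \<in> {..<n} \<times> {..<n} \<Longrightarrow> w * a (fst jk) (snd jk) \<in> OF"
    have "w * a j k \<in> OF" if "j < n" "k < n" for j k
      using w(2)[of "(j, k)"] that by simp
    then show ?thesis using w(1) by blast
  qed
  then obtain w where w: "w \<in> OF - P" and wa: "\<And>j k. j < n \<Longrightarrow> k < n \<Longrightarrow> w * a j k \<in> OF" by blast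
  \<comment> \<open>The coordinates of the scaled dual basis \<open>y\<close>, with the common
    denominator \<open>w\<close> cleared.\<close>
  define A where "A = mat n n (\<lambda>(j, k). w * a j k)"
  have A: "A \<in> carrier_mat n n" by (simp add: A_def)
  have "A * T = (w * v * ?\<delta>n) \<cdot>\<^sub>m 1\<^sub>m n"
  proof (rule eq_matI)
    fix j l assume "j < dim_row ((w * v * ?\<delta>n) \<cdot>\<^sub>m 1\<^sub>m n)" "l < dim_col ((w * v * ?\<delta>n) \<cdot>\<^sub>m 1\<^sub>m n)"
    then have jl: "j < n" "l < n" by auto
    have F: "a j k \<in> F" "b k * b l \<in> E" if "k < n" for k
      using a(1)[OF jl(1) that] bE jl that fldD(3)[OF fld_E] by (auto simp: local_ring_def)
    have "(A * T) $$ (j, l) = w * (\<Sum>k<n. a j k * trace (b k * b l))"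
      using jl by (simp add: A_def T_def scalar_prod_def atLeast0LessThan sum_distrib_left mult.assoc)
    also have "(\<Sum>k<n. a j k * trace (b k * b l)) = (\<Sum>k<n. trace (a j k * (b k * b l)))"
      using F by (simp add: trace_scale)
    also have "\<dots> = trace (y j * b l)"
      unfolding a(2)[OF jl(1)] sum_distrib_right using F FE fldD(3)[OF fld_E]
      by (subst trace_sum) (auto simp: mult.assoc subset_iff)
    also have "y j * b l = (v * ?\<delta>n * inverse d) * (e j * b l)" by (simp add: y_def divide_inverse mult_ac)
    also have "trace \<dots> = (v * ?\<delta>n * inverse d) * (if j = l then d else 0)"
      using trace_scale[OF vF, of "e j * b l"] eE[OF jl(1)] bE[OF jl(2)] fldD(3)[OF fld_E] tr_e[OF jl] by simp
    finally show "(A * T) $$ (j, l) = ((w * v * ?\<delta>n) \<cdot>\<^sub>m 1\<^sub>m n) $$ (j, l)"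
      using jl d(2) by simp
  qed (use A T in auto)
  then have "det A * d = (w * v * ?\<delta>n) ^ n" using det_mult[OF A T] by (simp add: d_def)
  moreover have "det A \<in> OF" using wa by (intro det_in_subring[OF OF_ring A]) (auto simp: A_def)
  ultimately have "(w * v) ^ n * ?\<delta>n ^ n \<in> ?D"
    using ideal_setD(4)[OF DI _ dD(1)] by (metis power_mult_distrib)
  moreover have wv: "w * v \<in> OF - P" using unit_mult[OF P(1) w v] .
  then have "(\<Prod>i<n. w * v) \<in> OF - P" by (intro max_ideal_prod[OF OF_ring P(1)])
  then have "(w * v) ^ n \<in> OF - P" by simp
  ultimately show False using P(2) by (auto simp: J_def)
qed

end

section \<open>Normal closures\<close>

context algebraic_type
begin

text \<open>Normality over \<open>F\<close>, expressed by automorphisms of the closure so that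
  extensions of infinite degree are covered as well.\<close>

definition stable :: "'a set \<Rightarrow> 'a set \<Rightarrow> bool" where
  "stable F L \<longleftrightarrow> fld L \<and> F \<subseteq> L \<and> (\<forall>\<sigma>\<in>Aut F. \<sigma> ` L \<subseteq> L)"

lemma stableD: "stable F L \<Longrightarrow> fld L" "stable F L \<Longrightarrow> F \<subseteq> L" "stable F L \<Longrightarrow> \<sigma> \<in> Aut F \<Longrightarrow> \<sigma> ` L \<subseteq> L"
  by (auto simp: stable_def)

lemma stable_image_eq:
  assumes "stable F L" "\<sigma> \<in> Aut F"
  shows "\<sigma> ` L = L"
proof
  show "L \<subseteq> \<sigma> ` L"
  proof
    fix x assume "x \<in> L"
    then have "inv_into UNIV \<sigma> x \<in> L" using stableD(3)[OF assms(1) inv_Aut[OF assms(2)]] by blast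
    then show "x \<in> \<sigma> ` L" using Aut_inv_simps(1)[OF assms(2), of x] by (metis imageI)
  qed
qed (rule stableD(3)[OF assms])

lemma stable_embeddings:
  assumes "fld F" "stable F L"
  shows "embeddings F L L = (\<lambda>\<sigma>. restrict \<sigma> L) ` Aut F" "embeddings F L L = embs F L"
  using embeddings_eq[OF assms(1), of L L] embs_eq[OF assms(1), of L] stableD[OF assms(2)] by auto

lemma carrier_gal_group:
  assumes "fld F" "stable F L"
  shows "carrier (gal_group F L) = embs F L"
proof -
  have "restrict \<sigma> L \<in> Bij L" if "\<sigma> \<in> Aut F" for \<sigma>
    using stable_image_eq[OF assms(2) that] inj_Aut[OF that]
    by (auto simp: Bij_def bij_betw_def inj_on_def dest: injD)
  then show ?thesis
    using stable_embeddings[OF assms] by (auto simp: gal_group_def)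
qed

text \<open>From fixed field to normality: the orbit of \<open>x\<close> under the Galois group of
  \<open>L\<close> is finite, and the product of \<open>T - y\<close> over it has coefficients in
  the fixed field \<open>F\<close>. Every automorphism over \<open>F\<close> therefore sends
  \<open>x\<close> to an element of that orbit, which lies in \<open>L\<close>.\<close>

lemma galois_ext_iff_stable:
  assumes F: "fld F"
  shows "galois_ext F L \<longleftrightarrow> stable F L"
proof
  assume st: "stable F L"
  have "x \<in> F" if "x \<in> L" "\<forall>\<sigma>\<in>embs F L. \<sigma> x = x" for x
  proof (rule fixed_field_Aut[OF F])
    fix \<sigma> assume "\<sigma> \<in> Aut F"
    then have "restrict \<sigma> L \<in> embs F L" using stable_embeddings[OF F st] by auto
    then show "\<sigma> x = x" using that by force
  qed
  moreover have "\<sigma> x = x" if "x \<in> F" "\<sigma> \<in> embs F L" for x \<sigma>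
    using that by (auto simp: embeddings_def)
  ultimately show "galois_ext F L"
    using stableD[OF st] carrier_gal_group[OF F st] by (auto simp: galois_ext_def subfield_iff_fld)
next
  assume G: "galois_ext F L"
  let ?G = "carrier (gal_group F L)"
  have L: "fld L" "F \<subseteq> L" and fixed: "{x \<in> L. \<forall>\<sigma>\<in>?G. \<sigma> x = x} = F"
    using G by (auto simp: galois_ext_def subfield_iff_fld)
  have G_def: "?G = embeddings F L L \<inter> Bij L" by (simp add: gal_group_def)
  have emb: "\<tau> \<in> embs F L" if "\<tau> \<in> ?G" for \<tau>
    using that unfolding G_def by (auto simp: embeddings_def Ring.ring_hom_def)
  have lift: "\<exists>\<rho>\<in>Aut F. \<tau> = restrict \<rho> L" if "\<tau> \<in> ?G" for \<tau>
    using embs_lift[OF F L emb[OF that]] by metis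
  have tL: "\<tau> x \<in> L" if "\<tau> \<in> ?G" "x \<in> L" for \<tau> x
    using that unfolding G_def by (auto simp: Bij_def bij_betw_def)
  have comp: "restrict (\<tau> \<circ> \<tau>') L \<in> ?G" if t: "\<tau> \<in> ?G" "\<tau>' \<in> ?G" for \<tau> \<tau>'
  proof -
    have "restrict (\<tau> \<circ> \<tau>') L = compose L \<tau> \<tau>'" by (simp add: compose_def fun_eq_iff)
    moreover have "compose L \<tau> \<tau>' \<in> Bij L" using t unfolding G_def by (auto intro: compose_Bij)
    moreover have "restrict (\<tau> \<circ> \<tau>') L \<in> embeddings F L L"
      using t tL[OF t(1) tL[OF t(2)]] tL[OF t(2)] L fldD(2,3)[OF L(1)] fldD(1)[OF L(1)] unfolding G_def
      by (auto simp: embeddings_def Ring.ring_hom_def subset_iff)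
    ultimately show ?thesis unfolding G_def by auto
  qed
  have "\<sigma> x \<in> L" if x: "x \<in> L" and \<sigma>: "\<sigma> \<in> Aut F" for x \<sigma>
  proof -
    let ?O = "(\<lambda>\<tau>. \<tau> x) ` ?G"
    have "?O \<subseteq> (\<lambda>\<rho>. \<rho> x) ` Aut F" using lift x by force
    then have fin: "finite ?O" using finite_Aut_orbit finite_subset by blast
    have OL: "?O \<subseteq> L" using tL x by blast
    have perm: "\<tau> ` ?O = ?O" if t: "\<tau> \<in> ?G" for \<tau>
    proof (rule endo_inj_surj[OF fin])
      show "\<tau> ` ?O \<subseteq> ?O"
      proof safe
        fix \<tau>' assume t': "\<tau>' \<in> ?G"
        have "\<tau> (\<tau>' x) = restrict (\<tau> \<circ> \<tau>') L x" using x by simp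
        then show "\<tau> (\<tau>' x) \<in> ?O" using comp[OF t t'] by blast
      qed
      show "inj_on \<tau> ?O" using t OL unfolding G_def by (auto simp: Bij_def bij_betw_def intro: inj_on_subset)
    qed
    define p where "p = (\<Prod>y\<in>?O. [:- y, 1:])"
    have pL: "poly_over L p" unfolding p_def
      using OL subring_setD(3)[OF fld_subring[OF L(1)]] by (intro poly_over_prod_linear[OF fld_subring[OF L(1)]]) auto
    have "coeff p k \<in> F" for k
    proof -
      have "\<tau> (coeff p k) = coeff p k" if t: "\<tau> \<in> ?G" for \<tau>
      proof -
        obtain \<rho> where \<rho>: "\<rho> \<in> Aut F" "\<tau> = restrict \<rho> L" using lift[OF t] by blast
        interpret \<rho>: field_hom \<rho> using \<rho>(1) by (rule Aut_field_hom)
        have "\<rho> (coeff p k) = coeff (\<Prod>y\<in>?O. [:\<rho> (- y), 1:]) k"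
          unfolding p_def by (rule ring_hom_coeff_prod) (auto simp: \<rho>.hom_add \<rho>.hom_mult)
        also have "(\<Prod>y\<in>?O. [:\<rho> (- y), 1:]) = (\<Prod>y\<in>?O. [:- \<tau> y, 1:])"
          using OL \<rho>(2) by (intro prod.cong) (auto simp: \<rho>.hom_uminus)
        also have "\<dots> = (\<Prod>y\<in>\<tau> ` ?O. [:- y, 1:])"
          using t OL unfolding G_def
          by (subst prod.reindex) (auto simp: Bij_def bij_betw_def intro: inj_on_subset)
        finally show ?thesis
          using \<rho>(2) pL perm[OF t] by (simp add: p_def poly_over_def)
      qed
      then show ?thesis using fixed pL by (auto simp: poly_over_def)
    qed
    then have pF: "poly_over F p" by (simp add: poly_over_def)
    have "restrict id L \<in> ?G"
      using L id_Aut(1) subring_setD(1)[OF fld_subring[OF L(1)]] unfolding G_def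
      by (auto simp: embeddings_def Ring.ring_hom_def Bij_def bij_betw_def inj_on_def subset_iff fldD[OF L(1)])
    then have "x \<in> ?O" using x by (intro image_eqI[of _ _ "restrict id L"]) auto
    then have "poly p x = 0" unfolding p_def poly_prod using fin by (auto intro!: prod_zero)
    then have "poly p (\<sigma> x) = 0"
      using poly_Aut[OF \<sigma>, of p x] map_poly_Aut_fixed[OF \<sigma> pF] AutD(4)[OF \<sigma>, of 0] by simp
    then have "\<exists>y\<in>?O. \<sigma> x - y = 0" unfolding p_def poly_prod using fin by (simp add: prod_zero_iff)
    then show ?thesis using OL by auto
  qed
  then show "stable F L" using L by (auto simp: stable_def)
qed

text \<open>Defined for arbitrary sets, because it is also taken of a union of fields, where it is
  the Galois closure of their compositum.\<close>

definition galois_hull :: "'a set \<Rightarrow> 'a set \<Rightarrow> 'a set" where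
  "galois_hull F S = \<Inter>{L. stable F L \<and> S \<subseteq> L}"

lemma galois_closure_eq_hull: "fld F \<Longrightarrow> galois_closure F E = galois_hull F E"
  by (simp add: galois_closure_def galois_hull_def galois_ext_iff_stable)

lemma stable_hull:
  assumes "fld F"
  shows "stable F (galois_hull F S)"
  unfolding stable_def
proof (intro conjI ballI)
  show "fld (galois_hull F S)"
    unfolding fld_def galois_hull_def using stableD(1) fldD by blast
  show "F \<subseteq> galois_hull F S" unfolding galois_hull_def using stableD(2) by blast
  show "\<sigma> ` galois_hull F S \<subseteq> galois_hull F S" if "\<sigma> \<in> Aut F" for \<sigma>
    unfolding galois_hull_def using stableD(3)[OF _ that] by blast
qed

lemma subset_hull: "S \<subseteq> galois_hull F S"
  unfolding galois_hull_def by blast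

lemma hull_minimal: "stable F L \<Longrightarrow> S \<subseteq> L \<Longrightarrow> galois_hull F S \<subseteq> L"
  unfolding galois_hull_def by blast

lemma hull_stable: "stable F L \<Longrightarrow> galois_hull F L = L"
  using hull_minimal[of F L L] subset_hull[of L F] by blast

text \<open>The elements all of whose conjugates are fixed by \<open>g\<close> form a normal field
  over \<open>F\<close>, which then contains the hull.\<close>

lemma Aut_trivial_on_hull:
  assumes F: "fld F" and g: "g \<in> Aut F" and triv: "\<And>\<rho> x. \<rho> \<in> Aut F \<Longrightarrow> x \<in> S \<Longrightarrow> g (\<rho> x) = \<rho> x"
    and x: "x \<in> galois_hull F S"
  shows "g x = x"
proof -
  let ?L = "{x. \<forall>\<rho>\<in>Aut F. g (\<rho> x) = \<rho> x}"
  have "stable F ?L"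
    unfolding stable_def
  proof (intro conjI ballI)
    show "fld ?L" unfolding fld_def using AutD[OF g] by (auto simp: AutD)
    show "F \<subseteq> ?L" using AutD(3)[OF g] by (auto simp: AutD)
    show "\<sigma> ` ?L \<subseteq> ?L" if "\<sigma> \<in> Aut F" for \<sigma>
    proof safe
      fix x \<rho> assume "\<forall>\<rho>\<in>Aut F. g (\<rho> x) = \<rho> x" "\<rho> \<in> Aut F"
      then show "g (\<rho> (\<sigma> x)) = \<rho> (\<sigma> x)" using comp_Aut[of \<rho> F \<sigma>] that by (metis comp_apply)
    qed
  qed
  then have "galois_hull F S \<subseteq> ?L" using triv by (intro hull_minimal) auto
  then show ?thesis using x id_Aut(1) by fastforce
qed

end

section \<open>Discriminants and indices of permutation groups\<close>

context number_ext
begin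

text \<open>Two embeddings \<open>\<sigma>\<close> and \<open>\<tau>\<close> of \<open>E\<close> are
  congruent. \<open>congruent_lift\<close> corrects \<open>\<tau>\<close> by some \<open>h\<close>
  over \<open>E\<close> so that the congruence holds on the integers of \<open>K\<close>, and
  \<open>g\<close> is \<open>\<tau>\<close>, \<open>h\<close> and the inverse of
  \<open>\<sigma>\<close> composed. It is not trivial on \<open>K\<close>, since
  \<open>\<sigma>\<close> and \<open>\<tau>\<close> differ on \<open>E\<close>.\<close>

lemma inertia_element:
  assumes P: "max_ideal OF P" "integral_basis_discs F E \<subseteq> P"
    and MM: "max_ideal algebraic_ints MM" "MM \<inter> OF = P"
    and K: "stable F K" "E \<subseteq> K" and fin: "finite (embs F K)"
  obtains g where "g \<in> Aut F" "\<And>x. x \<in> ring_of_integers K \<Longrightarrow> g x - x \<in> MM" "\<exists>x\<in>K. g x \<noteq> x"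
proof -
  note fld_K = stableD(1)[OF K(1)]
  note MI = max_idealD(1)[OF MM(1)]
  obtain i j where ij: "i < n" "j < n" "i \<noteq> j" "\<And>x. x \<in> OE \<Longrightarrow> (s ! i) x - (s ! j) x \<in> MM"
    using congruent_embeddings[OF P MM] by blast
  obtain \<sigma> where \<sigma>: "\<sigma> \<in> Aut F" "s ! i = restrict \<sigma> E" using s_lift[OF ij(1)] .
  obtain \<tau> where \<tau>: "\<tau> \<in> Aut F" "s ! j = restrict \<tau> E" using s_lift[OF ij(2)] .
  have AutEF: "Aut E \<subseteq> Aut F" using Aut_mono[OF FE] .
  have "embs E K \<subseteq> embs F K"
    using embs_eq[OF fld_E fld_K K(2)] embs_eq[OF fld_F fld_K] K(2) FE AutEF by auto
  then have finEK: "finite (embs E K)" using fin finite_subset by blast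
  have im: "h ` K \<subseteq> K" if "h \<in> Aut E" for h using stableD(3)[OF K(1)] AutEF that by blast
  have cong: "\<sigma> x - \<tau> x \<in> MM" if "x \<in> OE" for x
    using ij(4)[OF that] \<sigma>(2) \<tau>(2) that by (simp add: mem_OE)
  obtain h where h: "h \<in> Aut E" "\<And>x. x \<in> ring_of_integers K \<Longrightarrow> \<sigma> x - \<tau> (h x) \<in> MM"
    using congruent_lift[OF fld_E fld_K K(2) im finEK MM(1) \<sigma>(1) \<tau>(1) cong] by blast
  define g where "g = \<tau> \<circ> h \<circ> inv_into UNIV \<sigma>"
  have gF: "g \<in> Aut F" unfolding g_def using h(1) AutEF \<sigma>(1) \<tau>(1) by (intro comp_Aut inv_Aut) auto
  moreover have "g x - x \<in> MM" if x: "x \<in> ring_of_integers K" for x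
  proof -
    have "inv_into UNIV \<sigma> x \<in> ring_of_integers K"
      using x stableD(3)[OF K(1) inv_Aut[OF \<sigma>(1)]] algebraic_int_Aut[OF inv_Aut[OF \<sigma>(1)]]
      by (auto simp: ring_of_integers_def)
    from h(2)[OF this] have "x - g x \<in> MM" using Aut_inv_simps[OF \<sigma>(1)] by (simp add: g_def)
    from ideal_set_minus[OF subring_algebraic_ints MI this] show ?thesis by simp
  qed
  moreover have "\<exists>x\<in>K. g x \<noteq> x"
  proof (rule ccontr)
    assume no: "\<not> (\<exists>x\<in>K. g x \<noteq> x)"
    have "\<tau> x = \<sigma> x" if x: "x \<in> E" for x
    proof -
      have "\<sigma> x \<in> K" using stableD(3)[OF K(1) \<sigma>(1)] K(2) x by blast
      then have "g (\<sigma> x) = \<sigma> x" using no by blast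
      then show ?thesis using Aut_inv_simps[OF \<sigma>(1)] AutD(3)[OF h(1) x] by (simp add: g_def)
    qed
    then have "s ! i = s ! j" unfolding \<sigma>(2) \<tau>(2) by auto
    then show False using ij(1-3) s(1) length_s by (simp add: nth_eq_iff_index_eq)
  qed
  ultimately show thesis using that by blast
qed

text \<open>The fibres of \<open>f\<close> are the congruence classes of embeddings; they are
  numbered by \<open>\<kappa>\<close>, and \<open>y\<close> picks a representative of each.\<close>

lemma disc_local_power_classes:
  assumes P: "max_ideal OF P" and \<pi>: "\<pi> \<in> P" "\<pi> \<noteq> 0"
    "\<And>y. y \<in> P \<Longrightarrow> \<exists>u\<in>OF - P. \<exists>z\<in>OF. u * y = \<pi> * z"
    and MM: "max_ideal algebraic_ints MM" "MM \<inter> OF = P"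
    and f: "\<And>\<sigma> \<tau> x. \<sigma> \<in> embs F E \<Longrightarrow> \<tau> \<in> embs F E \<Longrightarrow> f \<sigma> = f \<tau> \<Longrightarrow> x \<in> OE \<Longrightarrow> \<sigma> x - \<tau> x \<in> MM"
    and b: "\<And>j. j < n \<Longrightarrow> b j \<in> OE"
  shows "(emb_det b)\<^sup>2 \<in> local_power P \<pi> (n - card (f ` embs F E))"
proof -
  define r where "r = card (f ` embs F E)"
  have fin: "finite (f ` embs F E)" using finite_embs[OF fld_F E] by simp
  obtain e where e: "bij_betw e {..<r} (f ` embs F E)"
    using ex_bij_betw_nat_finite[OF fin] by (auto simp: r_def atLeast0LessThan)
  define \<kappa> where "\<kappa> i = inv_into {..<r} e (f (s ! i))" for i
  have "\<forall>c. \<exists>\<tau>. c < r \<longrightarrow> \<tau> \<in> embs F E \<and> f \<tau> = e c" 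
  proof
    fix c
    show "\<exists>\<tau>. c < r \<longrightarrow> \<tau> \<in> embs F E \<and> f \<tau> = e c"
    proof (cases "c < r")
      case True
      then have "e c \<in> f ` embs F E" using e by (auto simp: bij_betw_def)
      then show ?thesis by force
    qed auto
  qed
  then obtain y where y: "\<And>c. c < r \<Longrightarrow> y c \<in> embs F E" "\<And>c. c < r \<Longrightarrow> f (y c) = e c" by metis
  have si: "s ! i \<in> embs F E" if "i < n" for i using that s(2) length_s by (metis nth_mem)
  have \<kappa>r: "\<kappa> i < r" if "i < n" for i
    unfolding \<kappa>_def using bij_betw_inv_into[OF e] si[OF that] by (auto simp: bij_betw_def)
  have cong: "(s ! i) x - y (\<kappa> i) x \<in> MM" if i: "i < n" and x: "x \<in> OE" for i x
  proof -
    have "e (\<kappa> i) = f (s ! i)" unfolding \<kappa>_def using bij_betw_inv_into_right[OF e] si[OF i] by blast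
    then show ?thesis using f[OF si[OF i] y(1)[OF \<kappa>r[OF i]] _ x] y(2)[OF \<kappa>r[OF i]] by simp
  qed
  show ?thesis
    unfolding r_def[symmetric]
    by (rule disc_local_power[where \<kappa> = \<kappa> and y = y, OF P \<pi> MM \<kappa>r _ cong b])
       (use y(1) embs_algebraic_int[OF fld_F fld_E FE] in auto)
qed

end

lemma transitive_groupD:
  assumes "transitive_group n G"
  shows "G \<subseteq> {p. p permutes {1..n}}" "finite G" "id \<in> G"
proof -
  have sub: "subgroup G (sym_group n)" using assms by (simp add: transitive_group_def)
  show "G \<subseteq> {p. p permutes {1..n}}" using subgroup.subset[OF sub] by (simp add: sym_group_def)
  then show "finite G" using finite_permutations[of "{1..n}"] finite_subset by blast
  show "id \<in> G" using subgroup.one_closed[OF sub] by (simp add: sym_group_def)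
qed

context number_base
begin

text \<open>That the identity goes to the identity is read off from the action: its image fixes each
  point of \<open>{1..n}\<close>, and elements of \<open>G\<close> fix everything else.\<close>

lemma has_galE:
  assumes E: "ext_of_degree F n E" and G: "transitive_group n G" and gal: "has_gal F E n G"
  obtains \<psi> \<beta> where "bij_betw \<psi> (embs F (galois_hull F E)) G" "bij_betw \<beta> (embs F E) {1..n}"
    "\<And>h \<tau>. h \<in> embs F (galois_hull F E) \<Longrightarrow> \<tau> \<in> embs F E \<Longrightarrow> \<beta> (compose E h \<tau>) = \<psi> h (\<beta> \<tau>)"
    "\<psi> (restrict id (galois_hull F E)) = id"
proof -
  let ?K = "galois_hull F E"
  note E' = ext_of_degreeD[OF fld_F E]
  have st: "stable F ?K" using stable_hull[OF fld_F] .
  have EK: "E \<subseteq> ?K" by (rule subset_hull)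
  have c: "carrier (gal_group F ?K) = embs F ?K" by (rule carrier_gal_group[OF fld_F st])
  have em: "embeddings F E ?K = embs F E"
    using embeddings_eq[OF fld_F E'(1,2), of ?K] embs_eq[OF fld_F E'(1,2)] stableD(3)[OF st] EK
    by (metis image_mono subset_trans)
  obtain \<psi> \<beta> where \<psi>: "\<psi> \<in> iso (gal_group F ?K) (sym_group n\<lparr>carrier := G\<rparr>)" and \<beta>: "bij_betw \<beta> (embs F E) {1..n}"
    "\<forall>h\<in>embs F ?K. \<forall>\<tau>\<in>embs F E. \<beta> (compose E h \<tau>) = \<psi> h (\<beta> \<tau>)"
    using gal unfolding has_gal_def perm_isomorphic_def galois_closure_eq_hull[OF fld_F] c em by blast
  have bij: "bij_betw \<psi> (embs F ?K) G" using \<psi> c by (simp add: iso_def)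
  have "restrict id ?K \<in> embs F ?K"
    using embs_eq[OF fld_F stableD(1,2)[OF st]] id_Aut(1) by auto
  then have idG: "\<psi> (restrict id ?K) \<in> G" using bij by (auto simp: bij_betw_def)
  have "\<psi> (restrict id ?K) i = i" for i
  proof (cases "i \<in> {1..n}")
    case True
    then have "i \<in> \<beta> ` embs F E" using bij_betw_imp_surj_on[OF \<beta>(1)] by simp
    then obtain \<tau> where \<tau>: "\<tau> \<in> embs F E" "\<beta> \<tau> = i" by blast
    then have "compose E (restrict id ?K) \<tau> = \<tau>"
    proof -
      obtain \<sigma> where "\<sigma> \<in> Aut F" "\<tau> = restrict \<sigma> E" using embs_lift[OF fld_F E'(1,2) \<tau>(1)] .
      then show ?thesis using stableD(3)[OF st] EK by (auto simp: compose_def fun_eq_iff subset_iff)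
    qed
    then show ?thesis using \<beta>(2) \<open>restrict id ?K \<in> embs F ?K\<close> \<tau> by metis
  next
    case False
    then show ?thesis using transitive_groupD(1)[OF G] idG by (auto simp: permutes_def)
  qed
  then have "\<psi> (restrict id ?K) = id" by auto
  then show thesis using that bij \<beta> by blast
qed

text \<open>A prime dividing the discriminant is ramified, and the reductions of the embeddings are constant
  on the orbits of a non-trivial element of its inertia group.\<close>

theorem prime_power_dvd_Disc:
  assumes E: "ext_of_degree F n E" and G: "transitive_group n G" and gal: "has_gal F E n G"
    and p: "prime p" "p dvd Disc F E"
  shows "p ^ group_index n G dvd Disc F E"
proof -
  let ?K = "galois_hull F E"
  note E' = ext_of_degreeD[OF fld_F E]
  note DI = disc_ideal_ideal[OF discs_OF[OF E]]
  have st: "stable F ?K" using stable_hull[OF fld_F] .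
  have EK: "E \<subseteq> ?K" by (rule subset_hull)
  obtain P where P: "max_ideal OF P" "disc_ideal F E \<subseteq> P" "of_nat p \<in> P" using prime_dvd_Disc[OF E p] .
  obtain \<pi> where \<pi>: "\<pi> \<in> P" "\<pi> \<noteq> 0" "\<And>y. y \<in> P \<Longrightarrow> \<exists>u\<in>OF - P. \<exists>z\<in>OF. u * y = \<pi> * z"
    using uniformizer[OF P(1)] by blast
  obtain MM where MM: "max_ideal algebraic_ints MM" "MM \<inter> OF = P" using lying_over[OF P(1)] .
  note MI = max_idealD(1)[OF MM(1)]
  obtain \<psi> \<beta> where \<psi>: "bij_betw \<psi> (embs F ?K) G" and \<beta>: "bij_betw \<beta> (embs F E) {1..n}"
    and act: "\<And>h \<tau>. h \<in> embs F ?K \<Longrightarrow> \<tau> \<in> embs F E \<Longrightarrow> \<beta> (compose E h \<tau>) = \<psi> h (\<beta> \<tau>)"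
    and \<psi>id: "\<psi> (restrict id ?K) = id"
    using has_galE[OF E G gal] by metis
  have finK: "finite (embs F ?K)" using \<psi> transitive_groupD(2)[OF G] bij_betw_finite by blast
  obtain s where "number_ext F deg E n s" using ext_list[OF E] .
  then interpret number_ext ty F deg E n s .
  have "integral_basis_discs F E \<subseteq> P" using discs_subset_disc_ideal[OF discs_OF[OF E]] P(2) by blast
  then obtain g where g: "g \<in> Aut F" "\<And>x. x \<in> ring_of_integers ?K \<Longrightarrow> g x - x \<in> MM" "\<exists>x\<in>?K. g x \<noteq> x"
    using inertia_element[OF P(1) _ MM st EK finK] by metis
  define \<gamma> where "\<gamma> = restrict g ?K"
  have \<gamma>: "\<gamma> \<in> embs F ?K" using g(1) embs_eq[OF fld_F stableD(1,2)[OF st]] by (auto simp: \<gamma>_def)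
  define g' where "g' = \<psi> \<gamma>"
  have g'G: "g' \<in> G" using \<psi> \<gamma> by (auto simp: g'_def bij_betw_def)
  have idK: "restrict id ?K \<in> embs F ?K" using embs_eq[OF fld_F stableD(1,2)[OF st]] id_Aut(1) by auto
  have "\<gamma> \<noteq> restrict id ?K"
  proof
    assume "\<gamma> = restrict id ?K"
    then have "g x = x" if "x \<in> ?K" for x using that by (metis \<gamma>_def id_apply restrict_apply)
    then show False using g(3) by blast
  qed
  then have g'id: "g' \<noteq> id" using \<psi> \<gamma> idK \<psi>id by (metis bij_betw_inv_into_left g'_def)
  have perm: "g' permutes {1..n}" using transitive_groupD(1)[OF G] g'G by blast
  then have permn: "permutation g'" by (auto simp: permutation_permutes)
  \<comment> \<open>Embeddings are labelled by the orbits of \<open>g'\<close>, so the number of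
    labels is the number of orbits and \<open>n\<close> minus it is the index of
    \<open>g'\<close>.\<close>
  define f where "f \<tau> = orbit g' (\<beta> \<tau>)" for \<tau>
  have inert: "compose E \<gamma> \<tau> \<in> embs F E" "x \<in> OE \<Longrightarrow> compose E \<gamma> \<tau> x - \<tau> x \<in> MM" if \<tau>: "\<tau> \<in> embs F E" for \<tau> x
  proof -
    obtain \<sigma> where \<sigma>: "\<sigma> \<in> Aut F" "\<tau> = restrict \<sigma> E" using embs_lift[OF fld_F E'(1,2) \<tau>] .
    have eq: "compose E \<gamma> \<tau> = restrict (g \<circ> \<sigma>) E"
      using stableD(3)[OF st \<sigma>(1)] EK by (auto simp: compose_def \<gamma>_def \<sigma>(2) fun_eq_iff subset_iff)
    then show "compose E \<gamma> \<tau> \<in> embs F E"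
      using comp_Aut[OF g(1) \<sigma>(1)] by (auto simp: embs_eq[OF fld_F E'(1,2)])
    assume x: "x \<in> OE"
    then have "\<sigma> x \<in> ring_of_integers ?K"
      using stableD(3)[OF st \<sigma>(1)] EK algebraic_int_Aut[OF \<sigma>(1)] by (auto simp: ring_of_integers_def)
    then show "compose E \<gamma> \<tau> x - \<tau> x \<in> MM" using g(2)[of "\<sigma> x"] x unfolding eq by (simp add: \<sigma>(2) mem_OE)
  qed
  have orb: "\<exists>\<tau>'\<in>embs F E. \<beta> \<tau>' = k \<and> (\<forall>x\<in>OE. \<tau>' x - \<tau> x \<in> MM)" if \<tau>: "\<tau> \<in> embs F E" and k: "k \<in> orbit g' (\<beta> \<tau>)" for \<tau> k
    using k
  proof (induction rule: orbit.induct)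
    case base
    show ?case using inert[OF \<tau>] act[OF \<gamma> \<tau>] by (intro bexI[of _ "compose E \<gamma> \<tau>"]) (auto simp: g'_def)
  next
    case (step k)
    then obtain \<tau>' where t: "\<tau>' \<in> embs F E" "\<beta> \<tau>' = k" "\<forall>x\<in>OE. \<tau>' x - \<tau> x \<in> MM" by blast
    have "compose E \<gamma> \<tau>' x - \<tau> x \<in> MM" if x: "x \<in> OE" for x
    proof -
      have "(compose E \<gamma> \<tau>' x - \<tau>' x) + (\<tau>' x - \<tau> x) \<in> MM"
        using inert(2)[OF t(1) x] t(3) x by (intro ideal_setD(3)[OF MI]) auto
      then show ?thesis by simp
    qed
    then show ?case
      using act[OF \<gamma> t(1)] t(2) inert(1)[OF t(1)]
      by (intro bexI[of _ "compose E \<gamma> \<tau>'"]) (auto simp: g'_def)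
  qed
  have cls: "\<sigma> x - \<tau> x \<in> MM" if "\<sigma> \<in> embs F E" "\<tau> \<in> embs F E" "f \<sigma> = f \<tau>" "x \<in> OE" for \<sigma> \<tau> x
  proof -
    have "\<beta> \<sigma> \<in> orbit g' (\<beta> \<tau>)" using permutation_self_in_orbit[OF permn, of "\<beta> \<sigma>"] that(3) by (simp add: f_def)
    then obtain \<tau>' where "\<tau>' \<in> embs F E" "\<beta> \<tau>' = \<beta> \<sigma>" "\<forall>x\<in>OE. \<tau>' x - \<tau> x \<in> MM"
      using orb[OF \<open>\<tau> \<in> embs F E\<close>] by blast
    then show ?thesis using \<beta> that by (metis bij_betw_inv_into_left)
  qed
  have "f ` embs F E = orbit g' ` (\<beta> ` embs F E)" by (simp add: f_def image_image)
  then have "f ` embs F E = orbit g' ` {1..n}" using bij_betw_imp_surj_on[OF \<beta>] by simp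
  then have idx: "n - card (f ` embs F E) = perm_index n g'" by (simp add: perm_index_def)
  have fin: "finite (perm_index n ` (G - {id}))" using transitive_groupD(2)[OF G] by simp
  have "group_index n G \<le> perm_index n g'"
    unfolding group_index_def using fin g'G g'id by (intro Min_le) auto
  moreover have "integral_basis_discs F E \<subseteq> local_power P \<pi> (perm_index n g')"
  proof
    fix d assume "d \<in> integral_basis_discs F E"
    then obtain s' b where s': "number_ext F deg E n s'" "\<And>j. j < n \<Longrightarrow> b j \<in> OE" "d = (number_ext.emb_det n s' b)\<^sup>2"
      using disc_cases[OF E] by metis
    interpret s': number_ext ty F deg E n s' by (rule s'(1))
    show "d \<in> local_power P \<pi> (perm_index n g')"
      unfolding s'(3) idx[symmetric] by (rule s'.disc_local_power_classes[OF P(1) \<pi> MM _ s'(2)]) (blast intro: cls)+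
  qed
  then have "disc_ideal F E \<subseteq> local_power P \<pi> (perm_index n g')"
    using disc_ideal_subset[OF discs_OF[OF E] local_power_ideal[OF P(1) \<pi>]] by blast
  then have "p ^ perm_index n g' dvd Disc F E"
    using prime_power_dvd_index[OF P(1) \<pi> p(1) P(3) DI _ finite_disc_classes[OF E]]
    by (simp add: Disc_def abs_norm_eq)
  ultimately show ?thesis using le_imp_power_dvd dvd_trans by blast
qed

end

section \<open>Normal extensions and regular permutation groups\<close>

text \<open>Every orbit has at least two points, so there are at most \<open>n / 2\<close>
  orbits.\<close>

lemma fixpoint_free_index:
  assumes g: "g permutes {1..n}" and free: "\<And>i. i \<in> {1..n} \<Longrightarrow> g i \<noteq> i"
  shows "n \<le> 2 * perm_index n g"
proof -
  have perm: "permutation g" using g by (auto simp: permutation_permutes)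
  have self: "i \<in> orbit g i" for i using permutation_self_in_orbit[OF perm] .
  have sub: "orbit g i \<subseteq> {1..n}" if "i \<in> {1..n}" for i using permutes_orbit_subset[OF g that] .
  have eq1: "orbit g k = orbit g i" if k: "k \<in> orbit g i" for i k
  proof (intro equalityI subsetI)
    show "l \<in> orbit g i" if "l \<in> orbit g k" for l using orbit_trans[OF that k] .
    show "l \<in> orbit g k" if "l \<in> orbit g i" for l using orbit_trans[OF that orbit_swap[OF self k]] .
  qed
  then have eq: "orbit g i = orbit g j" if "k \<in> orbit g i" "k \<in> orbit g j" for i j k
    using that by metis
  have "card (\<Union>(orbit g ` {1..n})) = (\<Sum>B\<in>orbit g ` {1..n}. card B)"
    using eq finite_orbit[OF self] by (intro card_Union_disjoint) (auto simp: pairwise_def disjnt_iff)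
  also have "\<dots> \<ge> (\<Sum>B\<in>orbit g ` {1..n}. 2)"
  proof (rule sum_mono)
    fix B assume "B \<in> orbit g ` {1..n}"
    then obtain i where i: "i \<in> {1..n}" "B = orbit g i" by blast
    have "{i, g i} \<subseteq> B" using self orbit.base i(2) by auto
    moreover have "card {i, g i} = 2" using free[OF i(1)] by auto
    ultimately show "2 \<le> card B" using card_mono[OF finite_orbit[OF self]] i(2) by metis
  qed
  finally have "2 * card (orbit g ` {1..n}) \<le> card (\<Union>(orbit g ` {1..n}))" by simp
  also have "\<dots> \<le> card {1..n}" using sub by (intro card_mono) blast+
  finally show ?thesis by (simp add: perm_index_def)
qed

context number_base
begin

text \<open>Cayley's construction: the Galois group acts on itself by left translation, where only
  the identity has a fixed point. \<open>\<beta>\<close> numbers the embeddings, and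
  \<open>\<psi> h\<close> is translation by \<open>h\<close> in these numbers, continued by the
  identity outside \<open>{1..N}\<close>.\<close>

lemma normal_ext_regular:
  assumes st: "stable F L" and fin: "finite (embs F L)" and N: "N = card (embs F L)" "N > 1"
  obtains H where "transitive_group N H" "has_gal F L N H" "N \<le> 2 * group_index N H"
proof -
  note L = stableD(1,2)[OF st]
  let ?S = "embs F L"
  note S_eq = embs_eq[OF fld_F L]
  have lift: "\<exists>\<sigma>\<in>Aut F. \<tau> = restrict \<sigma> L" if "\<tau> \<in> ?S" for \<tau>
    using embs_lift[OF fld_F L that] by metis
  have comp_eq: "compose L (restrict \<sigma> L) (restrict \<rho> L) = restrict (\<sigma> \<circ> \<rho>) L" if "\<rho> \<in> Aut F" for \<sigma> \<rho>
    using stableD(3)[OF st that] by (auto simp: compose_def fun_eq_iff subset_iff)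
  have comp: "compose L h \<tau> \<in> ?S" if "h \<in> ?S" "\<tau> \<in> ?S" for h \<tau>
  proof -
    obtain \<sigma> \<rho> where r: "\<sigma> \<in> Aut F" "h = restrict \<sigma> L" "\<rho> \<in> Aut F" "\<tau> = restrict \<rho> L"
      using lift \<open>h \<in> ?S\<close> \<open>\<tau> \<in> ?S\<close> by metis
    have "compose L h \<tau> = restrict (\<sigma> \<circ> \<rho>) L" unfolding r(2,4) by (rule comp_eq[OF r(3)])
    then show ?thesis using comp_Aut[OF r(1,3)] unfolding S_eq by blast
  qed
  have assoc: "compose L h (compose L h' \<tau>) = compose L (compose L h h') \<tau>" if "\<tau> \<in> ?S" for h h' \<tau>
    using lift[OF that] stableD(3)[OF st] by (auto simp: compose_def fun_eq_iff subset_iff)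
  define e where "e = restrict id L"
  have eS: "e \<in> ?S" using id_Aut(1) unfolding S_eq e_def by auto
  have e_left: "compose L e \<tau> = \<tau>" if "\<tau> \<in> ?S" for \<tau>
    using lift[OF that] stableD(3)[OF st] by (auto simp: compose_def e_def fun_eq_iff subset_iff)
  have e_right: "compose L \<tau> e = \<tau>" if "\<tau> \<in> ?S" for \<tau>
    using lift[OF that] by (auto simp: compose_def e_def fun_eq_iff)
  have quot: "\<exists>h\<in>?S. compose L h \<tau> = \<tau>'" if "\<tau> \<in> ?S" "\<tau>' \<in> ?S" for \<tau> \<tau>'
  proof -
    obtain \<rho> \<sigma> where r: "\<rho> \<in> Aut F" "\<tau> = restrict \<rho> L" "\<sigma> \<in> Aut F" "\<tau>' = restrict \<sigma> L"
      using lift \<open>\<tau> \<in> ?S\<close> \<open>\<tau>' \<in> ?S\<close> by metis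
    have "restrict (\<sigma> \<circ> inv_into UNIV \<rho>) L \<in> ?S" using comp_Aut[OF r(3) inv_Aut[OF r(1)]] unfolding S_eq by blast
    moreover have "compose L (restrict (\<sigma> \<circ> inv_into UNIV \<rho>) L) \<tau> = \<tau>'"
      unfolding r(2,4) comp_eq[OF r(1)] using Aut_inv_simps[OF r(1)] by (auto simp: fun_eq_iff)
    ultimately show ?thesis by blast
  qed
  have cancel: "h = h'" if "h \<in> ?S" "h' \<in> ?S" "\<tau> \<in> ?S" "compose L h \<tau> = compose L h' \<tau>" for h h' \<tau>
  proof -
    obtain k where k: "k \<in> ?S" "compose L \<tau> k = e"
    proof -
      obtain \<rho> where r: "\<rho> \<in> Aut F" "\<tau> = restrict \<rho> L" using lift[OF \<open>\<tau> \<in> ?S\<close>] by blast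
      have "restrict (inv_into UNIV \<rho>) L \<in> ?S" using inv_Aut[OF r(1)] unfolding S_eq by blast
      moreover have "compose L \<tau> (restrict (inv_into UNIV \<rho>) L) = e"
        unfolding r(2) comp_eq[OF inv_Aut[OF r(1)]] using Aut_inv_simps[OF r(1)] by (auto simp: e_def fun_eq_iff)
      ultimately show thesis using that by blast
    qed
    have "g = compose L (compose L g \<tau>) k" if "g \<in> ?S" for g
      using assoc[OF k(1), of g \<tau>] k(2) e_right[OF that] by simp
    from this[OF \<open>h \<in> ?S\<close>] this[OF \<open>h' \<in> ?S\<close>] show ?thesis
      using \<open>compose L h \<tau> = compose L h' \<tau>\<close> by simp
  qed
  have "card ?S = card {1..N}" by (simp add: N(1))
  from finite_same_card_bij[OF fin finite_atLeastAtMost this]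
  obtain \<beta> where \<beta>: "bij_betw \<beta> ?S {1..N}" by blast
  define ib where "ib = inv_into ?S \<beta>"
  have ib: "ib i \<in> ?S" "\<beta> (ib i) = i" if "i \<in> {1..N}" for i
    using that bij_betw_inv_into[OF \<beta>] bij_betw_inv_into_right[OF \<beta>] by (auto simp: ib_def bij_betw_def)
  have ib': "ib (\<beta> \<tau>) = \<tau>" "\<beta> \<tau> \<in> {1..N}" if "\<tau> \<in> ?S" for \<tau>
    using that bij_betw_inv_into_left[OF \<beta>] \<beta> by (auto simp: ib_def bij_betw_def)
  define \<psi> where "\<psi> h i = (if i \<in> {1..N} then \<beta> (compose L h (ib i)) else i)" for h i
  have \<psi>\<beta>: "\<psi> h (\<beta> \<tau>) = \<beta> (compose L h \<tau>)" if "\<tau> \<in> ?S" for h \<tau>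
    using ib'[OF that] by (simp add: \<psi>_def)
  have \<psi>_comp: "\<psi> (compose L h h') = \<psi> h \<circ> \<psi> h'" if "h \<in> ?S" "h' \<in> ?S" for h h'
  proof
    fix i
    show "\<psi> (compose L h h') i = (\<psi> h \<circ> \<psi> h') i"
    proof (cases "i \<in> {1..N}")
      case True
      have "\<psi> h (\<psi> h' i) = \<psi> h (\<beta> (compose L h' (ib i)))" using True by (simp add: \<psi>_def[of h'])
      also have "\<dots> = \<beta> (compose L h (compose L h' (ib i)))" using \<psi>\<beta> comp[OF that(2) ib(1)[OF True]] by blast
      also have "\<dots> = \<beta> (compose L (compose L h h') (ib i))" by (simp only: assoc[OF ib(1)[OF True]])
      also have "\<dots> = \<psi> (compose L h h') i" using True by (simp add: \<psi>_def)
      finally show ?thesis by simp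
    qed (auto simp: \<psi>_def)
  qed
  have \<psi>_e: "\<psi> e = id"
  proof
    fix i
    show "\<psi> e i = id i"
    proof (cases "i \<in> {1..N}")
      case True
      then show ?thesis using e_left[OF ib(1)[OF True]] ib(2)[OF True] by (simp add: \<psi>_def)
    qed (auto simp: \<psi>_def)
  qed
  have \<psi>_inj: "h = h'" if "h \<in> ?S" "h' \<in> ?S" "\<psi> h (\<beta> \<tau>) = \<psi> h' (\<beta> \<tau>)" "\<tau> \<in> ?S" for h h' \<tau>
    using that cancel[OF that(1,2,4)] comp ib'(1) \<psi>\<beta> by metis
  have \<psi>_perm: "\<psi> h permutes {1..N}" if h: "h \<in> ?S" for h
  proof -
    obtain k where k: "k \<in> ?S" "compose L k h = e" using quot[OF h eS] by blast
    have "compose L (compose L h k) h = compose L h (compose L k h)" by (rule assoc[OF h, symmetric])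
    also have "\<dots> = compose L e h" using k e_left[OF h] e_right[OF h] by simp
    finally have "compose L h k = e" using cancel[OF comp[OF h k(1)] eS h] by blast
    then have "\<psi> h \<circ> \<psi> k = id" "\<psi> k \<circ> \<psi> h = id" using \<psi>_comp h k \<psi>_e by metis+
    then have "bij (\<psi> h)" using o_bij by blast
    then show ?thesis unfolding permutes_def bij_iff by (auto simp: \<psi>_def)
  qed
  define H where "H = \<psi> ` ?S"
  interpret Sym: group "sym_group N" by (rule sym_group_is_group)
  have sub: "subgroup H (sym_group N)"
  proof (rule Sym.subgroupI)
    show "H \<subseteq> carrier (sym_group N)" using \<psi>_perm by (auto simp: H_def sym_group_def)
    show "H \<noteq> {}" using eS by (auto simp: H_def)
    fix a assume "a \<in> H"
    then obtain h where h: "h \<in> ?S" "a = \<psi> h" by (auto simp: H_def)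
    obtain k where k: "k \<in> ?S" "compose L k h = e" using quot[OF h(1) eS] by blast
    have "\<psi> k \<circ> \<psi> h = id" using \<psi>_comp[OF k(1) h(1)] k(2) \<psi>_e by simp
    then have "inv\<^bsub>sym_group N\<^esub> a = \<psi> k"
      using \<psi>_perm h k by (intro Sym.inv_equality) (auto simp: sym_group_def)
    then show "inv\<^bsub>sym_group N\<^esub> a \<in> H" using k by (auto simp: H_def)
    fix b assume "b \<in> H"
    then obtain h' where h': "h' \<in> ?S" "b = \<psi> h'" by (auto simp: H_def)
    show "a \<otimes>\<^bsub>sym_group N\<^esub> b \<in> H"
      using \<psi>_comp[OF h(1) h'(1)] comp[OF h(1) h'(1)] h h' by (auto simp: H_def sym_group_def simp flip: \<psi>_comp)
  qed
  have "\<exists>g\<in>H. g i = j" if "i \<in> {1..N}" "j \<in> {1..N}" for i j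
  proof -
    obtain h where "h \<in> ?S" "compose L h (ib i) = ib j" using quot[OF ib(1) ib(1)] \<open>i \<in> {1..N}\<close> \<open>j \<in> {1..N}\<close> by blast
    then show ?thesis using that ib(2)[OF that(2)] by (intro bexI[of _ "\<psi> h"]) (auto simp: \<psi>_def H_def)
  qed
  then have trans: "transitive_group N H" using sub by (simp add: transitive_group_def)
  \<comment> \<open>As \<open>L\<close> is its own Galois closure, the action in
    \<open>has_gal\<close> is the translation action just numbered.\<close>
  have "L = galois_closure F L" using galois_closure_eq_hull[OF fld_F] hull_stable[OF st] by simp
  moreover have "\<psi> \<in> iso (gal_group F L) (sym_group N\<lparr>carrier := H\<rparr>)"
  proof -
    have c: "carrier (gal_group F L) = ?S" by (rule carrier_gal_group[OF fld_F st])
    have "?S \<subseteq> Bij L" using c by (auto simp: gal_group_def)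
    then have mult: "h \<otimes>\<^bsub>gal_group F L\<^esub> h' = compose L h h'" if "h \<in> ?S" "h' \<in> ?S" for h h'
      using that by (auto simp: gal_group_def BijGroup_def)
    have "inj_on \<psi> ?S" using \<psi>_inj[OF _ _ _ eS] by (auto simp: inj_on_def)
    then show ?thesis
      unfolding iso_def hom_def c using mult \<psi>_comp
      by (auto simp: H_def sym_group_def bij_betw_def)
  qed
  moreover have "embeddings F L L = ?S" using stable_embeddings[OF fld_F st] by simp
  ultimately have gal: "has_gal F L N H"
    unfolding has_gal_def perm_isomorphic_def using \<beta> \<psi>\<beta> carrier_gal_group[OF fld_F st]
    by (metis (no_types, lifting))
  have "H - {id} \<noteq> {}"
  proof -
    have "inj_on \<psi> ?S" using \<psi>_inj[OF _ _ _ eS] by (auto simp: inj_on_def)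
    then have "card H = N" using N(1) by (simp add: H_def card_image)
    then show ?thesis using N(2) by (metis Diff_eq_empty_iff card_mono finite.emptyI finite_insert card.insert_remove card.empty empty_Diff not_less One_nat_def)
  qed
  moreover have "N \<le> 2 * perm_index N g" if g: "g \<in> H - {id}" for g
  proof (rule fixpoint_free_index)
    obtain h where h: "h \<in> ?S" "g = \<psi> h" using g by (auto simp: H_def)
    show "g permutes {1..N}" using \<psi>_perm h by simp
    show "g i \<noteq> i" if "i \<in> {1..N}" for i
    proof
      assume "g i = i"
      then have "\<psi> h (\<beta> (ib i)) = \<psi> e (\<beta> (ib i))" using ib(2)[OF that] h(2) \<psi>_e by simp
      then have "h = e" using \<psi>_inj[OF h(1) eS _ ib(1)[OF that]] by blast
      then show False using g h(2) \<psi>_e by simp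
    qed
  qed
  moreover have "finite H" using fin by (simp add: H_def)
  ultimately have "N \<le> 2 * group_index N H"
  proof -
    have "group_index N H \<in> perm_index N ` (H - {id})"
      unfolding group_index_def using \<open>finite H\<close> \<open>H - {id} \<noteq> {}\<close> by (intro Min_in) auto
    then obtain g where "g \<in> H - {id}" "group_index N H = perm_index N g" by blast
    then show ?thesis using \<open>\<And>g. g \<in> H - {id} \<Longrightarrow> N \<le> 2 * perm_index N g\<close>[of g] by simp
  qed
  then show thesis using that trans gal by blast
qed

end

section \<open>Counting powerful numbers\<close>

definition powerful :: "nat \<Rightarrow> nat \<Rightarrow> bool" where
  "powerful a D \<longleftrightarrow> D > 0 \<and> (\<forall>p. prime p \<longrightarrow> p dvd D \<longrightarrow> p ^ a dvd D)"

text \<open>The exponents are \<open>a, ..., a + J - 1\<close>. For \<open>J = a\<close> all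
  \<open>a\<close>-powerful numbers are included; a variable \<open>J\<close> allows counting by
  induction on the number of factors.\<close>

definition power_products :: "nat \<Rightarrow> nat \<Rightarrow> nat set" where
  "power_products a J = {\<Prod>j<J. v j ^ (a + j) |v :: nat \<Rightarrow> nat. \<forall>j. v j > 0}"

lemma power_products_mult:
  assumes "x \<in> power_products a J" "y \<in> power_products a J"
  shows "x * y \<in> power_products a J"
proof -
  obtain v w where "\<forall>j. v j > 0" "x = (\<Prod>j<J. v j ^ (a + j))" "\<forall>j. w j > 0" "y = (\<Prod>j<J. w j ^ (a + j))"
    using assms by (auto simp: power_products_def)
  then have "\<forall>j. v j * w j > 0" "x * y = (\<Prod>j<J. (v j * w j) ^ (a + j))"
    by (simp_all add: power_mult_distrib prod.distrib)
  then show ?thesis unfolding power_products_def by (intro CollectI exI[of _ "\<lambda>j. v j * w j"]) simp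
qed

lemma power_products_base:
  assumes "y > 0" "j < J"
  shows "y ^ (a + j) \<in> power_products a J"
proof -
  have "(\<Prod>i<J. ((\<lambda>_. 1)(j := y)) i ^ (a + i)) = (\<Prod>i<J. if i = j then y ^ (a + j) else 1)"
    by (intro prod.cong) auto
  also have "\<dots> = y ^ (a + j)" using assms(2) by simp
  finally show ?thesis
    using assms(1) unfolding power_products_def by (intro CollectI exI[of _ "(\<lambda>_. 1)(j := y)"]) simp
qed

text \<open>A prime power with exponent \<open>e \<ge> a\<close> is split as
  \<open>(p ^ q) ^ a * p ^ (a + j)\<close> with \<open>j < a\<close>. One block of length
  \<open>a\<close> is kept back for the second factor, whence
  \<open>q = e div a - 1\<close>.\<close>

lemma powerful_power_products:
  assumes a: "a > 0" and D: "powerful a D"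
  shows "D \<in> power_products a a"
  using D
proof (induction D rule: less_induct)
  case (less D)
  show ?case
  proof (cases "D = 1")
    case True
    then show ?thesis
      unfolding power_products_def by (intro CollectI exI[of _ "\<lambda>_. 1"]) simp
  next
    case False
    then obtain p where p: "prime p" "p dvd D" using prime_factor_nat by blast
    have "D > 0" using less.prems by (simp add: powerful_def)
    define e where "e = multiplicity p D"
    obtain D' where D': "D = p ^ e * D'" "\<not> p dvd D'"
      using multiplicity_decompose'[of D p] \<open>D > 0\<close> not_prime_unit p(1) unfolding e_def by blast
    have "a \<le> e"
      unfolding e_def using less.prems p \<open>D > 0\<close> by (intro multiplicity_geI) (auto simp: powerful_def)
    have "D' > 0" using D' \<open>D > 0\<close> by (intro Nat.gr0I) auto
    have "powerful a D'"
      unfolding powerful_def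
    proof (intro conjI allI impI)
      fix q assume q: "prime q" "q dvd D'"
      then have "q \<noteq> p" using D'(2) by auto
      then have "coprime (q ^ a) (p ^ e)" using primes_coprime[OF q(1) p(1)] by simp
      moreover have "q ^ a dvd p ^ e * D'" using less.prems q D'(1) by (auto simp: powerful_def)
      ultimately show "q ^ a dvd D'" using coprime_dvd_mult_right_iff by blast
    qed (rule \<open>D' > 0\<close>)
    moreover have "p ^ e > 1" using \<open>a \<le> e\<close> a prime_gt_1_nat[OF p(1)] by (intro one_less_power) auto
    then have "D' < D" using \<open>D' > 0\<close> by (simp add: D'(1))
    ultimately have "D' \<in> power_products a a" using less.IH by blast
    moreover have "p ^ e \<in> power_products a a"
    proof -
      define q j where "q = e div a - 1" and "j = e mod a"
      have "e div a \<ge> 1" using \<open>a \<le> e\<close> a by (simp add: div_greater_zero_iff Suc_le_eq)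
      then have "a * (e div a) = a * q + a" by (simp add: q_def diff_mult_distrib2)
      moreover have "e = a * (e div a) + j" by (simp add: j_def)
      ultimately have e: "e = a * q + (a + j)" by simp
      have "j < a" using a by (simp add: j_def)
      have "p > 0" using p(1) by (rule prime_gt_0_nat)
      have "p ^ e = (p ^ q) ^ (a + 0) * p ^ (a + j)" by (simp add: e power_add power_mult[symmetric] mult.commute)
      then show ?thesis
        using power_products_base[of "p ^ q" 0 a a] power_products_base[of p j a a] \<open>j < a\<close> \<open>p > 0\<close> a
        by (simp add: power_products_mult)
    qed
    ultimately show ?thesis unfolding D'(1) by (intro power_products_mult)
  qed
qed

text \<open>The integral test in telescoping form: by the mean value theorem each term after the
  first is at most a difference of successive values of \<open>v powr (- s) / s\<close>.\<close>

lemma sum_powr_bound: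
  fixes s :: real
  assumes s: "s > 0"
  shows "(\<Sum>v\<in>{1..m}. real v powr (- s - 1)) \<le> 1 + 1 / s"
proof -
  have "(\<Sum>v\<in>{1..Suc m}. real v powr (- s - 1)) \<le> 1 + (1 - real (Suc m) powr (- s)) / s" for m
  proof (induction m)
    case (Suc m)
    let ?x = "real (Suc m)" and ?y = "real (Suc (Suc m))"
    have "\<exists>z. ?x < z \<and> z < ?y \<and> ?y powr (- s) - ?x powr (- s) = (?y - ?x) * (- s * z powr (- s - 1))"
      using has_real_derivative_powr[of _ "- s"] by (intro MVT2) auto
    then obtain z where z: "?x < z" "z < ?y" "?y powr (- s) - ?x powr (- s) = (?y - ?x) * (- s * z powr (- s - 1))"
      by blast
    have "s * ?y powr (- s - 1) \<le> s * z powr (- s - 1)"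
      using z s by (intro mult_left_mono powr_mono2') auto
    also have "\<dots> = ?x powr (- s) - ?y powr (- s)" using z(3) by simp
    finally have "?y powr (- s - 1) \<le> (?x powr (- s) - ?y powr (- s)) / s"
      using s by (simp add: pos_le_divide_eq mult.commute)
    moreover have "(1 - ?x powr (- s)) / s + (?x powr (- s) - ?y powr (- s)) / s = (1 - ?y powr (- s)) / s"
      by (simp flip: add_divide_distrib)
    moreover have "(\<Sum>v\<in>{1..Suc (Suc m)}. real v powr (- s - 1)) =
        (\<Sum>v\<in>{1..Suc m}. real v powr (- s - 1)) + ?y powr (- s - 1)" by simp
    ultimately show ?case using Suc by linarith
  qed simp
  moreover have "(1 - real (Suc m) powr (- s)) / s \<le> 1 / s" for m
    using s by (intro divide_right_mono) auto
  ultimately have "(\<Sum>v\<in>{1..Suc m}. real v powr (- s - 1)) \<le> 1 + 1 / s" for m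
    by (meson add_left_mono order_trans)
  then show ?thesis using s by (cases m) auto
qed

text \<open>Fixing the base \<open>v\<close> of the last factor leaves a count up to
  \<open>x / v ^ k\<close> with one factor less. Its exponent \<open>k\<close> exceeds
  \<open>a\<close>, so the sum of \<open>v powr (- k / a)\<close> over all \<open>v\<close>
  converges and costs only a constant.\<close>

lemma power_products_count:
  assumes a: "a > 0"
  shows "\<exists>C\<ge>0. \<forall>x\<ge>0. finite {D \<in> power_products a (Suc J). real D \<le> x} \<and>
    real (card {D \<in> power_products a (Suc J). real D \<le> x}) \<le> C * x powr (1 / real a)"
proof (induction J)
  case 0
  have "{D \<in> power_products a (Suc 0). real D \<le> x} \<subseteq> (\<lambda>v. v ^ a) ` {1..nat \<lfloor>x powr (1 / real a)\<rfloor>}"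
    if "x \<ge> 0" for x :: real
  proof
    fix D assume "D \<in> {D \<in> power_products a (Suc 0). real D \<le> x}"
    then obtain w :: "nat \<Rightarrow> nat" where w: "\<forall>j. w j > 0" "D = w 0 ^ a" "real D \<le> x"
      by (auto simp: power_products_def)
    define v where "v = w 0"
    have v: "v > 0" "D = v ^ a" "real D \<le> x" using w by (simp_all add: v_def)
    have "real v = (real v ^ a) powr (1 / real a)"
      using v(1) a by (simp add: powr_realpow [symmetric] powr_powr)
    also have "\<dots> \<le> x powr (1 / real a)" using v by (intro powr_mono2) auto
    finally have "v \<le> nat \<lfloor>x powr (1 / real a)\<rfloor>" by (simp add: le_nat_floor)
    then show "D \<in> (\<lambda>v. v ^ a) ` {1..nat \<lfloor>x powr (1 / real a)\<rfloor>}" using v by auto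
  qed
  note sub = this
  have "finite {D \<in> power_products a (Suc 0). real D \<le> x} \<and>
      real (card {D \<in> power_products a (Suc 0). real D \<le> x}) \<le> 1 * x powr (1 / real a)" if x: "x \<ge> 0" for x
  proof
    show "finite {D \<in> power_products a (Suc 0). real D \<le> x}" using sub[OF x] by (rule finite_subset) simp
    have "card {D \<in> power_products a (Suc 0). real D \<le> x} \<le> card ((\<lambda>v. v ^ a) ` {1..nat \<lfloor>x powr (1 / real a)\<rfloor>})"
      using sub[OF x] by (intro card_mono) auto
    also have "\<dots> \<le> card {1..nat \<lfloor>x powr (1 / real a)\<rfloor>}" by (intro card_image_le) simp
    also have "\<dots> = nat \<lfloor>x powr (1 / real a)\<rfloor>" by simp
    finally show "real (card {D \<in> power_products a (Suc 0). real D \<le> x}) \<le> 1 * x powr (1 / real a)"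
      by (simp add: le_floor_iff nat_le_iff) (metis le_floor_iff nat_floor_neg of_int_of_nat_eq le_nat_iff of_nat_0_le_iff powr_ge_zero zero_le_floor)
  qed
  then show ?case by (intro exI[of _ 1]) auto
next
  case (Suc J)
  let ?S = "\<lambda>J x. {D \<in> power_products a (Suc J). real D \<le> x}"
  obtain C where C: "C \<ge> 0" "\<And>x. x \<ge> 0 \<Longrightarrow> finite (?S J x)"
    "\<And>x. x \<ge> 0 \<Longrightarrow> real (card (?S J x)) \<le> C * x powr (1 / real a)" using Suc by blast
  define k where "k = a + Suc J"
  define t where "t = - (real k / real a)"
  have "t < - 1" using a by (simp add: t_def k_def field_simps)
  define Z where "Z = 1 + 1 / (- t - 1)"
  have Z: "Z \<ge> 0" using \<open>t < - 1\<close> by (simp add: Z_def)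
  have sum: "(\<Sum>v\<in>{1..m}. real v powr t) \<le> Z" for m
    using sum_powr_bound[of "- t - 1" m] \<open>t < - 1\<close> by (simp add: Z_def)
  have "finite (?S (Suc J) x) \<and> real (card (?S (Suc J) x)) \<le> (C * Z) * x powr (1 / real a)" if x: "x \<ge> 0" for x
  proof -
    define T where "T v = (\<lambda>w. w * v ^ k) ` ?S J (x / real v ^ k)" for v :: nat
    have fT: "finite (T v)" for v unfolding T_def using C(2)[of "x / real v ^ k"] x by simp
    have sub: "?S (Suc J) x \<subseteq> (\<Union>v\<in>{1..nat \<lfloor>x\<rfloor>}. T v)"
    proof
      fix D assume "D \<in> ?S (Suc J) x"
      then obtain v :: "nat \<Rightarrow> nat" where v: "\<forall>j. v j > 0" "D = (\<Prod>j<Suc (Suc J). v j ^ (a + j))" "real D \<le> x"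
        by (auto simp: power_products_def)
      define w where "w = (\<Prod>j<Suc J. v j ^ (a + j))"
      have D: "D = w * v (Suc J) ^ k" by (simp add: v(2) w_def k_def)
      have "w > 0" unfolding w_def using v(1) by (intro prod_pos) auto
      have "w \<in> power_products a (Suc J)" unfolding power_products_def w_def using v(1) by blast
      moreover have "real w \<le> x / real (v (Suc J)) ^ k"
        using v(1,3) D by (simp add: pos_le_divide_eq)
      ultimately have "D \<in> T (v (Suc J))" unfolding T_def D by blast
      moreover have "v (Suc J) \<le> v (Suc J) ^ k" using v(1) by (intro self_le_power) (auto simp: Suc_le_eq k_def)
      then have "v (Suc J) \<le> D" using \<open>w > 0\<close> D by (metis One_nat_def Suc_leI dual_order.trans mult_le_mono1 nat_mult_1)
      then have "real (v (Suc J)) \<le> x" using v(3) by linarith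
      then have "v (Suc J) \<in> {1..nat \<lfloor>x\<rfloor>}" using v(1) by (simp add: Suc_le_eq le_nat_floor)
      ultimately show "D \<in> (\<Union>v\<in>{1..nat \<lfloor>x\<rfloor>}. T v)" by blast
    qed
    have "finite (?S (Suc J) x)" using sub fT by (meson finite_UN finite_atLeastAtMost finite_subset)
    have "card (?S (Suc J) x) \<le> card (\<Union>v\<in>{1..nat \<lfloor>x\<rfloor>}. T v)" using sub fT by (intro card_mono) auto
    also have "\<dots> \<le> (\<Sum>v\<in>{1..nat \<lfloor>x\<rfloor>}. card (T v))" by (rule card_UN_le) simp
    also have "real \<dots> \<le> (\<Sum>v\<in>{1..nat \<lfloor>x\<rfloor>}. C * x powr (1 / real a) * real v powr t)"
      unfolding of_nat_sum
    proof (rule sum_mono)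
      fix v assume v: "v \<in> {1..nat \<lfloor>x\<rfloor>}"
      have "real (card (T v)) \<le> real (card (?S J (x / real v ^ k)))"
        unfolding T_def using C(2)[of "x / real v ^ k"] x by (simp add: card_image_le)
      also have "\<dots> \<le> C * (x / real v ^ k) powr (1 / real a)" using C(3) x by simp
      also have "(x / real v ^ k) powr (1 / real a) = x powr (1 / real a) * real v powr t"
      proof -
        have "(x / real v ^ k) powr (1 / real a) = x powr (1 / real a) / (real v ^ k) powr (1 / real a)"
          by (rule powr_divide)
        also have "(real v ^ k) powr (1 / real a) = real v powr (real k / real a)"
          using v by (simp add: powr_realpow [symmetric] powr_powr)
        finally show ?thesis by (simp add: t_def powr_minus divide_inverse)
      qed
      finally show "real (card (T v)) \<le> C * x powr (1 / real a) * real v powr t" by (simp add: mult.assoc)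
    qed
    also have "\<dots> = C * x powr (1 / real a) * (\<Sum>v\<in>{1..nat \<lfloor>x\<rfloor>}. real v powr t)"
      by (simp add: sum_distrib_left)
    also have "\<dots> \<le> C * x powr (1 / real a) * Z"
      using C(1) by (intro mult_left_mono sum) auto
    finally have "real (card (?S (Suc J) x)) \<le> (C * Z) * x powr (1 / real a)" by (simp add: mult_ac)
    then show ?thesis using \<open>finite (?S (Suc J) x)\<close> by blast
  qed
  then show ?case using C(1) Z by (intro exI[of _ "C * Z"]) auto
qed

lemma powerful_count:
  assumes a: "a > 0"
  obtains C where "C \<ge> 0" "\<And>x. x \<ge> 0 \<Longrightarrow> finite {D. powerful a D \<and> real D \<le> x}"
    "\<And>x. x \<ge> 0 \<Longrightarrow> real (card {D. powerful a D \<and> real D \<le> x}) \<le> C * x powr (1 / real a)"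
proof -
  obtain C where C: "C \<ge> 0" "\<And>x. x \<ge> 0 \<Longrightarrow> finite {D \<in> power_products a (Suc (a - 1)). real D \<le> x}"
    "\<And>x. x \<ge> 0 \<Longrightarrow> real (card {D \<in> power_products a (Suc (a - 1)). real D \<le> x}) \<le> C * x powr (1 / real a)"
    using power_products_count[OF a, of "a - 1"] by blast
  have sub: "{D. powerful a D \<and> real D \<le> x} \<subseteq> {D \<in> power_products a (Suc (a - 1)). real D \<le> x}" for x
    using powerful_power_products[OF a] a by auto
  have "finite {D. powerful a D \<and> real D \<le> x}" if "x \<ge> 0" for x
    using sub C(2)[OF that] by (rule finite_subset)
  moreover have "real (card {D. powerful a D \<and> real D \<le> x}) \<le> C * x powr (1 / real a)" if "x \<ge> 0" for x
    using card_mono[OF C(2)[OF that] sub] C(3)[OF that] by linarith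
  ultimately show thesis using that C(1) by blast
qed

section \<open>Uniform bounds for discriminant multiplicities imply Malle's bound\<close>

lemma group_index_pos:
  assumes n: "n > 1" and G: "transitive_group n G"
  shows "group_index n G > 0"
proof -
  obtain g where g: "g \<in> G" "g 1 = 2" using G n by (force simp: transitive_group_def)
  then have "G - {id} \<noteq> {}" by auto
  then have "group_index n G \<in> perm_index n ` (G - {id})"
    unfolding group_index_def using transitive_groupD(2)[OF G] by (intro Min_in) auto
  then obtain h where h: "h \<in> G" "h \<noteq> id" "group_index n G = perm_index n h" by auto
  have perm: "h permutes {1..n}" using transitive_groupD(1)[OF G] h(1) by blast
  then have p: "permutation h" by (auto simp: permutation_permutes)
  obtain i where i: "h i \<noteq> i" using h(2) by fastforce
  then have "i \<in> {1..n}" "h i \<in> {1..n}" using perm permutes_in_image[OF perm, of i] by (auto simp: permutes_def)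
  moreover have "orbit h (h i) = orbit h i" by (rule permutation_orbit_step[OF p])
  ultimately have "\<not> inj_on (orbit h) {1..n}" using i unfolding inj_on_def by blast
  then have "card (orbit h ` {1..n}) \<noteq> card {1..n}" using inj_on_iff_eq_card[of "{1..n}" "orbit h"] by simp
  moreover have "card (orbit h ` {1..n}) \<le> card {1..n}" by (intro card_image_le) simp
  ultimately show ?thesis using h(3) by (simp add: perm_index_def)
qed

context number_base
begin

text \<open>The count of powerful numbers has the exact exponent \<open>1 / a\<close>, so the
  \<epsilon> of \<open>M\<close> is spent entirely on the number of fields per discriminant.\<close>

theorem DM_imp_M:
  assumes n: "n > 1" and G: "transitive_group n G" and DM: "DM C F n G"
  shows "M F n G"
proof -
  define a where "a = group_index n G"
  have a: "a > 0" unfolding a_def by (rule group_index_pos[OF n G])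
  obtain B where B: "B \<ge> 0" "\<And>x. x \<ge> 0 \<Longrightarrow> finite {D. powerful a D \<and> real D \<le> x}"
    "\<And>x. x \<ge> 0 \<Longrightarrow> real (card {D. powerful a D \<and> real D \<le> x}) \<le> B * x powr (1 / real a)"
    using powerful_count[OF a] by blast
  let ?D = "\<lambda>x. {D. powerful a D \<and> real D \<le> x}"
  have pw: "powerful a (Disc F E)" if "E \<in> gal_exts F n G" for E
    using that prime_power_dvd_Disc[OF _ G] Disc_pos by (auto simp: powerful_def gal_exts_def a_def)
  have eq: "exts_upto F n G x = (\<Union>D\<in>?D x. exts_with_disc F n G D)" for x
    using pw by (auto simp: exts_upto_def exts_with_disc_def)
  have fin_D: "finite (exts_with_disc F n G D)" if "powerful a D" for D
    using DM that by (auto simp: DM_def powerful_def)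
  have fin: "finite (exts_upto F n G x)" for x
  proof (cases "x \<ge> 0")
    case True
    then show ?thesis unfolding eq using B(2) fin_D by (intro finite_UN_I) auto
  next
    case False
    then have "exts_upto F n G x = {}" by (auto simp: exts_upto_def)
    then show ?thesis by simp
  qed
  have "(\<lambda>x. real (card (exts_upto F n G x))) \<in> O(\<lambda>x. x powr (1 / real a + \<epsilon>))" if \<epsilon>: "\<epsilon> > 0" for \<epsilon>
  proof (rule bigoI)
    show "\<forall>\<^sub>F x in at_top. norm (real (card (exts_upto F n G x))) \<le> (\<bar>C \<epsilon> n\<bar> * B) * norm (x powr (1 / real a + \<epsilon>))"
    proof (rule eventually_mono[OF eventually_ge_at_top[of 1]])
      fix x :: real assume x: "x \<ge> 1"
      have "real (card (exts_upto F n G x)) \<le> real (\<Sum>D\<in>?D x. card (exts_with_disc F n G D))"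
        unfolding eq using B(2) x by (intro of_nat_mono card_UN_le) auto
      also have "\<dots> \<le> (\<Sum>D\<in>?D x. \<bar>C \<epsilon> n\<bar> * x powr \<epsilon>)"
        unfolding of_nat_sum
      proof (rule sum_mono)
        fix D assume D: "D \<in> ?D x"
        then have "real (card (exts_with_disc F n G D)) \<le> C \<epsilon> n * real D powr \<epsilon>"
          using DM \<epsilon> by (auto simp: DM_def powerful_def)
        \<comment> \<open>The sign of \<open>C \<epsilon> n\<close> is not prescribed, hence the
          absolute value.\<close>
        also have "\<dots> \<le> \<bar>C \<epsilon> n\<bar> * real D powr \<epsilon>" by (intro mult_right_mono) auto
        also have "\<dots> \<le> \<bar>C \<epsilon> n\<bar> * x powr \<epsilon>" using D \<epsilon> by (intro mult_left_mono powr_mono2) auto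
        finally show "real (card (exts_with_disc F n G D)) \<le> \<bar>C \<epsilon> n\<bar> * x powr \<epsilon>" .
      qed
      also have "\<dots> = real (card (?D x)) * (\<bar>C \<epsilon> n\<bar> * x powr \<epsilon>)" by simp
      also have "\<dots> \<le> (B * x powr (1 / real a)) * (\<bar>C \<epsilon> n\<bar> * x powr \<epsilon>)"
        using B(3) x by (intro mult_right_mono) auto
      also have "\<dots> = (\<bar>C \<epsilon> n\<bar> * B) * x powr (1 / real a + \<epsilon>)" by (simp add: powr_add)
      finally show "norm (real (card (exts_upto F n G x))) \<le> (\<bar>C \<epsilon> n\<bar> * B) * norm (x powr (1 / real a + \<epsilon>))"
        by simp
    qed
  qed
  then show ?thesis using fin by (simp add: M_def a_def)
qed

section \<open>Malle's bound implies uniform bounds for discriminant multiplicities\<close>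

text \<open>An embedding of the hull is determined by its restrictions to the Galois closures of the
  \<open>E i\<close>, each of which has at most \<open>n!\<close> embeddings. For the injectivity,
  the quotient of two automorphisms with equal restrictions is trivial on all conjugates of the
  \<open>E i\<close>.\<close>

lemma card_embs_hull_le:
  assumes E: "\<And>i. i \<in> I \<Longrightarrow> ext_of_degree F n (E i)" and G: "transitive_group n G"
    and gal: "\<And>i. i \<in> I \<Longrightarrow> has_gal F (E i) n G" and I: "finite I"
  defines "L \<equiv> galois_hull F (\<Union>i\<in>I. E i)"
  shows "finite (embs F L)" "card (embs F L) \<le> fact n ^ card I"
proof -
  have st: "stable F L" unfolding L_def by (rule stable_hull[OF fld_F])
  let ?K = "\<lambda>i. galois_hull F (E i)"
  have stK: "stable F (?K i)" for i by (rule stable_hull[OF fld_F])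
  have KL: "?K i \<subseteq> L" if "i \<in> I" for i
    using hull_minimal[OF st] subset_hull[of "\<Union>i\<in>I. E i" F] that unfolding L_def by blast
  have emb_K: "finite (embs F (?K i))" "card (embs F (?K i)) \<le> fact n" if i: "i \<in> I" for i
  proof -
    obtain \<psi> \<beta> where \<psi>: "bij_betw \<psi> (embs F (?K i)) G"
      using has_galE[OF E[OF i] G gal[OF i]] by metis
    show "finite (embs F (?K i))" using \<psi> transitive_groupD(2)[OF G] bij_betw_finite by blast
    have "card G \<le> card {p. p permutes {1..n}}"
      using transitive_groupD(1)[OF G] by (intro card_mono finite_permutations) auto
    then show "card (embs F (?K i)) \<le> fact n"
      using bij_betw_same_card[OF \<psi>] card_permutations[of "{1..n}" n] by simp
  qed
  define f where "f \<tau> = (\<lambda>i\<in>I. restrict \<tau> (?K i))" for \<tau> :: "'a \<Rightarrow> 'a"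
  let ?Pi = "PiE I (\<lambda>i. embs F (?K i))"
  have lift: "\<exists>\<sigma>\<in>Aut F. \<tau> = restrict \<sigma> L" if "\<tau> \<in> embs F L" for \<tau>
    using embs_lift[OF fld_F stableD(1,2)[OF st] that] by metis
  have res: "restrict (restrict \<sigma> L) (?K i) = restrict \<sigma> (?K i)" if "i \<in> I" for \<sigma> i
    using KL[OF that] by (auto simp: fun_eq_iff)
  have sub: "f ` embs F L \<subseteq> ?Pi"
  proof (rule image_subsetI)
    fix \<tau> assume "\<tau> \<in> embs F L"
    then obtain \<sigma> where \<sigma>: "\<sigma> \<in> Aut F" "\<tau> = restrict \<sigma> L" using lift by blast
    show "f \<tau> \<in> ?Pi"
      using \<sigma> res embs_eq[OF fld_F stableD(1,2)[OF stK]] by (auto simp: f_def)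
  qed
  have inj: "inj_on f (embs F L)"
  proof (rule inj_onI)
    fix \<tau> \<tau>' assume *: "\<tau> \<in> embs F L" "\<tau>' \<in> embs F L" "f \<tau> = f \<tau>'"
    obtain \<sigma> \<sigma>' where s: "\<sigma> \<in> Aut F" "\<tau> = restrict \<sigma> L" "\<sigma>' \<in> Aut F" "\<tau>' = restrict \<sigma>' L"
      using lift *(1,2) by metis
    have eq: "\<sigma> x = \<sigma>' x" if "i \<in> I" "x \<in> ?K i" for i x
    proof -
      have "f \<tau> i x = f \<tau>' i x" using *(3) by simp
      then show ?thesis using that KL[OF that(1)] by (auto simp: f_def s(2,4) subset_iff)
    qed
    let ?g = "inv_into UNIV \<sigma>' \<circ> \<sigma>"
    have g: "?g \<in> Aut F" using comp_Aut[OF inv_Aut[OF s(3)] s(1)] .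
    have "?g x = x" if "x \<in> L" for x
    proof (rule Aut_trivial_on_hull[OF fld_F g _ that[unfolded L_def]])
      fix \<rho> x assume \<rho>: "\<rho> \<in> Aut F" and "x \<in> (\<Union>i\<in>I. E i)"
      then obtain i where i: "i \<in> I" "x \<in> E i" by blast
      then have "\<rho> x \<in> ?K i" using stableD(3)[OF stK \<rho>] subset_hull[of "E i" F] by blast
      then show "?g (\<rho> x) = \<rho> x" using eq[OF i(1)] Aut_inv_simps[OF s(3)] by simp
    qed
    then have "\<sigma> x = \<sigma>' x" if "x \<in> L" for x using that Aut_inv_simps(1)[OF s(3)] by (metis comp_apply)
    then show "\<tau> = \<tau>'" by (auto simp: s(2,4))
  qed
  have finPi: "finite ?Pi" using I emb_K(1) by (intro finite_PiE) auto
  show fin: "finite (embs F L)" using inj_on_finite[OF inj sub finPi] .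
  have "card (embs F L) \<le> card ?Pi" using card_inj_on_le[OF inj sub finPi] .
  also have "\<dots> = (\<Prod>i\<in>I. card (embs F (?K i)))" using I by (rule card_PiE)
  also have "\<dots> \<le> (\<Prod>i\<in>I. fact n)" using emb_K(2) by (intro prod_mono) auto
  finally show "card (embs F L) \<le> fact n ^ card I" by simp
qed

text \<open>An inertia element of the hull at \<open>P\<close> moves a conjugate of an element of
  some \<open>E i\<close>. Composing with it gives two different but congruent embeddings of that
  \<open>E i\<close>, so all its discriminants lie in \<open>P\<close>, and with them
  \<open>D\<close>.\<close>

lemma disc_ideal_hull:
  assumes E: "\<And>i. i \<in> I \<Longrightarrow> ext_of_degree F n (E i)"
    and L: "L = galois_hull F (\<Union>i\<in>I. E i)" "ext_of_degree F N L"
    and D: "\<And>i. i \<in> I \<Longrightarrow> Disc F (E i) = D"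
    and P: "max_ideal OF P" "disc_ideal F L \<subseteq> P"
  shows "of_nat D \<in> P"
proof -
  have st: "stable F L" unfolding L(1) by (rule stable_hull[OF fld_F])
  obtain s where "number_ext F deg L N s" using ext_list[OF L(2)] .
  then interpret L: number_ext ty F deg L N s .
  obtain MM where MM: "max_ideal algebraic_ints MM" "MM \<inter> OF = P" using lying_over[OF P(1)] .
  have "integral_basis_discs F L \<subseteq> P" using discs_subset_disc_ideal[OF discs_OF[OF L(2)]] P(2) by blast
  then obtain g where g: "g \<in> Aut F" "\<And>x. x \<in> ring_of_integers L \<Longrightarrow> g x - x \<in> MM" "\<exists>x\<in>L. g x \<noteq> x"
    using L.inertia_element[OF P(1) _ MM st order_refl finite_embs[OF fld_F L(2)]] by metis
  have "\<exists>\<rho>\<in>Aut F. \<exists>x\<in>(\<Union>i\<in>I. E i). g (\<rho> x) \<noteq> \<rho> x"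
    using Aut_trivial_on_hull[OF fld_F g(1), of "\<Union>i\<in>I. E i"] g(3) unfolding L(1) by blast
  then obtain \<rho> i x where \<rho>: "\<rho> \<in> Aut F" "i \<in> I" "x \<in> E i" "g (\<rho> x) \<noteq> \<rho> x" by blast
  note Ei = ext_of_degreeD[OF fld_F E[OF \<rho>(2)]]
  have EL: "E i \<subseteq> L" using subset_hull[of "\<Union>i\<in>I. E i" F] \<rho>(2) unfolding L(1) by blast
  have "integral_basis_discs F (E i) \<subseteq> P"
  proof
    fix d assume d: "d \<in> integral_basis_discs F (E i)"
    then obtain s b where s: "number_ext F deg (E i) n s" "\<And>j. j < n \<Longrightarrow> b j \<in> ring_of_integers (E i)"
      "d = (number_ext.emb_det n s b)\<^sup>2" using disc_cases[OF E[OF \<rho>(2)]] by metis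
    interpret E: number_ext ty F deg "E i" n s by (rule s(1))
    have mem: "restrict \<rho> (E i) \<in> set s" "restrict (g \<circ> \<rho>) (E i) \<in> set s"
      using \<rho>(1) comp_Aut[OF g(1) \<rho>(1)] unfolding E.s(2) embs_eq[OF fld_F Ei(1,2)] by auto
    then obtain a c where ac: "a < n" "s ! a = restrict (g \<circ> \<rho>) (E i)" "c < n" "s ! c = restrict \<rho> (E i)"
      using E.length_s by (metis in_set_conv_nth)
    have "restrict (g \<circ> \<rho>) (E i) x \<noteq> restrict \<rho> (E i) x" using \<rho>(3,4) by simp
    then have "a \<noteq> c" using ac(2,4) by metis
    have "(s ! a) y - (s ! c) y \<in> MM" if y: "y \<in> ring_of_integers (E i)" for y
    proof -
      have "\<rho> y \<in> ring_of_integers L"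
        using y stableD(3)[OF st \<rho>(1)] EL algebraic_int_Aut[OF \<rho>(1)] by (auto simp: ring_of_integers_def)
      from g(2)[OF this] show ?thesis using y by (simp add: ac ring_of_integers_def)
    qed
    then have "d \<in> MM" unfolding s(3) using E.disc_mem_of_congruent[OF MM(1) ac(1,3) \<open>a \<noteq> c\<close>] s(2) by blast
    moreover have "d \<in> OF" using discs_OF[OF E[OF \<rho>(2)]] d by blast
    ultimately show "d \<in> P" using MM(2) by blast
  qed
  then have "disc_ideal F (E i) \<subseteq> P"
    using disc_ideal_subset[OF discs_OF[OF E[OF \<rho>(2)]] P_ideal[OF P(1)]] by blast
  then show ?thesis using Disc_mem_disc_ideal[OF E[OF \<rho>(2)]] D[OF \<rho>(2)] by auto
qed

lemma Disc_hull_le: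
  assumes E: "\<And>i. i \<in> I \<Longrightarrow> ext_of_degree F n (E i)"
    and L: "L = galois_hull F (\<Union>i\<in>I. E i)" "ext_of_degree F N L"
    and D: "\<And>i. i \<in> I \<Longrightarrow> Disc F (E i) = D" "D > 0"
  shows "Disc F L \<le> ((D * N) ^ N) ^ deg"
proof -
  have st: "stable F L" unfolding L(1) by (rule stable_hull[OF fld_F])
  obtain s where "number_ext F deg L N s" using ext_list[OF L(2)] .
  then interpret number_ext ty F deg L N s .
  interpret normal_ext ty F deg L N s by unfold_locales (rule stableD(3)[OF st])
  have "of_nat ((D * N) ^ N) \<in> disc_ideal F L"
    using disc_ideal_contains[OF D(2)] disc_ideal_hull[where I = I and E = E and D = D, OF assms(1-4)] by blast
  then show ?thesis using Disc_le[OF L(2)] D(2) n_pos by simp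
qed

text \<open>An intermediate field is determined by the embeddings that fix it.\<close>

lemma card_subfields_le:
  assumes st: "stable F L" and fin: "finite (embs F L)"
  shows "finite {E. fld E \<and> F \<subseteq> E \<and> E \<subseteq> L}" "card {E. fld E \<and> F \<subseteq> E \<and> E \<subseteq> L} \<le> 2 ^ card (embs F L)"
proof -
  define fix' where "fix' E = {\<tau> \<in> embs F L. \<forall>x\<in>E. \<tau> x = x}" for E
  have E_eq: "E = {x \<in> L. \<forall>\<tau>\<in>fix' E. \<tau> x = x}" if E: "fld E" "F \<subseteq> E" "E \<subseteq> L" for E
  proof (intro equalityI subsetI)
    show "x \<in> {x \<in> L. \<forall>\<tau>\<in>fix' E. \<tau> x = x}" if "x \<in> E" for x using that E by (auto simp: fix'_def)
    fix x assume x: "x \<in> {x \<in> L. \<forall>\<tau>\<in>fix' E. \<tau> x = x}"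
    show "x \<in> E"
    proof (rule fixed_field_Aut[OF E(1)])
      fix \<sigma> assume \<sigma>: "\<sigma> \<in> Aut E"
      then have "\<sigma> \<in> Aut F" using Aut_mono[OF E(2)] by blast
      then have "restrict \<sigma> L \<in> fix' E"
        using embs_eq[OF fld_F stableD(1,2)[OF st]] E(3) AutD(3)[OF \<sigma>] by (auto simp: fix'_def subset_iff)
      then show "\<sigma> x = x" using x by force
    qed
  qed
  have inj: "inj_on fix' {E. fld E \<and> F \<subseteq> E \<and> E \<subseteq> L}"
  proof (rule inj_onI)
    fix E E' assume *: "E \<in> {E. fld E \<and> F \<subseteq> E \<and> E \<subseteq> L}" "E' \<in> {E. fld E \<and> F \<subseteq> E \<and> E \<subseteq> L}" "fix' E = fix' E'"
    have "E = {x \<in> L. \<forall>\<tau>\<in>fix' E. \<tau> x = x}" "E' = {x \<in> L. \<forall>\<tau>\<in>fix' E'. \<tau> x = x}"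
      using E_eq *(1,2) by auto
    then show "E = E'" using *(3) by simp
  qed
  have sub: "fix' ` {E. fld E \<and> F \<subseteq> E \<and> E \<subseteq> L} \<subseteq> Pow (embs F L)" by (auto simp: fix'_def)
  show "finite {E. fld E \<and> F \<subseteq> E \<and> E \<subseteq> L}" using inj_on_finite[OF inj sub] fin by simp
  show "card {E. fld E \<and> F \<subseteq> E \<and> E \<subseteq> L} \<le> 2 ^ card (embs F L)"
    using card_inj_on_le[OF inj sub] fin by (simp add: card_Pow)
qed

text \<open>The index bound makes Malle's exponent at most \<open>2 / N\<close>, and \<epsilon> is
  chosen as \<open>1 / N\<close>.\<close>

lemma M_bound:
  assumes "M F N H" "N > 0" "N \<le> 2 * group_index N H"
  obtains K where "K \<ge> 0" "\<And>x. x \<ge> 1 \<Longrightarrow> real (card (exts_upto F N H x)) \<le> K * x powr (3 / real N)"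
proof -
  define c where "c = 1 / real (group_index N H) + 1 / real N"
  have "real N \<le> 2 * real (group_index N H)" using assms(3) by linarith
  then have "c \<le> 3 / real N" using assms(2) by (simp add: c_def field_simps)
  have fin: "finite (exts_upto F N H x)" for x using assms(1) by (simp add: M_def)
  have "(\<lambda>x. real (card (exts_upto F N H x))) \<in> O(\<lambda>x. x powr c)"
    using assms(1,2) by (simp add: M_def c_def)
  then obtain k where k: "k > 0" "\<forall>\<^sub>F x in at_top. norm (real (card (exts_upto F N H x))) \<le> k * norm (x powr c)"
    by (elim landau_o.bigE) auto
  then obtain x0 where x0: "\<And>x. x \<ge> x0 \<Longrightarrow> real (card (exts_upto F N H x)) \<le> k * x powr c"
    by (auto simp: eventually_at_top_linorder)
  \<comment> \<open>Extends the asymptotic bound to all \<open>x \<ge> 1\<close>: below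
    \<open>x0\<close> the count is at most the one at \<open>x0\<close>.\<close>
  define K where "K = max k (real (card (exts_upto F N H x0)))"
  have "real (card (exts_upto F N H x)) \<le> K * x powr (3 / real N)" if x: "x \<ge> 1" for x
  proof (cases "x \<ge> x0")
    case True
    have "k * x powr c \<le> K * x powr (3 / real N)"
      using k(1) x \<open>c \<le> 3 / real N\<close> by (intro mult_mono powr_mono) (auto simp: K_def)
    then show ?thesis using x0[OF True] by linarith
  next
    case False
    have "card (exts_upto F N H x) \<le> card (exts_upto F N H x0)"
      using False fin by (intro card_mono) (auto simp: exts_upto_def)
    then have "real (card (exts_upto F N H x)) \<le> K * 1" by (simp add: K_def)
    also have "\<dots> \<le> K * x powr (3 / real N)"
      using x k(1) by (intro mult_left_mono ge_one_powr_ge_zero) (auto simp: K_def)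
    finally show ?thesis .
  qed
  moreover have "K \<ge> 0" using k(1) by (simp add: K_def)
  ultimately show thesis using that by blast
qed

text \<open>
  The hull of \<open>k\<close> fields of discriminant \<open>D\<close> has degree \<open>N \<le> (n!)\<^sup>k\<close> and discriminant at most
  \<open>(D N)\<^bsup>N deg\<^esup>\<close>, and the index of its regular Galois group is at least \<open>N / 2\<close>. So Malle's bound
  for the hulls is \<open>D\<^bsup>3 deg\<^esup>\<close> up to a constant, whatever \<open>k\<close> is, while a hull arises from boundedly
  many of the \<open>k\<close>-tuples.
\<close>

lemma tuple_bound:
  assumes M: "\<And>n G. n > 1 \<Longrightarrow> transitive_group n G \<Longrightarrow> M F n G" and n: "n > 1" and k: "k > 0"
  obtains K where "K \<ge> 0" "\<And>G D. transitive_group n G \<Longrightarrow> D > 0 \<Longrightarrow>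
    real (card (exts_with_disc F n G D)) ^ k \<le> K * real D ^ (3 * deg)"
proof -
  define B :: nat where "B = fact n ^ k"
  \<comment> \<open>The groups that hulls of degree \<open>N\<close> can have. They are finitely
    many, so the constants from Malle's bound can be summed; as no \<open>G\<close> enters, the
    result is uniform in \<open>G\<close>.\<close>
  define GG where "GG N = {H. transitive_group N H \<and> N \<le> 2 * group_index N H}" for N
  have "GG N \<subseteq> Pow {p. p permutes {1..N}}" for N
    using transitive_groupD(1) by (auto simp: GG_def)
  then have fin_GG: "finite (GG N)" for N
    using finite_permutations[of "{1..N}"] by (meson finite_Pow_iff finite_atLeastAtMost finite_subset)
  have "\<forall>N H. \<exists>K. N > 1 \<and> H \<in> GG N \<longrightarrow> K \<ge> 0 \<and> (\<forall>x\<ge>1. real (card (exts_upto F N H x)) \<le> K * x powr (3 / real N))"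
  proof (intro allI)
    fix N H
    show "\<exists>K. N > 1 \<and> H \<in> GG N \<longrightarrow> K \<ge> 0 \<and> (\<forall>x\<ge>1. real (card (exts_upto F N H x)) \<le> K * x powr (3 / real N))"
    proof (cases "N > 1 \<and> H \<in> GG N")
      case True
      then have "M F N H" "N > 0" "N \<le> 2 * group_index N H" using M by (auto simp: GG_def)
      from M_bound[OF this] show ?thesis by blast
    qed auto
  qed
  then obtain KK where KK: "\<And>N H. N > 1 \<Longrightarrow> H \<in> GG N \<Longrightarrow> KK N H \<ge> 0"
    "\<And>N H x. N > 1 \<Longrightarrow> H \<in> GG N \<Longrightarrow> x \<ge> 1 \<Longrightarrow> real (card (exts_upto F N H x)) \<le> KK N H * x powr (3 / real N)"
    by metis
  \<comment> \<open>The powers of \<open>N\<close> come from the discriminant bound. The last factor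
    bounds the tuples with a given hull: each of the \<open>k\<close> entries is one of at most
    \<open>2 ^ B\<close> intermediate fields.\<close>
  define K where "K = (\<Sum>N\<in>{2..B}. \<Sum>H\<in>GG N. KK N H * real N ^ (3 * deg)) * real ((2 ^ B) ^ k)"
  have "K \<ge> 0" unfolding K_def using KK(1) by (intro mult_nonneg_nonneg sum_nonneg) auto
  moreover have "real (card (exts_with_disc F n G D)) ^ k \<le> K * real D ^ (3 * deg)"
    if G: "transitive_group n G" and D: "D > 0" for G D
  proof -
    let ?W = "exts_with_disc F n G D"
    have "finite (exts_upto F n G (real D))" using M[OF n G] by (simp add: M_def)
    then have finW: "finite ?W" by (rule rev_finite_subset) (auto simp: exts_with_disc_def exts_upto_def)
    define T where "T = PiE {..<k} (\<lambda>_. ?W)"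
    define \<L> where "\<L> t = galois_hull F (\<Union>i\<in>{..<k}. t i)" for t :: "nat \<Rightarrow> 'a set"
    define Y where "Y N = real (((D * N) ^ N) ^ deg)" for N
    define U where "U = (\<Union>N\<in>{2..B}. \<Union>H\<in>GG N. exts_upto F N H (Y N))"
    have cardT: "card T = card ?W ^ k" by (simp add: T_def card_PiE)
    have finT: "finite T" unfolding T_def using finW by (intro finite_PiE) auto
    have hull: "\<L> t \<in> U \<and> card (embs F (\<L> t)) \<le> B \<and> finite (embs F (\<L> t)) \<and> stable F (\<L> t) \<and>
        (\<forall>i<k. fld (t i) \<and> F \<subseteq> t i \<and> t i \<subseteq> \<L> t)" if t: "t \<in> T" for t
    proof -
      have W: "ext_of_degree F n (t i)" "has_gal F (t i) n G" "Disc F (t i) = D" if "i \<in> {..<k}" for i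
        using t that by (auto simp: T_def exts_with_disc_def gal_exts_def dest: PiE_mem)
      have st: "stable F (\<L> t)" unfolding \<L>_def by (rule stable_hull[OF fld_F])
      define N where "N = card (embs F (\<L> t))"
      have fin: "finite (embs F (\<L> t))" and N_le: "N \<le> B"
        using card_embs_hull_le[of "{..<k}" n t G] W(1,2) G by (auto simp: \<L>_def N_def B_def)
      have fields: "\<forall>i<k. fld (t i) \<and> F \<subseteq> t i \<and> t i \<subseteq> \<L> t"
        using W(1) ext_of_degreeD[OF fld_F] subset_hull[of "\<Union>i\<in>{..<k}. t i" F] unfolding \<L>_def by blast
      \<comment> \<open>Restriction maps the embeddings of the hull onto the \<open>n\<close>
        embeddings of \<open>t 0\<close>. Hence \<open>N > 1\<close>, so the assumed bound covers
        the hull.\<close>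
      have "n \<le> N"
      proof -
        have t0: "fld (t 0)" "F \<subseteq> t 0" "t 0 \<subseteq> \<L> t" using fields k by auto
        have "embs F (t 0) \<subseteq> (\<lambda>\<tau>. restrict \<tau> (t 0)) ` embs F (\<L> t)"
        proof
          fix \<tau> assume "\<tau> \<in> embs F (t 0)"
          then obtain \<sigma> where \<sigma>: "\<sigma> \<in> Aut F" "\<tau> = restrict \<sigma> (t 0)" using embs_lift[OF fld_F t0(1,2)] by metis
          then have "restrict \<sigma> (\<L> t) \<in> embs F (\<L> t)" using embs_eq[OF fld_F stableD(1,2)[OF st]] by blast
          moreover have "\<tau> = restrict (restrict \<sigma> (\<L> t)) (t 0)" using t0(3) \<sigma>(2) by (auto simp: fun_eq_iff)
          ultimately show "\<tau> \<in> (\<lambda>\<tau>. restrict \<tau> (t 0)) ` embs F (\<L> t)" by blast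
        qed
        then have "card (embs F (t 0)) \<le> N" unfolding N_def using fin by (metis card_image_le card_mono finite_imageI le_trans)
        then show ?thesis using card_embs[OF fld_F W(1)[of 0]] k by simp
      qed
      then have N: "N > 1" using n by linarith
      obtain H where H: "transitive_group N H" "has_gal F (\<L> t) N H" "N \<le> 2 * group_index N H"
        using normal_ext_regular[OF st fin N_def N] .
      have ext: "ext_of_degree F N (\<L> t)"
        unfolding N_def by (rule ext_of_degree_card_embs[OF fld_F stableD(1,2)[OF st] fin])
      have "Disc F (\<L> t) \<le> ((D * N) ^ N) ^ deg"
        by (rule Disc_hull_le[of "{..<k}" n t, OF W(1) _ ext W(3) D]) (auto simp: \<L>_def)
      then have "\<L> t \<in> exts_upto F N H (Y N)" using ext H(2)
        by (simp add: exts_upto_def gal_exts_def Y_def del: of_nat_power of_nat_mult)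
      moreover have "H \<in> GG N" using H by (simp add: GG_def)
      ultimately have "\<L> t \<in> U" unfolding U_def using N N_le by auto
      then show ?thesis using N_le fin st fields by (auto simp: N_def)
    qed
    have finU: "finite U" unfolding U_def
      using M fin_GG by (intro finite_UN_I) (auto simp: GG_def M_def)
    have fibre: "card {t \<in> T. \<L> t = L} \<le> (2 ^ B) ^ k" for L
    proof (cases "\<exists>t\<in>T. \<L> t = L")
      case True
      then obtain t where t: "t \<in> T" "\<L> t = L" by blast
      let ?Z = "{E. fld E \<and> F \<subseteq> E \<and> E \<subseteq> L}"
      have Z: "finite ?Z" "card ?Z \<le> 2 ^ card (embs F L)" "card (embs F L) \<le> B"
        using card_subfields_le[of L] hull[OF t(1)] t(2) by auto
      have "card ?Z \<le> 2 ^ B" using Z(2,3) by (meson le_trans one_le_numeral power_increasing)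
      have "{t \<in> T. \<L> t = L} \<subseteq> PiE {..<k} (\<lambda>_. ?Z)"
      proof
        fix t assume "t \<in> {t \<in> T. \<L> t = L}"
        then have t: "t \<in> T" "\<L> t = L" by auto
        show "t \<in> PiE {..<k} (\<lambda>_. ?Z)"
        proof (rule PiE_I)
          show "t i \<in> ?Z" if "i \<in> {..<k}" for i using hull[OF t(1)] t(2) that by auto
          show "t i = undefined" if "i \<notin> {..<k}" for i using t(1) that unfolding T_def by (rule PiE_arb)
        qed
      qed
      then have "card {t \<in> T. \<L> t = L} \<le> card (PiE {..<k} (\<lambda>_. ?Z))"
        using Z(1) by (intro card_mono finite_PiE) auto
      also have "\<dots> = card ?Z ^ k" by (simp add: card_PiE)
      also have "\<dots> \<le> (2 ^ B) ^ k" using \<open>card ?Z \<le> 2 ^ B\<close> by (intro power_mono) auto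
      finally show ?thesis .
    next
      case False
      then have no: "{t \<in> T. \<L> t = L} = {}" by blast
      show ?thesis unfolding no by simp
    qed
    have "t \<in> (\<Union>L\<in>U. {t \<in> T. \<L> t = L})" if "t \<in> T" for t
      using hull[OF that] that by (intro UN_I[of "\<L> t"]) simp_all
    then have "T = (\<Union>L\<in>U. {t \<in> T. \<L> t = L})" by (intro equalityI subsetI) (assumption, blast)
    then have "card T = card (\<Union>L\<in>U. {t \<in> T. \<L> t = L})" by (rule arg_cong)
    also have "\<dots> \<le> (\<Sum>L\<in>U. card {t \<in> T. \<L> t = L})" by (rule card_UN_le[OF finU])
    also have "\<dots> \<le> (\<Sum>L\<in>U. (2 ^ B) ^ k)" using fibre by (intro sum_mono)
    also have "\<dots> = card U * (2 ^ B) ^ k" by simp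
    finally have T_le: "card T \<le> card U * (2 ^ B) ^ k" .
    have "card U \<le> (\<Sum>N\<in>{2..B}. card (\<Union>H\<in>GG N. exts_upto F N H (Y N)))"
      unfolding U_def by (rule card_UN_le) simp
    also have "\<dots> \<le> (\<Sum>N\<in>{2..B}. \<Sum>H\<in>GG N. card (exts_upto F N H (Y N)))"
      using fin_GG by (intro sum_mono card_UN_le)
    finally have "real (card U) \<le> (\<Sum>N\<in>{2..B}. \<Sum>H\<in>GG N. real (card (exts_upto F N H (Y N))))"
      by (metis (mono_tags, lifting) of_nat_le_iff of_nat_sum sum.cong)
    also have "\<dots> \<le> (\<Sum>N\<in>{2..B}. \<Sum>H\<in>GG N. KK N H * real N ^ (3 * deg) * real D ^ (3 * deg))"
    proof (intro sum_mono)
      fix N H assume NH: "N \<in> {2..B}" "H \<in> GG N"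
      then have N: "N > 1" by auto
      have "D * N \<ge> 1" using D N by (simp add: Suc_le_eq)
      then have "((D * N) ^ N) ^ deg \<ge> 1" by (intro one_le_power)
      then have "Y N \<ge> 1" unfolding Y_def by (metis of_nat_1 of_nat_le_iff)
      \<comment> \<open>The exponents \<open>N * deg\<close> and \<open>3 / N\<close> multiply to
        \<open>3 * deg\<close>, which no longer depends on \<open>N\<close>.\<close>
      have "Y N powr (3 / real N) = real (D * N) ^ (3 * deg)"
      proof -
        have "Y N = real (D * N) powr (real N * real deg)"
          using \<open>D * N \<ge> 1\<close> by (simp add: Y_def powr_realpow [symmetric] powr_powr flip: power_mult)
        then have "Y N powr (3 / real N) = real (D * N) powr (real (3 * deg))"
          using N by (simp add: powr_powr mult.commute)
        then show ?thesis using \<open>D * N \<ge> 1\<close> by (subst (asm) powr_realpow) auto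
      qed
      then show "real (card (exts_upto F N H (Y N))) \<le> KK N H * real N ^ (3 * deg) * real D ^ (3 * deg)"
        using KK(2)[OF N NH(2) \<open>Y N \<ge> 1\<close>] by (simp add: power_mult_distrib mult_ac)
    qed
    also have "\<dots> = (\<Sum>N\<in>{2..B}. \<Sum>H\<in>GG N. KK N H * real N ^ (3 * deg)) * real D ^ (3 * deg)"
      by (simp add: sum_distrib_right)
    finally have U_le: "real (card U) \<le> (\<Sum>N\<in>{2..B}. \<Sum>H\<in>GG N. KK N H * real N ^ (3 * deg)) * real D ^ (3 * deg)" .
    have "real (card ?W) ^ k \<le> real (card U) * real ((2 ^ B) ^ k)"
      using T_le unfolding cardT by (metis of_nat_le_iff of_nat_mult of_nat_power)
    also have "\<dots> \<le> K * real D ^ (3 * deg)"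
      using mult_right_mono[OF U_le, of "real ((2 ^ B) ^ k)"] by (simp add: K_def mult_ac)
    finally show ?thesis .
  qed
  ultimately show thesis using that by blast
qed

theorem M_imp_DM:
  assumes M: "\<And>n G. n > 1 \<Longrightarrow> transitive_group n G \<Longrightarrow> M F n G"
  shows "\<exists>C. \<forall>n G. n > 1 \<and> transitive_group n G \<longrightarrow> DM C F n G"
proof -
  have bound: "\<exists>K. \<forall>G D. transitive_group n G \<longrightarrow> D \<ge> 1 \<longrightarrow>
      real (card (exts_with_disc F n G D)) \<le> K * real D powr \<epsilon>" if n: "n > 1" and \<epsilon>: "\<epsilon> > 0" for n \<epsilon>
  proof -
    \<comment> \<open>Large enough for the \<open>k\<close>-th root of \<open>D ^ (3 * deg)\<close>
      to be at most \<open>D powr \<epsilon>\<close>.\<close>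
    define k where "k = Suc (nat \<lceil>3 * real deg / \<epsilon>\<rceil>)"
    have "3 * real deg / \<epsilon> \<le> real k" unfolding k_def by linarith
    then have k\<epsilon>: "3 * real deg \<le> \<epsilon> * real k" using \<epsilon> by (simp add: pos_divide_le_eq mult.commute)
    have "k > 0" by (simp add: k_def)
    obtain K where K: "K \<ge> 0" "\<And>G D. transitive_group n G \<Longrightarrow> D > 0 \<Longrightarrow>
        real (card (exts_with_disc F n G D)) ^ k \<le> K * real D ^ (3 * deg)"
      using tuple_bound[OF M n \<open>k > 0\<close>] by blast
    \<comment> \<open>\<open>max 1 K\<close> stands in for the \<open>k\<close>-th root of
      \<open>K\<close>, as its \<open>k\<close>-th power is at least \<open>K\<close>.\<close>
    have "real (card (exts_with_disc F n G D)) \<le> max 1 K * real D powr \<epsilon>"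
      if G: "transitive_group n G" and D: "D \<ge> 1" for G D
    proof (rule power_le_imp_le_base)
      have "K \<le> max 1 K ^ k" using \<open>k > 0\<close> by (metis max.cobounded1 max.coboundedI2 self_le_power max.cobounded2 order_trans)
      moreover have "real D ^ (3 * deg) \<le> (real D powr \<epsilon>) ^ k"
      proof -
        have "real D ^ (3 * deg) = real D powr (3 * real deg)"
          using D by (simp flip: powr_realpow)
        also have "\<dots> \<le> real D powr (\<epsilon> * real k)" using D k\<epsilon> by (intro powr_mono) auto
        also have "\<dots> = (real D powr \<epsilon>) ^ k" using D by (simp add: powr_realpow [symmetric] powr_powr)
        finally show ?thesis .
      qed
      ultimately have "K * real D ^ (3 * deg) \<le> max 1 K ^ k * (real D powr \<epsilon>) ^ k"
        by (intro mult_mono) auto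
      then show "real (card (exts_with_disc F n G D)) ^ Suc (k - 1) \<le> (max 1 K * real D powr \<epsilon>) ^ Suc (k - 1)"
        using K(2)[OF G, of D] D \<open>k > 0\<close> by (simp add: power_mult_distrib del: power_Suc)
    qed simp
    then show ?thesis by blast
  qed
  \<comment> \<open>\<open>G\<close> and \<open>D\<close> are quantified inside, so the constant
    chosen next depends on \<epsilon> and \<open>n\<close> only.\<close>
  have "\<forall>\<epsilon> n. \<exists>K. \<epsilon> > 0 \<and> n > 1 \<longrightarrow> (\<forall>G D. transitive_group n G \<longrightarrow> D \<ge> 1 \<longrightarrow>
      real (card (exts_with_disc F n G D)) \<le> K * real D powr \<epsilon>)"
    using bound by meson
  then obtain C where C: "\<And>\<epsilon> n G D. \<epsilon> > 0 \<Longrightarrow> n > 1 \<Longrightarrow> transitive_group n G \<Longrightarrow> D \<ge> 1 \<Longrightarrow>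
      real (card (exts_with_disc F n G D)) \<le> C \<epsilon> n * real D powr \<epsilon>" by metis
  have "DM C F n G" if n: "n > 1" and G: "transitive_group n G" for n G
    unfolding DM_def
  proof (intro conjI allI impI)
    fix D :: nat
    have "finite (exts_upto F n G (real D))" using M[OF n G] by (simp add: M_def)
    then show "finite (exts_with_disc F n G D)"
      by (rule rev_finite_subset) (auto simp: exts_with_disc_def exts_upto_def)
  qed (use C n G in auto)
  then show ?thesis by blast
qed

end

text \<open>Elements are algebraic over \<open>F\<close> and \<open>F\<close> is finite over
  \<open>\<rat>\<close>, hence they are algebraic over \<open>\<rat>\<close>. The dimension of
  \<open>F\<close> over \<open>\<rat>\<close> supplies the locale parameter
  \<open>deg\<close>.\<close>

lemma number_base_of_closure:
  fixes F :: "'a::{alg_closed_field, field_char_0} set"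
  assumes F: "number_field F" and cl: "algebraic_closure (\<Omega> :: 'a ring) F"
  obtains d where "number_base F d"
proof -
  interpret \<Omega>: field "\<Omega> :: 'a ring" by (rule field_from_type_algebra)
  interpret cl: algebraic_closure "\<Omega> :: 'a ring" F by (rule cl)
  have ops: "carrier (\<Omega> :: 'a ring) = UNIV" "\<zero>\<^bsub>\<Omega> :: 'a ring\<^esub> = 0" "\<one>\<^bsub>\<Omega> :: 'a ring\<^esub> = 1"
    "x \<otimes>\<^bsub>\<Omega> :: 'a ring\<^esub> y = x * y" "x \<oplus>\<^bsub>\<Omega> :: 'a ring\<^esub> y = x + y" for x y
    by (auto simp: ring_of_type_algebra_def)
  have inv: "\<ominus>\<^bsub>\<Omega> :: 'a ring\<^esub> x = - x" for x
    using \<Omega>.minus_equality[of "- x" x] by (simp add: ops)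
  have subF: "subfield F (\<Omega> :: 'a ring)" and finF: "\<Omega>.finite_dimension \<rat> F"
    using F by (auto simp: number_field_def)
  have subQ: "subfield \<rat> (\<Omega> :: 'a ring)"
  proof (rule \<Omega>.subfieldI')
    show "subring \<rat> (\<Omega> :: 'a ring)" by (intro \<Omega>.subringI) (auto simp: ops inv)
    show "m_inv (\<Omega> :: 'a ring) q \<in> \<rat>" if "q \<in> \<rat> - {\<zero>\<^bsub>\<Omega> :: 'a ring\<^esub>}" for q
    proof -
      have "m_inv (\<Omega> :: 'a ring) q = inverse q"
        using that \<Omega>.inv_unique'[of q "inverse q"] by (simp add: ops)
      then show ?thesis using that by simp
    qed
  qed
  \<comment> \<open>HOL-Algebra lists coefficients with the leading one first, hence the
    reversal.\<close>
  have eval: "\<Omega>.eval p x = poly (Poly (rev p)) x" for p and x :: 'a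
  proof (induction p)
    case (Cons c p)
    have "x [^]\<^bsub>\<Omega> :: 'a ring\<^esub> n = x ^ n" for n :: nat
      by (induction n) (simp_all add: ops mult.commute)
    then show ?case using Cons by (simp add: ops Poly_append poly_monom)
  qed (simp add: ops)
  have alg: "algebraic x" for x :: 'a
  proof -
    have xF: "(\<Omega>.algebraic over F) x" using cl.algebraic_extension[of x] by (simp add: ops)
    have "\<Omega>.finite_dimension F (\<Omega>.simple_extension F x)"
      using \<Omega>.dimension_simple_extension[OF subF _ xF] by (auto simp: ops intro: \<Omega>.finite_dimensionI)
    then have "\<Omega>.finite_dimension \<rat> (\<Omega>.simple_extension F x)"
      using \<Omega>.telescopic_base_dim(1)[OF subQ subF finF] by blast
    moreover have "subring (\<Omega>.simple_extension F x) (\<Omega> :: 'a ring)"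
      using \<Omega>.simple_extension_is_subring[OF subfieldE(1)[OF subF]] by (simp add: ops)
    moreover have "x \<in> \<Omega>.simple_extension F x"
      using \<Omega>.simple_extension_mem[OF subfieldE(1)[OF subF]] by (simp add: ops)
    ultimately have "(\<Omega>.algebraic over \<rat>) x" using \<Omega>.finite_dimension_imp_algebraic[OF subQ] by blast
    then obtain p where p: "p \<in> carrier (\<rat>[X]\<^bsub>\<Omega>\<^esub>)" "p \<noteq> []" "\<Omega>.eval p x = \<zero>\<^bsub>\<Omega> :: 'a ring\<^esub>"
      using \<Omega>.algebraicE[OF subfieldE(1)[OF subQ], of x] by (auto simp: ops)
    then have p': "set p \<subseteq> \<rat>" "hd p \<noteq> 0"
      by (auto simp: univ_poly_carrier[symmetric] polynomial_def ops)
    show ?thesis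
    proof (rule algebraicI')
      show "coeff (Poly (rev p)) i \<in> \<rat>" for i
        using p'(1) nth_mem[of i "rev p"] by (auto simp: coeff_Poly_eq nth_default_def subset_iff simp del: nth_mem)
      have "last (rev p) \<noteq> 0" using p' p(2) by (simp add: last_rev)
      show "Poly (rev p) \<noteq> 0"
      proof
        assume "Poly (rev p) = 0"
        then obtain n where "rev p = replicate n 0" by (auto simp: Poly_eq_0)
        then show False using \<open>last (rev p) \<noteq> 0\<close> p(2) by (cases "n = 0") auto
      qed
      show "poly (Poly (rev p)) x = 0" using p(3) eval by (simp add: ops)
    qed
  qed
  interpret algebraic_type "TYPE('a)" by unfold_locales (rule alg)
  have fldF: "fld F" using subF by (simp add: subfield_iff_fld)
  obtain d where d: "\<Omega>.dimension d \<rat> F" using finF by auto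
  have "\<exists>c :: nat \<Rightarrow> int. (\<exists>i\<le>d. c i \<noteq> 0) \<and> (\<Sum>i\<le>d. of_int (c i) * x i) = 0" if x: "\<And>i. i \<le> d \<Longrightarrow> x i \<in> F" for x
  proof -
    let ?b = "map x [0..<Suc d]"
    have nth: "?b ! i = x i" if "i < Suc d" for i using that by (simp del: upt_Suc)
    have "\<not> \<Omega>.independent \<rat> ?b"
    proof
      assume "\<Omega>.independent \<rat> ?b"
      moreover have "set ?b \<subseteq> F" using x by (auto simp del: upt_Suc)
      ultimately have "length ?b \<le> d" using \<Omega>.independent_length_le_dimension[OF subQ d] by blast
      then show False by simp
    qed
    then obtain q where q: "\<And>i. i < Suc d \<Longrightarrow> q i \<in> \<rat>" "(\<Sum>i<Suc d. q i * x i) = 0" "\<not> (\<forall>i<Suc d. q i = 0)"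
      using independentI[OF fld_Rats, of ?b] nth by (auto simp del: upt_Suc sum.lessThan_Suc)
    \<comment> \<open>The coefficients of the rational relation are treated as a polynomial, so that
      \<open>rational_poly_primitive\<close> makes them integral; primitivity keeps the relation
      nontrivial.\<close>
    define P where "P = Poly (map q [0..<Suc d])"
    have coeff_P: "coeff P i = (if i < Suc d then q i else 0)" for i
      by (simp add: P_def coeff_Poly_eq nth_default_def del: upt_Suc)
    have "poly_over \<rat> P" using q(1) by (auto simp: poly_over_def coeff_P)
    moreover have "P \<noteq> 0" using q(3) coeff_P by (metis coeff_0)
    ultimately obtain c Z z where Z: "c \<in> \<rat>" "Polynomial.smult c P = map_poly of_int Z"
      "(\<Sum>k\<le>degree P. z k * coeff Z k) = (1 :: int)"
      by (rule rational_poly_primitive)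
    have cZ: "of_int (coeff Z i) = c * coeff P i" for i
      using arg_cong[OF Z(2), of "\<lambda>p. coeff p i"] by (simp add: coeff_map_poly)
    have "(\<Sum>i\<le>d. of_int (coeff Z i) * x i) = c * (\<Sum>i<Suc d. q i * x i)"
      by (simp add: cZ coeff_P sum_distrib_left mult.assoc lessThan_Suc_atMost del: sum.lessThan_Suc)
    then have "(\<Sum>i\<le>d. of_int (coeff Z i) * x i) = 0" using q(2) by simp
    moreover have "\<exists>i\<le>d. coeff Z i \<noteq> 0"
    proof (rule ccontr)
      assume no: "\<not> (\<exists>i\<le>d. coeff Z i \<noteq> 0)"
      have "coeff Z i = 0" for i
        using no cZ[of i] coeff_P[of i] by (cases "i \<le> d") (auto simp: less_Suc_eq_le)
      then show False using Z(3) by simp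
    qed
    ultimately show ?thesis by blast
  qed
  then have "number_base F d" by unfold_locales (auto intro: fldF)
  then show thesis by (rule that)
qed

theorem theorem1p3:
  fixes F :: "'a::{alg_closed_field, field_char_0} set"
  assumes "number_field F"
    and "algebraic_closure (\<Omega> :: 'a ring) F"
  shows "((\<forall>n G. n > 1 \<and> transitive_group n G \<longrightarrow> M F n G) \<longrightarrow>
            (\<exists>C. \<forall>n G. n > 1 \<and> transitive_group n G \<longrightarrow> DM C F n G))
       \<and> (\<forall>n G. n > 1 \<and> transitive_group n G \<longrightarrow> (\<exists>C. DM C F n G) \<longrightarrow> M F n G)"
proof -
  obtain d where "number_base F d" using number_base_of_closure[OF assms] .
  then interpret number_base "TYPE('a)" F d .
  show ?thesis using M_imp_DM DM_imp_M by blast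
qed

end
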